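(* Fix a choice of sign $\pm$ and let $t_0>0$. There exists a constant $a_0>0$ such that for all $0<a<a_0$ and for all $u_+$ small in $L^1(\mathbb{R})\cap L^2(\mathbb{R})$ with respect to $a_0$ and $t_0$ (i.e. $\|u_+\|_{L^1}+\|u_+\|_{L^2}\le\delta$ for some $\delta>0$ depending only on $a_0$ and $t_0$), the equation $$i v_t+v_{xx}\pm\frac1t\left(|v|^2-a^2\right)v=0,\qquad t\ge t_0,\ x\in\mathbb{R},$$ has a unique solution $v$ with $$v-v_1\in \mathcal{C}([t_0,\infty),L^2(\mathbb{R}))\cap L^4([t_0,\infty),L^\infty(\mathbb{R})),\qquad v_1(t,x)=a+e^{\pm i a^2\log t}\,e^{it\partial_x^2}u_+(x),$$ satisfying, as $t\to\infty$, $$\|v(t)-v_1(t)\|_{L^2}+\|v-v_1\|_{L^4((t,\infty),L^\infty)}=\mathcal{O}(t^{-\frac14}).$$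
   Context: Functions are complex valued. $e^{it\partial_x^2}u_+$ denotes the solution at time $t$ of the free Schrödinger equation $iw_t+w_{xx}=0$ on $\mathbb{R}$ with $w(0)=u_+$. The signs $\pm$ in the equation and in $v_1$ are the same. Solutions are understood in the usual integral (Duhamel) sense. *)

theory Defs
  imports "HOL-Probability.Essential_Supremum" "HOL-Library.Landau_Symbols"
begin

text \<open>
  Elements of \<open>L\<^sup>p(\<real>)\<close> are represented by Lebesgue measurable functions
  \<open>real \<Rightarrow> complex\<close>, identified when they agree almost everywhere; space-time functions
  \<open>v(t,x)\<close> are curves \<open>t \<mapsto> v t\<close> of such functions.  The completed measure
  \<^const>\<open>lebesgue\<close> is used throughout, also in time, so that values on null sets
  never affect measurability.
\<close>

definition square_integrable :: "(real \<Rightarrow> complex) \<Rightarrow> bool" where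
  "square_integrable f \<longleftrightarrow>
     f \<in> borel_measurable lebesgue \<and> integrable lebesgue (\<lambda>x. (norm (f x))\<^sup>2)"

definition L1_norm :: "(real \<Rightarrow> complex) \<Rightarrow> real" where
  "L1_norm f = (LINT x|lebesgue. norm (f x))"

definition L2_norm :: "(real \<Rightarrow> complex) \<Rightarrow> real" where
  "L2_norm f = sqrt (LINT x|lebesgue. (norm (f x))\<^sup>2)"

definition L2_inner :: "(real \<Rightarrow> complex) \<Rightarrow> (real \<Rightarrow> complex) \<Rightarrow> complex" where
  "L2_inner f g = (LINT x|lebesgue. f x * cnj (g x))"

definition Linf_norm :: "(real \<Rightarrow> complex) \<Rightarrow> ennreal" where
  "Linf_norm f = esssup lebesgue (\<lambda>x. ennreal (norm (f x)))"

definition L2_continuous_on :: "real set \<Rightarrow> (real \<Rightarrow> real \<Rightarrow> complex) \<Rightarrow> bool" where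
  "L2_continuous_on I w \<longleftrightarrow>
     (\<forall>t\<in>I. square_integrable (w t)) \<and>
     (\<forall>t\<in>I. ((\<lambda>s. L2_norm (\<lambda>x. w s x - w t x)) \<longlongrightarrow> 0) (at t within I))"

text \<open>
  Membership in \<open>L\<^sup>4(I, L\<^sup>\<infinity>(\<real>))\<close>, for curves that are already known to be
  \<open>L\<^sup>2\<close>-continuous on \<open>I\<close>: measurability of \<open>r t\<close> and of \<open>t \<mapsto> r t\<close> then need not be
  imposed again, and the finite integral makes \<open>r t\<close> essentially bounded for almost
  every \<open>t \<in> I\<close>.
\<close>

definition in_L4_Linf :: "real set \<Rightarrow> (real \<Rightarrow> real \<Rightarrow> complex) \<Rightarrow> bool" where
  "in_L4_Linf I r \<longleftrightarrow>
     (\<lambda>t. Linf_norm (r t)) \<in> borel_measurable (restrict_space lebesgue I) \<and>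
     (\<integral>\<^sup>+t\<in>I. (Linf_norm (r t)) ^ 4 \<partial>lebesgue) < \<infinity>"

definition L4_Linf_norm :: "real set \<Rightarrow> (real \<Rightarrow> real \<Rightarrow> complex) \<Rightarrow> real" where
  "L4_Linf_norm I r = root 4 (enn2real (\<integral>\<^sup>+t\<in>I. (Linf_norm (r t)) ^ 4 \<partial>lebesgue))"

text \<open>
  The \<open>L\<^sup>2\<close> solution \<open>w \<in> C(\<real>, L\<^sup>2)\<close> of \<open>i w\<^sub>t + w\<^sub>x\<^sub>x = 0\<close>, \<open>w(0) = u\<close>, the
  equation being tested against \<open>C\<^sup>2\<close> functions \<open>\<phi>\<close> of compact support:
  \<open>(d/dt) \<integral> w(t) \<phi> = i \<integral> w(t) \<phi>''\<close>.
\<close>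

definition free_schroedinger_solution ::
    "(real \<Rightarrow> complex) \<Rightarrow> (real \<Rightarrow> real \<Rightarrow> complex) \<Rightarrow> bool" where
  "free_schroedinger_solution u w \<longleftrightarrow>
     L2_continuous_on UNIV w \<and>
     (AE x in lebesgue. w 0 x = u x) \<and>
     (\<forall>\<phi> \<phi>' \<phi>''.
        (\<forall>x. (\<phi> has_vector_derivative \<phi>' x) (at x)) \<and>
        (\<forall>x. (\<phi>' has_vector_derivative \<phi>'' x) (at x)) \<and>
        continuous_on UNIV \<phi>'' \<and> compact (closure {x. \<phi> x \<noteq> 0}) \<longrightarrow>
        (\<forall>t. ((\<lambda>t. LINT x|lebesgue. w t x * \<phi> x) has_vector_derivative
                 \<i> * (LINT x|lebesgue. w t x * \<phi>'' x)) (at t)))"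

text \<open>
  \<open>schroedinger_group t u\<close> is \<open>exp(i t \<partial>\<^sub>x\<^sup>2) u\<close> for \<open>u \<in> L\<^sup>2(\<real>)\<close>.  The solution is unique up to
  null sets at each time; the choice operator only picks representatives.
\<close>

definition schroedinger_group :: "real \<Rightarrow> (real \<Rightarrow> complex) \<Rightarrow> real \<Rightarrow> complex" where
  "schroedinger_group t u = (SOME w. free_schroedinger_solution u w) t"

text \<open>
  The \<open>L\<^sup>2(\<real>)\<close>-valued Bochner integral of a curve \<open>G\<close> over \<open>S\<close>.  As \<open>L\<^sup>2(\<real>)\<close> is a separable
  Hilbert space, Bochner integrability amounts to weak measurability and integrability of
  the norm, and the integral is determined by its inner products.
\<close>

definition has_L2_integral ::
    "(real \<Rightarrow> real \<Rightarrow> complex) \<Rightarrow> (real \<Rightarrow> complex) \<Rightarrow> real set \<Rightarrow> bool" where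
  "has_L2_integral G J S \<longleftrightarrow>
     square_integrable J \<and>
     (AE s in lebesgue. s \<in> S \<longrightarrow> square_integrable (G s)) \<and>
     set_integrable lebesgue S (\<lambda>s. L2_norm (G s)) \<and>
     (\<forall>\<phi>. square_integrable \<phi> \<longrightarrow>
        set_integrable lebesgue S (\<lambda>s. L2_inner (G s) \<phi>) \<and>
        L2_inner J \<phi> = (LINT s:S|lebesgue. L2_inner (G s) \<phi>))"

definition nonlinearity ::
    "real \<Rightarrow> (real \<Rightarrow> real \<Rightarrow> complex) \<Rightarrow> real \<Rightarrow> real \<Rightarrow> complex" where
  "nonlinearity a v s x = of_real (((norm (v s x))\<^sup>2 - a\<^sup>2) / s) * v s x"

text \<open>
  Duhamel solutions on \<open>[t\<^sub>0, \<infinity>)\<close> of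
  \<open>i v\<^sub>t + v\<^sub>x\<^sub>x + \<sigma> (\<bar>v\<bar>\<^sup>2 - a\<^sup>2) v / t = 0\<close> with \<open>\<sigma> = \<plusminus>1\<close>, i.e.
  \<open>v(t) = U(t - t\<^sub>0) v(t\<^sub>0) + i \<sigma> \<integral> U(t - s) F(s) ds\<close> over \<open>[t\<^sub>0, t]\<close>, where
  \<open>U\<close> is the free group.  Here \<open>v(t\<^sub>0) - a \<in> L\<^sup>2\<close> and constants are invariant under the
  free evolution, so \<open>U(t - t\<^sub>0) v(t\<^sub>0)\<close> is \<open>a + U(t - t\<^sub>0) (v(t\<^sub>0) - a)\<close>.
\<close>

definition duhamel_solution ::
    "real \<Rightarrow> real \<Rightarrow> real \<Rightarrow> (real \<Rightarrow> real \<Rightarrow> complex) \<Rightarrow> bool" where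
  "duhamel_solution \<sigma> a t\<^sub>0 v \<longleftrightarrow>
     square_integrable (\<lambda>x. v t\<^sub>0 x - of_real a) \<and>
     (\<forall>t\<ge>t\<^sub>0. \<exists>J.
        has_L2_integral (\<lambda>s. schroedinger_group (t - s) (nonlinearity a v s)) J {t\<^sub>0..t} \<and>
        (AE x in lebesgue. v t x =
           of_real a + schroedinger_group (t - t\<^sub>0) (\<lambda>y. v t\<^sub>0 y - of_real a) x
           + \<i> * of_real \<sigma> * J x))"

definition asymptotic_profile ::
    "real \<Rightarrow> real \<Rightarrow> (real \<Rightarrow> complex) \<Rightarrow> real \<Rightarrow> real \<Rightarrow> complex" where
  "asymptotic_profile \<sigma> a u t x =
     of_real a + exp (\<i> * of_real (\<sigma> * a\<^sup>2 * ln t)) * schroedinger_group t u x"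

definition scattering_solution ::
    "real \<Rightarrow> real \<Rightarrow> real \<Rightarrow> (real \<Rightarrow> complex) \<Rightarrow> (real \<Rightarrow> real \<Rightarrow> complex) \<Rightarrow> bool" where
  "scattering_solution \<sigma> a t\<^sub>0 u v \<longleftrightarrow>
     duhamel_solution \<sigma> a t\<^sub>0 v \<and>
     (let r = (\<lambda>t x. v t x - asymptotic_profile \<sigma> a u t x) in
        L2_continuous_on {t\<^sub>0..} r \<and> in_L4_Linf {t\<^sub>0..} r \<and>
        (\<lambda>t. L2_norm (r t) + L4_Linf_norm {t<..} r) \<in> O[at_top](\<lambda>t. t powr (- 1 / 4)))"

end

theory Submission
  imports Defs "HOL-Probability.Distributions" "HOL-Analysis.Bounded_Continuous_Function"
begin

text \<open>
  Write \<open>v = a + w + r\<close> with \<open>w(t) = exp(i \<sigma> a\<^sup>2 ln t) U(t) u\<close>.  The phase of \<open>w\<close> absorbs the resonant linear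
  term \<open>a\<^sup>2 w / t\<close> of the equation, the other linear term \<open>a\<^sup>2 cnj w / t\<close> oscillates like \<open>U(- 2 t)\<close> after
  conjugation by \<open>U\<close>, so that its Duhamel integral from infinity converges conditionally and is
  \<open>O(t^(-1/4))\<close> by Strichartz duality, and the rest is quadratic in \<open>w\<close>, hence integrable in time, or carries
  a factor \<open>r\<close>.  A fixed point argument in the \<open>L\<^sup>2\<close> metric weighted by \<open>t^(1/4)\<close>, on a set that is closed
  although it is cut out by an \<open>L\<^sup>4 L\<^sup>\<infinity>\<close> bound, yields \<open>r\<close>; smallness of \<open>a\<close> makes the linear term
  \<open>a\<^sup>2 r / t\<close> a contraction in this weight.  Uniqueness among large solutions holds first near
  infinity, where the tails are small, and then propagates backwards in time.

  No Fourier transform is used.  The group \<open>U(t)\<close> is the strong limit, as \<open>\<epsilon>\<close> tends to 0, of the convolution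
  with the Gaussian kernel at complex time \<open>\<epsilon> + i t\<close>; the dispersive estimate is the uniform bound of this
  kernel, and \<open>L\<^sup>\<infinity>\<close> norms are suprema over the unit ball of \<open>L\<^sup>1\<close>, which makes them lower
  semicontinuous on \<open>L\<^sup>2\<close>.
\<close>

text \<open>The weight t^(-1/4) is dictated by the bound for the oscillating source, and in this
  weight the linear term a^2 r / t has a norm proportional to a^2 that is invariant under rescaling
  of time. Neither a late starting time nor small data improve it, so a itself must be small, and
  the threshold comes out as an absolute constant. The rest of the Lipschitz constant is integrable:
  \<open>linf (w s)\<close> decays like s^(-1/2), and the square of an L4 function of time divided
  by s is integrable at infinity. Hence the remaining integrand can be measured in L1 of time with
  values in L2. Strichartz estimates only keep the L4 bound on the invariant set, while differences
  are compared in L2 alone; the inhomogeneous estimate then follows from the homogeneous one by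
  Minkowski's inequality.

  The quotient type \<open>l2\<close> serves Bochner integration and the fixed point theorem, which
  ask for a separable complete space of classes. Smallness of a also decides uniqueness: the
  nonintegrable part of the difference inequality must lose to the decay t^(-1/4) that both
  solutions share.\<close>

abbreviation bmeas :: "('a::topological_space => 'b::topological_space) set" where
 "bmeas \<equiv> borel_measurable borel"

abbreviation nn_lborel :: "(real => ennreal) => ennreal" (binder "NN " 10) where
 "nn_lborel f \<equiv> nn_integral lborel f"

section \<open>The Hilbert space of square integrable functions\<close>

lemma cnj_measurable[measurable]: "cnj \<in> bmeas"
 by (intro borel_measurable_continuous_onI continuous_intros)

text \<open>Borel representatives over \<open>lborel\<close> keep products measurable for Fubini
  arguments; the Lebesgue measurable functions of the statement are attached to them by
  \<open>of_fun\<close>.\<close>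

definition sqint :: "(real => complex) => bool" where
 "sqint f \<longleftrightarrow> f \<in> bmeas \<and> integrable lborel (\<lambda>x. (norm (f x))\<^sup>2)"

text \<open>A partial equivalence relation: requiring \<open>sqint\<close> on both sides restricts
  the quotient to square integrable functions, so the type itself carries integrability.\<close>

definition l2_eq :: "(real => complex) => (real => complex) => bool" where
 "l2_eq f g \<longleftrightarrow> sqint f \<and> sqint g \<and> (AE x in lborel. f x = g x)"

lemma norm_add_sq_le: "(norm (x + y))\<^sup>2 <= 2 * (norm x)\<^sup>2 + 2 * (norm (y::'a::real_normed_vector))\<^sup>2"
proof -
 have "(norm (x + y))\<^sup>2 <= (norm x + norm y)\<^sup>2"
  by (intro power_mono norm_triangle_ineq) auto
 also have "... <= 2 * (norm x)\<^sup>2 + 2 * (norm y)\<^sup>2"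
  using sum_squares_bound[of "norm x" "norm y"] by (simp add: power2_sum)
 finally show ?thesis .
qed

lemma sqint_measurable[measurable_dest]: "sqint f ==> f \<in> bmeas"
 by (simp add: sqint_def)

lemma sqint_integrable: "sqint f ==> integrable lborel (\<lambda>x. (norm (f x))\<^sup>2)"
 by (simp add: sqint_def)

lemma sqint_bound:
 assumes "f \<in> bmeas" "integrable lborel g" "AE x in lborel. (norm (f x))\<^sup>2 <= g x"
 shows "sqint f"
 unfolding sqint_def
proof (intro conjI assms(1) Bochner_Integration.integrable_bound[OF assms(2)])
 show "(\<lambda>x. (norm (f x))\<^sup>2) \<in> borel_measurable lborel" using assms(1) by measurable
 show "AE x in lborel. norm ((norm (f x))\<^sup>2) <= norm (g x)"
  using assms(3) by eventually_elim (auto intro: order_trans)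
qed

lemma sqint_zero: "sqint (\<lambda>x. 0)" by (simp add: sqint_def)

lemma sqint_add:
 assumes "sqint f" "sqint g" shows "sqint (\<lambda>x. f x + g x)"
proof (rule sqint_bound)
 show "(\<lambda>x. f x + g x) \<in> bmeas" using assms by (auto simp: sqint_def)
 show "integrable lborel (\<lambda>x. 2 * (norm (f x))\<^sup>2 + 2 * (norm (g x))\<^sup>2)"
  using assms by (auto simp: sqint_def)
qed (simp add: norm_add_sq_le)

lemma sqint_cmult: "sqint f ==> sqint (\<lambda>x. c * f x)"
 by (auto simp: sqint_def norm_mult power_mult_distrib)

lemma sqint_cnj: "sqint f ==> sqint (\<lambda>x. cnj (f x))"
 by (auto simp: sqint_def)

lemma sqint_uminus: "sqint f ==> sqint (\<lambda>x. - f x)"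
 by (auto simp: sqint_def)

lemma sqint_diff: "sqint f ==> sqint g ==> sqint (\<lambda>x. f x - g x)"
 using sqint_add[OF _ sqint_uminus] by fastforce

lemma sqint_scaleR: "sqint f ==> sqint (\<lambda>x. c *\<^sub>R f x)"
 by (auto simp: scaleR_conv_of_real intro: sqint_cmult)

lemma sqint_cong_AE: "sqint f ==> g \<in> bmeas ==> AE x in lborel. g x = f x ==> sqint g"
 by (rule sqint_bound[OF _ sqint_integrable]) auto

lemma sqint_mult_integrable:
 assumes "sqint f" "sqint g" shows "integrable lborel (\<lambda>x. f x * g x)"
proof (rule Bochner_Integration.integrable_bound)
 show "integrable lborel (\<lambda>x. (norm (f x))\<^sup>2 + (norm (g x))\<^sup>2)"
  using assms by (auto simp: sqint_def)
 show "(\<lambda>x. f x * g x) \<in> borel_measurable lborel" using assms by (auto simp: sqint_def)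
 have "norm (a * b) <= (norm a)\<^sup>2 + (norm b)\<^sup>2" for a b :: complex
  using sum_squares_bound[of "norm a" "norm b"] mult_nonneg_nonneg[of "norm a" "norm b"]
  unfolding norm_mult by (simp del: mult_nonneg_nonneg)
 then show "AE x in lborel. norm (f x * g x) <= norm ((norm (f x))\<^sup>2 + (norm (g x))\<^sup>2)"
  by (auto simp: abs_of_nonneg)
qed

quotient_type l2 = "real => complex" / partial: l2_eq
proof (rule part_equivpI)
 show "\<exists>x. l2_eq x x" by (intro exI[of _ "\<lambda>x. 0"]) (simp add: l2_eq_def sqint_zero)
 show "symp l2_eq" by (intro sympI) (auto simp: l2_eq_def)
 show "transp l2_eq" by (intro transpI) (auto simp: l2_eq_def)
qed

lift_definition cscale :: "complex => l2 => l2" is "\<lambda>c f x. c * f x"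
 by (auto simp: l2_eq_def sqint_cmult)

lift_definition cnj_l2 :: "l2 => l2" is "\<lambda>f x. cnj (f x)"
 by (auto simp: l2_eq_def sqint_cnj)

text \<open>The type class \<open>real_inner\<close> offers a real inner product only. This complex
  one, linear in the first argument, is kept beside it, and \<open>inner\<close> is its real
  part.\<close>

lift_definition cinner :: "l2 => l2 => complex" is "\<lambda>f g. LBINT x. f x * cnj (g x)"
 by (intro integral_cong_AE) (auto simp: l2_eq_def sqint_def intro!: borel_measurable_times measurable_compose[OF _ cnj_measurable])

instantiation l2 :: real_inner
begin
lift_definition zero_l2 :: l2 is "\<lambda>x. 0" by (simp add: l2_eq_def sqint_zero)
lift_definition plus_l2 :: "l2 => l2 => l2" is "\<lambda>f g x. f x + g x"
 by (auto simp: l2_eq_def sqint_add)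
lift_definition minus_l2 :: "l2 => l2 => l2" is "\<lambda>f g x. f x - g x"
 by (auto simp: l2_eq_def sqint_diff)
lift_definition uminus_l2 :: "l2 => l2" is "\<lambda>f x. - f x"
 by (auto simp: l2_eq_def sqint_uminus)
lift_definition scaleR_l2 :: "real => l2 => l2" is "\<lambda>c f x. c *\<^sub>R f x"
 by (auto simp: l2_eq_def sqint_scaleR)
definition inner_l2 :: "l2 => l2 => real" where "inner_l2 f g = Re (cinner f g)"
definition norm_l2 :: "l2 => real" where "norm_l2 f = sqrt (inner f f)"
definition dist_l2 :: "l2 => l2 => real" where "dist_l2 f g = norm (f - g)"
definition sgn_l2 :: "l2 => l2" where "sgn_l2 f = inverse (norm f) *\<^sub>R f"
definition uniformity_l2 :: "(l2 \<times> l2) filter"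
 where "uniformity_l2 = (INF e\<in>{0 <..}. principal {(x, y). dist x y < e})"
definition open_l2 :: "l2 set => bool"
 where "open_l2 U = (\<forall>x\<in>U. eventually (\<lambda>(x', y). x' = x \<longrightarrow> y \<in> U) uniformity)"
instance
proof
 fix f g h :: l2 and a b :: real
 show "f + g + h = f + (g + h)" by transfer (auto simp: l2_eq_def sqint_add add.assoc)
 show "f + g = g + f" by transfer (auto simp: l2_eq_def sqint_add add.commute)
 show "0 + f = f" by transfer (auto simp: l2_eq_def)
 show "- f + f = 0" by transfer (auto simp: l2_eq_def sqint_zero)
 show "f - g = f + - g" by transfer (auto simp: l2_eq_def sqint_diff)
 show "a *\<^sub>R (f + g) = a *\<^sub>R f + a *\<^sub>R g"
  by transfer (auto simp: l2_eq_def sqint_add sqint_scaleR scaleR_add_right simp flip: scaleR_add_right)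
 show "(a + b) *\<^sub>R f = a *\<^sub>R f + b *\<^sub>R f"
  by transfer (auto simp: l2_eq_def sqint_add sqint_scaleR simp flip: scaleR_add_left)
 show "a *\<^sub>R b *\<^sub>R f = (a * b) *\<^sub>R f"
  by transfer (auto simp: l2_eq_def sqint_scaleR)
 show "1 *\<^sub>R f = f" by transfer (auto simp: l2_eq_def)
 show "dist f g = norm (f - g)" by (simp add: dist_l2_def)
 show "sgn f = inverse (norm f) *\<^sub>R f" by (simp add: sgn_l2_def)
 show "uniformity = (INF e\<in>{0 <..}. principal {(x, y::l2). dist x y < e})"
  by (simp add: uniformity_l2_def)
 show "open U = (\<forall>x\<in>U. eventually (\<lambda>(x', y). x' = x \<longrightarrow> y \<in> U) uniformity)" for U :: "l2 set"
  by (simp add: open_l2_def)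
 show "norm f = sqrt (inner f f)" by (simp add: norm_l2_def)
 have int: "integrable lborel (\<lambda>x. f x * cnj (g x))" if "sqint f" "sqint g" for f g
  by (intro sqint_mult_integrable sqint_cnj that)
 show "inner f g = inner g f"
  unfolding inner_l2_def
 proof transfer
  fix f g assume "l2_eq f f" "l2_eq g g"
  have "(LBINT x. f x * cnj (g x)) = cnj (LBINT x. cnj (f x * cnj (g x)))"
   by (subst Bochner_Integration.integral_cnj) simp
  also have "(LBINT x. cnj (f x * cnj (g x))) = (LBINT x. g x * cnj (f x))"
   by (simp add: mult.commute)
  finally show "Re (LBINT x. f x * cnj (g x)) = Re (LBINT x. g x * cnj (f x))" by simp
 qed
 show "inner (f + g) h = inner f h + inner g h"
  unfolding inner_l2_def
  by transfer (auto simp: l2_eq_def distrib_right int)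
 show "inner (a *\<^sub>R f) g = a * inner f g"
  unfolding inner_l2_def
  by transfer (auto simp: l2_eq_def)
 have eq: "(LBINT x. f x * cnj (f x)) = of_real (LBINT x. (norm (f x))\<^sup>2)" for f
  by (simp only: complex_norm_square[symmetric] integral_complex_of_real)
 show "0 <= inner f f" unfolding inner_l2_def
  by transfer (simp add: eq)
 show "(inner f f = 0) = (f = 0)" unfolding inner_l2_def
 proof transfer
  fix f assume f: "l2_eq f f"
  have "(Re (LBINT x. f x * cnj (f x)) = 0) = ((LBINT x. (norm (f x))\<^sup>2) = 0)"
   by (simp add: eq)
  also have "... = (AE x in lborel. f x = 0)"
   using f by (subst integral_nonneg_eq_0_iff_AE) (auto simp: l2_eq_def sqint_def)
  finally show "(Re (LBINT x. f x * cnj (f x)) = 0) = l2_eq f (\<lambda>x. 0)"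
   using f by (auto simp: l2_eq_def sqint_zero)
 qed
qed
end

lemma l2_eq_rep: "l2_eq (rep_l2 f) (rep_l2 f)"
 by (rule Quotient3_rep_reflp[OF Quotient3_l2])

lemma sqint_rep[simp]: "sqint (rep_l2 f)"
 using l2_eq_rep[of f] by (simp add: l2_eq_def)

lemma rep_measurable[measurable]: "rep_l2 f \<in> bmeas"
 using sqint_rep[of f] by (simp add: sqint_def)

lemma abs_rep[simp]: "abs_l2 (rep_l2 f) = f"
 by (rule Quotient3_abs_rep[OF Quotient3_l2])

lemma rep_abs: "sqint f ==> AE x in lborel. rep_l2 (abs_l2 f) x = f x"
 using Quotient3_rep_abs[OF Quotient3_l2, of f] by (auto simp: l2_eq_def)

lemma abs_eqI: "sqint f ==> sqint g ==> AE x in lborel. f x = g x ==> abs_l2 f = abs_l2 g"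
 using Quotient3_rel[OF Quotient3_l2, of f g] by (auto simp: l2_eq_def)

lemma l2_eqI: "AE x in lborel. rep_l2 f x = rep_l2 g x ==> f = g"
 using abs_eqI[of "rep_l2 f" "rep_l2 g"] by simp

lemma abs_add: "sqint f ==> sqint g ==> abs_l2 f + abs_l2 g = abs_l2 (\<lambda>x. f x + g x)"
 by (rule plus_l2.abs_eq) (auto simp: l2_eq_def)
lemma abs_diff: "sqint f ==> sqint g ==> abs_l2 f - abs_l2 g = abs_l2 (\<lambda>x. f x - g x)"
 by (rule minus_l2.abs_eq) (auto simp: l2_eq_def)
lemma abs_uminus: "sqint f ==> - abs_l2 f = abs_l2 (\<lambda>x. - f x)"
 by (rule uminus_l2.abs_eq) (auto simp: l2_eq_def)
lemma abs_scaleR: "sqint f ==> c *\<^sub>R abs_l2 f = abs_l2 (\<lambda>x. c *\<^sub>R f x)"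
 by (rule scaleR_l2.abs_eq) (auto simp: l2_eq_def)
lemma abs_cscale: "sqint f ==> cscale c (abs_l2 f) = abs_l2 (\<lambda>x. c * f x)"
 by (rule cscale.abs_eq) (auto simp: l2_eq_def)
lemma abs_cnj: "sqint f ==> cnj_l2 (abs_l2 f) = abs_l2 (\<lambda>x. cnj (f x))"
 by (rule cnj_l2.abs_eq) (auto simp: l2_eq_def)
lemma cinner_abs: "sqint f ==> sqint g ==> cinner (abs_l2 f) (abs_l2 g) = (LBINT x. f x * cnj (g x))"
 by (rule cinner.abs_eq) (auto simp: l2_eq_def)
lemma abs_zero: "abs_l2 (\<lambda>x. 0) = 0"
 by (simp add: zero_l2.abs_eq)

lemma norm_abs_sq: "sqint f ==> (norm (abs_l2 f))\<^sup>2 = (LBINT x. (norm (f x))\<^sup>2)"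
 by (simp only: power2_norm_eq_inner inner_l2_def cinner_abs complex_norm_square[symmetric] integral_complex_of_real Re_complex_of_real)

lemma norm_sq: "(norm f)\<^sup>2 = (LBINT x. (norm (rep_l2 f x))\<^sup>2)"
 using norm_abs_sq[of "rep_l2 f"] by simp

lemma nn_norm_abs_sq: "sqint f ==> (NN x. ennreal ((norm (f x))\<^sup>2)) = ennreal ((norm (abs_l2 f))\<^sup>2)"
 by (simp add: norm_abs_sq nn_integral_eq_integral sqint_integrable)

lemma rep_add: "AE x in lborel. rep_l2 (f + g) x = rep_l2 f x + rep_l2 g x"
 using rep_abs[OF sqint_add[OF sqint_rep sqint_rep], of f g]
 by (simp flip: abs_add)
lemma rep_diff: "AE x in lborel. rep_l2 (f - g) x = rep_l2 f x - rep_l2 g x"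
 using rep_abs[OF sqint_diff[OF sqint_rep sqint_rep], of f g]
 by (simp flip: abs_diff)
lemma rep_cscale: "AE x in lborel. rep_l2 (cscale c f) x = c * rep_l2 f x"
 using rep_abs[OF sqint_cmult[OF sqint_rep], of c f]
 by (simp flip: abs_cscale)
lemma rep_cnj: "AE x in lborel. rep_l2 (cnj_l2 f) x = cnj (rep_l2 f x)"
 using rep_abs[OF sqint_cnj[OF sqint_rep], of f]
 by (simp flip: abs_cnj)
lemma rep_zero: "AE x in lborel. rep_l2 0 x = 0"
 using rep_abs[OF sqint_zero] by (simp add: abs_zero)

lemma cinner_rep: "cinner f g = (LBINT x. rep_l2 f x * cnj (rep_l2 g x))"
 using cinner_abs[of "rep_l2 f" "rep_l2 g"] by simp

lemma cinner_integrable: "integrable lborel (\<lambda>x. rep_l2 f x * cnj (rep_l2 g x))"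
 by (intro sqint_mult_integrable sqint_cnj sqint_rep)

lemma cinner_commute: "cinner g f = cnj (cinner f g)"
proof -
 have "cnj (cinner f g) = (LBINT x. cnj (rep_l2 f x * cnj (rep_l2 g x)))"
  by (simp only: cinner_rep Bochner_Integration.integral_cnj)
 also have "... = cinner g f" by (simp add: cinner_rep mult.commute)
 finally show ?thesis by simp
qed

lemma cinner_add_left: "cinner (f + g) h = cinner f h + cinner g h"
 by (transfer) (auto simp: l2_eq_def distrib_right sqint_mult_integrable sqint_cnj)
lemma cinner_add_right: "cinner h (f + g) = cinner h f + cinner h g"
 by (metis cinner_commute cinner_add_left complex_cnj_add)
lemma cinner_cscale_left[simp]: "cinner (cscale c f) g = c * cinner f g"
 by (transfer) (auto simp: l2_eq_def mult.assoc)
lemma cinner_cscale_right[simp]: "cinner f (cscale c g) = cnj c * cinner f g"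
 by (metis cinner_commute cinner_cscale_left complex_cnj_mult)
lemma scaleR_cscale: "r *\<^sub>R f = cscale (of_real r) f"
 by transfer (auto simp: l2_eq_def sqint_cmult scaleR_conv_of_real)
lemma cinner_scaleR_left[simp]: "cinner (r *\<^sub>R f) g = of_real r * cinner f g"
 by (simp add: scaleR_cscale)
lemma cinner_scaleR_right[simp]: "cinner f (r *\<^sub>R g) = of_real r * cinner f g"
 by (simp add: scaleR_cscale)
lemma cinner_self: "cinner f f = of_real ((norm f)\<^sup>2)"
 by (simp only: cinner_rep complex_norm_square[symmetric] integral_complex_of_real norm_sq)
lemma inner_cinner: "inner f g = Re (cinner f g)" by (simp add: inner_l2_def)

lemma cscale_assoc[simp]: "cscale c (cscale d f) = cscale (c * d) f"
 by transfer (auto simp: l2_eq_def sqint_cmult mult.assoc)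
lemma cscale_one[simp]: "cscale 1 f = f" by transfer (auto simp: l2_eq_def)
lemma cscale_add_right: "cscale c (f + g) = cscale c f + cscale c g"
 by transfer (auto simp: l2_eq_def sqint_cmult sqint_add distrib_left simp flip: distrib_left)
lemma cscale_add_left: "cscale (c + d) f = cscale c f + cscale d f"
 by transfer (auto simp: l2_eq_def sqint_cmult sqint_add simp flip: distrib_right)
lemma cscale_uminus: "cscale (- c) f = - cscale c f"
 by transfer (auto simp: l2_eq_def sqint_cmult sqint_uminus)
lemma norm_cscale[simp]: "norm (cscale c f) = norm c * norm f"
proof -
 have "(norm (cscale c f))\<^sup>2 = (norm c * norm f)\<^sup>2"
 proof -
  have "complex_of_real ((norm (cscale c f))\<^sup>2) = (c * cnj c) * cinner f f"
   by (simp only: cinner_self[symmetric] cinner_cscale_left cinner_cscale_right mult_ac)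
  also have "... = of_real ((norm c * norm f)\<^sup>2)"
   by (simp only: cinner_self complex_norm_square[symmetric] power_mult_distrib of_real_mult)
  finally show ?thesis by (simp only: of_real_eq_iff)
 qed
 then show ?thesis by (simp add: power2_eq_iff_nonneg)
qed

text \<open>The real Cauchy--Schwarz inequality applies once the unimodular factor \<open>c\<close>
  has rotated the pairing onto the positive axis.\<close>

lemma norm_cinner_le: "norm (cinner f g) <= norm f * norm g"
proof (cases "cinner f g = 0")
 case False
 define c where "c = cnj (cinner f g) / norm (cinner f g)"
 have c: "norm c = 1" using False by (simp add: c_def norm_divide)
 have "inner (cscale c f) g = Re (c * cinner f g)" by (simp add: inner_cinner)
 also have "c * cinner f g = of_real (norm (cinner f g))"
  using False complex_norm_square[of "cinner f g"]
  by (simp add: c_def mult.commute power2_eq_square field_simps)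
 finally have "norm (cinner f g) = inner (cscale c f) g" by simp
 also have "... <= norm (cscale c f) * norm g" by (rule norm_cauchy_schwarz)
 finally show ?thesis using c by simp
qed auto

lemma bounded_bilinear_cinner: "bounded_bilinear cinner"
 by unfold_locales
  (auto simp: cinner_add_left cinner_add_right scaleR_conv_of_real intro!: exI[of _ 1] norm_cinner_le)

interpretation cinner: bounded_bilinear cinner by (rule bounded_bilinear_cinner)

lemma bounded_bilinear_cscale: "bounded_bilinear cscale"
 by unfold_locales
  (auto simp: cscale_add_left cscale_add_right scaleR_cscale mult.commute scaleR_conv_of_real intro!: exI[of _ 1])

interpretation cscale: bounded_bilinear cscale by (rule bounded_bilinear_cscale)

lemma cinner_cnj: "cinner (cnj_l2 f) (cnj_l2 g) = cnj (cinner f g)"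
 by transfer (simp only: Bochner_Integration.integral_cnj[symmetric] complex_cnj_mult complex_cnj_cnj)

lemma cnj_l2_add: "cnj_l2 (f + g) = cnj_l2 f + cnj_l2 g"
 by transfer (auto simp: l2_eq_def sqint_add sqint_cnj simp flip: complex_cnj_add)
lemma cnj_l2_cscale: "cnj_l2 (cscale c f) = cscale (cnj c) (cnj_l2 f)"
 by transfer (auto simp: l2_eq_def sqint_cmult sqint_cnj)
lemma norm_cnj_l2[simp]: "norm (cnj_l2 f) = norm f"
 using cinner_cnj[of f f] unfolding cinner_self by (simp add: power2_eq_iff_nonneg flip: of_real_power)

lemma bounded_linear_cnj_l2: "bounded_linear cnj_l2"
 by (rule bounded_linear_intro[where K=1]) (auto simp: cnj_l2_add scaleR_cscale cnj_l2_cscale)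

text \<open>Dominated convergence for \<open>(norm (s n x - f x))\<^sup>2\<close> with majorant
  \<open>4 * (g x)\<^sup>2\<close>. It serves for the density of steps, the continuity of
  translations, the differentiation of test functions and the convergence of bumps.\<close>

lemma l2_dominated:
 assumes s: "!!n. sqint (s n)" and f: "f \<in> bmeas"
  and lim: "AE x in lborel. (\<lambda>n. s n x) \<longlonglongrightarrow> f x"
  and bd: "!!n. AE x in lborel. norm (s n x) <= g x" and g: "integrable lborel (\<lambda>x. (g x)\<^sup>2)"
 shows "sqint f" "(\<lambda>n. abs_l2 (s n)) \<longlonglongrightarrow> abs_l2 f"
proof -
 have bd': "AE x in lborel. \<forall>n. norm (s n x) <= g x" using bd by (simp add: AE_all_countable)
 have fg: "AE x in lborel. norm (f x) <= g x"
  using lim bd' by eventually_elim (rule LIMSEQ_le_const2[OF tendsto_norm], auto)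
 have fg2: "AE x in lborel. (norm (f x))\<^sup>2 <= (g x)\<^sup>2"
  using fg by eventually_elim (auto intro!: power_mono)
 show sf: "sqint f" by (rule sqint_bound[OF f g fg2])
 have "(\<lambda>n. LBINT x. (norm (s n x - f x))\<^sup>2) \<longlonglongrightarrow> (LINT x::real|lborel. 0)"
 proof (rule integral_dominated_convergence[where w="\<lambda>x. 4 * (g x)\<^sup>2"])
  show "integrable lborel (\<lambda>x. 4 * (g x)\<^sup>2)" using g by simp
  show "(\<lambda>x. (norm (s n x - f x))\<^sup>2) \<in> borel_measurable lborel" for n
   using s[of n] f by (auto simp: sqint_def)
  show "AE x in lborel. (\<lambda>n. (norm (s n x - f x))\<^sup>2) \<longlonglongrightarrow> 0"
   using lim by eventually_elim (auto intro!: tendsto_eq_intros simp: LIM_zero_iff)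
  show "AE x in lborel. norm ((norm (s n x - f x))\<^sup>2) <= 4 * (g x)\<^sup>2" for n
   using bd[of n] fg
  proof eventually_elim
   case (elim x)
   have "norm (s n x - f x) <= 2 * g x" using norm_triangle_ineq4[of "s n x" "f x"] elim by linarith
   then have "(norm (s n x - f x))\<^sup>2 <= (2 * g x)\<^sup>2" by (intro power_mono) auto
   then show ?case by simp
  qed
 qed auto
 then have "(\<lambda>n. (norm (abs_l2 (s n) - abs_l2 f))\<^sup>2) \<longlonglongrightarrow> 0"
  by (simp add: abs_diff s sf norm_abs_sq sqint_diff)
 then have "(\<lambda>n. sqrt ((norm (abs_l2 (s n) - abs_l2 f))\<^sup>2)) \<longlonglongrightarrow> sqrt 0"
  by (rule tendsto_real_sqrt)
 then show "(\<lambda>n. abs_l2 (s n)) \<longlonglongrightarrow> abs_l2 f"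
  by (simp add: tendsto_norm_zero_iff LIM_zero_iff)
qed

section \<open>Completeness of L2 (Riesz--Fischer)\<close>

instance l2 :: complete_space
proof
 fix X :: "nat => l2" assume X: "Cauchy X"
 have "\<exists>N. \<forall>m\<ge>N. \<forall>n\<ge>N. dist (X m) (X n) < (1/2)^k" for k :: nat
  using X unfolding Cauchy_def by auto
 then obtain N where N: "!!k m n. m \<ge> N k ==> n \<ge> N k ==> dist (X m) (X n) < (1/2)^k" by metis
 \<comment> \<open>Dominates \<open>N j\<close> for every j <= k, and the added k makes it strictly
   increasing.\<close>
 define r where "r k = (\<Sum>j\<le>k. N j) + k" for k
 have rN: "N j <= r k" if "j <= k" for j k
  using that member_le_sum[of j "{..k}" N] by (simp add: r_def trans_le_add1)
 define f where "f k = rep_l2 (X (r k))" for k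
 have f[measurable]: "f k \<in> bmeas" and sf: "sqint (f k)" for k by (auto simp: f_def)
 have absf: "abs_l2 (f k) = X (r k)" for k by (simp add: f_def)
 have nd: "(NN x. ennreal ((norm (f m x - f k x))\<^sup>2)) <= ennreal ((1/4)^k)" if "m \<ge> k" for m k
 proof -
  have "(NN x. ennreal ((norm (f m x - f k x))\<^sup>2)) = ennreal ((dist (X (r m)) (X (r k)))\<^sup>2)"
   by (subst nn_norm_abs_sq) (auto simp: sf sqint_diff absf dist_norm simp flip: abs_diff)
  also have "... <= ennreal (((1/2)^k)\<^sup>2)"
   using N[of k "r m" "r k"] rN[of k m] rN[of k k] that by (intro ennreal_leI power_mono) auto
  also have "((1/2::real)^k)\<^sup>2 = (1/4)^k" by (simp add: power2_eq_square flip: power_mult_distrib)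
  finally show ?thesis .
 qed
 \<comment> \<open>The squared increments have integral at most 4^(-k), so the weight 2^k still
   leaves a convergent series. The weight is what turns square summability at a point into
   summability of the increments below.\<close>
 have "(NN x. (\<Sum>k. ennreal (2^k * (norm (f (Suc k) x - f k x))\<^sup>2)))
   = (\<Sum>k. NN x. ennreal (2^k * (norm (f (Suc k) x - f k x))\<^sup>2))"
  by (intro nn_integral_suminf) measurable
 also have "... <= (\<Sum>k. ennreal ((1/2)^k))"
 proof (intro suminf_le summableI)
  fix k
  have "(NN x. ennreal (2^k * (norm (f (Suc k) x - f k x))\<^sup>2)) =
   ennreal (2^k) * (NN x. ennreal ((norm (f (Suc k) x - f k x))\<^sup>2))"
   by (subst nn_integral_cmult[symmetric]) (auto simp: ennreal_mult)
  also have "... <= ennreal (2^k) * ennreal ((1/4)^k)" by (intro mult_left_mono nd) auto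
  also have "... = ennreal ((1/2)^k)" by (simp flip: ennreal_mult power_mult_distrib)
  finally show "(NN x. ennreal (2^k * (norm (f (Suc k) x - f k x))\<^sup>2)) <= ennreal ((1/2)^k)" .
 qed
 also have "... = ennreal (\<Sum>k. (1/2)^k)" by (intro suminf_ennreal2) auto
 also have "... < \<infinity>" by simp
 finally have "AE x in lborel. (\<Sum>k. ennreal (2^k * (norm (f (Suc k) x - f k x))\<^sup>2)) \<noteq> \<infinity>"
  by (intro nn_integral_PInf_AE) auto
 then have conv: "AE x in lborel. convergent (\<lambda>k. f k x)"
 proof eventually_elim
  case (elim x)
  have "summable (\<lambda>k. 2^k * (norm (f (Suc k) x - f k x))\<^sup>2)"
   using elim by (intro summable_suminf_not_top) (auto simp: top_unique)
  then have "summable (\<lambda>k. 2^k * (norm (f (Suc k) x - f k x))\<^sup>2 + (1/2)^k)"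
   by (intro summable_add) auto
  then have "summable (\<lambda>k. norm (f (Suc k) x - f k x))"
  proof (rule summable_comparison_test'[where N=0])
   fix k
   define d where "d = norm (f (Suc k) x - f k x)"
   have d0: "0 <= d" by (simp add: d_def)
   \<comment> \<open>Yields 2 d <= 2^k d^2 + 2^(-k), and both terms on the right are
     summable.\<close>
   have "0 <= (2^k * d - 1)\<^sup>2 / 2^k" by simp
   also have "(2^k * d - 1)\<^sup>2 / 2^k = 2^k * d\<^sup>2 + (1/2)^k - 2 * d"
    by (simp add: power2_eq_square field_simps power_one_over)
   finally have "d <= 2^k * d\<^sup>2 + (1/2)^k" using d0 by linarith
   then show "norm (norm (f (Suc k) x - f k x)) <= 2^k * (norm (f (Suc k) x - f k x))\<^sup>2 + (1/2)^k"
    by (simp add: d_def)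
  qed
  then have "summable (\<lambda>k. f (Suc k) x - f k x)" by (rule summable_norm_cancel)
  then have "convergent (\<lambda>n. (\<Sum>k<n. f (Suc k) x - f k x) + f 0 x)"
   unfolding summable_iff_convergent by (intro convergent_add convergent_const)
  moreover have "(\<Sum>k<n. f (Suc k) x - f k x) + f 0 x = f n x" for n
   using sum_lessThan_telescope[of "\<lambda>k. f k x" n] by simp
  ultimately show ?case by simp
 qed
 define F where "F x = lim (\<lambda>k. f k x)" for x
 have F[measurable]: "F \<in> bmeas" unfolding F_def by measurable
 have lim: "AE x in lborel. (\<lambda>k. f k x) \<longlonglongrightarrow> F x"
  using conv by eventually_elim (simp add: F_def convergent_LIMSEQ_iff)
 have Fk: "(NN x. ennreal ((norm (F x - f k x))\<^sup>2)) <= ennreal ((1/4)^k)" for k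
 proof -
  have "(NN x. ennreal ((norm (F x - f k x))\<^sup>2)) = (NN x. liminf (\<lambda>m. ennreal ((norm (f m x - f k x))\<^sup>2)))"
  proof (rule nn_integral_cong_AE, use lim in eventually_elim)
   case (elim x)
   have "(\<lambda>m. ennreal ((norm (f m x - f k x))\<^sup>2)) \<longlonglongrightarrow> ennreal ((norm (F x - f k x))\<^sup>2)"
    by (intro tendsto_ennrealI tendsto_intros elim)
   then show ?case by (rule lim_imp_Liminf[OF trivial_limit_sequentially, symmetric])
  qed
  \<comment> \<open>Fatou's lemma in m carries the bound on increments over to the limit; it gives
    both the square integrability of \<open>F\<close> and the rate of convergence.\<close>
  also have "... <= liminf (\<lambda>m. NN x. ennreal ((norm (f m x - f k x))\<^sup>2))"
   by (intro nn_integral_liminf) measurable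
  also have "... <= limsup (\<lambda>m. NN x. ennreal ((norm (f m x - f k x))\<^sup>2))"
   by (intro Liminf_le_Limsup) auto
  also have "... <= ennreal ((1/4)^k)"
   by (intro Limsup_bounded eventually_sequentiallyI[of k] nd)
  finally show ?thesis .
 qed
 have sFk: "sqint (\<lambda>x. F x - f k x)" for k
  unfolding sqint_def
  by (auto simp: integrable_iff_bounded intro!: le_less_trans[OF Fk[of k]])
 have sF: "sqint F" using sqint_add[OF sFk[of 0] sf[of 0]] by simp
 have nF: "(norm (abs_l2 F - X (r k)))\<^sup>2 <= (1/4)^k" for k
  using Fk[of k] by (simp add: nn_norm_abs_sq sFk sF sf absf flip: abs_diff)
 have "(\<lambda>k. sqrt ((norm (abs_l2 F - X (r k)))\<^sup>2)) \<longlonglongrightarrow> sqrt 0"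
  by (intro tendsto_real_sqrt, rule tendsto_sandwich[OF _ _ tendsto_const LIMSEQ_power_zero[of "1/4"]])
   (auto simp: nF)
 then have "(\<lambda>k. X (r k)) \<longlonglongrightarrow> abs_l2 F"
  by (subst tendsto_dist_iff) (simp add: dist_norm norm_minus_commute)
 moreover have "strict_mono r" by (rule strict_monoI_Suc) (simp add: r_def)
 ultimately have "X \<longlonglongrightarrow> abs_l2 F"
  using Cauchy_converges_subseq[OF X, of r] by (simp add: o_def)
 then show "convergent X" by (auto simp: convergent_def)
qed

instance l2 :: banach ..

section \<open>Separability: rational step functions are dense\<close>

lemma integrable_ind_interval: "integrable lborel (\<lambda>x::real. c * indicat_real {a..<b} x)"
 by (intro integrable_mult_right integrable_real_indicator) (simp_all add: emeasure_bounded_finite[of "{a..<b}", unfolded infinity_ennreal_def])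

lemma indicator_sq[simp]: "(indicat_real A x)\<^sup>2 = indicat_real A x"
 by (simp add: indicator_def)

lemma sqint_bounded_support:
 fixes a b M :: real
 assumes "f \<in> bmeas" "!!x. norm (f x) <= M * indicat_real {a..<b} x"
 shows "sqint f"
proof (rule sqint_bound[OF assms(1)])
 show "integrable lborel (\<lambda>x. M\<^sup>2 * indicat_real {a..<b} x)" by (rule integrable_ind_interval)
 show "AE x in lborel. (norm (f x))\<^sup>2 <= M\<^sup>2 * indicat_real {a..<b} x"
 proof (rule AE_I2)
  fix x
  have "(norm (f x))\<^sup>2 <= (M * indicat_real {a..<b} x)\<^sup>2" by (intro power_mono assms(2)) auto
  then show "(norm (f x))\<^sup>2 <= M\<^sup>2 * indicat_real {a..<b} x" by (auto simp: indicator_def split: if_splits)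
 qed
qed

definition ind :: "real => real => l2" where
 "ind p q = abs_l2 (\<lambda>x. of_real (indicat_real {p..<q} x))"

lemma sqint_ind: "sqint (\<lambda>x. of_real (indicat_real {p..<q} x))"
 by (rule sqint_bounded_support[where M=1 and a=p and b=q]) auto

lemma abs_sum:
 assumes "!!k. k \<in> A ==> sqint (f k)"
 shows "sqint (\<lambda>x. \<Sum>k\<in>A. f k x)" "abs_l2 (\<lambda>x. \<Sum>k\<in>A. f k x) = (\<Sum>k\<in>A. abs_l2 (f k))"
proof -
 have "sqint (\<lambda>x. \<Sum>k\<in>A. f k x) \<and> abs_l2 (\<lambda>x. \<Sum>k\<in>A. f k x) = (\<Sum>k\<in>A. abs_l2 (f k))"
  using assms by (induction A rule: infinite_finite_induct) (auto simp: sqint_zero abs_zero sqint_add abs_add[symmetric])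
 then show "sqint (\<lambda>x. \<Sum>k\<in>A. f k x)" "abs_l2 (\<lambda>x. \<Sum>k\<in>A. f k x) = (\<Sum>k\<in>A. abs_l2 (f k))" by auto
qed

text \<open>The metric projection onto a closed ball: convexity makes it 1-Lipschitz, so truncation
  is continuous and never increases distances.\<close>

definition trunc :: "real => complex => complex" where
 "trunc M = closest_point (cball 0 M)"

lemma trunc_le: "0 <= M ==> norm (trunc M z) <= M"
 using closest_point_in_set[of "cball (0::complex) M" z] by (simp add: trunc_def)

lemma trunc_self: "norm z <= M ==> trunc M z = z"
 unfolding trunc_def by (rule closest_point_self) simp

lemma trunc_zero[simp]: "0 <= M ==> trunc M 0 = 0" by (simp add: trunc_self)

lemma trunc_lipschitz: "0 <= M ==> norm (trunc M z - trunc M w) <= norm (z - w)"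
 using closest_point_lipschitz[of "cball (0::complex) M" z w] by (simp add: trunc_def dist_norm)

lemma trunc_le_norm: "0 <= M ==> norm (trunc M z) <= norm z"
 using trunc_lipschitz[of M z 0] by simp

lemma trunc_continuous: "0 <= M ==> continuous_on UNIV (trunc M)"
 unfolding trunc_def by (intro continuous_on_closest_point) auto

lemma trunc_measurable: "0 <= M ==> trunc M \<in> bmeas"
 by (intro borel_measurable_continuous_onI trunc_continuous)

text \<open>Lists of quadruples of rationals make countability immediate. Second countability of the
  target is what the Bochner integral asks for, and it later provides the countable norming family
  of the Strichartz estimate.\<close>

definition rat_steps :: "l2 set" where
 "rat_steps = range (\<lambda>xs :: (rat \<times> rat \<times> rat \<times> rat) list.
   (\<Sum>(a, b, p, q)\<leftarrow>xs. cscale (Complex (of_rat a) (of_rat b)) (ind (of_rat p) (of_rat q))))"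

lemma countable_rat_steps: "countable rat_steps" unfolding rat_steps_def by simp

lemma rat_steps_add: "f \<in> rat_steps ==> g \<in> rat_steps ==> f + g \<in> rat_steps"
proof -
 assume "f \<in> rat_steps" "g \<in> rat_steps"
 then obtain xs ys where "f = (\<Sum>(a, b, p, q)\<leftarrow>xs. cscale (Complex (of_rat a) (of_rat b)) (ind (of_rat p) (of_rat q)))"
   "g = (\<Sum>(a, b, p, q)\<leftarrow>ys. cscale (Complex (of_rat a) (of_rat b)) (ind (of_rat p) (of_rat q)))"
  unfolding rat_steps_def by blast
 then have "f + g = (\<Sum>(a, b, p, q)\<leftarrow>xs @ ys. cscale (Complex (of_rat a) (of_rat b)) (ind (of_rat p) (of_rat q)))"
  by simp
 then show ?thesis unfolding rat_steps_def by blast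
qed

lemma closure_add_closed:
 fixes S :: "'a::real_normed_vector set"
 assumes "!!x y. x \<in> S ==> y \<in> S ==> x + y \<in> S" "x \<in> closure S" "y \<in> closure S"
 shows "x + y \<in> closure S"
proof -
 obtain f g where "\<forall>n. f n \<in> S" "f \<longlonglongrightarrow> x" "\<forall>n. g n \<in> S" "g \<longlonglongrightarrow> y"
  using assms unfolding closure_sequential by blast
 then show ?thesis unfolding closure_sequential
  using assms(1) by (intro exI[of _ "\<lambda>n. f n + g n"]) (auto intro: tendsto_add)
qed

lemma rat_steps_zero: "0 \<in> rat_steps"
 unfolding rat_steps_def by (rule range_eqI[of _ _ "[]"]) simp

lemma closure_rat_steps_sum:
 "(!!k. k \<in> A ==> f k \<in> closure rat_steps) ==> (\<Sum>k\<in>A. f k) \<in> closure rat_steps"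
proof (induction A rule: infinite_finite_induct)
 case (insert x F)
 then show ?case using closure_add_closed[of rat_steps, OF rat_steps_add] by auto
qed (use rat_steps_zero closure_subset in \<open>auto simp: subset_iff\<close>)

text \<open>The approximation concerns the coefficient alone; the grids used below have rational
  endpoints.\<close>

lemma closure_rat_steps_ind:
 assumes "p \<in> \<rat>" "q \<in> \<rat>"
 shows "cscale c (ind p q) \<in> closure rat_steps"
 unfolding closure_approachable
proof (intro allI impI)
 fix e :: real assume e: "e > 0"
 \<comment> \<open>Both components of the coefficient will be within d, so the error is at most 2 d
   times the norm of \<open>ind p q\<close>; the added 1 guards against a vanishing norm.\<close>
 define d where "d = e / (2 * (norm (ind p q) + 1))"
 have pos: "norm (ind p q) + 1 > 0" using norm_ge_zero[of "ind p q"] by linarith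
 then have d: "d > 0" using e by (simp add: d_def)
 obtain a where a: "a \<in> \<rat>" "Re c < a" "a < Re c + d" using Rats_dense_in_real[of "Re c" "Re c + d"] d by auto
 obtain b where b: "b \<in> \<rat>" "Im c < b" "b < Im c + d" using Rats_dense_in_real[of "Im c" "Im c + d"] d by auto
 have ab: "a \<in> \<rat>" "\<bar>a - Re c\<bar> < d" "b \<in> \<rat>" "\<bar>b - Im c\<bar> < d" using a b by auto
 obtain a' b' p' q' where r: "a = of_rat a'" "b = of_rat b'" "p = of_rat p'" "q = of_rat q'"
  using ab assms by (auto elim!: Rats_cases)
 have "cscale (Complex a b) (ind p q) \<in> rat_steps"
  unfolding rat_steps_def by (rule range_eqI[of _ _ "[(a', b', p', q')]"]) (simp add: r)
 moreover have "dist (cscale (Complex a b) (ind p q)) (cscale c (ind p q)) < e"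
 proof -
  have "norm (Complex a b - c) <= \<bar>a - Re c\<bar> + \<bar>b - Im c\<bar>"
   using cmod_le[of "Complex a b - c"] by simp
  then have n: "norm (Complex a b - c) < 2 * d" using ab by linarith
  have "dist (cscale (Complex a b) (ind p q)) (cscale c (ind p q)) = norm (Complex a b - c) * norm (ind p q)"
   by (simp add: dist_norm flip: cscale.diff_left)
  also have "... <= norm (Complex a b - c) * (norm (ind p q) + 1)" by (intro mult_left_mono) auto
  also have "... < 2 * d * (norm (ind p q) + 1)" using n pos by (intro mult_strict_right_mono)
  also have "... = e" using pos unfolding d_def by (simp only: times_divide_eq_right mult_divide_mult_cancel_left_if times_divide_eq_left) (simp add: divide_simps)
  finally show ?thesis .
 qed
 ultimately show "\<exists>y\<in>rat_steps. dist y (cscale c (ind p q)) < e" by blast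
qed

text \<open>The approximants sample g at the left ends of cells of length \<open>1 / Suc m\<close>.
  As n is an integer, \<open>K m\<close> lists exactly the cells that fill the window, and no cell
  is cut.\<close>

lemma step_approx:
 fixes g :: "real => complex" and n :: nat
 assumes g: "continuous_on UNIV g"
 shows "abs_l2 (\<lambda>x. g x * of_real (indicat_real {-real n..<real n} x)) \<in> closure rat_steps"
proof -
 let ?I = "\<lambda>x. indicat_real {-real n..<real n} x"
 have "compact (g ` {-real n..real n})"
  by (intro compact_continuous_image continuous_on_subset[OF g]) auto
 then have "bounded (g ` {-real n..real n})" by (rule compact_imp_bounded)
 then obtain M where "\<forall>y\<in>g ` {-real n..real n}. norm y <= M"
  unfolding bounded_iff by (elim exE)
 then have M: "norm (g x) <= M" if "x \<in> {-real n..real n}" for x using that by (simp del: atLeastAtMost_iff)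
 define K where "K m = {- int (n * Suc m)..<int (n * Suc m)}" for m
 define h where "h m k = (\<lambda>x. g (real_of_int k / Suc m) *
   of_real (indicat_real {real_of_int k / Suc m..<real_of_int (k + 1) / Suc m} x))" for m :: nat and k :: int
 define s where "s m x = (\<Sum>k\<in>K m. h m k x)" for m x
 have ind_iff: "x \<in> {real_of_int k / Suc m..<real_of_int (k + 1) / Suc m} \<longleftrightarrow> k = \<lfloor>x * Suc m\<rfloor>" for x :: real and k :: int and m :: nat
  by (auto simp: divide_simps floor_eq_iff mult.commute) (linarith+)?
 have floorK: "\<lfloor>x * Suc m\<rfloor> \<in> K m \<longleftrightarrow> x \<in> {-real n..<real n}" for x :: real and m :: nat
 proof -
  have "x < real n \<longleftrightarrow> x * Suc m < real n * Suc m" "-real n <= x \<longleftrightarrow> -real n * Suc m <= x * Suc m"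
   by (subst mult_less_cancel_right_pos mult_le_cancel_right_pos; simp)+
  moreover have "\<lfloor>x * Suc m\<rfloor> \<in> K m \<longleftrightarrow> - real n * Suc m <= x * Suc m \<and> x * Suc m < real n * Suc m"
   unfolding K_def atLeastLessThan_iff le_floor_iff floor_less_iff
   by (simp only: of_int_minus of_int_of_nat_eq of_nat_mult of_int_mult mult_minus_left)
  ultimately show ?thesis by (simp only: atLeastLessThan_iff)
 qed
 have s_eq: "s m x = g (real_of_int \<lfloor>x * Suc m\<rfloor> / Suc m) * of_real (?I x)" for m x
 proof -
  have "h m k x = (if k = \<lfloor>x * Suc m\<rfloor> then g (real_of_int k / Suc m) else 0)" for k
   unfolding h_def using ind_iff[of x k m] by (auto simp: indicator_def simp del: of_nat_Suc)
  then have "s m x = (\<Sum>k\<in>K m. if k = \<lfloor>x * Suc m\<rfloor> then g (real_of_int k / Suc m) else 0)"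
   by (simp add: s_def)
  also have "... = (if \<lfloor>x * Suc m\<rfloor> \<in> K m then g (real_of_int \<lfloor>x * Suc m\<rfloor> / Suc m) else 0)"
   by (subst sum.delta) (auto simp: K_def)
  finally show ?thesis using floorK[of x m] by (auto simp: indicator_def)
 qed
 have sh: "sqint (h m k)" for m k unfolding h_def by (intro sqint_cmult sqint_ind)
 have ss: "sqint (s m)" for m unfolding s_def by (intro abs_sum(1) sh)
 have "abs_l2 (s m) = (\<Sum>k\<in>K m. cscale (g (real_of_int k / Suc m)) (ind (real_of_int k / Suc m) (real_of_int (k + 1) / Suc m)))" for m
  unfolding s_def using sh by (subst abs_sum(2)) (auto simp: h_def ind_def abs_cscale sqint_ind)
 then have smem: "abs_l2 (s m) \<in> closure rat_steps" for m
  by (auto intro!: closure_rat_steps_sum closure_rat_steps_ind simp del: of_nat_Suc of_int_add)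
 have "(\<lambda>m. abs_l2 (s m)) \<longlonglongrightarrow> abs_l2 (\<lambda>x. g x * of_real (?I x))"
 proof (rule l2_dominated(2)[OF ss])
  show "(\<lambda>x. g x * of_real (?I x)) \<in> bmeas"
   using borel_measurable_continuous_onI[OF g] by measurable
  show "AE x in lborel. (\<lambda>m. s m x) \<longlonglongrightarrow> g x * of_real (?I x)"
  proof (rule AE_I2)
   fix x :: real
   have "(\<lambda>m. real_of_int \<lfloor>x * Suc m\<rfloor> / Suc m) \<longlonglongrightarrow> x"
   proof (rule tendsto_sandwich[where f="\<lambda>m. x - 1 / Suc m" and h="\<lambda>m. x"])
    have "x * Suc m - 1 <= real_of_int \<lfloor>x * Suc m\<rfloor>" for m :: nat by linarith
    then show "\<forall>\<^sub>F m in sequentially. x - 1 / real (Suc m) <= real_of_int \<lfloor>x * Suc m\<rfloor> / Suc m"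
     by (intro always_eventually allI) (simp add: divide_simps del: of_nat_Suc)
    show "\<forall>\<^sub>F m in sequentially. real_of_int \<lfloor>x * Suc m\<rfloor> / Suc m <= x"
     by (intro always_eventually allI) (simp add: divide_simps del: of_nat_Suc)
    show "(\<lambda>m. x - 1 / real (Suc m)) \<longlonglongrightarrow> x"
     using tendsto_diff[OF tendsto_const[of x] LIMSEQ_inverse_real_of_nat] by (simp add: inverse_eq_divide)
   qed auto
   then have "(\<lambda>m. g (real_of_int \<lfloor>x * Suc m\<rfloor> / Suc m)) \<longlonglongrightarrow> g x"
    using g by (auto simp: continuous_on_eq_continuous_at intro: isCont_tendsto_compose)
   then show "(\<lambda>m. s m x) \<longlonglongrightarrow> g x * of_real (?I x)"
    unfolding s_eq by (intro tendsto_intros)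
  qed
  show "integrable lborel (\<lambda>x. (M * ?I x)\<^sup>2)"
   using integrable_ind_interval[of "M\<^sup>2" "-real n" "real n"]
   by (simp add: power_mult_distrib)
  show "AE x in lborel. norm (s m x) <= M * ?I x" for m
  proof (rule AE_I2)
   fix x :: real
   show "norm (s m x) <= M * ?I x"
   proof (cases "x \<in> {-real n..<real n}")
    case True
    then have "\<lfloor>x * Suc m\<rfloor> \<in> K m" using floorK by blast
    then have "- (real n * Suc m) <= real_of_int \<lfloor>x * Suc m\<rfloor>" "real_of_int \<lfloor>x * Suc m\<rfloor> <= real n * Suc m"
     unfolding K_def by (simp_all flip: of_nat_mult of_int_le_iff of_int_less_iff del: of_nat_Suc)
    then have "real_of_int \<lfloor>x * Suc m\<rfloor> / Suc m \<in> {-real n..real n}"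
     by (simp add: divide_simps del: of_nat_Suc)
    from M[OF this] True show ?thesis by (simp add: s_eq)
   qed (simp add: s_eq)
  qed
 qed
 then show ?thesis by (rule closed_sequentially[OF closed_closure smem])
qed

text \<open>Obtained through \<open>measurable_on\<close>, which describes Lebesgue measurable
  functions as limits of continuous ones off a negligible set.\<close>

lemma continuous_approx:
 fixes F :: "real => complex"
 assumes "F \<in> bmeas"
 obtains G where "!!n::nat. continuous_on UNIV (G n)" "AE x in lborel. (\<lambda>n. G n x) \<longlonglongrightarrow> F x"
proof -
 have "F \<in> borel_measurable lebesgue"
  using assms by (intro measurable_completion) simp
 then have "F measurable_on UNIV"
  by (rule lebesgue_measurable_imp_measurable_on) simp
 then obtain N G where N: "negligible N" "!!n. continuous_on UNIV (G n)"
  "!!x. x \<notin> N ==> (\<lambda>n. G n x) \<longlonglongrightarrow> F x"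
  unfolding measurable_on_def by auto
 have "AE x in lebesgue. x \<notin> N"
  using N(1) by (simp add: negligible_iff_null_sets AE_not_in)
 then have "AE x in lborel. x \<notin> N" by (simp add: AE_completion_iff)
 then have "AE x in lborel. (\<lambda>n. G n x) \<longlonglongrightarrow> F x" by eventually_elim (rule N)
 then show thesis using N(2) that by blast
qed

text \<open>Two limits: first the continuous \<open>G n\<close> at a fixed cut-off j in size and
  space, where \<open>step_approx\<close> applies, then j tends to infinity.\<close>

lemma closure_steps_UNIV: "closure rat_steps = (UNIV :: l2 set)"
proof -
 have "f \<in> closure rat_steps" for f
 proof -
  define F where "F = rep_l2 f"
  have sF: "sqint F" and [measurable]: "F \<in> bmeas" by (auto simp: F_def)
  obtain G where Gc: "!!n::nat. continuous_on UNIV (G n)" and Gl: "AE x in lborel. (\<lambda>n. G n x) \<longlonglongrightarrow> F x"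
   using continuous_approx[of F] by auto
  define H where "H j x = trunc (real j) (F x) * of_real (indicat_real {-real j..<real j} x)" for j x
  have mt[measurable]: "trunc (real j) \<in> bmeas" for j by (rule trunc_measurable) simp
  have mH: "H j \<in> bmeas" for j unfolding H_def by measurable
  have nH: "norm (H j x) <= norm (F x)" for j x
   using trunc_le_norm[of "real j" "F x"] by (auto simp: H_def indicator_def norm_mult)
  have sH: "sqint (H j)" for j
   by (rule sqint_bound[OF mH sqint_integrable[OF sF]]) (auto intro!: power_mono nH)
  have Hin: "abs_l2 (H j) \<in> closure rat_steps" for j
  proof -
   have c: "continuous_on UNIV (\<lambda>x. trunc (real j) (G n x))" for n
    using continuous_on_compose[OF Gc[of n], of "trunc (real j)"] trunc_continuous[of "real j"]
    by (auto simp: o_def intro: continuous_on_subset)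
   define s where "s n x = trunc (real j) (G n x) * of_real (indicat_real {-real j..<real j} x)" for n x
   have sb: "norm (s n x) <= real j * indicat_real {-real j..<real j} x" for n x
    using trunc_le[of "real j" "G n x"] by (auto simp: s_def indicator_def norm_mult)
   have sm: "s n \<in> bmeas" for n
    unfolding s_def using borel_measurable_continuous_onI[OF c[of n]] by measurable
   have "(\<lambda>n. abs_l2 (s n)) \<longlonglongrightarrow> abs_l2 (H j)"
   proof (rule l2_dominated(2)[OF _ mH])
    show "sqint (s n)" for n by (rule sqint_bounded_support[OF sm sb])
    show "AE x in lborel. (\<lambda>n. s n x) \<longlonglongrightarrow> H j x"
     using Gl
    proof eventually_elim
     case (elim x)
     have "(\<lambda>n. trunc (real j) (G n x)) \<longlonglongrightarrow> trunc (real j) (F x)"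
      using trunc_continuous[of "real j"] elim
      by (auto simp: continuous_on_eq_continuous_at intro: isCont_tendsto_compose)
     then show ?case unfolding s_def H_def by (intro tendsto_intros)
    qed
    show "AE x in lborel. norm (s n x) <= real j * indicat_real {-real j..<real j} x" for n
     using sb by auto
    show "integrable lborel (\<lambda>x. (real j * indicat_real {-real j..<real j} x)\<^sup>2)"
     using integrable_ind_interval[of "(real j)\<^sup>2" "-real j" "real j"]
     by (simp add: power_mult_distrib)
   qed
   moreover have "abs_l2 (s n) \<in> closure rat_steps" for n
    unfolding s_def by (rule step_approx[OF c])
   ultimately have "abs_l2 (H j) \<in> closure (closure rat_steps)"
    unfolding closure_sequential[of _ "closure rat_steps"] by (intro exI[of _ "\<lambda>n. abs_l2 (s n)"]) auto
   then show ?thesis by simp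
  qed
  have "(\<lambda>j. abs_l2 (H j)) \<longlonglongrightarrow> abs_l2 F"
  proof (rule l2_dominated(2)[OF sH])
   show "AE x in lborel. (\<lambda>j. H j x) \<longlonglongrightarrow> F x"
   proof (rule AE_I2)
    fix x
    obtain J :: nat where J: "norm (F x) <= real J" "\<bar>x\<bar> < real J"
     by (metis less_le_trans nle_le reals_Archimedean2 order_less_imp_le)
    have "H j x = F x" if "j \<ge> J" for j
     using J that by (auto simp: H_def trunc_self indicator_def)
    then show "(\<lambda>j. H j x) \<longlonglongrightarrow> F x"
     by (intro tendsto_eventually eventually_sequentiallyI)
   qed
   show "integrable lborel (\<lambda>x. (norm (F x))\<^sup>2)" by (rule sqint_integrable[OF sF])
  qed (use nH in auto)
  then have "abs_l2 F \<in> closure (closure rat_steps)"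
   unfolding closure_sequential[of _ "closure rat_steps"] using Hin by (intro exI[of _ "\<lambda>n. abs_l2 (H n)"]) auto
  then show ?thesis by (simp add: F_def)
 qed
 then show ?thesis by blast
qed

instance l2 :: second_countable_topology
proof
 define B where "B = (\<lambda>(d, n). ball d (1 / real (Suc n))) ` ((rat_steps :: l2 set) \<times> (UNIV :: nat set))"
 have "topological_basis B"
 proof (rule topological_basisI)
  show "open U" if "U \<in> B" for U using that by (auto simp: B_def)
  fix U :: "l2 set" and x assume "open U" "x \<in> U"
  then obtain e where e: "e > 0" "ball x e \<subseteq> U" using openE by blast
  obtain n where n: "1 / real (Suc n) < e / 2" using nat_approx_posE[of "e/2"] e by auto
  have "x \<in> closure rat_steps" by (simp add: closure_steps_UNIV)
  then obtain d where d: "d \<in> rat_steps" "dist d x < 1 / real (Suc n)"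
   unfolding closure_approachable by (metis of_nat_0_less_iff zero_less_Suc zero_less_divide_1_iff)
  have "ball d (1 / real (Suc n)) \<subseteq> U"
  proof
   fix y assume "y \<in> ball d (1 / real (Suc n))"
   then have "dist x y < e" using dist_triangle[of x y d] d n by (auto simp: dist_commute)
   then show "y \<in> U" using e by auto
  qed
  then show "\<exists>B'\<in>B. x \<in> B' \<and> B' \<subseteq> U"
   unfolding B_def using d by (intro bexI[of _ "ball d (1 / real (Suc n))"]) auto
 qed
 moreover have "countable B" unfolding B_def by (intro countable_image countable_SIGMA countable_rat_steps) auto
 ultimately show "\<exists>B::l2 set set. countable B \<and> open = generate_topology B"
  using topological_basis_imp_subbasis by blast
qed

section \<open>Complex Gaussian kernels\<close>

lemma integral_deriv_line_eq_zero:
 fixes F f :: "real => complex"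
 assumes F: "!!x. (F has_vector_derivative f x) (at x)" and c: "!!x. isCont f x"
  and i: "integrable lborel f" and lim: "(F \<longlongrightarrow> 0) at_top" "(F \<longlongrightarrow> 0) at_bot"
 shows "(LBINT x. f x) = 0"
proof -
 have "(LBINT x=-\<infinity>..\<infinity>. f x) = 0 - 0"
  by (rule interval_integral_FTC_integrable)
   (use assms in \<open>auto simp: ereal_tendsto_simps1 set_integrable_def\<close>)
 then show ?thesis by (simp add: interval_lebesgue_integral_def set_lebesgue_integral_def)
qed

text \<open>Derivatives are tested along sequences so that convergence theorems for sequences apply
  to difference quotients.\<close>

lemma has_vector_derivative_seqI:
 fixes F :: "real => 'a::real_normed_vector"
 assumes "!!h. (!!n. h n \<noteq> 0) ==> h \<longlonglongrightarrow> 0 ==> (\<lambda>n. (F (t + h n) - F t) /\<^sub>R h n) \<longlonglongrightarrow> D"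
 shows "(F has_vector_derivative D) (at t)"
proof -
 let ?q = "\<lambda>h. norm (F (t + h) - F t - h *\<^sub>R D) / norm h"
 have "((?q) \<longlongrightarrow> 0) (at 0)"
  unfolding tendsto_at_iff_sequentially
 proof (intro allI impI)
  fix h :: "nat => real" assume h: "\<forall>i. h i \<in> UNIV - {0}" "h \<longlonglongrightarrow> 0"
  have "(\<lambda>n. norm ((F (t + h n) - F t) /\<^sub>R h n - D)) \<longlonglongrightarrow> 0"
   using assms[of h] h by (simp add: tendsto_norm_zero_iff LIM_zero_iff)
  also have "(\<lambda>n. norm ((F (t + h n) - F t) /\<^sub>R h n - D)) = (?q) \<circ> h"
  proof
   fix n
   have "h n \<noteq> 0" using h by auto
   then have "(F (t + h n) - F t) /\<^sub>R h n - D = (1 / h n) *\<^sub>R (F (t + h n) - F t - h n *\<^sub>R D)"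
    by (simp add: algebra_simps divide_inverse)
   then show "norm ((F (t + h n) - F t) /\<^sub>R h n - D) = ((?q) \<circ> h) n"
    by simp
  qed
  finally show "((?q) \<circ> h) \<longlonglongrightarrow> 0" .
 qed
 then show ?thesis
  unfolding has_vector_derivative_def has_derivative_at by (simp add: bounded_linear_scaleR_left)
qed

lemma has_vector_derivative_seqD:
 fixes F :: "real => 'a::real_normed_vector"
 assumes "(F has_vector_derivative D) (at t)" "!!n. h n \<noteq> 0" "h \<longlonglongrightarrow> 0"
 shows "(\<lambda>n. (F (t + h n) - F t) /\<^sub>R h n) \<longlonglongrightarrow> D"
proof -
 let ?q = "\<lambda>h. norm (F (t + h) - F t - h *\<^sub>R D) / norm h"
 have "((?q) \<longlongrightarrow> 0) (at 0)"
  using assms(1) unfolding has_vector_derivative_def has_derivative_at by simp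
 then have "((?q) \<circ> h) \<longlonglongrightarrow> 0"
  unfolding tendsto_at_iff_sequentially using assms(2,3) by auto
 also have "((?q) \<circ> h) = (\<lambda>n. norm ((F (t + h n) - F t) /\<^sub>R h n - D))"
 proof
  fix n
  have "(F (t + h n) - F t) /\<^sub>R h n - D = (1 / h n) *\<^sub>R (F (t + h n) - F t - h n *\<^sub>R D)"
   using assms(2)[of n] by (simp add: algebra_simps divide_inverse)
  then show "((?q) \<circ> h) n = norm ((F (t + h n) - F t) /\<^sub>R h n - D)"
   by simp
 qed
 finally show ?thesis by (simp add: tendsto_norm_zero_iff LIM_zero_iff)
qed

lemma difference_quotient_bound:
 fixes F :: "real => 'a::real_normed_vector"
 assumes F: "!!s. \<bar>s - t\<bar> < r ==> (F has_vector_derivative F' s) (at s)"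
  and bd: "!!s. \<bar>s - t\<bar> < r ==> norm (F' s) <= B" and h: "h \<noteq> 0" "\<bar>h\<bar> < r"
 shows "norm ((F (t + h) - F t) /\<^sub>R h) <= B"
proof -
 have "norm (F (t + h) - F t) <= B * norm ((t + h) - t)"
 proof (rule differentiable_bound[where S="ball t r" and f'="\<lambda>x h. h *\<^sub>R F' x"])
  show "(F has_derivative (\<lambda>h. h *\<^sub>R F' x)) (at x within ball t r)" if "x \<in> ball t r" for x
   using F[of x] that by (auto simp: has_vector_derivative_def dist_real_def intro: has_derivative_at_withinI)
  show "onorm (\<lambda>h. h *\<^sub>R F' x) <= B" if "x \<in> ball t r" for x
   using mult_left_mono[OF bd[of x] abs_ge_zero] that
   by (intro onorm_le) (simp add: dist_real_def mult.commute[of B] abs_minus_commute)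
 qed (use h in \<open>auto simp: dist_real_def\<close>)
 then show ?thesis using h by (simp add: divide_simps)
qed

text \<open>By the mean value inequality a majorant of the derivatives also dominates the difference
  quotients, and dominated convergence applies.\<close>

lemma integral_has_vector_derivative_param:
 fixes f f' :: "real => 'b => 'a::{banach, second_countable_topology}"
 assumes r: "r > 0"
  and int: "!!s. \<bar>s - t\<bar> < r ==> integrable M (f s)"
  and der: "!!s x. \<bar>s - t\<bar> < r ==> ((\<lambda>s. f s x) has_vector_derivative f' s x) (at s)"
  and bd: "!!s x. \<bar>s - t\<bar> < r ==> norm (f' s x) <= g x" and g: "integrable M g"
  and meas: "f' t \<in> borel_measurable M"
 shows "((\<lambda>s. LINT x|M. f s x) has_vector_derivative (LINT x|M. f' t x)) (at t)"
proof (rule has_vector_derivative_seqI)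
 fix h :: "nat => real" assume h: "!!n. h n \<noteq> 0" "h \<longlonglongrightarrow> 0"
 obtain N where N: "!!n. n \<ge> N ==> \<bar>h n\<bar> < r"
  using LIMSEQ_D[OF h(2) r] by auto
 \<comment> \<open>Only increments smaller than r are controlled, hence the shift of the sequence by
   N.\<close>
 have "(\<lambda>n. LINT x|M. (f (t + h (n + N)) x - f t x) /\<^sub>R h (n + N)) \<longlonglongrightarrow> (LINT x|M. f' t x)"
 proof (rule integral_dominated_convergence[where w=g])
  show "(\<lambda>x. (f (t + h (n + N)) x - f t x) /\<^sub>R h (n + N)) \<in> borel_measurable M" for n
   using int[of "t + h (n + N)"] int[of t] N[of "n + N"] r
   by (intro borel_measurable_scaleR borel_measurable_diff borel_measurable_integrable) auto
  show "AE x in M. (\<lambda>n. (f (t + h (n + N)) x - f t x) /\<^sub>R h (n + N)) \<longlonglongrightarrow> f' t x"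
   using LIMSEQ_ignore_initial_segment[OF has_vector_derivative_seqD[OF der[of t] h]] r by auto
  show "AE x in M. norm ((f (t + h (n + N)) x - f t x) /\<^sub>R h (n + N)) <= g x" for n
   by (rule AE_I2, rule difference_quotient_bound[where r=r]) (use der bd h N in auto)
 qed (use g meas in auto)
 also have "(\<lambda>n. LINT x|M. (f (t + h (n + N)) x - f t x) /\<^sub>R h (n + N)) =
   (\<lambda>n. ((LINT x|M. f (t + h (n + N)) x) - (LINT x|M. f t x)) /\<^sub>R h (n + N))"
  using int N r by (intro ext) simp
 finally show "(\<lambda>n. ((LINT x|M. f (t + h n) x) - (LINT x|M. f t x)) /\<^sub>R h n) \<longlonglongrightarrow> (LINT x|M. f' t x)"
  by (rule LIMSEQ_offset)
qed

text \<open>One majorant for the Gaussian and for the factors x and x^2 that differentiation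
  produces.\<close>

definition gmaj :: "real => real => real" where "gmaj k x = (1 + x\<^sup>2) * exp (- k * x\<^sup>2)"

lemma integrable_exp_gauss:
 assumes "k > 0" shows "integrable lborel (\<lambda>x::real. exp (- k * x\<^sup>2))"
proof -
 define s where "s = sqrt (1 / (2 * k))"
 have s: "s > 0" "s\<^sup>2 = 1 / (2 * k)" using assms by (auto simp: s_def)
 have "integrable lborel (\<lambda>x. sqrt (2 * pi * s\<^sup>2) * normal_density 0 s x)"
  by (intro integrable_mult_right integrable_normal_density s(1))
 also have "(\<lambda>x. sqrt (2 * pi * s\<^sup>2) * normal_density 0 s x) = (\<lambda>x. exp (- k * x\<^sup>2))"
 proof
  fix x
  have p: "sqrt (2 * pi * s\<^sup>2) > 0" using s(1) by simp
  show "sqrt (2 * pi * s\<^sup>2) * normal_density 0 s x = exp (- k * x\<^sup>2)"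
   unfolding normal_density_def using p assms by (simp add: s(2) del: real_sqrt_gt_0_iff)
 qed
 finally show ?thesis .
qed

text \<open>Half of the decay absorbs the factor x^2, because y <= exp y.\<close>

lemma sq_exp_le: "k > 0 ==> x\<^sup>2 * exp (- k * x\<^sup>2) <= (2 / k) * exp (- (k / 2) * x\<^sup>2)" for x :: real
proof -
 assume k: "k > 0"
 have "k / 2 * x\<^sup>2 <= exp (k / 2 * x\<^sup>2)" using exp_ge_add_one_self[of "k/2 * x\<^sup>2"] by linarith
 then have "(2 / k) * (k / 2 * x\<^sup>2) <= (2 / k) * exp (k / 2 * x\<^sup>2)" using k by (intro mult_left_mono) auto
 then have "x\<^sup>2 <= (2 / k) * exp (k / 2 * x\<^sup>2)" using k by simp
 then have "x\<^sup>2 * exp (- k * x\<^sup>2) <= (2 / k) * exp (k / 2 * x\<^sup>2) * exp (- k * x\<^sup>2)"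
  by (intro mult_right_mono) auto
 also have "... = (2 / k) * exp (- (k / 2) * x\<^sup>2)"
  unfolding mult.assoc exp_add[symmetric] by (simp add: field_simps)
 finally show ?thesis .
qed

lemma integrable_gmaj: "k > 0 ==> integrable lborel (gmaj k)"
proof -
 assume k: "k > 0"
 show ?thesis
 proof (rule Bochner_Integration.integrable_bound)
  show "integrable lborel (\<lambda>x. exp (- k * x\<^sup>2) + (2 / k) * exp (- (k / 2) * x\<^sup>2))"
   using k by (intro Bochner_Integration.integrable_add integrable_mult_right integrable_exp_gauss) auto
  show "gmaj k \<in> borel_measurable lborel" unfolding gmaj_def by measurable
  show "AE x in lborel. norm (gmaj k x) <= norm (exp (- k * x\<^sup>2) + (2 / k) * exp (- (k / 2) * x\<^sup>2))"
  proof (rule AE_I2)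
   fix x
   have "gmaj k x <= exp (- k * x\<^sup>2) + (2 / k) * exp (- (k / 2) * x\<^sup>2)"
    using sq_exp_le[OF k, of x] by (simp add: gmaj_def distrib_right)
   moreover have "0 <= gmaj k x" by (simp add: gmaj_def)
   ultimately show "norm (gmaj k x) <= norm (exp (- k * x\<^sup>2) + (2 / k) * exp (- (k / 2) * x\<^sup>2))" by simp
  qed
 qed
qed

lemma gmaj_tendsto:
 assumes "k > 0" shows "(gmaj k \<longlongrightarrow> 0) at_top" "(gmaj k \<longlongrightarrow> 0) at_bot"
proof -
 have e: "gmaj k (- x) = gmaj k x" for x by (simp add: gmaj_def)
 have lim: "((\<lambda>x. exp (- c * x\<^sup>2)) \<longlongrightarrow> 0) at_top" if "c > 0" for c :: real
  by (rule filterlim_compose[OF exp_at_bot],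
    rule filterlim_tendsto_neg_mult_at_bot[OF tendsto_const])
   (use that in \<open>auto intro!: filterlim_pow_at_top filterlim_ident\<close>)
 have "((\<lambda>x. exp (- k * x\<^sup>2) + (2 / k) * exp (- (k / 2) * x\<^sup>2)) \<longlongrightarrow> 0 + (2/k) * 0) at_top"
  using assms by (intro tendsto_intros lim) auto
 then have u: "((\<lambda>x. exp (- k * x\<^sup>2) + (2 / k) * exp (- (k / 2) * x\<^sup>2)) \<longlongrightarrow> 0) at_top" by simp
 show 1: "(gmaj k \<longlongrightarrow> 0) at_top"
  by (rule tendsto_sandwich[OF _ _ tendsto_const u])
   (use sq_exp_le[OF assms] in \<open>auto simp: gmaj_def distrib_right\<close>)
 show "(gmaj k \<longlongrightarrow> 0) at_bot"
  unfolding filterlim_at_bot_mirror using 1 by (simp add: e)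
qed

definition egauss :: "complex => real => complex" where
 "egauss z x = exp (- (of_real (x\<^sup>2) / (4 * z)))"

text \<open>A square root of 4 pi z. Defining it as the integral avoids the choice of a branch;
  \<open>gnorm_sq\<close> identifies its square and \<open>gnorm_mult\<close> the products that
  occur.\<close>

definition gnorm :: "complex => complex" where
 "gnorm z = (LBINT x. egauss z x)"

definition gk :: "complex => real => complex" where
 "gk z x = egauss z x / gnorm z"

text \<open>The real part of 1/(4 z), which is the decay rate of the modulus of
  \<open>egauss z\<close>.\<close>

definition grate :: "complex => real" where "grate z = Re z / (4 * (norm z)\<^sup>2)"

lemma Re_inverse_4: "Re (of_real r / (4 * z)) = r * grate z"
proof -
 have "of_real r / (4 * z) = (of_real r * cnj (4 * z)) / of_real ((norm (4 * z))\<^sup>2)"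
  by (subst complex_div_cnj) simp
 then have "Re (of_real r / (4 * z)) = Re (of_real r * cnj (4 * z)) / (norm (4 * z))\<^sup>2"
  by (simp only: Re_divide_of_real)
 also have "... = r * (4 * Re z) / (16 * (norm z)\<^sup>2)"
  by (simp add: norm_mult power_mult_distrib)
 finally show ?thesis by (simp add: grate_def)
qed

lemma norm_egauss: "norm (egauss z x) = exp (- grate z * x\<^sup>2)"
 unfolding egauss_def by (simp only: norm_exp_eq_Re uminus_complex.sel Re_inverse_4) (simp add: mult.commute)

lemma grate_pos: "Re z > 0 ==> grate z > 0"
 by (auto simp: grate_def intro!: divide_pos_pos mult_pos_pos)

lemma grate_lower:
 assumes "m > 0" "m <= Re z" "norm z <= R"
 shows "m / (4 * R\<^sup>2) <= grate z"
proof -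
 have "0 < norm z" using assms by auto
 then show ?thesis unfolding grate_def using assms by (intro frac_le mult_left_mono power_mono) auto
qed

lemma egauss_continuous: "continuous_on UNIV (egauss z)"
 unfolding egauss_def divide_inverse by (intro continuous_intros)

lemma egauss_measurable[measurable]: "egauss z \<in> bmeas"
 by (intro borel_measurable_continuous_onI egauss_continuous)

lemma norm_egauss_le: "Re z > 0 ==> norm (egauss z x) <= 1"
 using grate_pos[of z] by (simp add: norm_egauss mult_le_0_iff)

lemma egauss_le_gmaj: "norm (egauss z x) <= gmaj (grate z) x"
 by (simp add: norm_egauss gmaj_def distrib_right)

lemma egauss_sq_le_gmaj: "norm (of_real (x\<^sup>2) * egauss z x) <= gmaj (grate z) x"
 by (simp add: norm_mult norm_egauss gmaj_def distrib_right norm_power)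

lemma egauss_lin_le_gmaj: "norm (of_real x * egauss z x) <= gmaj (grate z) x"
proof -
 have "\<bar>x\<bar> <= 1 + x\<^sup>2"
  using sum_squares_bound[of "\<bar>x\<bar>" 1] by simp
 then show ?thesis by (simp add: norm_mult norm_egauss gmaj_def mult_right_mono)
qed

lemma integrable_gmaj_bound:
 fixes f :: "real => complex"
 assumes "k > 0" "f \<in> bmeas" "!!x. norm (f x) <= C * gmaj k x"
 shows "integrable lborel f"
 by (rule Bochner_Integration.integrable_bound[OF integrable_mult_right[OF integrable_gmaj[OF assms(1)], of C]])
  (use assms in \<open>auto intro: order_trans[OF _ abs_ge_self]\<close>)

lemma integrable_egauss: "Re z > 0 ==> integrable lborel (egauss z)"
 by (rule integrable_gmaj_bound[OF grate_pos, where C=1]) (use egauss_le_gmaj in auto)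

lemma integrable_egauss_sq: "Re z > 0 ==> integrable lborel (\<lambda>x. of_real (x\<^sup>2) * egauss z x)"
 by (rule integrable_gmaj_bound[OF grate_pos, where C=1]) (use egauss_sq_le_gmaj in auto)

lemma egauss_deriv: "(egauss z has_vector_derivative - (of_real x / (2 * z)) * egauss z x) (at x)"
proof -
 define c where "c = - 1 / (4 * z)"
 have e: "egauss z = (\<lambda>x. exp ((of_real x)\<^sup>2 * c))" by (auto simp: egauss_def c_def)
 have "((\<lambda>w. exp (w\<^sup>2 * c)) has_field_derivative (2 * of_real x * c) * exp ((of_real x)\<^sup>2 * c)) (at (of_real x))"
  by (auto intro!: derivative_eq_intros)
 from has_vector_derivative_real_field[OF this] show ?thesis
  unfolding e by (simp add: c_def)
qed

lemma aux_inverse_sq: "- (a / 4) * (- (inverse Z * d * inverse Z)) = d * (a / (4 * Z\<^sup>2))" for a d Z :: complex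
 unfolding minus_mult_minus divide_inverse power2_eq_square nonzero_inverse_mult_distrib inverse_mult_distrib
 by (simp only: mult_ac)

text \<open>Near t the real part of the time stays above \<open>m\<close>, half its value, and the
  modulus stays below \<open>R\<close>, so one Gaussian majorant serves for all nearby derivatives.
  The bounded weight c is 1 for \<open>gnorm\<close> and a pairing of translates for the
  evolution.\<close>

lemma egauss_param_deriv:
 assumes c: "c \<in> bmeas" "!!x. norm (c x) <= B" and z: "Re (z0 + of_real t * d) > 0"
 shows "((\<lambda>s. LBINT x. egauss (z0 + of_real s * d) x * c x) has_vector_derivative
   (LBINT x. d * (of_real (x\<^sup>2) / (4 * (z0 + of_real t * d)\<^sup>2)) * egauss (z0 + of_real t * d) x * c x)) (at t)"
proof -
 define m where "m = Re (z0 + of_real t * d) / 2"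
 define R where "R = norm (z0 + of_real t * d) + m"
 define r where "r = m / (norm d + 1)"
 have m: "m > 0" using z by (simp add: m_def)
 have d1: "norm d + 1 > 0" using norm_ge_zero[of d] by linarith
 have r: "r > 0" using m d1 by (simp add: r_def)
 have B: "B \<ge> 0" using c(2)[of 0] norm_ge_zero order_trans by blast
 have R: "R > 0" using m by (simp add: R_def add_nonneg_pos)
 have near: "norm (of_real (s - t) * d) <= m" if "\<bar>s - t\<bar> < r" for s
 proof -
  have "norm (of_real (s - t) * d) <= r * (norm d + 1)"
   unfolding norm_mult norm_of_real using that by (intro mult_mono) auto
  then show ?thesis using d1 by (simp add: r_def)
 qed
 have eq: "z0 + of_real s * d = (z0 + of_real t * d) + of_real (s - t) * d" for s
  by (simp add: algebra_simps)
 have Rez: "m <= Re (z0 + of_real s * d)" and nz: "norm (z0 + of_real s * d) <= R" if "\<bar>s - t\<bar> < r" for s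
 proof -
  show "m <= Re (z0 + of_real s * d)"
   using abs_Re_le_cmod[of "of_real (s - t) * d"] near[OF that] unfolding eq[of s]
   by (simp add: m_def)
  show "norm (z0 + of_real s * d) <= R"
   using norm_triangle_ineq[of "z0 + of_real t * d" "of_real (s - t) * d"] near[OF that]
   unfolding eq[of s] R_def by linarith
 qed
 define k where "k = m / (4 * R\<^sup>2)"
 have k: "k > 0" using m R by (simp add: k_def)
 have maj: "gmaj (grate (z0 + of_real s * d)) x <= gmaj k x" if "\<bar>s - t\<bar> < r" for s x
  using mult_right_mono[OF grate_lower[OF m Rez[OF that] nz[OF that]], of "x\<^sup>2"]
  unfolding gmaj_def k_def by (intro mult_left_mono) auto
 have ne: "z0 + of_real s * d \<noteq> 0" if "\<bar>s - t\<bar> < r" for s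
  using Rez[OF that] m by (metis not_le zero_complex.sel(1))
 show ?thesis
 proof (rule integral_has_vector_derivative_param[OF r, where g="\<lambda>x. norm d / (4 * m\<^sup>2) * B * gmaj k x"
   and f'="\<lambda>t x. d * (of_real (x\<^sup>2) / (4 * (z0 + of_real t * d)\<^sup>2)) * egauss (z0 + of_real t * d) x * c x"])
  fix s assume s: "\<bar>s - t\<bar> < r"
  show "integrable lborel (\<lambda>x. egauss (z0 + of_real s * d) x * c x)"
  proof (rule integrable_gmaj_bound[OF k, where C=B])
   show "norm (egauss (z0 + of_real s * d) x * c x) <= B * gmaj k x" for x
    unfolding norm_mult mult.commute[of B]
    using order_trans[OF egauss_le_gmaj maj[OF s]] c(2)[of x] B
    by (intro mult_mono) (auto simp: gmaj_def)
  qed (use c in measurable)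
  fix x
  have "((\<lambda>s. - (of_real (x\<^sup>2) / (4 * (z0 + of_real s * d)))) has_vector_derivative
    d * (of_real (x\<^sup>2) / (4 * (z0 + of_real s * d)\<^sup>2))) (at s)"
  proof -
   define Z where "Z = z0 + of_real s * d"
   have Z: "Z \<noteq> 0" unfolding Z_def by (rule ne[OF s])
   have lin: "((\<lambda>w. z0 + w * d) has_field_derivative d) (at (of_real s))"
    by (auto intro!: derivative_eq_intros)
   have "((\<lambda>w. inverse (z0 + w * d)) has_field_derivative - (inverse Z * d * inverse Z)) (at (of_real s))"
    unfolding Z_def by (rule DERIV_inverse'[OF lin ne[OF s]])
   from DERIV_cmult[OF this]
   have f1: "((\<lambda>w. - (of_real (x\<^sup>2) / 4) * inverse (z0 + w * d)) has_field_derivative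
     - (of_real (x\<^sup>2) / 4) * (- (inverse Z * d * inverse Z))) (at (of_real s))" .
   have f3: "- (of_real (x\<^sup>2) / 4) * inverse w = - (of_real (x\<^sup>2) / (4 * w))" for w :: complex
    by (simp only: divide_inverse inverse_mult_distrib mult_ac mult_minus_left mult_minus_right)
   have "((\<lambda>w. - (of_real (x\<^sup>2) / (4 * (z0 + w * d)))) has_field_derivative
     d * (of_real (x\<^sup>2) / (4 * (z0 + of_real s * d)\<^sup>2))) (at (of_real s))"
    using f1 unfolding aux_inverse_sq f3 unfolding Z_def .
   from has_vector_derivative_real_field[OF this] show ?thesis by simp
  qed
  from field_vector_diff_chain_at[OF this DERIV_exp]
  have "((\<lambda>s. egauss (z0 + of_real s * d) x) has_vector_derivative
    d * (of_real (x\<^sup>2) / (4 * (z0 + of_real s * d)\<^sup>2)) * egauss (z0 + of_real s * d) x) (at s)"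
   by (simp add: egauss_def o_def)
  then show "((\<lambda>s. egauss (z0 + of_real s * d) x * c x) has_vector_derivative
    d * (of_real (x\<^sup>2) / (4 * (z0 + of_real s * d)\<^sup>2)) * egauss (z0 + of_real s * d) x * c x) (at s)"
   by (rule has_vector_derivative_mult_left)
  have "norm (d * (of_real (x\<^sup>2) / (4 * (z0 + of_real s * d)\<^sup>2)) * egauss (z0 + of_real s * d) x * c x)
   = norm d / (4 * (norm (z0 + of_real s * d))\<^sup>2) * norm (c x) * norm (of_real (x\<^sup>2) * egauss (z0 + of_real s * d) x)"
   by (simp add: norm_mult norm_divide norm_power)
  also have "... <= norm d / (4 * m\<^sup>2) * B * gmaj k x"
  proof -
   have "m <= norm (z0 + of_real s * d)" using Rez[OF s] complex_Re_le_cmod order_trans by blast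
   then have "norm d / (4 * (norm (z0 + of_real s * d))\<^sup>2) <= norm d / (4 * m\<^sup>2)"
    using m by (intro divide_left_mono mult_left_mono power_mono mult_pos_pos) (auto intro!: zero_less_power)
   then show ?thesis
    using order_trans[OF egauss_sq_le_gmaj maj[OF s]] c(2)[of x] B
    by (intro mult_mono) auto
  qed
  finally show "norm (d * (of_real (x\<^sup>2) / (4 * (z0 + of_real s * d)\<^sup>2)) * egauss (z0 + of_real s * d) x * c x)
   <= norm d / (4 * m\<^sup>2) * B * gmaj k x" .
 next
  show "integrable lborel (\<lambda>x. norm d / (4 * m\<^sup>2) * B * gmaj k x)"
   by (intro integrable_mult_right integrable_gmaj k)
 qed (use c in measurable)
qed

text \<open>The derivative of x times the Gaussian integrates to zero. This moment closes the
  formula for the derivative of \<open>gnorm\<close> into a differential equation.\<close>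

lemma egauss_second_moment:
 assumes z: "Re z > 0"
 shows "(LBINT x. of_real (x\<^sup>2) * egauss z x) = 2 * z * gnorm z"
proof -
 have nz: "z \<noteq> 0" using z by auto
 have k: "grate z > 0" by (rule grate_pos[OF z])
 have i1: "integrable lborel (egauss z)" by (rule integrable_egauss[OF z])
 have i2: "integrable lborel (\<lambda>x. of_real (x\<^sup>2) * egauss z x)" by (rule integrable_egauss_sq[OF z])
 have "(LBINT x. egauss z x - (of_real (x\<^sup>2) * egauss z x) * (1 / (2 * z))) = 0"
 proof (rule integral_deriv_line_eq_zero[where F="\<lambda>x. of_real x * egauss z x"])
  show "((\<lambda>x. of_real x * egauss z x) has_vector_derivative
    egauss z x - (of_real (x\<^sup>2) * egauss z x) * (1 / (2 * z))) (at x)" for x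
   by (auto intro!: derivative_eq_intros egauss_deriv simp: power2_eq_square)
  show "isCont (\<lambda>x. egauss z x - (of_real (x\<^sup>2) * egauss z x) * (1 / (2 * z))) x" for x
   using egauss_continuous[of z] by (intro continuous_intros) (auto simp: continuous_on_eq_continuous_at)
  show "integrable lborel (\<lambda>x. egauss z x - (of_real (x\<^sup>2) * egauss z x) * (1 / (2 * z)))"
   using i1 i2 by (intro Bochner_Integration.integrable_diff integrable_mult_left)
  show "((\<lambda>x. of_real x * egauss z x) \<longlongrightarrow> 0) at_top" "((\<lambda>x. of_real x * egauss z x) \<longlongrightarrow> 0) at_bot"
   by (rule Lim_null_comparison[OF _ gmaj_tendsto(1)[OF k]] Lim_null_comparison[OF _ gmaj_tendsto(2)[OF k]];
     use egauss_lin_le_gmaj[of _ z] in auto)+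
 qed
 then have "gnorm z - (LBINT x. of_real (x\<^sup>2) * egauss z x) * (1 / (2 * z)) = 0"
  by (subst (asm) Bochner_Integration.integral_diff[OF i1 integrable_mult_left[OF i2]])
   (simp only: gnorm_def integral_mult_left_zero)
 then show ?thesis using nz by (simp add: field_simps)
qed

lemma gnorm_deriv:
 assumes z: "Re (z0 + of_real t * d) > 0"
 shows "((\<lambda>s. gnorm (z0 + of_real s * d)) has_vector_derivative
   d / (2 * (z0 + of_real t * d)) * gnorm (z0 + of_real t * d)) (at t)"
proof -
 let ?z = "z0 + of_real t * d"
 have nz: "?z \<noteq> 0" using z by (metis less_irrefl zero_complex.sel(1))
 have "(LBINT x. d * (of_real (x\<^sup>2) / (4 * ?z\<^sup>2)) * egauss ?z x * 1)
   = d / (4 * ?z\<^sup>2) * (LBINT x. of_real (x\<^sup>2) * egauss ?z x)"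
  by (subst integral_mult_right_zero[symmetric], rule Bochner_Integration.integral_cong) (simp_all add: field_simps)
 also have "... = d / (2 * ?z) * gnorm ?z"
 proof -
  have "d / (4 * Z\<^sup>2) * (2 * Z * g) = d / (2 * Z) * g" if "Z \<noteq> 0" for Z g :: complex
   using that by (simp add: power2_eq_square)
  from this[OF nz] show ?thesis unfolding egauss_second_moment[OF z] .
 qed
 finally show ?thesis
  using egauss_param_deriv[of "\<lambda>x. 1" 1 z0 t d] z by (simp add: gnorm_def)
qed

lemma gnorm_1: "gnorm 1 = of_real (sqrt (4 * pi))"
proof -
 have "gnorm 1 = of_real (LBINT x. exp (- (x\<^sup>2 / 4)))"
  unfolding gnorm_def egauss_def by (simp flip: integral_complex_of_real exp_of_real)
 also have "(LBINT x. exp (- (x\<^sup>2 / 4))) = (LBINT x. sqrt (4 * pi) * normal_density 0 (sqrt 2) x)"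
  by (intro Bochner_Integration.integral_cong refl) (simp add: normal_density_def)
 also have "... = sqrt (4 * pi)" by (subst integral_mult_right_zero) simp
 finally show ?thesis .
qed

text \<open>Since g' = g / (2 z), the quotient \<open>(gnorm z)\<^sup>2 / z\<close> is constant
  along the segment from 1 to z, which stays in the half plane; at 1 it is the classical Gaussian
  integral.\<close>

lemma gnorm_sq: fixes z :: complex assumes z: "Re z > 0" shows "(gnorm z)\<^sup>2 = 4 * of_real pi * z"
proof -
 define p :: "real => complex" where "p t = 1 + of_real t * (z - 1)" for t
 have Rep: "Re (p t) > 0" if "t \<in> {0..1}" for t
 proof -
  have "Re (p t) = (1 - t) + t * Re z" by (simp add: p_def algebra_simps)
  moreover have "t * Re z > 0 \<or> t = 0" using that z by auto
  ultimately show ?thesis using that by (auto simp: add_nonneg_pos)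
 qed
 have "\<exists>c. \<forall>t\<in>{0..1}. (gnorm (p t))\<^sup>2 / p t = c"
 proof (rule has_vector_derivative_zero_constant)
  fix t :: real assume t: "t \<in> {0..1}"
  have nz: "p t \<noteq> 0" using Rep[OF t] by auto
  have g: "((\<lambda>s. gnorm (p s)) has_vector_derivative (z - 1) / (2 * p t) * gnorm (p t)) (at t within {0..1})"
   using gnorm_deriv[of 1 t "z - 1"] Rep[OF t] unfolding p_def by (auto intro: has_vector_derivative_at_within)
  have pi: "((\<lambda>s. inverse (p s)) has_vector_derivative - (z - 1) / (p t)\<^sup>2) (at t within {0..1})"
  proof -
   have "((\<lambda>w. inverse (1 + w * (z - 1))) has_field_derivative - (z - 1) / (p t)\<^sup>2) (at (of_real t))"
    using nz unfolding p_def by (auto intro!: derivative_eq_intros simp: power2_eq_square divide_simps)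
   from has_vector_derivative_real_field[OF this] show ?thesis
    unfolding p_def by (auto intro: has_vector_derivative_at_within)
  qed
  have "((\<lambda>s. gnorm (p s) * gnorm (p s) * inverse (p s)) has_vector_derivative 0) (at t within {0..1})"
   by (rule has_vector_derivative_eq_rhs[OF has_vector_derivative_mult[OF has_vector_derivative_mult[OF g g] pi]])
    (use nz in \<open>simp add: field_simps power2_eq_square\<close>)
  then show "((\<lambda>s. (gnorm (p s))\<^sup>2 / p s) has_vector_derivative 0) (at t within {0..1})"
   by (simp add: power2_eq_square divide_inverse)
 qed auto
 then obtain c where c: "\<forall>t\<in>{0..1}. (gnorm (p t))\<^sup>2 / p t = c" by blast
 have "(gnorm 1)\<^sup>2 = c" "(gnorm z)\<^sup>2 / z = c"
  using c[rule_format, of 0] c[rule_format, of 1] by (simp_all add: p_def)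
 moreover have "(gnorm 1)\<^sup>2 = 4 * of_real pi"
  unfolding gnorm_1 of_real_power[symmetric] by simp
 moreover have "z \<noteq> 0" using z by auto
 ultimately show ?thesis by (simp add: field_simps)
qed

lemma gnorm_nz: "Re z > 0 ==> gnorm z \<noteq> 0"
 using gnorm_sq[of z] by auto

lemma norm_gnorm: assumes "Re z > 0" shows "norm (gnorm z) = sqrt (4 * pi * norm z)"
proof -
 have "(norm (gnorm z))\<^sup>2 = 4 * pi * norm z"
  using gnorm_sq[OF assms] by (simp add: norm_power[symmetric] norm_mult)
 then show ?thesis by (metis norm_ge_zero real_sqrt_abs abs_of_nonneg)
qed

text \<open>A Gaussian with complex centre c, as it appears on completing the square in a
  convolution of complex Gaussians.\<close>

definition esh :: "complex => complex => real => complex" where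
 "esh z c y = exp (- ((of_real y - c)\<^sup>2 / (4 * z)))"

lemma esh_zero: "esh z 0 = egauss z"
 by (auto simp: esh_def egauss_def)

text \<open>The cross term y c / (2 z) is absorbed by half of the quadratic decay, at the price of a
  constant that is uniform over bounded centres.\<close>

lemma norm_esh_le:
 assumes z: "Re z > 0" and c: "norm c <= \<rho>"
 shows "norm (esh z c y) <= exp (\<rho>\<^sup>2 / (4 * norm z) + (\<rho> / (2 * norm z))\<^sup>2 / (2 * grate z)) * exp (- (grate z / 2) * y\<^sup>2)"
proof -
 define k where "k = grate z"
 define b where "b = \<rho> / (2 * norm z)"
 have k: "k > 0" using grate_pos[OF z] by (simp add: k_def)
 have nz: "norm z > 0" using z by auto
 have \<rho>: "\<rho> \<ge> 0" using c norm_ge_zero order_trans by blast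
 have b: "b \<ge> 0" using \<rho> by (simp add: b_def)
 have eq: "- ((of_real y - c)\<^sup>2 / (4 * z)) = - (of_real (y\<^sup>2) / (4 * z)) + of_real y * c / (2 * z) - c\<^sup>2 / (4 * z)"
  by (simp add: power2_diff diff_divide_distrib add_divide_distrib) (simp add: mult_ac)?
 have 1: "Re (of_real y * c / (2 * z)) <= \<bar>y\<bar> * b"
 proof -
  have "Re (of_real y * c / (2 * z)) <= norm (of_real y * c / (2 * z))" by (rule complex_Re_le_cmod)
  also have "... = \<bar>y\<bar> * (norm c / (2 * norm z))" by (simp add: norm_mult norm_divide)
  also have "... <= \<bar>y\<bar> * b" unfolding b_def using c nz by (intro mult_left_mono divide_right_mono) auto
  finally show ?thesis .
 qed
 have 2: "- Re (c\<^sup>2 / (4 * z)) <= \<rho>\<^sup>2 / (4 * norm z)"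
 proof -
  have "- Re (c\<^sup>2 / (4 * z)) <= norm (c\<^sup>2 / (4 * z))" using abs_Re_le_cmod[of "c\<^sup>2 / (4 * z)"] by linarith
  also have "... = (norm c)\<^sup>2 / (4 * norm z)" by (simp add: norm_mult norm_divide norm_power)
  also have "... <= \<rho>\<^sup>2 / (4 * norm z)" using c nz by (intro divide_right_mono power_mono) auto
  finally show ?thesis .
 qed
 have 3: "\<bar>y\<bar> * b <= k / 2 * y\<^sup>2 + b\<^sup>2 / (2 * k)"
 proof -
  have "0 <= (k * \<bar>y\<bar> - b)\<^sup>2 / (2 * k)" using k by simp
  also have "... = k / 2 * y\<^sup>2 + b\<^sup>2 / (2 * k) - \<bar>y\<bar> * b"
  proof -
   have "(k * Y - b)\<^sup>2 / (2 * k) = k / 2 * Y\<^sup>2 + b\<^sup>2 / (2 * k) - Y * b" for Y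
    using k by (simp add: field_simps power2_eq_square)
   from this[of "\<bar>y\<bar>"] show ?thesis by simp
  qed
  finally show ?thesis by simp
 qed
 have "norm (esh z c y) = exp (Re (- ((of_real y - c)\<^sup>2 / (4 * z))))"
  unfolding esh_def by (rule norm_exp_eq_Re)
 also have "Re (- ((of_real y - c)\<^sup>2 / (4 * z))) = - (y\<^sup>2 * k) + Re (of_real y * c / (2 * z)) - Re (c\<^sup>2 / (4 * z))"
  unfolding eq by (simp only: minus_complex.sel plus_complex.sel uminus_complex.sel Re_inverse_4 k_def)
 also have "... <= (\<rho>\<^sup>2 / (4 * norm z) + b\<^sup>2 / (2 * k)) + (- (k / 2) * y\<^sup>2)"
 proof -
  define A where "A = k / 2 * y\<^sup>2"
  have "y\<^sup>2 * k = A + A" "- (k / 2) * y\<^sup>2 = - A" by (simp_all add: A_def)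
  then show ?thesis using 1 2 3[folded A_def] by linarith
 qed
 finally show ?thesis unfolding exp_add k_def b_def by simp
qed

lemma aux_cancel: "2 * u * (- 1 / (4 * z)) = - (u / (2 * z))" "- 2 * c * u * (- 1 / (4 * z)) * E = c / (2 * z) * (u * E)"
 "c / (2 * z) * (u * E) = - c * (- (u / (2 * z)) * E)"
 for u z c E :: complex by simp_all

lemma esh_deriv: "(esh z c has_vector_derivative - ((of_real y - c) / (2 * z)) * esh z c y) (at y)"
proof -
 define d where "d = - 1 / (4 * z)"
 have e: "esh z c = (\<lambda>x. exp ((of_real x - c)\<^sup>2 * d))" by (auto simp: esh_def d_def)
 have "((\<lambda>w. exp ((w - c)\<^sup>2 * d)) has_field_derivative (2 * (of_real y - c) * d) * exp ((of_real y - c)\<^sup>2 * d)) (at (of_real y))"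
  by (auto intro!: derivative_eq_intros)
 from this[unfolded d_def aux_cancel, folded d_def]
 have D: "((\<lambda>w. exp ((w - c)\<^sup>2 * d)) has_field_derivative - ((of_real y - c) / (2 * z)) * exp ((of_real y - c)\<^sup>2 * d)) (at (of_real y))" .
 show ?thesis
  unfolding e by (rule has_vector_derivative_real_field[OF D])
qed

lemma esh_continuous: "continuous_on UNIV (esh z c)"
 unfolding esh_def divide_inverse by (intro continuous_intros)

lemma esh_bounds:
 assumes z: "Re z > 0"
 obtains C k where "C \<ge> 0" "k > 0" "!!c y. norm c <= \<rho> ==> norm (esh z c y) <= C * gmaj k y"
  "!!c y. norm c <= \<rho> ==> norm ((of_real y - c) * esh z c y) <= C * gmaj k y"
proof -
 define K where "K = exp (\<rho>\<^sup>2 / (4 * norm z) + (\<rho> / (2 * norm z))\<^sup>2 / (2 * grate z))"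
 define k where "k = grate z / 2"
 define C where "C = (1 + \<bar>\<rho>\<bar>) * K"
 have k: "k > 0" using grate_pos[OF z] by (simp add: k_def)
 have K: "K > 0" by (simp add: K_def)
 have b: "norm (esh z c y) <= K * exp (- k * y\<^sup>2)" if "norm c <= \<rho>" for c y
  using norm_esh_le[OF z that, of y] by (simp add: K_def k_def)
 have KC: "K <= C" using K by (simp add: C_def distrib_right)
 have 1: "norm (esh z c y) <= C * gmaj k y" if "norm c <= \<rho>" for c y
 proof -
  have "K * exp (- k * y\<^sup>2) <= C * gmaj k y"
   unfolding gmaj_def using KC K by (intro mult_mono) (auto simp: distrib_right)
  then show ?thesis using b[OF that, of y] by linarith
 qed
 have 2: "norm ((of_real y - c) * esh z c y) <= C * gmaj k y" if "norm c <= \<rho>" for c y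
 proof -
  have "norm (of_real y - c) <= \<bar>y\<bar> + \<bar>\<rho>\<bar>" using norm_triangle_ineq4[of "of_real y" c] that by simp
  also have "... <= (1 + \<bar>\<rho>\<bar>) * (1 + y\<^sup>2)"
  proof -
   have "0 <= \<bar>\<rho>\<bar> * y\<^sup>2" by simp
   then show ?thesis using sum_squares_bound[of "\<bar>y\<bar>" 1, unfolded power2_abs power_one mult_1_right] unfolding distrib_left distrib_right by linarith
  qed
  finally have "norm ((of_real y - c) * esh z c y) <= ((1 + \<bar>\<rho>\<bar>) * (1 + y\<^sup>2)) * (K * exp (- k * y\<^sup>2))"
   unfolding norm_mult using b[OF that, of y] by (intro mult_mono) auto
  then show ?thesis by (simp add: C_def gmaj_def mult_ac)
 qed
 show thesis using that[of C k] 1 2 k KC K by auto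
qed

text \<open>The integral of a complex shift of a Gaussian does not depend on the shift, since its
 derivative along the segment from 0 to \<open>c\<close> is the integral of an exact derivative.\<close>

lemma integral_esh:
 assumes z: "Re z > 0"
 shows "integrable lborel (esh z c)" "(LBINT y. esh z c y) = gnorm z"
proof -
 \<comment> \<open>The derivative at s in [0, 1] uses parameters at distance less than 1 from s,
   hence of modulus below 2.\<close>
 define \<rho> where "\<rho> = 2 * norm c"
 obtain C k where C: "C \<ge> 0" and k: "k > 0" and b1: "!!c y. norm c <= \<rho> ==> norm (esh z c y) <= C * gmaj k y"
  and b2: "!!c y. norm c <= \<rho> ==> norm ((of_real y - c) * esh z c y) <= C * gmaj k y"
  using esh_bounds[OF z, of \<rho>] by blast
 have m[measurable]: "esh z d \<in> bmeas" for d
  by (intro borel_measurable_continuous_onI esh_continuous)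
 have int: "integrable lborel (esh z d)" if "norm d <= \<rho>" for d
  by (rule integrable_gmaj_bound[OF k m b1[OF that]])
 show "integrable lborel (esh z c)" by (rule int) (simp add: \<rho>_def)
 have int2: "integrable lborel (\<lambda>y. (of_real y - d) * esh z d y)" if "norm d <= \<rho>" for d
  by (rule integrable_gmaj_bound[OF k _ b2[OF that]]) measurable
 have zero: "(LBINT y. - ((of_real y - d) / (2 * z)) * esh z d y) = 0" if d: "norm d <= \<rho>" for d
 proof (rule integral_deriv_line_eq_zero[where F="esh z d"])
  show "isCont (\<lambda>y. - ((of_real y - d) / (2 * z)) * esh z d y) y" for y
   using esh_continuous[of z d] unfolding divide_inverse
   by (intro continuous_intros) (auto simp: continuous_on_eq_continuous_at)
  have "integrable lborel (\<lambda>y. (- 1 / (2 * z)) * ((of_real y - d) * esh z d y))"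
   by (intro integrable_mult_right int2 d)
  then show "integrable lborel (\<lambda>y. - ((of_real y - d) / (2 * z)) * esh z d y)" by (simp add: mult_ac)
  have "((\<lambda>y. C * gmaj k y) \<longlongrightarrow> C * 0) at_top" "((\<lambda>y. C * gmaj k y) \<longlongrightarrow> C * 0) at_bot"
   by (intro tendsto_intros gmaj_tendsto k)+
  then show "(esh z d \<longlongrightarrow> 0) at_top" "(esh z d \<longlongrightarrow> 0) at_bot"
   by (auto intro!: Lim_null_comparison[where f="esh z d" and g="\<lambda>y. C * gmaj k y"] always_eventually b1[OF d])
 qed (rule esh_deriv)
 have "\<exists>a. \<forall>s\<in>{0..1}. (LBINT y. esh z (of_real s * c) y) = a"
 proof (rule has_vector_derivative_zero_constant)
  fix s :: real assume s: "s \<in> {0..1}"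
  have sc: "norm (of_real s' * c) <= \<rho>" if "\<bar>s' - s\<bar> < 1" for s'
   unfolding norm_mult norm_of_real \<rho>_def using that s by (intro mult_right_mono) auto
  have "((\<lambda>s. LBINT y. esh z (of_real s * c) y) has_vector_derivative
    (LBINT y. c / (2 * z) * ((of_real y - of_real s * c) * esh z (of_real s * c) y))) (at s)"
  proof (rule integral_has_vector_derivative_param[where r=1 and g="\<lambda>y. norm (c / (2 * z)) * (C * gmaj k y)"
    and f'="\<lambda>s y. c / (2 * z) * ((of_real y - of_real s * c) * esh z (of_real s * c) y)"])
   fix s' :: real and y assume s': "\<bar>s' - s\<bar> < 1"
   show "integrable lborel (esh z (of_real s' * c))" by (rule int[OF sc[OF s']])
   show "norm (c / (2 * z) * ((of_real y - of_real s' * c) * esh z (of_real s' * c) y)) <= norm (c / (2 * z)) * (C * gmaj k y)"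
    unfolding norm_mult[of "c / (2 * z)"] by (intro mult_left_mono b2[OF sc[OF s']]) simp
   define d where "d = - 1 / (4 * z)"
   have e: "esh z (of_real s * c) y = exp ((of_real y - of_real s * c)\<^sup>2 * d)" for s by (auto simp: esh_def d_def)
   have "((\<lambda>w. exp ((of_real y - w * c)\<^sup>2 * d)) has_field_derivative
     (- 2 * c * (of_real y - of_real s' * c) * d) * exp ((of_real y - of_real s' * c)\<^sup>2 * d)) (at (of_real s'))"
    by (auto intro!: derivative_eq_intros)
   from has_vector_derivative_real_field[OF this, where s=UNIV]
   show "((\<lambda>s. esh z (of_real s * c) y) has_vector_derivative
     c / (2 * z) * ((of_real y - of_real s' * c) * esh z (of_real s' * c) y)) (at s')"
    unfolding e unfolding d_def aux_cancel .
  next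
   show "integrable lborel (\<lambda>y. norm (c / (2 * z)) * (C * gmaj k y))"
    by (intro integrable_mult_right integrable_gmaj k)
  qed measurable
  also have "(LBINT y. c / (2 * z) * ((of_real y - of_real s * c) * esh z (of_real s * c) y)) =
    - c * (LBINT y. - ((of_real y - of_real s * c) / (2 * z)) * esh z (of_real s * c) y)"
   by (subst integral_mult_right_zero[symmetric], rule Bochner_Integration.integral_cong[OF refl]) (rule aux_cancel(3))
  also have "... = 0" using zero[OF sc[of s]] by simp
  finally show "((\<lambda>s. LBINT y. esh z (of_real s * c) y) has_vector_derivative 0) (at s within {0..1})"
   by (rule has_vector_derivative_at_within)
 qed auto
 then obtain a where "\<forall>s\<in>{0..1}. (LBINT y. esh z (of_real s * c) y) = a" by blast
 from this[rule_format, of 0] this[rule_format, of 1] show "(LBINT y. esh z c y) = gnorm z"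
  by (simp add: esh_zero gnorm_def)
qed

lemma integrable_convolution:
 fixes f g :: "real => complex"
 assumes f: "integrable lborel f" and g: "integrable lborel g"
 shows "integrable (lborel \<Otimes>\<^sub>M lborel) (\<lambda>(y, x). f (x - y) * g y)"
proof (rule lborel_pair.Fubini_integrable)
 have [measurable]: "f \<in> bmeas" "g \<in> bmeas"
  using f g by (auto dest: borel_measurable_integrable)
 show "(\<lambda>(y, x). f (x - y) * g y) \<in> borel_measurable (lborel \<Otimes>\<^sub>M lborel)" by measurable
 have tr: "integrable lborel (\<lambda>x. f (x - y))" for y
  using lborel_integrable_real_affine[OF f, of 1 "-y"] by simp
 have "(LBINT x. norm (f (x - y) * g y)) = (LBINT x. norm (f x)) * norm (g y)" for y
  using lborel_integral_real_affine[of 1 "\<lambda>x. norm (f x)" "-y"] by (simp add: norm_mult)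
 then show "integrable lborel (\<lambda>y. LBINT x. norm (case (y, x) of (y, x) => f (x - y) * g y))"
  using g by simp
 show "AE y in lborel. integrable lborel (\<lambda>x. case (y, x) of (y, x) => f (x - y) * g y)"
  using tr by simp
qed

text \<open>Inversion preserves the right half plane, and the inverse of the quotient is 1/z +
  1/w.\<close>

lemma Re_harmonic:
 assumes "Re z > 0" "Re w > 0" shows "Re (z * w / (z + w)) > 0"
proof -
 have zw: "z \<noteq> 0" "w \<noteq> 0" "z + w \<noteq> 0" using assms by (metis less_irrefl plus_complex.sel(1) zero_complex.sel(1) add_pos_pos)+
 have pos: "Re (inverse u) > 0 \<longleftrightarrow> Re u > 0" if "u \<noteq> 0" for u
  using that by (simp add: cmod_power2[symmetric] zero_less_divide_iff)
 have "inverse (z * w / (z + w)) = inverse z + inverse w" using zw by (simp add: field_simps)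
 moreover have "Re (inverse z + inverse w) > 0"
  using pos[OF zw(1), THEN iffD2] pos[OF zw(2), THEN iffD2] assms by (simp only: plus_complex.sel add_pos_pos)
 ultimately show ?thesis using pos[of "z * w / (z + w)"] zw by simp
qed

text \<open>Completing the square in y leaves a Gaussian of time z w / (z + w) with complex centre x
  w / (z + w); \<open>integral_esh\<close> removes the centre.\<close>

lemma egauss_convolution:
 assumes z: "Re z > 0" and w: "Re w > 0"
 shows "(LBINT y. egauss z (x - y) * egauss w y) = gnorm (z * w / (z + w)) * egauss (z + w) x"
proof -
 define v where "v = z * w / (z + w)"
 define c where "c = of_real x * w / (z + w)"
 have zw: "z \<noteq> 0" "w \<noteq> 0" "z + w \<noteq> 0" using assms by (metis less_irrefl plus_complex.sel(1) zero_complex.sel(1) add_pos_pos)+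
 have v: "Re v > 0" unfolding v_def by (rule Re_harmonic[OF z w])
 have "egauss z (x - y) * egauss w y = esh v c y * egauss (z + w) x" for y
 proof -
  have key: "(of_real (x - y) :: complex)\<^sup>2 / (4 * z) + (of_real y)\<^sup>2 / (4 * w)
   = (of_real y - c)\<^sup>2 / (4 * v) + (of_real x)\<^sup>2 / (4 * (z + w))"
  proof -
   have "(X - Y)\<^sup>2 / (4 * z) + Y\<^sup>2 / (4 * w) = (Y - X * w / s)\<^sup>2 / (4 * (z * w / s)) + X\<^sup>2 / (4 * s)"
    if s: "s = z + w" "s \<noteq> 0" for X Y s
   proof -
    have "(X - Y)\<^sup>2 / (4 * z) + Y\<^sup>2 / (4 * w) = ((X - Y)\<^sup>2 * w * s + Y\<^sup>2 * z * s) / (4 * z * w * s)"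
     using zw s(2) by (simp add: add_divide_distrib)
    also have "(X - Y)\<^sup>2 * w * s + Y\<^sup>2 * z * s = (Y * s - X * w)\<^sup>2 + X\<^sup>2 * z * w"
     unfolding s(1) by (simp add: power2_eq_square algebra_simps)
    also have "... / (4 * z * w * s) = (Y - X * w / s)\<^sup>2 / (4 * (z * w / s)) + X\<^sup>2 / (4 * s)"
    proof -
     have 1: "Y - X * w / s = (Y * s - X * w) / s" using s(2) by (simp add: diff_divide_distrib)
     show ?thesis unfolding 1 power_divide using zw s(2) by (simp add: add_divide_distrib power2_eq_square)
    qed
    finally show ?thesis .
   qed
   from this[OF refl zw(3), of "of_real x" "of_real y"] show ?thesis unfolding v_def c_def by simp
  qed
  have "egauss z (x - y) * egauss w y = exp (- ((of_real (x - y))\<^sup>2 / (4 * z) + (of_real y)\<^sup>2 / (4 * w)))"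
   by (simp only: egauss_def of_real_power minus_add_distrib exp_add)
  also have "... = esh v c y * egauss (z + w) x"
   unfolding key by (simp only: egauss_def esh_def of_real_power minus_add_distrib exp_add)
  finally show ?thesis .
 qed
 then show ?thesis using integral_esh[OF v, of c] by (simp add: v_def)
qed

text \<open>\<open>gnorm_sq\<close> yields this up to sign. Integrating
  \<open>egauss_convolution\<close> over x and exchanging the integrals settles the sign.\<close>

lemma gnorm_mult:
 assumes z: "Re z > 0" and w: "Re w > 0"
 shows "gnorm (z * w / (z + w)) * gnorm (z + w) = gnorm z * gnorm w"
proof -
 have i: "integrable (lborel \<Otimes>\<^sub>M lborel) (\<lambda>(y, x). egauss z (x - y) * egauss w y)"
  by (rule integrable_convolution[OF integrable_egauss[OF z] integrable_egauss[OF w]])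
 have "(LBINT x. LBINT y. egauss z (x - y) * egauss w y)
  = (LBINT y. LBINT x. egauss z (x - y) * egauss w y)"
  using lborel_pair.Fubini_integral[OF i] by simp
 moreover have "(LBINT x. egauss z (x - y) * egauss w y) = gnorm z * egauss w y" for y
  using lborel_integral_real_affine[of 1 "egauss z" "-y"] by (simp add: gnorm_def)
 ultimately have "(LBINT x. LBINT y. egauss z (x - y) * egauss w y) = (LBINT y. gnorm z * egauss w y)"
  by (simp only:)
 then show ?thesis
  unfolding egauss_convolution[OF z w] by (simp add: gnorm_def)
qed

lemma gk_continuous: "continuous_on UNIV (gk z)"
 unfolding gk_def divide_inverse using egauss_continuous[of z] by (intro continuous_intros) 

lemma gk_measurable[measurable]: "gk z \<in> bmeas"
 by (intro borel_measurable_continuous_onI gk_continuous)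

lemma integrable_gk: "Re z > 0 ==> integrable lborel (gk z)"
 unfolding gk_def divide_inverse by (intro integrable_mult_left integrable_egauss)

lemma gk_convolution:
 assumes z: "Re z > 0" and w: "Re w > 0"
 shows "(LBINT y. gk z (x - y) * gk w y) = gk (z + w) x"
proof -
 have nz: "gnorm z \<noteq> 0" "gnorm w \<noteq> 0" "gnorm (z + w) \<noteq> 0" using assms by (auto intro!: gnorm_nz)
 have "(LBINT y. gk z (x - y) * gk w y) = (LBINT y. egauss z (x - y) * egauss w y * (1 / (gnorm z * gnorm w)))"
  by (simp add: gk_def)
 also have "... = gnorm (z * w / (z + w)) * egauss (z + w) x * (1 / (gnorm z * gnorm w))"
  by (simp only: integral_mult_left_zero egauss_convolution[OF z w])
 also have "... = gk (z + w) x"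
  using gnorm_mult[OF z w] nz by (simp add: gk_def field_simps)
 finally show ?thesis .
qed

lemma gk_total: "Re z > 0 ==> (LBINT y. gk z y) = 1"
 using gnorm_nz[of z] by (simp add: gk_def gnorm_def)

lemma gk_even: "gk z (- y) = gk z y"
 by (simp add: gk_def egauss_def)

lemma cnj_gk: "cnj (gk z y) = gk (cnj z) y"
proof -
 have e: "cnj (egauss z y) = egauss (cnj z) y" for y by (simp add: egauss_def exp_cnj)
 have "cnj (gnorm z) = gnorm (cnj z)"
  unfolding gnorm_def by (simp add: e flip: Bochner_Integration.integral_cnj)
 then show ?thesis by (simp add: gk_def e)
qed

lemma norm_gk_le: "Re z > 0 ==> norm (gk z y) <= 1 / sqrt (4 * pi * norm z)"
 using norm_egauss_le[of z y] by (simp add: gk_def norm_divide norm_gnorm divide_right_mono)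

text \<open>At real time the kernel is a probability density, which makes the heat operators there
  contractions.\<close>

lemma gk_real_nonneg:
 assumes "e > 0" shows "gk (of_real e) y = of_real (norm (gk (of_real e) y))"
proof -
 have 1: "egauss (of_real e) y = of_real (exp (- (y\<^sup>2 / (4 * e))))" for y
  by (simp add: egauss_def flip: exp_of_real)
 have "gnorm (of_real e) = of_real (LBINT y. exp (- (y\<^sup>2 / (4 * e))))"
  unfolding gnorm_def 1 by (rule integral_complex_of_real)
 then have "gk (of_real e) y = of_real (exp (- (y\<^sup>2 / (4 * e))) / (LBINT y. exp (- (y\<^sup>2 / (4 * e)))))"
  by (simp add: gk_def 1)
 moreover have "0 <= exp (- (y\<^sup>2 / (4 * e))) / (LBINT y. exp (- (y\<^sup>2 / (4 * e))))"
  by (intro divide_nonneg_nonneg Bochner_Integration.integral_nonneg) auto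
 ultimately show ?thesis by (simp add: norm_of_real del: of_real_divide)
qed

lemma gk_real_norm_total:
 assumes e: "e > 0" shows "(LBINT y. norm (gk (of_real e) y)) = 1"
proof -
 have "complex_of_real (LBINT y. norm (gk (of_real e) y)) = (LBINT y. gk (of_real e) y)"
  by (subst integral_complex_of_real[symmetric], rule Bochner_Integration.integral_cong[OF refl])
   (rule gk_real_nonneg[OF e, symmetric])
 also have "... = 1" using e by (intro gk_total) simp
 finally show ?thesis by simp
qed

lemma gk_scale:
 assumes "e > 0" shows "of_real (sqrt e) * gk (of_real e) (sqrt e * y) = gk 1 y"
proof -
 have 1: "egauss (of_real e) (sqrt e * y) = egauss 1 y" for y
  using assms by (simp add: egauss_def power_mult_distrib flip: of_real_power)
 have "gnorm (of_real e) = of_real (sqrt e) * gnorm 1"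
  using lborel_integral_real_affine[of "sqrt e" "egauss (of_real e)" 0] assms
  by (simp add: gnorm_def 1 scaleR_conv_of_real)
 then show ?thesis using assms by (simp add: gk_def 1)
qed

section \<open>The free group\<close>

lemma borel_affine_AE: "AE x in lborel. P x ==> AE x in lborel. P (x - h)" for h :: real and P
proof -
 assume "AE x in lborel. P x"
 then obtain N where N: "N \<in> null_sets lborel" "{x \<in> space lborel. \<not> P x} \<subseteq> N"
  by (auto simp: eventually_ae_filter)
 have "AE x in lborel. x \<notin> N" using N(1) by (rule AE_not_in)
 then have "AE x in lborel. - h + 1 * x \<notin> N"
  by (rule AE_borel_affine[rotated 2]) (use N(1) in auto)
 then show ?thesis by eventually_elim (use N(2) in auto)
qed

lemma AE_eq_translate: "AE x in lborel. f x = g x ==> AE x in lborel. f (x - h) = g (x - h)" for h :: real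
 by (rule borel_affine_AE)

lemma sqint_translate: "sqint f ==> sqint (\<lambda>x. f (x - h))"
 unfolding sqint_def
 using lborel_integrable_real_affine[of "\<lambda>x. (norm (f x))\<^sup>2" 1 "-h"] by auto

lift_definition tau :: "real => l2 => l2" is "\<lambda>h f x. f (x - h)"
 by (simp add: l2_eq_def sqint_translate AE_eq_translate)

lemma abs_tau: "sqint f ==> tau h (abs_l2 f) = abs_l2 (\<lambda>x. f (x - h))"
 by (rule tau.abs_eq) (auto simp: l2_eq_def)

lemma rep_tau: "AE x in lborel. rep_l2 (tau h f) x = rep_l2 f (x - h)"
 using rep_abs[OF sqint_translate[OF sqint_rep], of f h] by (simp flip: abs_tau)

lemma tau_add: "tau h (f + g) = tau h f + tau h g"
 by transfer (auto simp: l2_eq_def sqint_translate sqint_add)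
lemma tau_cscale: "tau h (cscale c f) = cscale c (tau h f)"
 by transfer (auto simp: l2_eq_def sqint_translate[OF sqint_cmult] sqint_cmult sqint_translate)
lemma tau_tau: "tau h (tau k f) = tau (h + k) f"
 by transfer (auto simp: l2_eq_def sqint_translate diff_diff_eq)
lemma tau_0[simp]: "tau 0 f = f" by transfer (auto simp: l2_eq_def)
lemma cinner_tau: "cinner (tau h f) (tau h g) = cinner f g"
proof transfer
 fix h and f g :: "real => complex"
 show "(LBINT x. f (x - h) * cnj (g (x - h))) = (LBINT x. f x * cnj (g x))"
  using lborel_integral_real_affine[of 1 "\<lambda>x. f x * cnj (g x)" "-h"] by simp
qed
lemma norm_tau[simp]: "norm (tau h f) = norm f"
 by (simp add: norm_eq_sqrt_inner inner_cinner cinner_tau)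
lemma cnj_tau: "cnj_l2 (tau h f) = tau h (cnj_l2 f)"
 by transfer (auto simp: l2_eq_def sqint_translate sqint_cnj sqint_translate[OF sqint_cnj])
lemma cinner_tau_left: "cinner (tau h f) g = cinner f (tau (- h) g)"
 using cinner_tau[of "-h" "tau h f" g] by (simp add: tau_tau)

lemma bounded_linear_tau: "bounded_linear (tau h)"
 by (rule bounded_linear_intro[where K=1]) (auto simp: tau_add scaleR_cscale tau_cscale)

lemma tau_diff: "tau h (f - g) = tau h f - tau h g"
 by (rule linear_diff[OF bounded_linear.linear[OF bounded_linear_tau]])

lemma tau_ind_tendsto:
 assumes "hs \<longlonglongrightarrow> 0" shows "(\<lambda>n. tau (hs n) (ind p q)) \<longlonglongrightarrow> ind p q"
proof -
 have "Bseq hs" using assms by (intro convergent_imp_Bseq) (auto simp: convergent_def)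
 then obtain B where B: "!!n. \<bar>hs n\<bar> <= B" unfolding Bseq_def by auto
 show ?thesis unfolding ind_def abs_tau[OF sqint_ind]
 proof (rule l2_dominated(2))
  show "sqint (\<lambda>x. of_real (indicat_real {p..<q} (x - hs n)))" for n by (rule sqint_translate[OF sqint_ind])
  show "AE x in lborel. norm (of_real (indicat_real {p..<q} (x - hs n)) :: complex) <= indicat_real {p - B..<q + B} x" for n
   using B[of n] by (auto simp: indicator_def)
  show "integrable lborel (\<lambda>x. (indicat_real {p - B..<q + B} x)\<^sup>2)"
   using integrable_ind_interval[of 1] by simp
  have "AE x in lborel. x \<noteq> p" "AE x in lborel. x \<noteq> q" by (rule AE_lborel_singleton)+
  then show "AE x in lborel. (\<lambda>n. of_real (indicat_real {p..<q} (x - hs n)) :: complex) \<longlonglongrightarrow> of_real (indicat_real {p..<q} x)"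
  proof eventually_elim
   case (elim x)
   have l: "(\<lambda>n. x - hs n) \<longlonglongrightarrow> x" using tendsto_diff[OF tendsto_const assms, of x] by simp
   have "\<forall>\<^sub>F n in sequentially. indicat_real {p..<q} (x - hs n) = indicat_real {p..<q} x"
   proof -
    consider "x < p" | "p < x" "x < q" | "q < x" using elim by linarith
    then show ?thesis
    proof cases
     case 1
     then have "\<forall>\<^sub>F n in sequentially. x - hs n < p" by (rule order_tendstoD(2)[OF l])
     then show ?thesis by eventually_elim (use 1 in \<open>auto simp: indicator_def\<close>)
    next
     case 2
     have "\<forall>\<^sub>F n in sequentially. p < x - hs n" "\<forall>\<^sub>F n in sequentially. x - hs n < q"
      using order_tendstoD[OF l] 2 by auto
     then show ?thesis by eventually_elim (use 2 in \<open>auto simp: indicator_def\<close>)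
    next
     case 3
     then have "\<forall>\<^sub>F n in sequentially. q < x - hs n" by (rule order_tendstoD(1)[OF l])
     then show ?thesis by eventually_elim (use 3 in \<open>auto simp: indicator_def\<close>)
    qed
   qed
   then show ?case by (intro tendsto_eventually) (auto elim: eventually_mono)
  qed
 qed simp
qed

text \<open>Translations are isometries, so convergence on the dense set of rational steps extends
  to all of L2 by splitting the error in three.\<close>

lemma tau_tendsto_0:
 assumes h: "hs \<longlonglongrightarrow> 0" shows "(\<lambda>n. tau (hs n) f) \<longlonglongrightarrow> f"
proof -
 define S where "S = {f. (\<lambda>n. tau (hs n) f) \<longlonglongrightarrow> f}"
 have sum: "(\<Sum>(a, b, p, q)\<leftarrow>xs. cscale (Complex (of_rat a) (of_rat b)) (ind (of_rat p) (of_rat q))) \<in> S"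
  for xs :: "(rat \<times> rat \<times> rat \<times> rat) list"
 proof (induction xs)
  case Nil
  have "tau h 0 = 0" for h by (rule linear_0[OF bounded_linear.linear[OF bounded_linear_tau]])
  then show ?case by (simp add: S_def)
 next
  case (Cons x xs)
  obtain a b p q where x: "x = (a, b, p, q)" by (cases x)
  have "(\<lambda>n. cscale (Complex (of_rat a) (of_rat b)) (tau (hs n) (ind (of_rat p) (of_rat q))))
   \<longlonglongrightarrow> cscale (Complex (of_rat a) (of_rat b)) (ind (of_rat p) (of_rat q))"
   by (intro cscale.tendsto tendsto_const tau_ind_tendsto h)
  then show ?case using Cons unfolding S_def x by (simp add: tau_add tau_cscale tendsto_add)
 qed
 have rs: "rat_steps \<subseteq> S" unfolding rat_steps_def using sum by blast
 show ?thesis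
 proof (rule LIMSEQ_I)
  fix e :: real assume e: "e > 0"
  have "f \<in> closure rat_steps" by (simp add: closure_steps_UNIV)
  then obtain g where g: "g \<in> rat_steps" "dist g f < e / 3"
   unfolding closure_approachable using e by (meson divide_pos_pos zero_less_numeral)
  then have "(\<lambda>n. tau (hs n) g) \<longlonglongrightarrow> g" using rs by (auto simp: S_def)
  then obtain N where N: "!!n. n \<ge> N ==> norm (tau (hs n) g - g) < e / 3"
   using LIMSEQ_D[of "\<lambda>n. tau (hs n) g" g "e/3"] e by auto
  have "norm (tau (hs n) f - f) < e" if "n \<ge> N" for n
  proof -
   have "tau (hs n) f - f = tau (hs n) (f - g) + (tau (hs n) g - g) + (g - f)"
    by (simp add: tau_diff)
   then have "norm (tau (hs n) f - f) <= norm (tau (hs n) (f - g)) + norm (tau (hs n) g - g) + norm (g - f)"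
    using norm_triangle_ineq[of "tau (hs n) (f - g) + (tau (hs n) g - g)" "g - f"]
     norm_triangle_ineq[of "tau (hs n) (f - g)" "tau (hs n) g - g"] by simp
   then show ?thesis using g(2) N[OF that] by (simp add: dist_norm norm_minus_commute)
  qed
  then show "\<exists>no. \<forall>n\<ge>no. norm (tau (hs n) f - f) < e" by blast
 qed
qed

lemma tau_continuous: "continuous_on UNIV (\<lambda>h. tau h f)"
proof (rule continuous_at_imp_continuous_on, rule ballI)
 fix h
 have "(\<lambda>n. tau (s n) f) \<longlonglongrightarrow> tau h f" if s: "s \<longlonglongrightarrow> h" for s
 proof -
  have "(\<lambda>n. s n - h) \<longlonglongrightarrow> 0" using s by (simp add: LIM_zero_iff)
  then have "(\<lambda>n. tau h (tau (s n - h) f)) \<longlonglongrightarrow> tau h f"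
   by (intro bounded_linear.tendsto[OF bounded_linear_tau] tau_tendsto_0)
  then show ?thesis by (simp add: tau_tau)
 qed
 then show "isCont (\<lambda>h. tau h f) h"
  unfolding continuous_at_sequentially comp_def by auto
qed

lemma tau_measurable[measurable]: "(\<lambda>h. tau h f) \<in> bmeas"
 by (intro borel_measurable_continuous_onI tau_continuous)

lemma cscale_measurable[measurable (raw)]:
 assumes "a \<in> borel_measurable M" "f \<in> borel_measurable M"
 shows "(\<lambda>x. cscale (a x) (f x)) \<in> borel_measurable M"
 using borel_measurable_continuous_Pair[OF assms, of cscale]
 by (simp add: bounded_bilinear.continuous_on[OF bounded_bilinear_cscale] continuous_on_fst continuous_on_snd)

lemma cinner_measurable[measurable (raw)]:
 assumes "a \<in> borel_measurable M" "f \<in> borel_measurable M"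
 shows "(\<lambda>x. cinner (a x) (f x)) \<in> borel_measurable M"
 using borel_measurable_continuous_Pair[OF assms, of cinner]
 by (simp add: bounded_bilinear.continuous_on[OF bounded_bilinear_cinner] continuous_on_fst continuous_on_snd)

section \<open>Convolutions and the heat semigroup at complex time\<close>

definition conv :: "(real => complex) => l2 => l2" where
 "conv k f = (LBINT h. cscale (k h) (tau h f))"

lemma conv_integrable:
 assumes k: "integrable lborel k" shows "integrable lborel (\<lambda>h. cscale (k h) (tau h f))"
proof (rule Bochner_Integration.integrable_bound[OF integrable_mult_left[OF integrable_norm[OF k], of "norm f"]])
 show "(\<lambda>h. cscale (k h) (tau h f)) \<in> borel_measurable lborel"
  using borel_measurable_integrable[OF k] by measurable
qed simp

lemma norm_conv_le: "norm (conv k f) <= (LBINT h. norm (k h)) * norm f"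
proof -
 have "norm (conv k f) <= (LBINT h. norm (cscale (k h) (tau h f)))"
  unfolding conv_def by (rule integral_norm_bound)
 also have "... = (LBINT h. norm (k h)) * norm f" by simp
 finally show ?thesis .
qed

lemma conv_linear:
 assumes k: "integrable lborel k"
 shows "conv k (f + g) = conv k f + conv k g" "conv k (cscale c f) = cscale c (conv k f)"
proof -
 show "conv k (f + g) = conv k f + conv k g"
  unfolding conv_def tau_add cscale_add_right
  by (rule Bochner_Integration.integral_add[OF conv_integrable[OF k] conv_integrable[OF k]])
 have "cscale c (conv k f) = (LBINT h. cscale c (cscale (k h) (tau h f)))"
  unfolding conv_def
  by (rule integral_bounded_linear[OF cscale.bounded_linear_right conv_integrable[OF k], symmetric])
 then show "conv k (cscale c f) = cscale c (conv k f)"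
  by (simp add: conv_def tau_cscale mult.commute)
qed

lemma cinner_integral_left:
 "integrable M F ==> cinner (integral\<^sup>L M F) g = (LINT x|M. cinner (F x) g)"
 by (rule integral_bounded_linear[OF cinner.bounded_linear_left, symmetric])

lemma cinner_integral_right:
 "integrable M F ==> cinner g (integral\<^sup>L M F) = (LINT x|M. cinner g (F x))"
 by (rule integral_bounded_linear[OF cinner.bounded_linear_right, symmetric])

text \<open>Pairing turns the vector valued integral into a scalar one against a bounded continuous
  function of h, the form in which kernels are estimated and differentiated below.\<close>

lemma cinner_conv: "integrable lborel k ==> cinner (conv k f) g = (LBINT h. k h * cinner (tau h f) g)"
 unfolding conv_def by (simp add: cinner_integral_left conv_integrable)

lemma tau_conv: "integrable lborel k ==> tau m (conv k f) = conv k (tau m f)"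
 unfolding conv_def
 by (subst integral_bounded_linear[OF bounded_linear_tau conv_integrable, symmetric])
  (auto simp: tau_cscale tau_tau add.commute)

lemma l2_eq_cinnerI: "(!!g. cinner f g = cinner f' g) ==> f = f'"
proof -
 assume "!!g. cinner f g = cinner f' g"
 then have "cinner (f - f') (f - f') = 0" by (simp add: cinner.diff_left)
 then show ?thesis by (simp add: cinner_self)
qed

text \<open>Paired with g, both sides are double integrals of \<open>k (r - h) * l h\<close> against
  the bounded function \<open>A\<close>, and Fubini's theorem applies.\<close>

lemma conv_conv:
 assumes k: "integrable lborel k" and l: "integrable lborel l"
 shows "conv k (conv l f) = conv (\<lambda>r. LBINT h. k (r - h) * l h) f"
proof (rule l2_eq_cinnerI)
 fix g
 define A where "A r = cinner (tau r f) g" for r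
 have A[measurable]: "A \<in> bmeas" unfolding A_def by measurable
 have Ab: "norm (A r) <= norm f * norm g" for r
  unfolding A_def using norm_cinner_le[of "tau r f" g] by simp
 have [measurable]: "k \<in> bmeas" "l \<in> bmeas"
  using k l by (auto dest: borel_measurable_integrable)
 have i: "integrable (lborel \<Otimes>\<^sub>M lborel) (\<lambda>(h, r). k (r - h) * l h)"
  by (rule integrable_convolution[OF k l])
 have i2: "integrable (lborel \<Otimes>\<^sub>M lborel) (\<lambda>(h, r). k (r - h) * l h * A r)"
 proof (rule Bochner_Integration.integrable_bound[OF integrable_mult_left[OF i, of "of_real (norm f * norm g)"]])
  show "AE x in lborel \<Otimes>\<^sub>M lborel. norm (case x of (h, r) => k (r - h) * l h * A r)
    <= norm ((case x of (h, r) => k (r - h) * l h) * of_real (norm f * norm g))"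
  proof (rule AE_I2)
   fix x :: "real \<times> real"
   obtain h r where x: "x = (h, r)" by (cases x)
   have "norm (k (r - h) * l h) * norm (A r) <= norm (k (r - h) * l h) * (norm f * norm g)"
    by (intro mult_left_mono Ab) simp
   then show "norm (case x of (h, r) => k (r - h) * l h * A r)
    <= norm ((case x of (h, r) => k (r - h) * l h) * of_real (norm f * norm g))"
    by (simp add: x norm_mult)
  qed
 qed measurable
 have kl: "integrable lborel (\<lambda>r. LBINT h. k (r - h) * l h)"
  using lborel_pair.integrable_snd[OF i] by simp
 \<comment> \<open>With l as the outer kernel, the substitution r = h + m produces precisely the
   kernel on the right-hand side.\<close>
 have "conv k (conv l f) = conv l (conv k f)"
 proof -
  have "norm (conv l u) <= norm u * (LBINT h. norm (l h))" for u
   using norm_conv_le[of l u] by (simp add: mult.commute)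
  then have bl: "bounded_linear (conv l)"
   by (intro bounded_linear_intro[where K="LBINT h. norm (l h)"])
    (auto simp: conv_linear[OF l] scaleR_cscale)
  have "conv l (conv k f) = (LBINT h. conv l (cscale (k h) (tau h f)))"
   unfolding conv_def[of k] by (rule integral_bounded_linear[OF bl conv_integrable[OF k], symmetric])
  also have "... = conv k (conv l f)"
   unfolding conv_def[of k] by (simp add: conv_linear(2)[OF l] tau_conv[OF l])
  finally show ?thesis by simp
 qed
 then have "cinner (conv k (conv l f)) g = cinner (conv l (conv k f)) g" by simp
 also have "... = (LBINT h. l h * (LBINT m. k m * A (h + m)))"
  by (simp add: cinner_conv[OF l] tau_conv[OF k] cinner_conv[OF k] tau_tau A_def add.commute)
 also have "... = (LBINT h. LBINT r. k (r - h) * l h * A r)"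
 proof (rule Bochner_Integration.integral_cong[OF refl])
  fix h
  have "(LBINT m. k m * A (h + m)) = (LBINT r. k (r - h) * A r)"
   using lborel_integral_real_affine[of 1 "\<lambda>m. k m * A (h + m)" "-h"] by simp
  then have "l h * (LBINT m. k m * A (h + m)) = (LBINT r. l h * (k (r - h) * A r))"
   by (simp only: integral_mult_right_zero)
  then show "l h * (LBINT m. k m * A (h + m)) = (LBINT r. k (r - h) * l h * A r)"
   by (simp only: mult_ac)
 qed
 also have "... = (LBINT r. LBINT h. k (r - h) * l h * A r)"
  using lborel_pair.Fubini_integral[OF i2] by simp
 also have "... = cinner (conv (\<lambda>r. LBINT h. k (r - h) * l h) f) g"
  by (simp add: cinner_conv[OF kl] A_def)
 finally show "cinner (conv k (conv l f)) g = cinner (conv (\<lambda>r. LBINT h. k (r - h) * l h) f) g" .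
qed

definition heat :: "complex => l2 => l2" where "heat z f = conv (gk z) f"

lemma heat_heat: "Re z > 0 ==> Re w > 0 ==> heat z (heat w f) = heat (z + w) f"
 unfolding heat_def by (simp add: conv_conv integrable_gk gk_convolution)

lemma cinner_heat: "Re z > 0 ==> cinner (heat z f) g = (LBINT h. gk z h * cinner (tau h f) g)"
 unfolding heat_def by (rule cinner_conv[OF integrable_gk])

lemma heat_linear: "Re z > 0 ==> heat z (f + g) = heat z f + heat z g"
 "Re z > 0 ==> heat z (cscale c f) = cscale c (heat z f)"
 unfolding heat_def by (simp_all add: conv_linear integrable_gk)

text \<open>The kernel is even and its conjugate is the kernel at the conjugate time, so moving a
  translation to the other argument only changes the sign of h.\<close>

lemma cinner_heat_adj:
 assumes z: "Re z > 0" shows "cinner (heat z f) g = cinner f (heat (cnj z) g)"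
proof -
 have z': "Re (cnj z) > 0" using z by simp
 have "cinner f (heat (cnj z) g) = cnj (cinner (heat (cnj z) g) f)" by (rule cinner_commute)
 also have "... = (LBINT h. cnj (gk (cnj z) h * cinner (tau h g) f))"
  by (simp only: cinner_heat[OF z'] Bochner_Integration.integral_cnj)
 also have "... = (LBINT h. gk z h * cinner (tau (- h) f) g)"
 proof (rule Bochner_Integration.integral_cong[OF refl])
  fix h
  have "cnj (cinner (tau h g) f) = cinner (tau (- h) f) g"
   using cinner_commute[of f "tau h g"] cinner_tau_left[of "-h" f g] by simp
  then show "cnj (gk (cnj z) h * cinner (tau h g) f) = gk z h * cinner (tau (- h) f) g"
   by (simp add: cnj_gk)
 qed
 also have "... = (LBINT h. gk z h * cinner (tau h f) g)"
  using lborel_integral_real_affine[of "-1" "\<lambda>h. gk z h * cinner (tau h f) g" 0] by (simp add: gk_even)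
 finally show ?thesis by (simp add: cinner_heat[OF z])
qed

text \<open>Substituting sqrt d times h leaves the fixed kernel \<open>gk 1\<close>; the parameter d
  survives only in a translation that tends to the identity.\<close>

lemma heat_real_tendsto:
 assumes e: "!!n. e n > 0" "e \<longlonglongrightarrow> 0"
 shows "(\<lambda>n. heat (of_real (e n)) f) \<longlonglongrightarrow> f"
proof -
 have eq: "heat (of_real d) f = (LBINT h. cscale (gk 1 h) (tau (sqrt d * h) f))" if d: "d > 0" for d
 proof -
  have "heat (of_real d) f = sqrt d *\<^sub>R (LBINT h. cscale (gk (of_real d) (sqrt d * h)) (tau (sqrt d * h) f))"
   using lborel_integral_real_affine[of "sqrt d" "\<lambda>h. cscale (gk (of_real d) h) (tau h f)" 0] d
   by (simp add: heat_def conv_def)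
  also have "... = (LBINT h. sqrt d *\<^sub>R cscale (gk (of_real d) (sqrt d * h)) (tau (sqrt d * h) f))"
   by (simp only: integral_scaleR_right)
  also have "... = (LBINT h. cscale (gk 1 h) (tau (sqrt d * h) f))"
   by (simp only: scaleR_cscale cscale_assoc gk_scale[OF d])
  finally show ?thesis .
 qed
 have "(\<lambda>n. LBINT h. cscale (gk 1 h) (tau (sqrt (e n) * h) f)) \<longlonglongrightarrow> (LBINT h. cscale (gk 1 h) f)"
 proof (rule integral_dominated_convergence[where w="\<lambda>h. norm (gk 1 h) * norm f"])
  show "integrable lborel (\<lambda>h. norm (gk 1 h) * norm f)"
   by (intro integrable_mult_left integrable_norm integrable_gk) simp
  show "AE h in lborel. (\<lambda>n. cscale (gk 1 h) (tau (sqrt (e n) * h) f)) \<longlonglongrightarrow> cscale (gk 1 h) f"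
  proof (rule AE_I2)
   fix h
   have "(\<lambda>n. sqrt (e n) * h) \<longlonglongrightarrow> sqrt 0 * h" by (intro tendsto_intros e)
   then show "(\<lambda>n. cscale (gk 1 h) (tau (sqrt (e n) * h) f)) \<longlonglongrightarrow> cscale (gk 1 h) f"
    by (intro cscale.tendsto tendsto_const tau_tendsto_0) simp
  qed
  show "(\<lambda>h. cscale (gk 1 h) (tau (sqrt (e n) * h) f)) \<in> borel_measurable lborel" for n
   using measurable_compose[OF _ tau_measurable, of "\<lambda>h. sqrt (e n) * h" lborel f] by measurable
 qed auto
 also have "(LBINT h. cscale (gk 1 h) f) = cscale (LBINT h. gk 1 h) f"
  by (rule integral_bounded_linear[OF cscale.bounded_linear_left]) (simp add: integrable_gk)
 also have "... = f" by (simp add: gk_total)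
 finally show ?thesis by (simp add: eq e)
qed

lemma norm_heat_real_le: "e > 0 ==> norm (heat (of_real e) f) <= norm f"
 using norm_conv_le[of "gk (of_real e)" f] by (simp add: heat_def gk_real_norm_total)

text \<open>The adjoint of \<open>heat w\<close> is \<open>heat (cnj w)\<close>, and for equal
  imaginary parts the oscillation cancels in the semigroup law, so that real time remains.
  Contraction, convergence and unitarity all rest on this identity.\<close>

lemma cinner_heat_heat:
 assumes "Re z > 0" "Re w > 0" "Im z = Im w"
 shows "cinner (heat z f) (heat w f) = cinner (heat (of_real (Re z + Re w)) f) f"
proof -
 have "cinner (heat (cnj w) (heat z f)) f = cinner (heat z f) (heat w f)"
  using cinner_heat_adj[of "cnj w" "heat z f" f] assms by simp
 moreover have "cnj w + z = of_real (Re z + Re w)" using assms by (simp add: complex_eq_iff)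
 ultimately show ?thesis using heat_heat[of "cnj w" z f] assms by simp
qed

text \<open>For a fixed nonzero imaginary part the L1 norm of the kernel blows up as Re z tends to
  0. The bound therefore passes through \<open>cinner_heat_heat\<close> to the contraction at real
  time.\<close>

lemma norm_heat_le: assumes "Re z > 0" shows "norm (heat z f) <= norm f"
proof -
 have "complex_of_real ((norm (heat z f))\<^sup>2) = cinner (heat (of_real (Re z + Re z)) f) f"
  using cinner_heat_heat[OF assms assms refl, of f] by (simp only: cinner_self)
 then have "(norm (heat z f))\<^sup>2 = norm (cinner (heat (of_real (Re z + Re z)) f) f)"
  by (metis abs_of_nonneg norm_of_real zero_le_power2)
 also have "... <= norm (heat (of_real (Re z + Re z)) f) * norm f" by (rule norm_cinner_le)
 also have "... <= norm f * norm f"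
  using norm_heat_real_le[of "Re z + Re z" f] assms by (intro mult_right_mono) auto
 finally have "(norm (heat z f))\<^sup>2 <= (norm f)\<^sup>2" by (simp only: power2_eq_square)
 then show ?thesis by (rule power2_le_imp_le) simp
qed

text \<open>The right-hand side is free of t: regularisation errors at imaginary time t are those at
  time 0.\<close>

lemma heat_diff_sq:
 assumes "d > 0" "e > 0"
 shows "(norm (heat (Complex d t) f - heat (Complex e t) f))\<^sup>2 =
  Re (cinner (heat (of_real (d + d)) f) f) + Re (cinner (heat (of_real (e + e)) f) f)
  - 2 * Re (cinner (heat (of_real (d + e)) f) f)"
proof -
 have "(norm (heat (Complex d t) f - heat (Complex e t) f))\<^sup>2 =
   inner (heat (Complex d t) f) (heat (Complex d t) f) + inner (heat (Complex e t) f) (heat (Complex e t) f)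
   - 2 * inner (heat (Complex d t) f) (heat (Complex e t) f)"
  by (simp add: power2_norm_eq_inner inner_diff_left inner_diff_right inner_commute)
 then show ?thesis using assms by (simp add: inner_cinner cinner_heat_heat)
qed

text \<open>The three terms of \<open>heat_diff_sq\<close> tend to the same square of a norm, with
  coefficients 1, 1 and -2. Two independent sequences are compared, so the lemma also shows that
  limits do not depend on the sequence.\<close>

lemma heat_cauchy:
 assumes "!!n. d n > 0" "d \<longlonglongrightarrow> 0" "!!n. e n > 0" "e \<longlonglongrightarrow> 0"
 shows "(\<lambda>n. heat (Complex (d n) t) f - heat (Complex (e n) t) f) \<longlonglongrightarrow> 0"
proof -
 have l: "(\<lambda>n. Re (cinner (heat (of_real (a n + b n)) f) f)) \<longlonglongrightarrow> (norm f)\<^sup>2"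
  if "!!n. a n > 0" "a \<longlonglongrightarrow> 0" "!!n. b n > 0" "b \<longlonglongrightarrow> 0" for a b :: "nat => real"
 proof -
  have "(\<lambda>n. Re (cinner (heat (of_real (a n + b n)) f) f)) \<longlonglongrightarrow> Re (cinner f f)"
   using that tendsto_add[OF that(2,4)]
   by (intro tendsto_Re cinner.tendsto tendsto_const heat_real_tendsto) (auto intro: add_pos_pos)
  then show ?thesis by (simp add: cinner_self)
 qed
 have "(\<lambda>n. (norm (heat (Complex (d n) t) f - heat (Complex (e n) t) f))\<^sup>2) \<longlonglongrightarrow> (norm f)\<^sup>2 + (norm f)\<^sup>2 - 2 * (norm f)\<^sup>2"
  unfolding heat_diff_sq[OF assms(1) assms(3)]
  by (intro tendsto_intros l assms)
 then have "(\<lambda>n. sqrt ((norm (heat (Complex (d n) t) f - heat (Complex (e n) t) f))\<^sup>2)) \<longlonglongrightarrow> sqrt 0"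
  by (intro tendsto_real_sqrt) simp
 then show ?thesis by (simp add: tendsto_norm_zero_iff)
qed

section \<open>The Schroedinger group as boundary value of the heat semigroup\<close>

definition sg :: "real => l2 => l2" where
 "sg t f = lim (\<lambda>n. heat (Complex (1 / real (Suc n)) t) f)"

text \<open>If the sequence with parameters 1/(n+1) were not Cauchy, two of its subsequences would
  stay apart, against \<open>heat_cauchy\<close>; the same lemma then compares it with an arbitrary
  sequence d.\<close>

lemma sg_limit:
 assumes d: "!!n. d n > 0" "d \<longlonglongrightarrow> 0" shows "(\<lambda>n. heat (Complex (d n) t) f) \<longlonglongrightarrow> sg t f"
proof -
 define X where "X n = heat (Complex (1 / real (Suc n)) t) f" for n
 have inv: "(\<lambda>n. 1 / real (Suc n)) \<longlonglongrightarrow> 0" using LIMSEQ_inverse_real_of_nat by (simp add: inverse_eq_divide)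
 have "Cauchy X"
 proof (rule ccontr)
  assume "\<not> Cauchy X"
  then obtain e where e: "e > 0" and ne: "!!M. \<exists>m\<ge>M. \<exists>n\<ge>M. \<not> dist (X m) (X n) < e"
   unfolding Cauchy_def by blast
  obtain p q where pq: "!!M. p M \<ge> M" "!!M. q M \<ge> M" "!!M. \<not> dist (X (p M)) (X (q M)) < e"
   using ne by metis
  have sub: "(\<lambda>M. 1 / real (Suc (p M))) \<longlonglongrightarrow> 0" if "!!M. p M \<ge> M" for p :: "nat => nat"
   by (rule tendsto_sandwich[OF _ _ tendsto_const inv]) (use that in \<open>auto intro!: always_eventually divide_left_mono\<close>)
  have "(\<lambda>M. X (p M) - X (q M)) \<longlonglongrightarrow> 0"
   unfolding X_def by (rule heat_cauchy) (use sub pq in auto)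
  then obtain M where "norm (X (p M) - X (q M)) < e"
   using LIMSEQ_D[of "\<lambda>M. X (p M) - X (q M)" 0 e] e by auto
  then show False using pq(3)[of M] by (simp add: dist_norm)
 qed
 then have "X \<longlonglongrightarrow> sg t f"
  unfolding sg_def X_def[symmetric] by (simp add: Cauchy_convergent_iff convergent_LIMSEQ_iff)
 moreover have "(\<lambda>n. heat (Complex (d n) t) f - X n) \<longlonglongrightarrow> 0"
  unfolding X_def by (rule heat_cauchy) (use d inv in auto)
 ultimately have "(\<lambda>n. (heat (Complex (d n) t) f - X n) + X n) \<longlonglongrightarrow> 0 + sg t f"
  by (intro tendsto_add)
 then show ?thesis by simp
qed

lemma inv_Suc_tendsto: "(\<lambda>n. 1 / real (Suc n)) \<longlonglongrightarrow> 0"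
 using LIMSEQ_inverse_real_of_nat by (simp add: inverse_eq_divide)

lemma norm_sg[simp]: "norm (sg t f) = norm f"
proof -
 let ?d = "\<lambda>n. 1 / real (Suc n)"
 have "(\<lambda>n. (norm (heat (Complex (?d n) t) f))\<^sup>2) \<longlonglongrightarrow> (norm (sg t f))\<^sup>2"
  by (intro tendsto_intros sg_limit inv_Suc_tendsto) auto
 moreover have "(norm (heat (Complex (?d n) t) f))\<^sup>2 = Re (cinner (heat (of_real (?d n + ?d n)) f) f)" for n
  using cinner_heat_heat[of "Complex (?d n) t" "Complex (?d n) t" f]
  by (simp add: power2_norm_eq_inner inner_cinner)
 moreover have "(\<lambda>n. Re (cinner (heat (of_real (?d n + ?d n)) f) f)) \<longlonglongrightarrow> Re (cinner f f)"
  using tendsto_add[OF inv_Suc_tendsto inv_Suc_tendsto]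
  by (intro tendsto_Re cinner.tendsto tendsto_const heat_real_tendsto) (auto intro: add_pos_pos)
 ultimately have "(norm (sg t f))\<^sup>2 = Re (cinner f f)"
  by (simp only: LIMSEQ_unique)
 then show ?thesis by (simp add: cinner_self power2_eq_iff_nonneg)
qed

lemma sg_add: "sg t (f + g) = sg t f + sg t g"
proof -
 let ?z = "\<lambda>n. Complex (1 / real (Suc n)) t"
 have "(\<lambda>n. heat (?z n) f + heat (?z n) g) \<longlonglongrightarrow> sg t f + sg t g"
  by (intro tendsto_add sg_limit inv_Suc_tendsto) auto
 moreover have "(\<lambda>n. heat (?z n) (f + g)) \<longlonglongrightarrow> sg t (f + g)"
  by (intro sg_limit inv_Suc_tendsto) auto
 moreover have "heat (?z n) (f + g) = heat (?z n) f + heat (?z n) g" for n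
  by (rule heat_linear(1)) simp
 ultimately show ?thesis by (simp only: LIMSEQ_unique)
qed

lemma sg_cscale: "sg t (cscale c f) = cscale c (sg t f)"
proof -
 let ?z = "\<lambda>n. Complex (1 / real (Suc n)) t"
 have "(\<lambda>n. cscale c (heat (?z n) f)) \<longlonglongrightarrow> cscale c (sg t f)"
  by (intro cscale.tendsto tendsto_const sg_limit inv_Suc_tendsto) auto
 moreover have "(\<lambda>n. heat (?z n) (cscale c f)) \<longlonglongrightarrow> sg t (cscale c f)"
  by (intro sg_limit inv_Suc_tendsto) auto
 moreover have "heat (?z n) (cscale c f) = cscale c (heat (?z n) f)" for n
  by (rule heat_linear(2)) simp
 ultimately show ?thesis by (simp only: LIMSEQ_unique)
qed

lemma bounded_linear_sg: "bounded_linear (sg t)"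
 by (rule bounded_linear_intro[where K=1]) (auto simp: sg_add scaleR_cscale sg_cscale)

lemma sg_diff: "sg t (f - g) = sg t f - sg t g"
 by (rule linear_diff[OF bounded_linear.linear[OF bounded_linear_sg]])

lemma sg_zero[simp]: "sg t 0 = 0"
 by (rule linear_0[OF bounded_linear.linear[OF bounded_linear_sg]])

text \<open>The error of regularising the inner operator tends to 0 and is not amplified by the
  contractive outer one, so the semigroup law of \<open>heat\<close> passes to the limit with both
  regularisations equal.\<close>

lemma sg_sg: "sg t (sg s f) = sg (t + s) f"
proof -
 let ?d = "\<lambda>n. 1 / real (Suc n)"
 have "(\<lambda>n. heat (Complex (?d n) t) (sg s f - heat (Complex (?d n) s) f)) \<longlonglongrightarrow> 0"
 proof (rule Lim_null_comparison[where g="\<lambda>n. norm (sg s f - heat (Complex (?d n) s) f)"])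
  show "\<forall>\<^sub>F n in sequentially. norm (heat (Complex (?d n) t) (sg s f - heat (Complex (?d n) s) f)) <= norm (sg s f - heat (Complex (?d n) s) f)"
   by (intro always_eventually allI norm_heat_le) simp
  have "(\<lambda>n. sg s f - heat (Complex (?d n) s) f) \<longlonglongrightarrow> sg s f - sg s f"
   by (intro tendsto_intros sg_limit inv_Suc_tendsto) auto
  then show "(\<lambda>n. norm (sg s f - heat (Complex (?d n) s) f)) \<longlonglongrightarrow> 0"
   by (simp add: tendsto_norm_zero_iff)
 qed
 moreover have "(\<lambda>n. heat (Complex (?d n) t) (heat (Complex (?d n) s) f)) \<longlonglongrightarrow> sg (t + s) f"
 proof -
  have "(\<lambda>n. heat (Complex (?d n + ?d n) (t + s)) f) \<longlonglongrightarrow> sg (t + s) f"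
   using tendsto_add[OF inv_Suc_tendsto inv_Suc_tendsto] by (intro sg_limit) (auto intro: add_pos_pos)
  moreover have "heat (Complex (?d n) t) (heat (Complex (?d n) s) f) = heat (Complex (?d n + ?d n) (t + s)) f" for n
   by (subst heat_heat) (auto simp: complex_add)
  ultimately show ?thesis by simp
 qed
 ultimately have "(\<lambda>n. heat (Complex (?d n) t) (sg s f - heat (Complex (?d n) s) f) + heat (Complex (?d n) t) (heat (Complex (?d n) s) f)) \<longlonglongrightarrow> 0 + sg (t + s) f"
  by (rule tendsto_add)
 moreover have "heat (Complex (?d n) t) (sg s f - heat (Complex (?d n) s) f) + heat (Complex (?d n) t) (heat (Complex (?d n) s) f) = heat (Complex (?d n) t) (sg s f)" for n
  by (subst heat_linear(1)[symmetric]) auto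
 ultimately have "(\<lambda>n. heat (Complex (?d n) t) (sg s f)) \<longlonglongrightarrow> sg (t + s) f" by simp
 moreover have "(\<lambda>n. heat (Complex (?d n) t) (sg s f)) \<longlonglongrightarrow> sg t (sg s f)"
  by (intro sg_limit inv_Suc_tendsto) auto
 ultimately show ?thesis by (rule LIMSEQ_unique[symmetric])
qed

lemma sg_0[simp]: "sg 0 f = f"
proof -
 have "(\<lambda>n. heat (of_real (1 / real (Suc n))) f) \<longlonglongrightarrow> f"
  by (intro heat_real_tendsto inv_Suc_tendsto) auto
 moreover have "(\<lambda>n. heat (Complex (1 / real (Suc n)) 0) f) \<longlonglongrightarrow> sg 0 f"
  by (intro sg_limit inv_Suc_tendsto) auto
 moreover have "complex_of_real r = Complex r 0" for r by (simp add: complex_eq_iff)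
 ultimately show ?thesis by (simp only: LIMSEQ_unique)
qed

lemma cinner_sg_adj: "cinner (sg t f) g = cinner f (sg (- t) g)"
proof -
 let ?d = "\<lambda>n. 1 / real (Suc n)"
 have "(\<lambda>n. cinner (heat (Complex (?d n) t) f) g) \<longlonglongrightarrow> cinner (sg t f) g"
  by (intro cinner.tendsto tendsto_const sg_limit inv_Suc_tendsto) auto
 moreover have "(\<lambda>n. cinner f (heat (Complex (?d n) (- t)) g)) \<longlonglongrightarrow> cinner f (sg (- t) g)"
  by (intro cinner.tendsto tendsto_const sg_limit inv_Suc_tendsto) auto
 moreover have "cinner (heat (Complex (?d n) t) f) g = cinner f (heat (Complex (?d n) (- t)) g)" for n
 proof -
  have "cnj (Complex (?d n) t) = Complex (?d n) (- t)" by (simp add: complex_eq_iff)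
  then show ?thesis using cinner_heat_adj[of "Complex (?d n) t" f g] by simp
 qed
 ultimately show ?thesis by (simp only: LIMSEQ_unique)
qed

lemma cinner_sg_sg: "cinner (sg t f) (sg s g) = cinner (sg (t - s) f) g"
 by (simp add: cinner_sg_adj sg_sg) (simp add: algebra_simps)?

lemma cnj_sg: "cnj_l2 (sg t f) = sg (- t) (cnj_l2 f)"
proof -
 let ?d = "\<lambda>n. 1 / real (Suc n)"
 have h: "cnj_l2 (heat (Complex (?d n) t) f) = heat (Complex (?d n) (- t)) (cnj_l2 f)" for n
 proof -
  have i: "integrable lborel (\<lambda>h. cscale (gk (Complex (?d n) t) h) (tau h f))"
   by (intro conv_integrable integrable_gk) simp
  have "cnj_l2 (heat (Complex (?d n) t) f) = (LBINT h. cnj_l2 (cscale (gk (Complex (?d n) t) h) (tau h f)))"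
   unfolding heat_def conv_def by (rule integral_bounded_linear[OF bounded_linear_cnj_l2 i, symmetric])
  also have "... = heat (Complex (?d n) (- t)) (cnj_l2 f)"
   by (simp add: heat_def conv_def cnj_l2_cscale cnj_gk cnj_tau complex_cnj)
  finally show ?thesis .
 qed
 have "(\<lambda>n. cnj_l2 (heat (Complex (?d n) t) f)) \<longlonglongrightarrow> cnj_l2 (sg t f)"
  by (intro bounded_linear.tendsto[OF bounded_linear_cnj_l2] sg_limit inv_Suc_tendsto) auto
 moreover have "(\<lambda>n. heat (Complex (?d n) (- t)) (cnj_l2 f)) \<longlonglongrightarrow> sg (- t) (cnj_l2 f)"
  by (intro sg_limit inv_Suc_tendsto) auto
 ultimately show ?thesis unfolding h by (rule LIMSEQ_unique)
qed

text \<open>The second derivative of \<open>gk z\<close> in x and, by the heat equation, also its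
  derivative in z.\<close>

definition gk2 :: "complex => real => complex" where
 "gk2 z x = (of_real (x\<^sup>2) / (4 * z\<^sup>2) - 1 / (2 * z)) * gk z x"

lemma Re_Complex_line: "of_real e + of_real t * \<i> = Complex e t"
 by (simp add: complex_eq_iff)

lemma integrable_egauss_mult:
 assumes z: "Re z > 0" and c: "c \<in> bmeas" "!!x. norm (c x) <= B"
 shows "integrable lborel (\<lambda>x. egauss z x * c x)" "integrable lborel (\<lambda>x. of_real (x\<^sup>2) * egauss z x * c x)"
proof -
 have B: "B \<ge> 0" using c(2)[of 0] norm_ge_zero order_trans by blast
 show "integrable lborel (\<lambda>x. egauss z x * c x)"
 proof (rule integrable_gmaj_bound[OF grate_pos[OF z], where C=B])
  show "norm (egauss z x * c x) <= B * gmaj (grate z) x" for x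
   unfolding norm_mult mult.commute[of B] using egauss_le_gmaj[of z x] c(2)[of x] B
   by (intro mult_mono) (auto simp: gmaj_def)
 qed (use c in measurable)
 show "integrable lborel (\<lambda>x. of_real (x\<^sup>2) * egauss z x * c x)"
 proof (rule integrable_gmaj_bound[OF grate_pos[OF z], where C=B])
  show "norm (of_real (x\<^sup>2) * egauss z x * c x) <= B * gmaj (grate z) x" for x
   unfolding norm_mult[of _ "c x"] mult.commute[of B] using egauss_sq_le_gmaj[of x z] c(2)[of x] B
   by (intro mult_mono) (auto simp: gmaj_def)
 qed (use c in measurable)
qed

lemma gk2_expand: "gk2 z x * w = 1 / (4 * z\<^sup>2 * gnorm z) * (of_real (x\<^sup>2) * egauss z x * w)
    - 1 / (2 * z * gnorm z) * (egauss z x * w)"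
proof -
 have "gk2 z x * w = (of_real (x\<^sup>2) / (4 * z\<^sup>2)) * (egauss z x / gnorm z) * w - 1 / (2 * z) * (egauss z x / gnorm z) * w"
  unfolding gk2_def gk_def by (simp only: left_diff_distrib)
 then show ?thesis by simp
qed

text \<open>The quotient rule for \<open>egauss\<close> over \<open>gnorm\<close> along a vertical
  line of times, whose direction contributes the factor \<open>\<i>\<close>.\<close>

lemma gk_param_deriv:
 assumes e: "e > 0" and c: "c \<in> bmeas" "!!x. norm (c x) <= B"
 shows "((\<lambda>s. LBINT x. gk (Complex e s) x * c x) has_vector_derivative
   \<i> * (LBINT x. gk2 (Complex e t) x * c x)) (at t)"
proof -
 define z where "z = Complex e t"
 have z: "Re z > 0" "z \<noteq> 0" using e by (auto simp: z_def complex_eq_iff)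
 define I where "I = (LBINT x. egauss z x * c x)"
 define M where "M = (LBINT x. of_real (x\<^sup>2) * egauss z x * c x)"
 have nz: "gnorm z \<noteq> 0" by (rule gnorm_nz[OF z(1)])
 have i1: "integrable lborel (\<lambda>x. egauss z x * c x)" and i2: "integrable lborel (\<lambda>x. of_real (x\<^sup>2) * egauss z x * c x)"
  by (rule integrable_egauss_mult[OF z(1) c])+
 have d1: "((\<lambda>s. LBINT x. egauss (Complex e s) x * c x) has_vector_derivative \<i> / (4 * z\<^sup>2) * M) (at t)"
 proof -
  have "(LBINT x. \<i> * (of_real (x\<^sup>2) / (4 * z\<^sup>2)) * egauss z x * c x) = \<i> / (4 * z\<^sup>2) * M"
   unfolding M_def by (subst integral_mult_right_zero[symmetric], rule Bochner_Integration.integral_cong) simp_all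
  moreover have "Re (of_real e + of_real t * \<i>) > 0" using e by simp
  ultimately show ?thesis
   using egauss_param_deriv[OF c, of "of_real e" t \<i>] unfolding Re_Complex_line z_def[symmetric] by (simp only:)
 qed
 have d2: "((\<lambda>s. gnorm (Complex e s)) has_vector_derivative \<i> / (2 * z) * gnorm z) (at t)"
  using gnorm_deriv[of "of_real e" t \<i>] e unfolding Re_Complex_line z_def by simp
 have d3: "((\<lambda>s. inverse (gnorm (Complex e s))) has_vector_derivative - (\<i> / (2 * z)) / gnorm z) (at t)"
 proof -
  have "(inverse has_field_derivative - (inverse (gnorm z))\<^sup>2) (at (gnorm z))"
   using DERIV_inverse[OF nz, of UNIV] by (simp add: power2_eq_square)
  from field_vector_diff_chain_at[OF d2, unfolded z_def, OF this[unfolded z_def]]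
  show ?thesis using nz by (simp add: o_def z_def power2_eq_square divide_simps mult.assoc)
 qed
 have "((\<lambda>s. (LBINT x. egauss (Complex e s) x * c x) * inverse (gnorm (Complex e s))) has_vector_derivative
   I * (- (\<i> / (2 * z)) / gnorm z) + \<i> / (4 * z\<^sup>2) * M * inverse (gnorm z)) (at t)"
  using has_vector_derivative_mult[OF d1 d3] by (simp add: I_def z_def)
 moreover have "I * (- (\<i> / (2 * z)) / gnorm z) + \<i> / (4 * z\<^sup>2) * M * inverse (gnorm z)
   = \<i> * ((1 / (4 * z\<^sup>2 * gnorm z)) * M - (1 / (2 * z * gnorm z)) * I)"
  using nz z(2) by (simp add: divide_simps) (simp add: algebra_simps)?
 moreover have "(1 / (4 * z\<^sup>2 * gnorm z)) * M - (1 / (2 * z * gnorm z)) * I = (LBINT x. gk2 z x * c x)"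
 proof -
  have "(LBINT x. gk2 z x * c x) = (LBINT x. (1 / (4 * z\<^sup>2 * gnorm z)) * (of_real (x\<^sup>2) * egauss z x * c x)
    - (1 / (2 * z * gnorm z)) * (egauss z x * c x))"
   by (simp only: gk2_expand)
  also have "... = (1 / (4 * z\<^sup>2 * gnorm z)) * M - (1 / (2 * z * gnorm z)) * I"
   unfolding M_def I_def
   by (subst Bochner_Integration.integral_diff) (use i1 i2 in \<open>auto intro!: integrable_mult_right simp del: times_divide_eq_left\<close>)
  finally show ?thesis by simp
 qed
 moreover have "(LBINT x. gk (Complex e s) x * c x) = (LBINT x. egauss (Complex e s) x * c x) * inverse (gnorm (Complex e s))" for s
  by (subst integral_mult_left_zero[symmetric], rule Bochner_Integration.integral_cong) (simp_all only: gk_def divide_inverse mult_ac)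
 ultimately show ?thesis by (simp only: z_def)
qed

text \<open>The difference of the integrands is the derivative of
  \<open>g1 x * c x - gk z x * c1 x\<close>, where \<open>g1\<close> is the derivative of the
  kernel; this function vanishes at infinity.\<close>

lemma gk_by_parts:
 fixes c c1 c2 :: "real => complex"
 assumes z: "Re z > 0"
  and c1: "!!x. (c has_vector_derivative c1 x) (at x)" and c2: "!!x. (c1 has_vector_derivative c2 x) (at x)"
  and cont: "continuous_on UNIV c2"
  and b: "!!x. norm (c x) <= B" "!!x. norm (c1 x) <= B" "!!x. norm (c2 x) <= B"
 shows "(LBINT x. gk2 z x * c x) = (LBINT x. gk z x * c2 x)"
proof -
 have nz: "gnorm z \<noteq> 0" "z \<noteq> 0" using gnorm_nz[OF z] z by auto
 have k: "grate z > 0" by (rule grate_pos[OF z])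
 have B: "B \<ge> 0" using b(1)[of 0] norm_ge_zero order_trans by blast
 define g1 where "g1 x = - (of_real x / (2 * z)) * gk z x" for x
 have d0: "(gk z has_vector_derivative g1 x) (at x)" for x
 proof -
  have "((\<lambda>x. egauss z x * inverse (gnorm z)) has_vector_derivative - (of_real x / (2 * z)) * egauss z x * inverse (gnorm z)) (at x)"
   by (rule has_vector_derivative_mult_left[OF egauss_deriv])
  moreover have "gk z = (\<lambda>x. egauss z x * inverse (gnorm z))" unfolding gk_def[abs_def] divide_inverse ..
  ultimately show ?thesis unfolding g1_def by (simp only: mult.assoc)
 qed
 have d1: "(g1 has_vector_derivative gk2 z x) (at x)" for x
 proof -
  have "((\<lambda>x. (- (1 / (2 * z))) * of_real x) has_vector_derivative - (1 / (2 * z)) * 1) (at x)"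
   by (intro has_vector_derivative_mult_right) (auto intro!: derivative_eq_intros)
  from has_vector_derivative_mult[OF this d0]
  have "((\<lambda>x. (- (1 / (2 * z))) * of_real x * gk z x) has_vector_derivative
   - (1 / (2 * z)) * of_real x * g1 x + - (1 / (2 * z)) * 1 * gk z x) (at x)" .
  moreover have "- (1 / (2 * z)) * of_real x * g1 x + - (1 / (2 * z)) * 1 * gk z x = gk2 z x"
   unfolding g1_def gk2_def by (simp add: power2_eq_square left_diff_distrib)
  ultimately show ?thesis unfolding g1_def[abs_def] by simp
 qed
 have cc: "continuous_on UNIV c" "continuous_on UNIV c1"
  using c1 c2 by (auto intro!: continuous_at_imp_continuous_on has_vector_derivative_continuous)
 have [measurable]: "c \<in> bmeas" "c1 \<in> bmeas" "c2 \<in> bmeas"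
  using cc cont by (auto intro: borel_measurable_continuous_onI)
 have i1: "integrable lborel (\<lambda>x. gk z x * c2 x)"
 proof -
  have "integrable lborel (\<lambda>x. (egauss z x * c2 x) * inverse (gnorm z))"
   by (intro integrable_mult_left integrable_egauss_mult[OF z _ b(3)]) measurable
  then show ?thesis by (simp only: gk_def divide_inverse mult_ac)
 qed
 have i2: "integrable lborel (\<lambda>x. gk2 z x * c x)"
 proof -
  have "integrable lborel (\<lambda>x. 1 / (4 * z\<^sup>2 * gnorm z) * (of_real (x\<^sup>2) * egauss z x * c x) - 1 / (2 * z * gnorm z) * (egauss z x * c x))"
   by (intro Bochner_Integration.integrable_diff integrable_mult_right integrable_egauss_mult[OF z _ b(1)]) measurable
  then show ?thesis by (simp only: gk2_expand)
 qed
 have "(LBINT x. gk2 z x * c x - gk z x * c2 x) = 0"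
 proof (rule integral_deriv_line_eq_zero[where F="\<lambda>x. g1 x * c x - gk z x * c1 x"])
  show "((\<lambda>x. g1 x * c x - gk z x * c1 x) has_vector_derivative gk2 z x * c x - gk z x * c2 x) (at x)" for x
   by (rule has_vector_derivative_eq_rhs[OF has_vector_derivative_diff[OF
    has_vector_derivative_mult[OF d1 c1] has_vector_derivative_mult[OF d0 c2]]]) (simp add: algebra_simps)
  have g2c: "continuous_on UNIV (gk2 z)" unfolding gk2_def[abs_def] divide_inverse
   using gk_continuous[of z] by (intro continuous_intros)
  have "continuous_on UNIV (\<lambda>x. gk2 z x * c x - gk z x * c2 x)"
   using gk_continuous[of z] g2c cc cont by (intro continuous_intros)
  then show "isCont (\<lambda>x. gk2 z x * c x - gk z x * c2 x) x" for x
   by (auto simp: continuous_on_eq_continuous_at)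
  show "integrable lborel (\<lambda>x. gk2 z x * c x - gk z x * c2 x)"
   by (rule Bochner_Integration.integrable_diff[OF i2 i1])
  define K where "K = (1 / (2 * norm z) + 1) / norm (gnorm z) * B"
  have bd: "norm (g1 x * c x - gk z x * c1 x) <= K * gmaj (grate z) x" for x
  proof -
   have "norm (g1 x * c x) = 1 / (2 * norm z) / norm (gnorm z) * norm (of_real x * egauss z x) * norm (c x)"
    by (simp add: g1_def gk_def norm_mult norm_divide)
   also have "... <= 1 / (2 * norm z) / norm (gnorm z) * gmaj (grate z) x * B"
    using egauss_lin_le_gmaj[of x z] b(1)[of x] B by (intro mult_mono mult_left_mono) (auto simp: gmaj_def)
   finally have 1: "norm (g1 x * c x) <= 1 / (2 * norm z) / norm (gnorm z) * gmaj (grate z) x * B" .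
   have "norm (gk z x * c1 x) = 1 / norm (gnorm z) * norm (egauss z x) * norm (c1 x)"
    by (simp add: gk_def norm_mult norm_divide)
   also have "... <= 1 / norm (gnorm z) * gmaj (grate z) x * B"
    using egauss_le_gmaj[of z x] b(2)[of x] B by (intro mult_mono mult_left_mono) (auto simp: gmaj_def)
   finally have "norm (g1 x * c x - gk z x * c1 x) <= 1 / (2 * norm z) / norm (gnorm z) * gmaj (grate z) x * B + 1 / norm (gnorm z) * gmaj (grate z) x * B"
    using 1 norm_triangle_ineq4[of "g1 x * c x" "gk z x * c1 x"] by linarith
   also have "... = K * gmaj (grate z) x"
    unfolding K_def by (simp add: add_divide_distrib distrib_right distrib_left mult_ac)
   finally show ?thesis .
  qed
  have "((\<lambda>y. K * gmaj (grate z) y) \<longlongrightarrow> K * 0) at_top" "((\<lambda>y. K * gmaj (grate z) y) \<longlongrightarrow> K * 0) at_bot"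
   by (intro tendsto_intros gmaj_tendsto k)+
  then show "((\<lambda>x. g1 x * c x - gk z x * c1 x) \<longlongrightarrow> 0) at_top" "((\<lambda>x. g1 x * c x - gk z x * c1 x) \<longlongrightarrow> 0) at_bot"
   by (auto intro!: Lim_null_comparison[where g="\<lambda>y. K * gmaj (grate z) y"] always_eventually bd)
 qed
 then show ?thesis using Bochner_Integration.integral_diff[OF i2 i1] by simp
qed

lemma cinner_tau_bound: "norm (cinner (tau h f) g) <= norm f * norm g"
 using norm_cinner_le[of "tau h f" g] by simp

lemma heat_weak_deriv:
 assumes e: "e > 0"
 shows "((\<lambda>s. cinner (heat (Complex e s) f) g) has_vector_derivative
   \<i> * (LBINT x. gk2 (Complex e t) x * cinner (tau x f) g)) (at t)"
proof -
 have "((\<lambda>s. LBINT x. gk (Complex e s) x * cinner (tau x f) g) has_vector_derivative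
   \<i> * (LBINT x. gk2 (Complex e t) x * cinner (tau x f) g)) (at t)"
  by (rule gk_param_deriv[OF e _ cinner_tau_bound]) measurable
 then show ?thesis using e by (simp add: cinner_heat)
qed

text \<open>As \<open>heat_diff_sq\<close> does not contain the imaginary time, the regularisation
  error is the same for every s. This uniformity carries continuity and differentiability from
  \<open>heat\<close> over to \<open>sg\<close>.\<close>

lemma norm_sg_heat:
 assumes e: "e > 0"
 shows "norm (sg s f - heat (Complex e s) f) = norm (f - heat (of_real e) f)"
proof -
 let ?d = "\<lambda>n. 1 / real (Suc n)"
 have l: "(\<lambda>n. (norm (heat (Complex (?d n) s) f - heat (Complex e s) f))\<^sup>2) \<longlonglongrightarrow> (norm (sg s f - heat (Complex e s) f))\<^sup>2" for s
  by (intro tendsto_intros sg_limit inv_Suc_tendsto) auto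
 have "(norm (heat (Complex (?d n) s) f - heat (Complex e s) f))\<^sup>2 = (norm (heat (Complex (?d n) 0) f - heat (Complex e 0) f))\<^sup>2" for n
  by (simp only: heat_diff_sq[OF _ e] of_nat_0_less_iff zero_less_Suc zero_less_divide_1_iff)
 with l[of s] l[of 0] have "(norm (sg s f - heat (Complex e s) f))\<^sup>2 = (norm (sg 0 f - heat (Complex e 0) f))\<^sup>2"
  by (simp only: LIMSEQ_unique)
 moreover have "Complex e 0 = of_real e" by (simp add: complex_eq_iff)
 ultimately show ?thesis by (simp add: power2_eq_iff_nonneg)
qed

lemma sg_weak_continuous: "continuous_on UNIV (\<lambda>s. cinner (sg s f) g)"
proof (rule uniform_limit_theorem[where F=sequentially and f="\<lambda>n s. cinner (heat (Complex (1 / real (Suc n)) s) f) g"])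
 show "\<forall>\<^sub>F n in sequentially. continuous_on UNIV (\<lambda>s. cinner (heat (Complex (1 / real (Suc n)) s) f) g)"
  by (auto intro!: always_eventually continuous_at_imp_continuous_on has_vector_derivative_continuous heat_weak_deriv)
 have lim: "(\<lambda>n. norm (f - heat (of_real (1 / real (Suc n))) f) * norm g) \<longlonglongrightarrow> norm (f - f) * norm g"
  by (intro tendsto_intros heat_real_tendsto inv_Suc_tendsto) auto
 show "uniform_limit UNIV (\<lambda>n s. cinner (heat (Complex (1 / real (Suc n)) s) f) g) (\<lambda>s. cinner (sg s f) g) sequentially"
 proof (rule uniform_limitI)
  fix r :: real assume "r > 0"
  then have "\<forall>\<^sub>F n in sequentially. norm (f - heat (of_real (1 / real (Suc n))) f) * norm g < r"
   using order_tendstoD(2)[OF lim] by simp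
  then show "\<forall>\<^sub>F n in sequentially. \<forall>s\<in>UNIV. dist (cinner (heat (Complex (1 / real (Suc n)) s) f) g) (cinner (sg s f) g) < r"
  proof eventually_elim
   case (elim n)
   show ?case
   proof
    fix s
    have "dist (cinner (heat (Complex (1 / real (Suc n)) s) f) g) (cinner (sg s f) g)
     = norm (cinner (sg s f - heat (Complex (1 / real (Suc n)) s) f) g)"
     by (simp add: dist_norm cinner.diff_left norm_minus_commute)
    also have "... <= norm (sg s f - heat (Complex (1 / real (Suc n)) s) f) * norm g" by (rule norm_cinner_le)
    also have "... = norm (f - heat (of_real (1 / real (Suc n))) f) * norm g"
     by (subst norm_sg_heat) auto
    finally show "dist (cinner (heat (Complex (1 / real (Suc n)) s) f) g) (cinner (sg s f) g) < r" using elim by simp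
   qed
  qed
 qed
qed simp

text \<open>Weak continuity together with conservation of the norm gives strong continuity.\<close>

lemma sg_continuous: "continuous_on UNIV (\<lambda>s. sg s f)"
proof (rule continuous_at_imp_continuous_on, rule ballI)
 fix t
 have c: "isCont (\<lambda>s. cinner (sg s f) (sg t f)) t"
  using sg_weak_continuous[of f "sg t f"] by (simp add: continuous_on_eq_continuous_at)
 have eq: "(norm (sg s f - sg t f))\<^sup>2 = 2 * (norm f)\<^sup>2 - 2 * Re (cinner (sg s f) (sg t f))" for s
 proof -
  have "(norm (sg s f - sg t f))\<^sup>2 = (norm (sg s f))\<^sup>2 + (norm (sg t f))\<^sup>2 - 2 * inner (sg s f) (sg t f)"
   unfolding power2_norm_eq_inner inner_diff_left inner_diff_right by (simp add: inner_commute)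
  then show ?thesis by (simp add: inner_cinner)
 qed
 have "((\<lambda>s. 2 * (norm f)\<^sup>2 - 2 * Re (cinner (sg s f) (sg t f))) \<longlongrightarrow> 2 * (norm f)\<^sup>2 - 2 * Re (cinner (sg t f) (sg t f))) (at t)"
  using c unfolding isCont_def by (intro tendsto_intros)
 then have "((\<lambda>s. (norm (sg s f - sg t f))\<^sup>2) \<longlongrightarrow> 0) (at t)"
  unfolding eq by (simp add: cinner_self)
 then have "((\<lambda>s. sqrt ((norm (sg s f - sg t f))\<^sup>2)) \<longlongrightarrow> sqrt 0) (at t)"
  by (rule tendsto_real_sqrt)
 then show "isCont (\<lambda>s. sg s f) t"
  by (simp add: isCont_def tendsto_norm_zero_iff LIM_zero_iff)
qed

lemma sg_continuous_pair: "continuous_on UNIV (\<lambda>(s, f). sg s f)"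
proof (rule continuous_at_imp_continuous_on, rule ballI)
 fix p :: "real \<times> l2"
 obtain t f where p: "p = (t, f)" by (cases p)
 have "((\<lambda>q. sg (fst q) (snd q)) \<longlongrightarrow> sg t f) (at p)"
 proof -
  have "((\<lambda>q. sg (fst q) (snd q - f) + (sg (fst q) f - sg t f)) \<longlongrightarrow> 0 + 0) (at p)"
  proof (rule tendsto_add)
   have "((\<lambda>q. norm (snd q - f)) \<longlongrightarrow> norm (snd p - f)) (at p)" by (intro tendsto_intros)
   then have l: "((\<lambda>q. norm (snd q - f)) \<longlongrightarrow> 0) (at p)" unfolding p by (simp only: snd_conv diff_self norm_zero)
   show "((\<lambda>q. sg (fst q) (snd q - f)) \<longlongrightarrow> 0) (at p)"
    by (rule Lim_null_comparison[OF _ l]) simp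
   have "isCont (\<lambda>s. sg s f) (fst p)" using sg_continuous[of f] by (simp add: continuous_on_eq_continuous_at)
   then have "((\<lambda>q. sg (fst q) f) \<longlongrightarrow> sg (fst p) f) (at p)"
    by (rule isCont_tendsto_compose) (intro tendsto_intros)
   then have "((\<lambda>q. sg (fst q) f) \<longlongrightarrow> sg t f) (at p)" unfolding p by (simp only: fst_conv)
   then show "((\<lambda>q. sg (fst q) f - sg t f) \<longlongrightarrow> 0) (at p)" by (rule LIM_zero)
  qed
  moreover have "sg (fst q) (snd q - f) + (sg (fst q) f - sg t f) = sg (fst q) (snd q) - sg t f" for q
   by (simp add: sg_diff)
  ultimately have "((\<lambda>q. sg (fst q) (snd q) - sg t f) \<longlongrightarrow> 0) (at p)" by (simp only: add_0)
  then show ?thesis by (rule LIM_zero_cancel)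
 qed
 then show "isCont (\<lambda>(s, f). sg s f) p" unfolding isCont_def p by (simp add: case_prod_unfold)
qed

lemma sg_measurable[measurable (raw)]:
 assumes "a \<in> borel_measurable M" "f \<in> borel_measurable M"
 shows "(\<lambda>x. sg (a x) (f x)) \<in> borel_measurable M"
 using borel_measurable_continuous_Pair[OF assms, of sg] sg_continuous_pair by (simp add: case_prod_unfold)

lemma sg_tendsto:
 assumes "(a \<longlongrightarrow> t) F" "(f \<longlongrightarrow> g) F" shows "((\<lambda>x. sg (a x) (f x)) \<longlongrightarrow> sg t g) F"
proof -
 have "isCont (\<lambda>(s, f). sg s f) (t, g)" using sg_continuous_pair by (simp add: continuous_on_eq_continuous_at)
 then have "((\<lambda>x. (\<lambda>(s, f). sg s f) (a x, f x)) \<longlongrightarrow> (\<lambda>(s, f). sg s f) (t, g)) F"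
  by (rule isCont_tendsto_compose) (intro tendsto_Pair assms)
 then show ?thesis by simp
qed

section \<open>The dispersive estimate\<close>

definition n1 :: "l2 => real" where "n1 f = (LBINT x. norm (rep_l2 f x))"

lemma n1_nonneg: "n1 f \<ge> 0" by (simp add: n1_def)

text \<open>The kernel is bounded through the modulus of z alone, which survives Re z tending to 0;
  Fubini's theorem bounds the integral over h of the pairings with translates by the product of the
  L1 norms.\<close>

lemma cinner_heat_dispersive:
 assumes z: "Re z > 0" and f: "integrable lborel (rep_l2 f)" and g: "integrable lborel (rep_l2 g)"
 shows "norm (cinner (heat z f) g) <= 1 / sqrt (4 * pi * norm z) * (n1 f * n1 g)"
proof -
 define C where "C = 1 / sqrt (4 * pi * norm z)"
 define D where "D h = (LBINT x. norm (rep_l2 f (x - h)) * norm (rep_l2 g x))" for h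
 have i: "integrable (lborel \<Otimes>\<^sub>M lborel) (\<lambda>(h, x). rep_l2 f (x - h) * rep_l2 g x)"
 proof (rule lborel_pair.Fubini_integrable)
  show "(\<lambda>(h, x). rep_l2 f (x - h) * rep_l2 g x) \<in> borel_measurable (lborel \<Otimes>\<^sub>M lborel)" by measurable
  have "integrable lborel (\<lambda>h. (LBINT x. norm (rep_l2 g x) * norm (rep_l2 f (x - h))))"
  proof -
   have "integrable (lborel \<Otimes>\<^sub>M lborel) (\<lambda>(y, x). rep_l2 f (- (x - y)) * rep_l2 g y)"
    by (rule integrable_convolution[of "\<lambda>x. rep_l2 f (- x)"])
     (use lborel_integrable_real_affine[OF f, of "-1" 0] g in auto)
   from integrable_norm[OF this] 
   have "integrable (lborel \<Otimes>\<^sub>M lborel) (\<lambda>(y, x). norm (rep_l2 f (y - x)) * norm (rep_l2 g y))"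
    by (simp add: case_prod_unfold norm_mult)
   from lborel_pair.integrable_snd[OF this] show ?thesis by (simp add: mult.commute)
  qed
  then show "integrable lborel (\<lambda>h. LBINT x. norm (case (h, x) of (h, x) => rep_l2 f (x - h) * rep_l2 g x))"
   by (simp add: norm_mult mult.commute)
  show "AE h in lborel. integrable lborel (\<lambda>x. case (h, x) of (h, x) => rep_l2 f (x - h) * rep_l2 g x)"
   by (auto intro!: sqint_mult_integrable sqint_translate)
 qed
 from integrable_norm[OF i]
 have i': "integrable (lborel \<Otimes>\<^sub>M lborel) (\<lambda>(h, x). norm (rep_l2 f (x - h)) * norm (rep_l2 g x))"
  by (simp add: case_prod_unfold norm_mult)
 have Di: "integrable lborel D" unfolding D_def using lborel_pair.integrable_fst'[OF i'] by simp
 have Dtot: "(LBINT h. D h) = n1 f * n1 g"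
 proof -
  have "(LBINT h. D h) = (LBINT x. LBINT h. norm (rep_l2 f (x - h)) * norm (rep_l2 g x))"
   unfolding D_def using lborel_pair.Fubini_integral[OF i'] by simp
  also have "(\<lambda>x. LBINT h. norm (rep_l2 f (x - h)) * norm (rep_l2 g x)) = (\<lambda>x. n1 f * norm (rep_l2 g x))"
   using lborel_integral_real_affine[of "-1" "\<lambda>y. norm (rep_l2 f y)"] by (auto simp: n1_def)
  finally show ?thesis by (simp add: n1_def)
 qed
 have cD: "norm (cinner (tau h f) g) <= D h" for h
 proof -
  have "cinner (tau h f) g = (LBINT x. rep_l2 f (x - h) * cnj (rep_l2 g x))"
   unfolding cinner_rep by (rule integral_cong_AE) (use rep_tau[of h f] in \<open>auto elim: eventually_mono\<close>)
  then have "norm (cinner (tau h f) g) <= (LBINT x. norm (rep_l2 f (x - h) * cnj (rep_l2 g x)))"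
   by (simp only: integral_norm_bound)
  then show ?thesis by (simp add: D_def norm_mult)
 qed
 have "norm (cinner (heat z f) g) <= (LBINT h. norm (gk z h * cinner (tau h f) g))"
  unfolding cinner_heat[OF z] by (rule integral_norm_bound)
 also have "... <= (LBINT h. C * D h)"
 proof (rule integral_mono_AE')
  show "integrable lborel (\<lambda>h. C * D h)" using Di by simp
  have "norm (gk z h * cinner (tau h f) g) <= C * D h" for h
   unfolding norm_mult C_def using norm_gk_le[OF z] cD by (intro mult_mono) auto
  then show "AE h in lborel. norm (gk z h * cinner (tau h f) g) <= C * D h" by simp
  have "0 <= D h" for h using cD[of h] norm_ge_zero order_trans by blast
  then show "AE h in lborel. 0 <= C * D h" by (simp add: C_def)
 qed
 also have "... = C * (n1 f * n1 g)" by (simp add: Dtot)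
 finally show ?thesis by (simp add: C_def)
qed

text \<open>The modulus of the time stays at least that of t while the regularisation disappears; of
  the factor 4 pi only 4 pi >= 1 is kept.\<close>

lemma cinner_sg_dispersive:
 assumes f: "integrable lborel (rep_l2 f)" and g: "integrable lborel (rep_l2 g)" and t: "t \<noteq> 0"
 shows "norm (cinner (sg t f) g) <= 1 / sqrt \<bar>t\<bar> * (n1 f * n1 g)"
proof -
 let ?d = "\<lambda>n. 1 / real (Suc n)"
 have "(\<lambda>n. norm (cinner (heat (Complex (?d n) t) f) g)) \<longlonglongrightarrow> norm (cinner (sg t f) g)"
  by (intro tendsto_intros cinner.tendsto sg_limit inv_Suc_tendsto) auto
 then show ?thesis
 proof (rule LIMSEQ_le_const2, intro exI allI impI)
  fix n :: nat
  have tn: "\<bar>t\<bar> <= norm (Complex (?d n) t)" using abs_Im_le_cmod[of "Complex (?d n) t"] by simp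
  have "\<bar>t\<bar> * 1 <= norm (Complex (?d n) t) * (4 * pi)"
   using tn pi_ge_two by (intro mult_mono) auto
  then have "sqrt \<bar>t\<bar> <= sqrt (4 * pi * norm (Complex (?d n) t))" by (simp add: mult.commute)
  then have le: "1 / sqrt (4 * pi * norm (Complex (?d n) t)) <= 1 / sqrt \<bar>t\<bar>"
   using t by (intro divide_left_mono) (auto intro!: mult_pos_pos)
  have "norm (cinner (heat (Complex (?d n) t) f) g) <= 1 / sqrt (4 * pi * norm (Complex (?d n) t)) * (n1 f * n1 g)"
   by (rule cinner_heat_dispersive[OF _ f g]) simp
  also have "... <= 1 / sqrt \<bar>t\<bar> * (n1 f * n1 g)"
   using le n1_nonneg by (intro mult_right_mono) auto
  finally show "norm (cinner (heat (Complex (?d n) t) f) g) <= 1 / sqrt \<bar>t\<bar> * (n1 f * n1 g)" .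
 qed
qed

section \<open>Weak solutions of the free equation\<close>

definition testfn :: "(real => complex) => (real => complex) => (real => complex) => bool" where
 "testfn \<phi> \<phi>' \<phi>'' \<longleftrightarrow> (\<forall>x. (\<phi> has_vector_derivative \<phi>' x) (at x)) \<and>
    (\<forall>x. (\<phi>' has_vector_derivative \<phi>'' x) (at x)) \<and>
    continuous_on UNIV \<phi>'' \<and> compact (closure {x. \<phi> x \<noteq> 0})"

lemma vector_derivative_zero_outside:
 fixes f :: "real => complex"
 assumes "(f has_vector_derivative D) (at x)" "K < \<bar>x\<bar>" "!!y. K < \<bar>y\<bar> ==> f y = 0"
 shows "D = 0"
proof -
 have o: "open {y::real. K < \<bar>y\<bar>}" by (intro open_Collect_less continuous_intros)
 have "((\<lambda>_. 0) has_vector_derivative D) (at x)"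
  by (rule has_vector_derivative_transform_within_open[OF assms(1) o]) (use assms in auto)
 then show ?thesis by (rule vector_derivative_unique_at) (rule has_vector_derivative_const)
qed

lemma testfn_support:
 assumes t: "testfn \<phi> \<phi>' \<phi>''"
 shows "\<exists>L>0. \<forall>x. L < \<bar>x\<bar> \<longrightarrow> \<phi> x = 0 \<and> \<phi>' x = 0 \<and> \<phi>'' x = 0"
proof -
 have "compact (closure {x. \<phi> x \<noteq> 0})" using t by (simp add: testfn_def)
 from compact_imp_bounded[OF this, unfolded bounded_pos]
 obtain K where K': "0 < K \<and> (\<forall>x\<in>closure {x. \<phi> x \<noteq> 0}. norm x <= K)" ..
 note K = conjunct1[OF K'] conjunct2[OF K']
 have 0: "\<phi> x = 0" if "K < \<bar>x\<bar>" for x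
 proof (rule ccontr)
  assume "\<phi> x \<noteq> 0"
  then have "x \<in> closure {x. \<phi> x \<noteq> 0}" by (intro closure_subset[THEN subsetD]) simp
  then have "norm x <= K" by (rule bspec[OF K(2)])
  then show False using that by simp
 qed
 have 1: "\<phi>' x = 0" if "K < \<bar>x\<bar>" for x
  by (rule vector_derivative_zero_outside[where f=\<phi>, OF _ that 0]) (use t in \<open>auto simp: testfn_def\<close>)
 have 2: "\<phi>'' x = 0" if "K < \<bar>x\<bar>" for x
  by (rule vector_derivative_zero_outside[where f=\<phi>', OF _ that 1]) (use t in \<open>auto simp: testfn_def\<close>)
 show ?thesis by (rule exI[of _ K]) (use K 0 1 2 in auto)
qed

lemma bounded_of_support:
 fixes f :: "real => complex"
 assumes c: "continuous_on UNIV f" and s: "!!x. L < \<bar>x\<bar> ==> f x = 0"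
 shows "\<exists>M\<ge>0. \<forall>x. norm (f x) <= M * indicat_real {-(L+1)..<L+1} x"
proof -
 have "compact (f ` {-L..L})" by (rule compact_continuous_image[OF continuous_on_subset[OF c]]) auto
 then have "bounded (f ` {-L..L})" by (rule compact_imp_bounded)
 then obtain M where M: "M > 0" "\<forall>y\<in>f ` {-L..L}. norm y <= M"
  unfolding bounded_pos by (elim exE conjE)
 have "norm (f x) <= M * indicat_real {-(L+1)..<L+1} x" for x
 proof (cases "\<bar>x\<bar> <= L")
  case True
  then have "x \<in> {-L..L}" by auto
  then have "norm (f x) <= M" using M(2) by (metis imageI)
  then show ?thesis using True by (auto simp: indicator_def)
 qed (use M(1) s[of x] in auto)
 then show ?thesis using M(1) by (intro exI[of _ M]) auto
qed

lemma testfn_continuous: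
 assumes "testfn \<phi> \<phi>' \<phi>''"
 shows "continuous_on UNIV \<phi>" "continuous_on UNIV \<phi>'" "continuous_on UNIV \<phi>''"
 using assms by (auto simp: testfn_def intro!: continuous_at_imp_continuous_on has_vector_derivative_continuous)

lemma testfn_sqint:
 assumes t: "testfn \<phi> \<phi>' \<phi>''" shows "sqint \<phi>" "sqint \<phi>'" "sqint \<phi>''"
proof -
 obtain L where "\<forall>x. L < \<bar>x\<bar> \<longrightarrow> \<phi> x = 0 \<and> \<phi>' x = 0 \<and> \<phi>'' x = 0"
  using testfn_support[OF t] by blast
 then have L: "!!x. L < \<bar>x\<bar> ==> \<phi> x = 0" "!!x. L < \<bar>x\<bar> ==> \<phi>' x = 0" "!!x. L < \<bar>x\<bar> ==> \<phi>'' x = 0"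
  by auto
 have "sqint f" if "continuous_on UNIV f" "!!x. L < \<bar>x\<bar> ==> f x = 0" for f
 proof -
  from bounded_of_support[OF that]
  obtain M where M: "M \<ge> 0 \<and> (\<forall>x. norm (f x) <= M * indicat_real {-(L+1)..<L+1} x)" ..
  show ?thesis
   by (rule sqint_bounded_support[OF borel_measurable_continuous_onI[OF that(1)]]) (rule conjunct2[OF M, rule_format])
 qed
 then show "sqint \<phi>" "sqint \<phi>'" "sqint \<phi>''" using testfn_continuous[OF t] L by auto
qed

text \<open>Difference quotients of a C1 function of compact support are bounded and live in a fixed
  interval, so they converge in L2 by domination.\<close>

lemma tau_has_derivative:
 assumes d: "!!x. (\<phi> has_vector_derivative \<phi>' x) (at x)" and c: "continuous_on UNIV \<phi>'"
  and s: "!!x. L < \<bar>x\<bar> ==> \<phi> x = 0" and s': "!!x. L < \<bar>x\<bar> ==> \<phi>' x = 0"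
  and q: "sqint \<phi>" "sqint \<phi>'"
 shows "((\<lambda>h. tau h (abs_l2 \<phi>)) has_vector_derivative - tau h (abs_l2 \<phi>')) (at h)"
proof (rule has_vector_derivative_seqI)
 fix hs :: "nat => real" assume hs: "!!n. hs n \<noteq> 0" "hs \<longlonglongrightarrow> 0"
 have "Bseq hs" using hs by (intro convergent_imp_Bseq) (auto simp: convergent_def)
 then obtain B where B: "!!n. \<bar>hs n\<bar> <= B" unfolding Bseq_def by auto
 from bounded_of_support[OF c s']
 obtain M where "M \<ge> 0 \<and> (\<forall>x. norm (\<phi>' x) <= M * indicat_real {-(L+1)..<L+1} x)" ..
 then have M: "M \<ge> 0" "!!x. norm (\<phi>' x) <= M * indicat_real {-(L+1)..<L+1} x" by auto
 have M': "norm (\<phi>' x) <= M" for x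
  by (rule order_trans[OF M(2)]) (use M(1) in \<open>auto simp: indicator_def\<close>)
 define F where "F n x = (\<phi> (x - (h + hs n)) - \<phi> (x - h)) /\<^sub>R hs n" for n x
 define K where "K = L + \<bar>h\<bar> + B + 1"
 have "(tau (h + hs n) (abs_l2 \<phi>) - tau h (abs_l2 \<phi>)) /\<^sub>R hs n = abs_l2 (F n)" for n
  unfolding F_def by (simp add: abs_tau abs_diff abs_scaleR q sqint_translate sqint_diff)
 moreover have "- tau h (abs_l2 \<phi>') = abs_l2 (\<lambda>x. - \<phi>' (x - h))"
  by (simp add: abs_tau abs_uminus q sqint_translate)
 moreover have "(\<lambda>n. abs_l2 (F n)) \<longlonglongrightarrow> abs_l2 (\<lambda>x. - \<phi>' (x - h))"
 proof (rule l2_dominated(2))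
  show "sqint (F n)" for n unfolding F_def by (intro sqint_scaleR sqint_diff sqint_translate q)
  show "(\<lambda>x. - \<phi>' (x - h)) \<in> bmeas"
   by (rule sqint_measurable) (intro sqint_uminus sqint_translate q)
  have neg: "((\<lambda>r. \<phi> (y - r)) has_vector_derivative - \<phi>' (y - r)) (at r)" for y r
  proof -
   have "((\<lambda>r. y - r) has_vector_derivative - 1) (at r)" by (auto intro!: derivative_eq_intros)
   from vector_diff_chain_at[OF this d] show ?thesis by (simp add: o_def)
  qed
  show "AE x in lborel. (\<lambda>n. F n x) \<longlonglongrightarrow> - \<phi>' (x - h)"
   unfolding F_def by (intro AE_I2 has_vector_derivative_seqD neg hs)
  show "AE x in lborel. norm (F n x) <= M * indicat_real {-K..<K} x" for n
  proof (rule AE_I2)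
   fix x
   have le: "norm (F n x) <= M"
    unfolding F_def
    by (rule difference_quotient_bound[where r="\<bar>hs n\<bar> + 1" and F="\<lambda>r. \<phi> (x - r)" and F'="\<lambda>r. - \<phi>' (x - r)"])
     (use neg M' hs in auto)
   show "norm (F n x) <= M * indicat_real {-K..<K} x"
   proof (cases "x \<in> {-K..<K}")
    case False
    then have "L < \<bar>x - (h + hs n)\<bar>" "L < \<bar>x - h\<bar>" using B[of n] unfolding K_def by auto
    then have "F n x = 0" by (simp add: F_def s)
    then show ?thesis using M(1) by simp
   qed (use le in simp)
  qed
  show "integrable lborel (\<lambda>x. (M * indicat_real {-K..<K} x)\<^sup>2)"
   using integrable_ind_interval[of "M\<^sup>2" "-K" K] by (simp add: power_mult_distrib)
 qed
 ultimately show "(\<lambda>n. (tau (h + hs n) (abs_l2 \<phi>) - tau h (abs_l2 \<phi>)) /\<^sub>R hs n) \<longlonglongrightarrow> - tau h (abs_l2 \<phi>')"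
  by simp
qed

text \<open>Two integrations by parts move the derivatives from the kernel to the test function. The
  result is again a \<open>heat\<close> term, so its limit e to 0 is available.\<close>

lemma heat_test_deriv:
 assumes t: "testfn \<phi> \<phi>' \<phi>''" and e: "e > 0"
 shows "((\<lambda>s. cinner (heat (Complex e s) (abs_l2 \<phi>)) g) has_vector_derivative
   \<i> * cinner (heat (Complex e r) (abs_l2 \<phi>'')) g) (at r)"
proof -
 define T T1 T2 where "T = abs_l2 \<phi>" and "T1 = abs_l2 \<phi>'" and "T2 = abs_l2 \<phi>''"
 obtain L where "\<forall>x. L < \<bar>x\<bar> \<longrightarrow> \<phi> x = 0 \<and> \<phi>' x = 0 \<and> \<phi>'' x = 0"
  using testfn_support[OF t] by blast
 then have L: "!!x. L < \<bar>x\<bar> ==> \<phi> x = 0" "!!x. L < \<bar>x\<bar> ==> \<phi>' x = 0" "!!x. L < \<bar>x\<bar> ==> \<phi>'' x = 0"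
  by auto
 note tc = testfn_continuous[OF t] and ts = testfn_sqint[OF t]
 have d1: "((\<lambda>h. tau h T) has_vector_derivative - tau h T1) (at h)" for h
  unfolding T_def T1_def by (rule tau_has_derivative[where L=L]) (use t L tc ts in \<open>auto simp: testfn_def\<close>)
 have d2: "((\<lambda>h. tau h T1) has_vector_derivative - tau h T2) (at h)" for h
  unfolding T1_def T2_def by (rule tau_has_derivative[where L=L]) (use t L tc ts in \<open>auto simp: testfn_def\<close>)
 define B where "B = (norm T + norm T1 + norm T2) * norm g"
 have "(LBINT x. gk2 (Complex e r) x * cinner (tau x T) g) = (LBINT x. gk (Complex e r) x * cinner (tau x T2) g)"
 proof (rule gk_by_parts[where ?c1.0="\<lambda>x. - cinner (tau x T1) g" and B=B])
  show "((\<lambda>x. cinner (tau x T) g) has_vector_derivative - cinner (tau x T1) g) (at x)" for x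
   using bounded_linear.has_vector_derivative[OF cinner.bounded_linear_left d1, of g] by (simp add: cinner.minus_left)
  show "((\<lambda>x. - cinner (tau x T1) g) has_vector_derivative cinner (tau x T2) g) (at x)" for x
   using has_vector_derivative_minus[OF bounded_linear.has_vector_derivative[OF cinner.bounded_linear_left d2, of g]]
   by (simp add: cinner.minus_left)
  show "continuous_on UNIV (\<lambda>x. cinner (tau x T2) g)"
   by (intro cinner.continuous_on tau_continuous continuous_on_const)
  have "norm (cinner (tau x f) g) <= B" if "norm f <= norm T + norm T1 + norm T2" for x f
   unfolding B_def using cinner_tau_bound[of x f g] mult_right_mono[OF that, of "norm g"] by simp
  then show "norm (cinner (tau x T) g) <= B" "norm (- cinner (tau x T1) g) <= B" "norm (cinner (tau x T2) g) <= B" for x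
   by simp_all
 qed (use e in simp)
 then show ?thesis
  using heat_weak_deriv[OF e, of "abs_l2 \<phi>" g r] e by (simp add: T_def T2_def cinner_heat)
qed

lemma vector_derivative_sequence:
 fixes f f' :: "nat => real => complex"
 assumes d: "!!n t. \<bar>t - t0\<bar> <= 1 ==> (f n has_vector_derivative f' n t) (at t)"
  and u: "!!n t. \<bar>t - t0\<bar> <= 1 ==> norm (f' n t - g' t) <= b n" and b: "b \<longlonglongrightarrow> 0"
  and l: "!!t. \<bar>t - t0\<bar> <= 1 ==> (\<lambda>n. f n t) \<longlonglongrightarrow> g t"
 shows "(g has_vector_derivative g' t0) (at t0)"
proof -
 let ?S = "{t0 - 1..t0 + 1}"
 have S: "t \<in> ?S \<longleftrightarrow> \<bar>t - t0\<bar> <= 1" for t by auto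
 have "\<exists>G. \<forall>x\<in>?S. (\<lambda>n. f n x) \<longlonglongrightarrow> G x \<and> (G has_derivative (\<lambda>h. h *\<^sub>R g' x)) (at x within ?S)"
 proof (rule has_derivative_sequence[where f'="\<lambda>n x h. h *\<^sub>R f' n x"])
  show "(f n has_derivative (\<lambda>h. h *\<^sub>R f' n x)) (at x within ?S)" if "x \<in> ?S" for n x
   using d[of x n] that unfolding S by (auto simp: has_vector_derivative_def intro: has_derivative_at_withinI)
  show "\<forall>\<^sub>F n in sequentially. \<forall>x\<in>?S. \<forall>h. norm (h *\<^sub>R f' n x - h *\<^sub>R g' x) <= e * norm h" if "e > 0" for e
   using order_tendstoD(2)[OF b that]
  proof eventually_elim
   case (elim n)
   show ?case
   proof (intro ballI allI)
    fix x h assume "x \<in> ?S"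
    then have "norm (f' n x - g' x) <= e" using u[of x n] elim unfolding S by linarith
    then have "\<bar>h\<bar> * norm (f' n x - g' x) <= \<bar>h\<bar> * e" by (intro mult_left_mono) auto
    then show "norm (h *\<^sub>R f' n x - h *\<^sub>R g' x) <= e * norm h"
     by (simp add: mult.commute flip: scaleR_diff_right)
   qed
  qed
  show "t0 \<in> ?S" by simp
  show "(\<lambda>n. f n t0) \<longlonglongrightarrow> g t0" by (rule l) simp
 qed auto
 then obtain G where G: "!!x. x \<in> ?S ==> (\<lambda>n. f n x) \<longlonglongrightarrow> G x"
  "!!x. x \<in> ?S ==> (G has_derivative (\<lambda>h. h *\<^sub>R g' x)) (at x within ?S)" by blast
 have "G x = g x" if "x \<in> ?S" for x using LIMSEQ_unique[OF G(1)[OF that] l] that unfolding S by simp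
 then have "(g has_derivative (\<lambda>h. h *\<^sub>R g' t0)) (at t0 within ?S)"
  by (intro has_derivative_transform[OF _ _ G(2)]) auto
 moreover have "at t0 within ?S = at t0" by (rule at_within_interior) simp
 ultimately show ?thesis by (simp add: has_vector_derivative_def)
qed

lemma heat_norm_diff_tendsto:
 "(\<lambda>n. norm (f - heat (of_real (1 / real (Suc n))) f) * c) \<longlonglongrightarrow> 0"
proof -
 have "(\<lambda>n. norm (f - heat (of_real (1 / real (Suc n))) f) * c) \<longlonglongrightarrow> norm (f - f) * c"
  by (intro tendsto_intros heat_real_tendsto inv_Suc_tendsto) auto
 then show ?thesis by simp
qed

lemma sg_test_weak_deriv:
 assumes t: "testfn \<phi> \<phi>' \<phi>''"
 shows "((\<lambda>s. cinner (sg s (abs_l2 \<phi>)) g) has_vector_derivative \<i> * cinner (sg r (abs_l2 \<phi>'')) g) (at r)"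
proof (rule vector_derivative_sequence)
 let ?d = "\<lambda>n. 1 / real (Suc n)"
 show "((\<lambda>s. cinner (heat (Complex (?d n) s) (abs_l2 \<phi>)) g) has_vector_derivative
   \<i> * cinner (heat (Complex (?d n) s) (abs_l2 \<phi>'')) g) (at s)" for n s
  by (rule heat_test_deriv[OF t]) simp
 show "(\<lambda>n. cinner (heat (Complex (?d n) s) (abs_l2 \<phi>)) g) \<longlonglongrightarrow> cinner (sg s (abs_l2 \<phi>)) g" for s
  by (intro cinner.tendsto tendsto_const sg_limit inv_Suc_tendsto) simp
 show "norm (\<i> * cinner (heat (Complex (?d n) s) (abs_l2 \<phi>'')) g - \<i> * cinner (sg s (abs_l2 \<phi>'')) g)
   <= norm (abs_l2 \<phi>'' - heat (of_real (?d n)) (abs_l2 \<phi>'')) * norm g" for n s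
 proof -
  have "norm (\<i> * cinner (heat (Complex (?d n) s) (abs_l2 \<phi>'')) g - \<i> * cinner (sg s (abs_l2 \<phi>'')) g)
   = norm (cinner (sg s (abs_l2 \<phi>'') - heat (Complex (?d n) s) (abs_l2 \<phi>'')) g)"
   unfolding right_diff_distrib[symmetric] norm_mult by (simp add: cinner.diff_left norm_minus_commute)
  also have "... <= norm (sg s (abs_l2 \<phi>'') - heat (Complex (?d n) s) (abs_l2 \<phi>'')) * norm g"
   by (rule norm_cinner_le)
  finally show ?thesis by (subst (asm) norm_sg_heat) auto
 qed
qed (rule heat_norm_diff_tendsto)

text \<open>Tested against any g, \<open>sg u T\<close> minus the integral of the continuous curve
  \<open>F\<close> is constant, so the identity holds in L2 and the fundamental theorem of calculus
  yields a derivative in norm. This strong form serves the product rule in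
  \<open>weak_sol_conserved\<close>.\<close>

lemma sg_test_deriv:
 assumes t: "testfn \<phi> \<phi>' \<phi>''"
 shows "((\<lambda>s. sg s (abs_l2 \<phi>)) has_vector_derivative cscale \<i> (sg r (abs_l2 \<phi>''))) (at r)"
proof -
 define T T2 where "T = abs_l2 \<phi>" and "T2 = abs_l2 \<phi>''"
 let ?S = "{r - 1..r + 1}"
 define F where "F s = cscale \<i> (sg s T2)" for s
 define \<Psi> where "\<Psi> u = integral {r - 1..u} F" for u
 have Fc: "continuous_on ?S F"
  unfolding F_def by (intro cscale.continuous_on continuous_on_const continuous_on_subset[OF sg_continuous]) auto
 have P: "(\<Psi> has_vector_derivative F u) (at u within ?S)" if "u \<in> ?S" for u
  unfolding \<Psi>_def by (rule integral_has_vector_derivative[OF Fc that])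
 have eq: "sg u T = sg (r - 1) T + \<Psi> u" if u: "u \<in> ?S" for u
 proof -
  have "cinner (sg u T - \<Psi> u) g = cinner (sg (r - 1) T) g" for g
  proof -
   have "\<exists>c. \<forall>u\<in>?S. cinner (sg u T) g - cinner (\<Psi> u) g = c"
   proof (rule has_vector_derivative_zero_constant)
    fix u assume u: "u \<in> ?S"
    have 1: "((\<lambda>s. cinner (sg s T) g) has_vector_derivative \<i> * cinner (sg u T2) g) (at u within ?S)"
     unfolding T_def T2_def by (rule has_vector_derivative_at_within[OF sg_test_weak_deriv[OF t]])
    have 2: "((\<lambda>s. cinner (\<Psi> s) g) has_vector_derivative cinner (F u) g) (at u within ?S)"
     by (rule bounded_linear.has_vector_derivative[OF cinner.bounded_linear_left P[OF u]])
    show "((\<lambda>u. cinner (sg u T) g - cinner (\<Psi> u) g) has_vector_derivative 0) (at u within ?S)"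
     using has_vector_derivative_diff[OF 1 2] by (simp add: F_def)
   qed auto
   then obtain c where c: "!!u. u \<in> ?S ==> cinner (sg u T) g - cinner (\<Psi> u) g = c" by blast
   have "\<Psi> (r - 1) = 0" by (simp add: \<Psi>_def)
   then show ?thesis using c[OF u] c[of "r - 1"] by (simp add: cinner.diff_left cinner.zero_left)
  qed
  then have "sg u T - \<Psi> u = sg (r - 1) T" by (rule l2_eq_cinnerI)
  then show ?thesis by (simp add: algebra_simps)
 qed
 have r: "r \<in> ?S" by simp
 have D: "((\<lambda>u. sg (r - 1) T + \<Psi> u) has_vector_derivative 0 + F r) (at r within ?S)"
  by (rule has_vector_derivative_add[OF has_vector_derivative_const P[OF r]])
 have "((\<lambda>u. sg u T) has_vector_derivative 0 + F r) (at r within ?S)"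
  by (rule has_vector_derivative_transform[OF r _ D]) (rule eq)
 moreover have "at r within ?S = at r" by (rule at_within_interior) simp
 ultimately show ?thesis by (simp add: F_def T_def T2_def)
qed

lemma testfn_translate:
 assumes t: "testfn \<phi> \<phi>' \<phi>''" shows "testfn (\<lambda>x. \<phi> (x - h)) (\<lambda>x. \<phi>' (x - h)) (\<lambda>x. \<phi>'' (x - h))"
proof -
 have ch: "((\<lambda>x. f (x - h)) has_vector_derivative f' (x - h)) (at x)"
  if "!!x. (f has_vector_derivative f' x) (at x)" for f f' :: "real => complex" and x
 proof -
  have "((\<lambda>x. x - h) has_vector_derivative 1) (at x)" by (auto intro!: derivative_eq_intros)
  from vector_diff_chain_at[OF this that] show ?thesis by (simp add: o_def)
 qed
 obtain L where L: "\<forall>x. L < \<bar>x\<bar> \<longrightarrow> \<phi> x = 0 \<and> \<phi>' x = 0 \<and> \<phi>'' x = 0" using testfn_support[OF t] by blast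
 have "{x. \<phi> (x - h) \<noteq> 0} \<subseteq> {-(L + \<bar>h\<bar>)..L + \<bar>h\<bar>}"
 proof
  fix x assume "x \<in> {x. \<phi> (x - h) \<noteq> 0}"
  then have "\<bar>x - h\<bar> <= L" using L[rule_format, of "x - h"] by force
  then show "x \<in> {-(L + \<bar>h\<bar>)..L + \<bar>h\<bar>}" by auto
 qed
 then have "bounded {x. \<phi> (x - h) \<noteq> 0}" by (rule bounded_subset[OF bounded_closed_interval])
 then have "compact (closure {x. \<phi> (x - h) \<noteq> 0})" by (simp add: compact_closure)
 moreover have "continuous_on UNIV (\<lambda>x. \<phi>'' (x - h))"
  by (rule continuous_on_compose2[OF testfn_continuous(3)[OF t]]) (auto intro!: continuous_intros)
 ultimately show ?thesis using t[unfolded testfn_def] unfolding testfn_def by (intro conjI allI ch) auto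
qed

section \<open>Uniqueness of weak solutions by duality\<close>

definition weak_sol :: "(real => l2) => bool" where
 "weak_sol w \<longleftrightarrow> continuous_on UNIV w \<and> (\<forall>\<phi> \<phi>' \<phi>''. testfn \<phi> \<phi>' \<phi>'' \<longrightarrow>
   (\<forall>t. ((\<lambda>t. cinner (w t) (abs_l2 \<phi>)) has_vector_derivative \<i> * cinner (w t) (abs_l2 \<phi>'')) (at t)))"

lemma locally_bounded:
 fixes w :: "real => l2"
 assumes "continuous_on UNIV w"
 shows "\<exists>C\<ge>0. \<forall>s. \<bar>s - t\<bar> <= 1 \<longrightarrow> norm (w s) <= C"
proof -
 have "compact (w ` {t - 1..t + 1})" by (rule compact_continuous_image[OF continuous_on_subset[OF assms]]) auto
 then have "bounded (w ` {t - 1..t + 1})" by (rule compact_imp_bounded)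
 then obtain M where M: "M > 0" "\<forall>y\<in>w ` {t - 1..t + 1}. norm y <= M"
  unfolding bounded_pos by (elim exE conjE)
 then have "norm (w s) <= M" if "\<bar>s - t\<bar> <= 1" for s
 proof -
  have "s \<in> {t - 1..t + 1}" using that by auto
  then show ?thesis using M(2) by (metis imageI)
 qed
 then show ?thesis using M(1) by (intro exI[of _ M]) auto
qed

text \<open>A smoothed test function no longer has compact support, but it is a superposition of
  translates of a test function, so the weak equation can be integrated against the kernel.\<close>

lemma weak_sol_heat_test:
 assumes w: "weak_sol w" and t: "testfn \<phi> \<phi>' \<phi>''" and z: "Re z > 0"
 shows "((\<lambda>t. cinner (w t) (heat z (abs_l2 \<phi>))) has_vector_derivative \<i> * cinner (w r) (heat z (abs_l2 \<phi>''))) (at r)"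
proof -
 have wc: "continuous_on UNIV w" using w by (simp add: weak_sol_def)
 from locally_bounded[OF wc, of r] obtain C where "C \<ge> 0 \<and> (\<forall>s. \<bar>s - r\<bar> <= 1 \<longrightarrow> norm (w s) <= C)" ..
 then have C: "C \<ge> 0" "!!s. \<bar>s - r\<bar> <= 1 ==> norm (w s) <= C" by auto
 note ts = testfn_sqint[OF t]
 have ex: "cinner u (heat z f) = (LBINT h. cnj (gk z h) * cinner u (tau h f))" for u f
  unfolding heat_def conv_def by (simp add: cinner_integral_right conv_integrable integrable_gk z)
 have int: "integrable lborel (\<lambda>h. cnj (gk z h) * cinner u (tau h f))" for u f
 proof -
  have "integrable lborel (\<lambda>h. cinner u (cscale (gk z h) (tau h f)))"
   by (rule integrable_bounded_linear[OF cinner.bounded_linear_right conv_integrable[OF integrable_gk[OF z]]])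
  then show ?thesis by simp
 qed
 have "((\<lambda>t. LBINT h. cnj (gk z h) * cinner (w t) (tau h (abs_l2 \<phi>))) has_vector_derivative
   (LBINT h. cnj (gk z h) * (\<i> * cinner (w r) (tau h (abs_l2 \<phi>''))))) (at r)"
 proof (rule integral_has_vector_derivative_param[where r=1 and g="\<lambda>h. norm (gk z h) * (C * norm (abs_l2 \<phi>''))"
   and f'="\<lambda>t h. cnj (gk z h) * (\<i> * cinner (w t) (tau h (abs_l2 \<phi>'')))"])
  fix s h assume s: "\<bar>s - r\<bar> < (1::real)"
  show "integrable lborel (\<lambda>h. cnj (gk z h) * cinner (w s) (tau h (abs_l2 \<phi>)))" by (rule int)
  have "((\<lambda>t. cinner (w t) (tau h (abs_l2 \<phi>))) has_vector_derivative \<i> * cinner (w s) (tau h (abs_l2 \<phi>''))) (at s)"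
   using w testfn_translate[OF t, of h] unfolding weak_sol_def by (simp add: abs_tau ts)
  then show "((\<lambda>t. cnj (gk z h) * cinner (w t) (tau h (abs_l2 \<phi>))) has_vector_derivative
    cnj (gk z h) * (\<i> * cinner (w s) (tau h (abs_l2 \<phi>'')))) (at s)"
   by (rule has_vector_derivative_mult_right)
  have "norm (cinner (w s) (tau h (abs_l2 \<phi>''))) <= norm (w s) * norm (abs_l2 \<phi>'')"
   using norm_cinner_le[of "w s" "tau h (abs_l2 \<phi>'')"] by simp
  also have "... <= C * norm (abs_l2 \<phi>'')" using C(2)[of s] s by (intro mult_right_mono) auto
  finally show "norm (cnj (gk z h) * (\<i> * cinner (w s) (tau h (abs_l2 \<phi>'')))) <= norm (gk z h) * (C * norm (abs_l2 \<phi>''))"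
   by (simp add: norm_mult mult_left_mono)
 next
  show "integrable lborel (\<lambda>h. norm (gk z h) * (C * norm (abs_l2 \<phi>'')))"
   by (intro integrable_mult_left integrable_norm integrable_gk z)
  show "(\<lambda>h. cnj (gk z h) * (\<i> * cinner (w r) (tau h (abs_l2 \<phi>'')))) \<in> borel_measurable lborel"
   by measurable
 qed simp
 moreover have "(LBINT h. cnj (gk z h) * (\<i> * cinner (w r) (tau h (abs_l2 \<phi>'')))) =
   \<i> * (LBINT h. cnj (gk z h) * cinner (w r) (tau h (abs_l2 \<phi>'')))"
  by (subst integral_mult_right_zero[symmetric], rule Bochner_Integration.integral_cong) simp_all
 ultimately show ?thesis by (simp only: ex)
qed

lemma weak_sol_sg_test:
 assumes w: "weak_sol w" and t: "testfn \<phi> \<phi>' \<phi>''"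
 shows "((\<lambda>t. cinner (w t) (sg s (abs_l2 \<phi>))) has_vector_derivative \<i> * cinner (w r) (sg s (abs_l2 \<phi>''))) (at r)"
proof -
 let ?d = "\<lambda>n. 1 / real (Suc n)"
 have wc: "continuous_on UNIV w" using w by (simp add: weak_sol_def)
 from locally_bounded[OF wc, of r] obtain C where "C \<ge> 0 \<and> (\<forall>s. \<bar>s - r\<bar> <= 1 \<longrightarrow> norm (w s) <= C)" ..
 then have C: "C \<ge> 0" "!!s. \<bar>s - r\<bar> <= 1 ==> norm (w s) <= C" by auto
 show ?thesis
 proof (rule vector_derivative_sequence)
  show "((\<lambda>t. cinner (w t) (heat (Complex (?d n) s) (abs_l2 \<phi>))) has_vector_derivative
    \<i> * cinner (w t) (heat (Complex (?d n) s) (abs_l2 \<phi>''))) (at t)" for n t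
   by (rule weak_sol_heat_test[OF w t]) simp
  show "(\<lambda>n. cinner (w t) (heat (Complex (?d n) s) (abs_l2 \<phi>))) \<longlonglongrightarrow> cinner (w t) (sg s (abs_l2 \<phi>))" for t
   by (intro cinner.tendsto tendsto_const sg_limit inv_Suc_tendsto) simp
  show "norm (\<i> * cinner (w t) (heat (Complex (?d n) s) (abs_l2 \<phi>'')) - \<i> * cinner (w t) (sg s (abs_l2 \<phi>'')))
    <= norm (abs_l2 \<phi>'' - heat (of_real (?d n)) (abs_l2 \<phi>'')) * C" if "\<bar>t - r\<bar> <= 1" for n t
  proof -
   have "norm (\<i> * cinner (w t) (heat (Complex (?d n) s) (abs_l2 \<phi>'')) - \<i> * cinner (w t) (sg s (abs_l2 \<phi>'')))
    = norm (cinner (w t) (sg s (abs_l2 \<phi>'') - heat (Complex (?d n) s) (abs_l2 \<phi>'')))"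
    unfolding right_diff_distrib[symmetric] norm_mult by (simp add: cinner.diff_right norm_minus_commute)
   also have "... <= norm (w t) * norm (sg s (abs_l2 \<phi>'') - heat (Complex (?d n) s) (abs_l2 \<phi>''))"
    by (rule norm_cinner_le)
   also have "... <= C * norm (sg s (abs_l2 \<phi>'') - heat (Complex (?d n) s) (abs_l2 \<phi>''))"
    by (intro mult_right_mono C that) simp
   finally show ?thesis by (subst (asm) norm_sg_heat) (auto simp: mult.commute)
  qed
 qed (rule heat_norm_diff_tendsto)
qed

text \<open>In the product rule the two derivatives carry i and its conjugate and cancel. The factor
  w is differentiated against evolved test functions, which is what the two preceding lemmas
  provide.\<close>

lemma weak_sol_conserved:
 assumes w: "weak_sol w" and t: "testfn \<phi> \<phi>' \<phi>''"
 shows "cinner (w r) (sg r (abs_l2 \<phi>)) = cinner (w 0) (abs_l2 \<phi>)"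
proof -
 define T T2 where "T = abs_l2 \<phi>" and "T2 = abs_l2 \<phi>''"
 have wc: "continuous_on UNIV w" using w by (simp add: weak_sol_def)
 have D0: "((\<lambda>s. cinner (w s) (sg s T)) has_vector_derivative 0) (at s)" for s
 proof (rule has_vector_derivative_seqI)
  fix h :: "nat => real" assume h: "!!n. h n \<noteq> 0" "h \<longlonglongrightarrow> 0"
  have l: "(\<lambda>n. s + h n) \<longlonglongrightarrow> s" using tendsto_add[OF tendsto_const h(2), of s] by simp
  have wl: "(\<lambda>n. w (s + h n)) \<longlonglongrightarrow> w s"
   using wc by (auto simp: continuous_on_eq_continuous_at intro!: isCont_tendsto_compose[OF _ l])
  have 1: "(\<lambda>n. (sg (s + h n) T - sg s T) /\<^sub>R h n) \<longlonglongrightarrow> cscale \<i> (sg s T2)"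
   unfolding T_def T2_def by (rule has_vector_derivative_seqD[OF sg_test_deriv[OF t] h])
  have 2: "(\<lambda>n. (cinner (w (s + h n)) (sg s T) - cinner (w s) (sg s T)) /\<^sub>R h n) \<longlonglongrightarrow> \<i> * cinner (w s) (sg s T2)"
   unfolding T_def T2_def by (rule has_vector_derivative_seqD[OF weak_sol_sg_test[OF w t] h])
  have "(\<lambda>n. cinner (w (s + h n)) ((sg (s + h n) T - sg s T) /\<^sub>R h n) +
    (cinner (w (s + h n)) (sg s T) - cinner (w s) (sg s T)) /\<^sub>R h n) \<longlonglongrightarrow>
    cinner (w s) (cscale \<i> (sg s T2)) + \<i> * cinner (w s) (sg s T2)"
   by (intro tendsto_add cinner.tendsto wl 1 2)
  then show "(\<lambda>n. (cinner (w (s + h n)) (sg (s + h n) T) - cinner (w s) (sg s T)) /\<^sub>R h n) \<longlonglongrightarrow> 0"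
   by (simp add: cinner.diff_right scaleR_conv_of_real algebra_simps)
 qed
 have "\<exists>c. \<forall>s\<in>UNIV. cinner (w s) (sg s T) = c"
  by (rule has_vector_derivative_zero_constant[OF convex_UNIV], rule D0, blast)
 then obtain c where c: "\<forall>s\<in>UNIV. cinner (w s) (sg s T) = c" ..
 have "cinner (w r) (sg r T) = cinner (w 0) (sg 0 T)" using c[rule_format, of r] c[rule_format, of 0] by simp
 then show ?thesis by (simp add: T_def)
qed

text \<open>An exponent of at least 2 makes the power of the positive part differentiable at 0; two
  applications give the C2 bumps below.\<close>

lemma relu_power_deriv:
 "((\<lambda>y::real. (max 0 y) ^ Suc (Suc k)) has_real_derivative real (Suc (Suc k)) * (max 0 y) ^ Suc k) (at y)"
proof -
 consider "y > 0" | "y < 0" | "y = 0" by linarith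
 then show ?thesis
 proof cases
  case 1
  have "((\<lambda>y::real. y ^ Suc (Suc k)) has_real_derivative real (Suc (Suc k)) * y ^ Suc k) (at y)"
   using DERIV_pow[of "Suc (Suc k)" y UNIV] by (simp del: of_nat_Suc)
  then have "((\<lambda>y::real. (max 0 y) ^ Suc (Suc k)) has_real_derivative real (Suc (Suc k)) * y ^ Suc k) (at y)"
   by (rule has_field_derivative_transform_within_open[where S="{0<..}"]) (use 1 in auto)
  then show ?thesis using 1 by simp
 next
  case 2
  have "((\<lambda>y::real. 0) has_real_derivative 0) (at y)" by simp
  then have "((\<lambda>y::real. (max 0 y) ^ Suc (Suc k)) has_real_derivative 0) (at y)"
   by (rule has_field_derivative_transform_within_open[where S="{..<0}"]) (use 2 in auto)
  then show ?thesis using 2 by simp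
 next
  case 3
  have "((\<lambda>h::real. (max 0 h) ^ Suc k) \<longlongrightarrow> (max 0 0) ^ Suc k) (at 0)"
   by (intro tendsto_intros)
  then have l: "((\<lambda>h::real. (max 0 h) ^ Suc k) \<longlongrightarrow> 0) (at 0)" by simp
  have "((\<lambda>h::real. ((max 0 (0 + h)) ^ Suc (Suc k) - (max 0 0) ^ Suc (Suc k)) / h) \<longlongrightarrow> 0) (at 0)"
  proof (rule Lim_transform_eventually[OF l])
   show "\<forall>\<^sub>F h in at (0::real). (max 0 h) ^ Suc k = ((max 0 (0 + h)) ^ Suc (Suc k) - (max 0 0) ^ Suc (Suc k)) / h"
    by (auto simp: eventually_at_filter max_def)
  qed
  then show ?thesis using 3 by (simp add: DERIV_def)
 qed
qed

text \<open>An explicit C2 bump: the parabola that vanishes at p and q and has maximum 1, its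
  positive part cubed for two derivatives, and \<open>1 - (1 - m) ^ (n + 2)\<close> to push interior
  values to 1 as n grows. The exponent n + 2 stays nonnegative after two derivatives.\<close>

lemma bump_test:
 fixes p q :: real and n :: nat
 assumes pq: "p < q"
 defines "\<phi> \<equiv> \<lambda>x. of_real (1 - (1 - (max 0 (4 * (x - p) * (q - x) / (q - p)\<^sup>2)) ^ 3) ^ (n + 2)) :: complex"
 shows "\<exists>\<phi>' \<phi>''. testfn \<phi> \<phi>' \<phi>''"
proof -
 define c where "c = 4 / (q - p)\<^sup>2"
 define r where "r x = c * (x - p) * (q - x)" for x
 define r' where "r' x = c * (p + q - 2 * x)" for x
 define m where "m x = (max 0 (r x)) ^ 3" for x
 define m1 where "m1 x = 3 * (max 0 (r x)) ^ 2 * r' x" for x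
 define m2 where "m2 x = 3 * (2 * max 0 (r x) * r' x * r' x + (max 0 (r x)) ^ 2 * (- 2 * c))" for x
 define f where "f x = 1 - (1 - m x) ^ (n + 2)" for x
 define f1 where "f1 x = real (n + 2) * (1 - m x) ^ (n + 1) * m1 x" for x
 define f2 where "f2 x = real (n + 2) * ((1 - m x) ^ (n + 1) * m2 x - real (n + 1) * (1 - m x) ^ n * m1 x * m1 x)" for x
 have dr: "(r has_real_derivative r' x) (at x)" for x
  unfolding r_def r'_def by (auto intro!: derivative_eq_intros simp: algebra_simps)
 have dr': "(r' has_real_derivative - 2 * c) (at x)" for x
  unfolding r'_def by (auto intro!: derivative_eq_intros simp: algebra_simps)
 have d3: "((\<lambda>x. (max 0 (r x)) ^ 3) has_real_derivative 3 * (max 0 (r x)) ^ 2 * r' x) (at x)" for x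
  using DERIV_chain2[OF relu_power_deriv[of 1] dr] by (simp add: numeral_3_eq_3 numeral_2_eq_2)
 have d2: "((\<lambda>x. (max 0 (r x)) ^ 2) has_real_derivative 2 * max 0 (r x) * r' x) (at x)" for x
  using DERIV_chain2[OF relu_power_deriv[of 0] dr] by (simp add: numeral_2_eq_2)
 have dm: "(m has_real_derivative m1 x) (at x)" for x unfolding m_def m1_def by (rule d3)
 have dm1: "(m1 has_real_derivative m2 x) (at x)" for x
 proof -
  have "((\<lambda>x. 3 * ((max 0 (r x)) ^ 2 * r' x)) has_real_derivative
    3 * ((max 0 (r x)) ^ 2 * (- 2 * c) + 2 * max 0 (r x) * r' x * r' x)) (at x)"
   by (intro DERIV_cmult DERIV_mult' d2 dr')
  then show ?thesis unfolding m1_def m2_def by (simp only: mult.assoc add.commute)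
 qed
 have dp: "((\<lambda>x. (1 - m x) ^ Suc k) has_real_derivative - (real (Suc k) * (1 - m x) ^ k * m1 x)) (at x)" for k x
 proof -
  have "((\<lambda>x. 1 - m x) has_real_derivative - m1 x) (at x)"
   using DERIV_diff[OF DERIV_const dm] by simp
  from DERIV_power[OF this, of "Suc k"] show ?thesis by (simp add: mult_ac del: of_nat_Suc)
 qed
 have df: "(f has_real_derivative f1 x) (at x)" for x
  unfolding f_def f1_def using DERIV_diff[OF DERIV_const dp[of "n + 1"], of 1] by simp
 have df1: "(f1 has_real_derivative f2 x) (at x)" for x
 proof -
  have "((\<lambda>x. real (n + 2) * ((1 - m x) ^ Suc n * m1 x)) has_real_derivative
    real (n + 2) * ((1 - m x) ^ Suc n * m2 x + - (real (Suc n) * (1 - m x) ^ n * m1 x) * m1 x)) (at x)"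
   by (intro DERIV_cmult DERIV_mult' dp dm1)
  then show ?thesis unfolding f1_def f2_def by (simp add: mult.assoc)
 qed
 have cont: "continuous_on UNIV r" "continuous_on UNIV r'"
  unfolding r_def r'_def by (intro continuous_intros)+
 have cf2: "continuous_on UNIV f2"
  unfolding f2_def m_def m1_def m2_def using cont by (intro continuous_intros)
 have cv: "((\<lambda>x. complex_of_real (g x)) has_vector_derivative of_real D) (at x)"
  if "(g has_real_derivative D) (at x)" for g :: "real => real" and D x
  using bounded_linear.has_vector_derivative[OF bounded_linear_of_real that[unfolded has_real_derivative_iff_has_vector_derivative]] .
 have \<phi>: "\<phi> = (\<lambda>x. of_real (f x))"
 proof -
  have "4 * (x - p) * (q - x) / (q - p)\<^sup>2 = r x" for x by (simp add: r_def c_def)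
  then show ?thesis unfolding \<phi>_def f_def m_def by (simp only:)
 qed
 have out: "f x = 0" if "x < p \<or> q < x" for x
 proof -
  have "c > 0" using pq by (simp add: c_def)
  then have "r x <= 0" unfolding r_def using that pq
   by (auto simp: mult_le_0_iff zero_le_mult_iff)
  then show ?thesis by (simp add: f_def m_def)
 qed
 have "{x. \<phi> x \<noteq> 0} \<subseteq> {p..q}" using out by (force simp: \<phi>)
 then have "bounded {x. \<phi> x \<noteq> 0}" by (rule bounded_subset[OF bounded_closed_interval])
 then have "compact (closure {x. \<phi> x \<noteq> 0})" by (simp add: compact_closure)
 moreover have "continuous_on UNIV (\<lambda>x. complex_of_real (f2 x))" using cf2 by (intro continuous_intros)
 ultimately have "testfn \<phi> (\<lambda>x. of_real (f1 x)) (\<lambda>x. of_real (f2 x))"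
  unfolding testfn_def \<phi> using cv[OF df] cv[OF df1] by blast
 then show ?thesis by blast
qed

text \<open>The bumps converge boundedly to indicators of intervals, whose combinations are
  dense.\<close>

lemma test_determines_zero:
 assumes "!!\<phi> \<phi>' \<phi>''. testfn \<phi> \<phi>' \<phi>'' ==> cinner f (abs_l2 \<phi>) = 0"
 shows "f = 0"
proof -
 have ind0: "cinner f (ind p q) = 0" for p q
 proof (cases "p < q")
  case False
  then have "ind p q = 0" by (simp add: ind_def abs_zero)
  then show ?thesis by (simp add: cinner.zero_right)
 next
  case True
  define m where "m x = (max 0 (4 * (x - p) * (q - x) / (q - p)\<^sup>2)) ^ 3" for x :: real
  define \<phi> where "\<phi> n x = complex_of_real (1 - (1 - m x) ^ (n + 2))" for n x
  have t: "\<exists>\<phi>' \<phi>''. testfn (\<phi> n) \<phi>' \<phi>''" for n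
   using bump_test[OF True, of n] by (simp add: \<phi>_def[abs_def] m_def)
  have z: "cinner f (abs_l2 (\<phi> n)) = 0" for n using t[of n] assms by blast
  have m01: "0 <= m x" "m x <= 1" for x
  proof -
   have "4 * (x - p) * (q - x) <= (q - p)\<^sup>2"
    using zero_le_power2[of "2 * x - p - q"] by (simp add: power2_eq_square algebra_simps)
   then have "4 * (x - p) * (q - x) / (q - p)\<^sup>2 <= 1" using True by (simp add: divide_le_eq)
   then show "0 <= m x" "m x <= 1" unfolding m_def by (auto intro!: power_le_one)
  qed
  have out: "m x = 0" if "x < p \<or> q < x" for x
  proof -
   have "(x - p) * (q - x) <= 0" using that True by (auto simp: mult_le_0_iff)
   moreover have "4 * (x - p) * (q - x) = 4 * ((x - p) * (q - x))" by (simp only: mult.assoc)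
   ultimately have "4 * (x - p) * (q - x) <= 0" by linarith
   then have "4 * (x - p) * (q - x) / (q - p)\<^sup>2 <= 0"
    by (intro divide_nonpos_nonneg) auto
   then show ?thesis by (simp add: m_def)
  qed
  have bd: "norm (\<phi> n x) <= indicat_real {p..<q+1} x" for n x
  proof (cases "x < p \<or> q < x")
   case True
   then show ?thesis by (simp add: \<phi>_def out)
  next
   case False
   have "0 <= (1 - m x) ^ (n + 2)" "(1 - m x) ^ (n + 2) <= 1"
    using m01[of x] by (rule_tac zero_le_power, simp) (rule power_le_one, use m01[of x] in auto)
   then have "norm (\<phi> n x) <= 1" unfolding \<phi>_def norm_of_real by linarith
   then show ?thesis using False by (auto simp: indicator_def)
  qed
  have "(\<lambda>n. abs_l2 (\<phi> n)) \<longlonglongrightarrow> abs_l2 (\<lambda>x. of_real (indicat_real {p..<q} x))"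
  proof (rule l2_dominated(2))
   show "sqint (\<phi> n)" for n using t[of n] testfn_sqint(1) by blast
   show "AE x in lborel. norm (\<phi> n x) <= indicat_real {p..<q+1} x" for n using bd by simp
   show "integrable lborel (\<lambda>x. (indicat_real {p..<q+1} x)\<^sup>2)" using integrable_ind_interval[of 1] by simp
   have "AE x in lborel. x \<noteq> p" "AE x in lborel. x \<noteq> q" by (rule AE_lborel_singleton)+
   then show "AE x in lborel. (\<lambda>n. \<phi> n x) \<longlonglongrightarrow> of_real (indicat_real {p..<q} x)"
   proof eventually_elim
    case (elim x)
    show ?case
    proof (cases "x < p \<or> q < x")
     case True
     then show ?thesis by (auto simp: \<phi>_def out indicator_def)
    next
     case False
     then have x: "p < x" "x < q" using elim by auto
     then have "0 < 4 * (x - p) * (q - x) / (q - p)\<^sup>2" by (intro divide_pos_pos mult_pos_pos) auto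
     then have "m x > 0" by (simp add: m_def)
     then have "\<bar>1 - m x\<bar> < 1" using m01[of x] by simp
     then have "(\<lambda>n. (1 - m x) ^ (n + 2)) \<longlonglongrightarrow> 0"
      by (intro LIMSEQ_ignore_initial_segment LIMSEQ_power_zero) simp
     then have "(\<lambda>n. complex_of_real (1 - (1 - m x) ^ (n + 2))) \<longlonglongrightarrow> of_real (1 - 0)"
      by (intro tendsto_of_real tendsto_diff tendsto_const)
     then show ?thesis using x by (simp add: \<phi>_def)
    qed
   qed
  qed measurable
  then have "(\<lambda>n. cinner f (abs_l2 (\<phi> n))) \<longlonglongrightarrow> cinner f (ind p q)"
   unfolding ind_def by (intro cinner.tendsto tendsto_const)
  then show ?thesis unfolding z by (simp add: LIMSEQ_const_iff)
 qed
 have rs: "cinner f g = 0" if "g \<in> rat_steps" for g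
 proof -
  have "cinner f (\<Sum>(a, b, p, q)\<leftarrow>xs. cscale (Complex (of_rat a) (of_rat b)) (ind (of_rat p) (of_rat q))) = 0"
   for xs :: "(rat \<times> rat \<times> rat \<times> rat) list"
   by (induction xs) (auto simp: cinner.zero_right cinner_add_right ind0)
  then show ?thesis using that unfolding rat_steps_def by blast
 qed
 have "f \<in> closure rat_steps" by (simp add: closure_steps_UNIV)
 then obtain s where s: "!!n. s n \<in> rat_steps" "s \<longlonglongrightarrow> f" unfolding closure_sequential by blast
 have "(\<lambda>n. cinner f (s n)) \<longlonglongrightarrow> cinner f f" by (intro cinner.tendsto tendsto_const s)
 then have "cinner f f = 0" by (simp add: rs s(1) LIMSEQ_const_iff)
 then show ?thesis by (simp add: cinner_self)
qed

lemma weak_sol_unique: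
 assumes w: "weak_sol w" shows "w r = sg r (w 0)"
proof -
 have "sg (- r) (w r) - w 0 = 0"
 proof (rule test_determines_zero)
  fix \<phi> \<phi>' \<phi>'' assume t: "testfn \<phi> \<phi>' \<phi>''"
  have "cinner (sg (- r) (w r)) (abs_l2 \<phi>) = cinner (w r) (sg r (abs_l2 \<phi>))" by (simp add: cinner_sg_adj)
  also have "... = cinner (w 0) (abs_l2 \<phi>)" by (rule weak_sol_conserved[OF w t])
  finally show "cinner (sg (- r) (w r) - w 0) (abs_l2 \<phi>) = 0" by (simp add: cinner.diff_left)
 qed
 then have "sg r (sg (- r) (w r)) = sg r (w 0)" by simp
 then show ?thesis by (simp add: sg_sg)
qed

text \<open>Moving the group to the other argument reverses time and conjugates, so the weak
  derivative known for evolved test functions transfers to the evolution of f.\<close>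

lemma weak_sol_sg: "weak_sol (\<lambda>t. sg t f)"
 unfolding weak_sol_def
proof (intro conjI allI impI sg_continuous)
 fix \<phi> \<phi>' \<phi>'' t assume t: "testfn \<phi> \<phi>' \<phi>''"
 have eq: "cinner (sg s f) u = cnj (cinner (sg (- s) u) f)" for s u
  by (metis cinner_commute cinner_sg_adj minus_minus)
 have "((\<lambda>s. cinner (sg s (abs_l2 \<phi>)) f) has_vector_derivative \<i> * cinner (sg (- t) (abs_l2 \<phi>'')) f) (at (- t))"
  by (rule sg_test_weak_deriv[OF t])
 moreover have "((\<lambda>s::real. - s) has_vector_derivative - 1) (at t)" by (auto intro!: derivative_eq_intros)
 ultimately have "((\<lambda>s. cinner (sg (- s) (abs_l2 \<phi>)) f) has_vector_derivative (- 1) *\<^sub>R (\<i> * cinner (sg (- t) (abs_l2 \<phi>'')) f)) (at t)"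
  using vector_diff_chain_at[of "\<lambda>s. - s" "- 1" t] by (auto simp: o_def)
 from bounded_linear.has_vector_derivative[OF bounded_linear_cnj this]
 show "((\<lambda>t. cinner (sg t f) (abs_l2 \<phi>)) has_vector_derivative \<i> * cinner (sg t f) (abs_l2 \<phi>'')) (at t)"
  by (simp add: eq)
qed

section \<open>Lebesgue measurable functions and their classes\<close>

definition of_fun :: "(real => complex) => l2" where
 "of_fun f = abs_l2 (SOME g. g \<in> bmeas \<and> (AE x in lborel. f x = g x))"

lemma lebesgue_borel_rep:
 assumes "f \<in> borel_measurable lebesgue"
 shows "\<exists>g::real => complex. g \<in> bmeas \<and> (AE x in lborel. f x = g x)"
proof -
 have "(\<lambda>x. Re (f x)) \<in> borel_measurable lebesgue" "(\<lambda>x. Im (f x)) \<in> borel_measurable lebesgue"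
  using assms by (auto intro: measurable_compose[OF _ borel_measurable_Re] measurable_compose[OF _ borel_measurable_Im])
 then obtain a b where a: "a \<in> borel_measurable lborel" "AE x in lborel. Re (f x) = a x"
  and b: "b \<in> borel_measurable lborel" "AE x in lborel. Im (f x) = b x"
  using completion_ex_borel_measurable_real by metis
 have "(\<lambda>x. Complex (a x) (b x)) \<in> bmeas"
  using a(1) b(1) by (simp add: Complex_eq)
 moreover have "AE x in lborel. f x = Complex (a x) (b x)"
  using a(2) b(2) by eventually_elim (simp add: complex_eq_iff)
 ultimately show ?thesis by blast
qed

lemma integrable_lebesgue_iff:
 fixes f g :: "real => 'b::{banach, second_countable_topology}"
 assumes f: "f \<in> borel_measurable lebesgue" and g: "g \<in> bmeas" and e: "AE x in lborel. f x = g x"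
 shows "integrable lebesgue f \<longleftrightarrow> integrable lborel g" "(LINT x|lebesgue. f x) = (LBINT x. g x)"
proof -
 have e': "AE x in lebesgue. f x = g x" using e by (simp add: AE_completion_iff)
 have g': "g \<in> borel_measurable lebesgue" using g by (intro measurable_completion) simp
 show "integrable lebesgue f \<longleftrightarrow> integrable lborel g"
  using integrable_cong_AE[OF f g' e'] integrable_completion[of g lborel] g by simp
 show "(LINT x|lebesgue. f x) = (LBINT x. g x)"
  using integral_cong_AE[OF f g' e'] integral_completion[of g lborel] g by simp
qed

lemma square_integrable_rep:
 assumes f: "square_integrable f"
 shows "AE x in lborel. rep_l2 (of_fun f) x = f x"
proof -
 have fm: "f \<in> borel_measurable lebesgue" using f by (simp add: square_integrable_def)
 define g where "g = (SOME g. g \<in> bmeas \<and> (AE x in lborel. f x = g x))"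
 have g: "g \<in> bmeas" "AE x in lborel. f x = g x"
  using someI_ex[OF lebesgue_borel_rep[OF fm]] unfolding g_def by auto
 have "integrable lebesgue (\<lambda>x. (norm (f x))\<^sup>2) \<longleftrightarrow> integrable lborel (\<lambda>x. (norm (g x))\<^sup>2)"
  using g fm by (intro integrable_lebesgue_iff) (auto elim: eventually_mono)
 then have "sqint g" using f g by (simp add: sqint_def square_integrable_def)
 from rep_abs[OF this] g(2) show ?thesis
  unfolding of_fun_def g_def[symmetric] by eventually_elim simp
qed

lemma of_fun_eqI:
 assumes f: "square_integrable f" and e: "AE x in lborel. f x = rep_l2 h x" shows "of_fun f = h"
proof (rule l2_eqI)
 show "AE x in lborel. rep_l2 (of_fun f) x = rep_l2 h x"
  using square_integrable_rep[OF f] e by eventually_elim simp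
qed

lemma square_integrable_AE:
 assumes e: "AE x in lborel. f x = rep_l2 h x" shows "square_integrable f" "of_fun f = h"
proof -
 have e': "AE x in lebesgue. rep_l2 h x = f x" using e by (simp add: AE_completion_iff eq_commute)
 have r: "rep_l2 h \<in> borel_measurable lebesgue" by (intro measurable_completion) simp
 have f: "f \<in> borel_measurable lebesgue" by (rule borel_measurable_AE[OF r e']) 
 have "integrable lebesgue (\<lambda>x. (norm (f x))\<^sup>2) \<longleftrightarrow> integrable lborel (\<lambda>x. (norm (rep_l2 h x))\<^sup>2)"
  using f e by (intro integrable_lebesgue_iff) (auto elim: eventually_mono)
 then show "square_integrable f" using f by (simp add: square_integrable_def sqint_integrable)
 then show "of_fun f = h" by (rule of_fun_eqI[OF _ e])
qed

lemma L2_norm_of_fun: assumes f: "square_integrable f" shows "L2_norm f = norm (of_fun f)"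
proof -
 have fm: "f \<in> borel_measurable lebesgue" using f by (simp add: square_integrable_def)
 have "(LINT x|lebesgue. (norm (f x))\<^sup>2) = (LBINT x. (norm (rep_l2 (of_fun f) x))\<^sup>2)"
  using square_integrable_rep[OF f] fm by (intro integrable_lebesgue_iff) (auto elim: eventually_mono)
 then show ?thesis by (simp add: L2_norm_def norm_sq[symmetric])
qed

lemma L2_inner_of_fun:
 assumes f: "square_integrable f" and g: "square_integrable g" shows "L2_inner f g = cinner (of_fun f) (of_fun g)"
proof -
 have fm: "f \<in> borel_measurable lebesgue" "g \<in> borel_measurable lebesgue" using f g by (auto simp: square_integrable_def)
 have "AE x in lborel. f x * cnj (g x) = rep_l2 (of_fun f) x * cnj (rep_l2 (of_fun g) x)"
  using square_integrable_rep[OF f] square_integrable_rep[OF g] by eventually_elim simp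
 then show ?thesis unfolding L2_inner_def cinner_rep
  using fm by (intro integrable_lebesgue_iff) (auto intro!: borel_measurable_times measurable_compose[OF _ cnj_measurable])
qed

lemma of_fun_AE_eq:
 assumes "square_integrable f" "square_integrable g"
 shows "of_fun f = of_fun g \<longleftrightarrow> (AE x in lebesgue. f x = g x)"
proof
 assume eq: "of_fun f = of_fun g"
 have "AE x in lborel. f x = g x"
  using square_integrable_rep[OF assms(1)] square_integrable_rep[OF assms(2)] by eventually_elim (simp add: eq)
 then show "AE x in lebesgue. f x = g x" by (simp add: AE_completion_iff)
next
 assume "AE x in lebesgue. f x = g x"
 then have "AE x in lborel. f x = g x" by (simp add: AE_completion_iff)
 then have "AE x in lborel. f x = rep_l2 (of_fun g) x"
  using square_integrable_rep[OF assms(2)] by eventually_elim simp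
 then show "of_fun f = of_fun g" by (rule of_fun_eqI[OF assms(1)])
qed

lemma square_integrable_diff:
 assumes "square_integrable f" "square_integrable g"
 shows "square_integrable (\<lambda>x. f x - g x)" "of_fun (\<lambda>x. f x - g x) = of_fun f - of_fun g"
proof -
 have "AE x in lborel. f x - g x = rep_l2 (of_fun f - of_fun g) x"
  using square_integrable_rep[OF assms(1)] square_integrable_rep[OF assms(2)] rep_diff[of "of_fun f" "of_fun g"]
  by eventually_elim simp
 from square_integrable_AE[OF this] show "square_integrable (\<lambda>x. f x - g x)" "of_fun (\<lambda>x. f x - g x) = of_fun f - of_fun g" .
qed

lemma L2_continuous_on_iff:
 assumes "!!t. t \<in> I ==> square_integrable (w t)"
 shows "L2_continuous_on I w \<longleftrightarrow> continuous_on I (\<lambda>t. of_fun (w t))"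
proof -
 have "((\<lambda>s. L2_norm (\<lambda>x. w s x - w t x)) \<longlongrightarrow> 0) (at t within I) \<longleftrightarrow> ((\<lambda>s. of_fun (w s)) \<longlongrightarrow> of_fun (w t)) (at t within I)"
  if t: "t \<in> I" for t
 proof -
  have "\<forall>\<^sub>F s in at t within I. L2_norm (\<lambda>x. w s x - w t x) = dist (of_fun (w s)) (of_fun (w t))"
   unfolding eventually_at_filter
   by (intro always_eventually) (auto simp: L2_norm_of_fun square_integrable_diff assms t dist_norm)
  then have "((\<lambda>s. L2_norm (\<lambda>x. w s x - w t x)) \<longlongrightarrow> 0) (at t within I) \<longleftrightarrow>
   ((\<lambda>s. dist (of_fun (w s)) (of_fun (w t))) \<longlongrightarrow> 0) (at t within I)" by (rule tendsto_cong)
  then show ?thesis unfolding tendsto_dist_iff[of "\<lambda>s. of_fun (w s)"] .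
 qed
 then show ?thesis using assms by (auto simp: L2_continuous_on_def continuous_on_def)
qed

lemma testfn_square_integrable:
 assumes t: "testfn \<phi> \<phi>' \<phi>''" shows "square_integrable \<phi>" "of_fun \<phi> = abs_l2 \<phi>" "square_integrable \<phi>''" "of_fun \<phi>'' = abs_l2 \<phi>''"
proof -
 have e: "AE x in lborel. \<phi> x = rep_l2 (abs_l2 \<phi>) x" "AE x in lborel. \<phi>'' x = rep_l2 (abs_l2 \<phi>'') x"
  using rep_abs[OF testfn_sqint(1)[OF t]] rep_abs[OF testfn_sqint(3)[OF t]] by (auto elim: eventually_mono)
 show "square_integrable \<phi>" "of_fun \<phi> = abs_l2 \<phi>" "square_integrable \<phi>''" "of_fun \<phi>'' = abs_l2 \<phi>''"
  using square_integrable_AE[OF e(1)] square_integrable_AE[OF e(2)] by auto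
qed

lemma testfn_cnj:
 assumes t: "testfn \<phi> \<phi>' \<phi>''" shows "testfn (\<lambda>x. cnj (\<phi> x)) (\<lambda>x. cnj (\<phi>' x)) (\<lambda>x. cnj (\<phi>'' x))"
proof -
 have "((\<lambda>x. cnj (f x)) has_vector_derivative cnj D) (at x)" if "(f has_vector_derivative D) (at x)" for f D x
  by (rule bounded_linear.has_vector_derivative[OF bounded_linear_cnj that])
 then show ?thesis using t by (auto simp: testfn_def intro: continuous_on_cnj)
qed

lemma pairing_cinner:
 assumes f: "square_integrable f" and t: "square_integrable g"
 shows "(LINT x|lebesgue. f x * cnj (g x)) = cinner (of_fun f) (of_fun g)"
 using L2_inner_of_fun[OF f t] by (simp add: L2_inner_def)

text \<open>The definition in the statement pairs without conjugation while \<open>cinner\<close>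
  conjugates its second argument; test functions are closed under conjugation, which reconciles the
  two.\<close>

lemma free_schroedinger_weak_sol:
 assumes f: "free_schroedinger_solution u w"
 shows "weak_sol (\<lambda>t. of_fun (w t))" "!!t. square_integrable (w t)"
proof -
 have sq: "square_integrable (w t)" for t
  using f by (auto simp: free_schroedinger_solution_def L2_continuous_on_def)
 show "weak_sol (\<lambda>t. of_fun (w t))"
  unfolding weak_sol_def
 proof (intro conjI allI impI)
  show "continuous_on UNIV (\<lambda>t. of_fun (w t))"
   using f L2_continuous_on_iff[of UNIV w] sq by (auto simp: free_schroedinger_solution_def)
  fix \<phi> \<phi>' \<phi>'' t assume t: "testfn \<phi> \<phi>' \<phi>''"
  have "((\<lambda>t. LINT x|lebesgue. w t x * cnj (\<phi> x)) has_vector_derivative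
         \<i> * (LINT x|lebesgue. w t x * cnj (\<phi>'' x))) (at t)"
  proof -
   have "\<forall>\<phi> \<phi>' \<phi>''. testfn \<phi> \<phi>' \<phi>'' \<longrightarrow> (\<forall>t. ((\<lambda>t. LINT x|lebesgue. w t x * \<phi> x) has_vector_derivative
         \<i> * (LINT x|lebesgue. w t x * \<phi>'' x)) (at t))"
    using f unfolding free_schroedinger_solution_def testfn_def by (elim conjE)
   from this[rule_format, OF testfn_cnj[OF t]] show ?thesis .
  qed
  then show "((\<lambda>t. cinner (of_fun (w t)) (abs_l2 \<phi>)) has_vector_derivative \<i> * cinner (of_fun (w t)) (abs_l2 \<phi>'')) (at t)"
   by (simp add: pairing_cinner sq testfn_square_integrable[OF t])
 qed
 show "!!t. square_integrable (w t)" by (rule sq)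
qed

lemma free_schroedinger_exists:
 assumes u: "square_integrable u"
 shows "free_schroedinger_solution u (\<lambda>t. rep_l2 (sg t (of_fun u)))"
proof -
 have sq: "square_integrable (rep_l2 h)" "of_fun (rep_l2 h) = h" for h
  using square_integrable_AE[of "rep_l2 h" h] by auto
 have ws: "weak_sol (\<lambda>t. sg t (of_fun u))" by (rule weak_sol_sg)
 show ?thesis unfolding free_schroedinger_solution_def
 proof (intro conjI allI impI)
  show "L2_continuous_on UNIV (\<lambda>t. rep_l2 (sg t (of_fun u)))"
   by (subst L2_continuous_on_iff) (auto simp: sq sg_continuous)
  show "AE x in lebesgue. rep_l2 (sg 0 (of_fun u)) x = u x"
   using square_integrable_rep[OF u] by (simp add: AE_completion_iff)
  fix \<phi> \<phi>' \<phi>'' :: "real => complex" and t :: real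
  assume "(\<forall>x. (\<phi> has_vector_derivative \<phi>' x) (at x)) \<and> (\<forall>x. (\<phi>' has_vector_derivative \<phi>'' x) (at x)) \<and>
   continuous_on UNIV \<phi>'' \<and> compact (closure {x. \<phi> x \<noteq> 0})"
  then have t: "testfn (\<lambda>x. cnj (\<phi> x)) (\<lambda>x. cnj (\<phi>' x)) (\<lambda>x. cnj (\<phi>'' x))"
   by (intro testfn_cnj) (simp add: testfn_def)
  have "((\<lambda>t. cinner (sg t (of_fun u)) (abs_l2 (\<lambda>x. cnj (\<phi> x)))) has_vector_derivative
    \<i> * cinner (sg t (of_fun u)) (abs_l2 (\<lambda>x. cnj (\<phi>'' x)))) (at t)"
   using ws t unfolding weak_sol_def by blast
  moreover have "(LINT x|lebesgue. rep_l2 h x * \<phi> x) = cinner h (abs_l2 (\<lambda>x. cnj (\<phi> x)))" for h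
   using pairing_cinner[OF sq(1) testfn_square_integrable(1)[OF t], of h] by (simp add: sq testfn_square_integrable[OF t])
  moreover have "(LINT x|lebesgue. rep_l2 h x * \<phi>'' x) = cinner h (abs_l2 (\<lambda>x. cnj (\<phi>'' x)))" for h
   using pairing_cinner[OF sq(1) testfn_square_integrable(3)[OF t], of h] by (simp add: sq testfn_square_integrable[OF t])
  ultimately show "((\<lambda>t. LINT x|lebesgue. rep_l2 (sg t (of_fun u)) x * \<phi> x) has_vector_derivative
         \<i> * (LINT x|lebesgue. rep_l2 (sg t (of_fun u)) x * \<phi>'' x)) (at t)"
   by simp
 qed
qed

text \<open>Existence makes the choice in \<open>schroedinger_group\<close> a genuine solution, and
  uniqueness identifies the class of whatever is chosen with \<open>sg\<close>.\<close>

lemma schroedinger_group_sg: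
 assumes u: "square_integrable u"
 shows "square_integrable (schroedinger_group t u)" "of_fun (schroedinger_group t u) = sg t (of_fun u)"
proof -
 define w where "w = (SOME w. free_schroedinger_solution u w)"
 have "\<exists>w. free_schroedinger_solution u w" by (rule exI, rule free_schroedinger_exists[OF u])
 then have w: "free_schroedinger_solution u w" unfolding w_def by (rule someI_ex)
 note ws = free_schroedinger_weak_sol[OF w]
 have "of_fun (w 0) = of_fun u"
  using w u ws(2) by (subst of_fun_AE_eq) (auto simp: free_schroedinger_solution_def)
 then have "of_fun (w t) = sg t (of_fun u)" using weak_sol_unique[OF ws(1), of t] by simp
 then show "square_integrable (schroedinger_group t u)" "of_fun (schroedinger_group t u) = sg t (of_fun u)"
  using ws(2) by (auto simp: schroedinger_group_def w_def)
qed

section \<open>Essential suprema and Strichartz estimates\<close>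

text \<open>Integrability is listed separately because the integral \<open>n1\<close> of a function
  that is not integrable has the value 0.\<close>

definition B1 :: "l2 set" where "B1 = {g. integrable lborel (rep_l2 g) \<and> n1 g <= 1}"

text \<open>As a supremum of continuous functionals, this norm is lower semicontinuous on \<open>L\<^sup>2\<close> and
 independent of representatives.\<close>

definition linf :: "l2 => ennreal" where "linf f = (SUP g\<in>B1. ennreal (norm (cinner f g)))"

lemma integrable_rep_zero: "integrable lborel (rep_l2 0)" "n1 0 = 0"
proof -
 have "integrable lborel (rep_l2 0) \<longleftrightarrow> integrable lborel (\<lambda>x::real. 0::complex)"
  by (rule integrable_cong_AE) (use rep_zero in auto)
 then show "integrable lborel (rep_l2 0)" by simp
 have "n1 0 = (LINT x::real|lborel. norm (0::complex))"
  unfolding n1_def by (rule integral_cong_AE) (use rep_zero in \<open>auto elim: eventually_mono\<close>)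
 then show "n1 0 = 0" by simp
qed

lemma zero_B1: "0 \<in> B1" by (simp add: B1_def integrable_rep_zero)

lemma cinner_le_linf: "g \<in> B1 ==> ennreal (norm (cinner f g)) <= linf f"
 unfolding linf_def by (rule SUP_upper)

lemma linf_leI: "(!!g. g \<in> B1 ==> ennreal (norm (cinner f g)) <= C) ==> linf f <= C"
 unfolding linf_def by (rule SUP_least)

lemma linf_zero[simp]: "linf 0 = 0"
proof -
 have "linf 0 <= 0" by (rule linf_leI) (simp add: cinner.zero_left)
 then show ?thesis by simp
qed

lemma linf_add: "linf (f + g) <= linf f + linf g"
proof (rule linf_leI)
 fix h assume h: "h \<in> B1"
 have "ennreal (norm (cinner (f + g) h)) <= ennreal (norm (cinner f h) + norm (cinner g h))"
  by (intro ennreal_leI) (simp add: cinner_add_left norm_triangle_ineq)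
 also have "... = ennreal (norm (cinner f h)) + ennreal (norm (cinner g h))" by simp
 also have "... <= linf f + linf g" by (intro add_mono cinner_le_linf h)
 finally show "ennreal (norm (cinner (f + g) h)) <= linf f + linf g" .
qed

lemma linf_cscale: "linf (cscale c f) <= ennreal (norm c) * linf f"
proof (rule linf_leI)
 fix h assume h: "h \<in> B1"
 have "ennreal (norm (cinner (cscale c f) h)) = ennreal (norm c) * ennreal (norm (cinner f h))"
  by (simp add: norm_mult ennreal_mult)
 also have "... <= ennreal (norm c) * linf f" by (intro mult_left_mono cinner_le_linf h) auto
 finally show "ennreal (norm (cinner (cscale c f) h)) <= ennreal (norm c) * linf f" .
qed

text \<open>A supremum of continuous functions has open superlevel sets, even over an uncountable
  index set.\<close>

lemma linf_measurable[measurable]: "linf \<in> bmeas"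
proof (rule borel_measurableI_greater)
 fix y
 have "{x \<in> space borel. y < linf x} = (\<Union>g\<in>B1. {f. y < ennreal (norm (cinner f g))})"
  by (auto simp: linf_def less_SUP_iff)
 moreover have "open (\<Union>g\<in>B1. {f. y < ennreal (norm (cinner f g))})"
 proof (intro open_UN ballI open_Collect_less continuous_on_const)
  fix g
  show "continuous_on UNIV (\<lambda>f. ennreal (norm (cinner f g)))"
   by (intro continuous_on_ennreal continuous_on_norm cinner.continuous_on continuous_on_id continuous_on_const)
 qed
 ultimately show "{x \<in> space borel. y < linf x} \<in> sets borel" by simp
qed

lemma linf_lsc:
 assumes "(\<lambda>n. f n) \<longlonglongrightarrow> (g::l2)" shows "linf g <= liminf (\<lambda>n. linf (f n))"
proof (rule linf_leI)
 fix h assume h: "h \<in> B1"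
 have "(\<lambda>n. ennreal (norm (cinner (f n) h))) \<longlonglongrightarrow> ennreal (norm (cinner g h))"
  by (intro tendsto_ennrealI tendsto_norm cinner.tendsto tendsto_const assms)
 then have "ennreal (norm (cinner g h)) = liminf (\<lambda>n. ennreal (norm (cinner (f n) h)))"
  by (rule lim_imp_Liminf[OF trivial_limit_sequentially, symmetric])
 also have "... <= liminf (\<lambda>n. linf (f n))"
  by (intro Liminf_mono always_eventually allI cinner_le_linf h)
 finally show "ennreal (norm (cinner g h)) <= liminf (\<lambda>n. linf (f n))" .
qed

lemma linf_integral:
 assumes F: "integrable M F" shows "linf (LINT s|M. F s) <= (\<integral>\<^sup>+s. linf (F s) \<partial>M)"
proof (rule linf_leI)
 fix h assume h: "h \<in> B1"
 have i: "integrable M (\<lambda>s. cinner (F s) h)" by (rule integrable_bounded_linear[OF cinner.bounded_linear_left F])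
 have "ennreal (norm (cinner (LINT s|M. F s) h)) = ennreal (norm (LINT s|M. cinner (F s) h))"
  by (simp add: cinner_integral_left F)
 also have "... <= ennreal (LINT s|M. norm (cinner (F s) h))"
  by (intro ennreal_leI integral_norm_bound)
 also have "... = (\<integral>\<^sup>+s. ennreal (norm (cinner (F s) h)) \<partial>M)"
  using i by (subst nn_integral_eq_integral) auto
 also have "... <= (\<integral>\<^sup>+s. linf (F s) \<partial>M)" by (intro nn_integral_mono cinner_le_linf h)
 finally show "ennreal (norm (cinner (LINT s|M. F s) h)) <= (\<integral>\<^sup>+s. linf (F s) \<partial>M)" .
qed

lemma n1_cscale:
 assumes "integrable lborel (rep_l2 g)"
 shows "integrable lborel (rep_l2 (cscale c g))" "n1 (cscale c g) = norm c * n1 g"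
proof -
 have "integrable lborel (rep_l2 (cscale c g)) \<longleftrightarrow> integrable lborel (\<lambda>x. c * rep_l2 g x)"
  by (rule integrable_cong_AE) (use rep_cscale in auto)
 then show "integrable lborel (rep_l2 (cscale c g))" using assms by simp
 have "n1 (cscale c g) = (LBINT x. norm (c * rep_l2 g x))"
  unfolding n1_def by (rule integral_cong_AE) (use rep_cscale[of c g] in \<open>auto elim: eventually_mono\<close>)
 then show "n1 (cscale c g) = norm c * n1 g" by (simp add: n1_def norm_mult)
qed

lemma cinner_le_linf_n1:
 assumes g: "integrable lborel (rep_l2 g)" and c: "linf f <= ennreal c" "0 <= c"
 shows "norm (cinner f g) <= c * n1 g"
proof (cases "n1 g = 0")
 case True
 then have "AE x in lborel. norm (rep_l2 g x) = 0"
  unfolding n1_def using g by (subst (asm) integral_nonneg_eq_0_iff_AE) auto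
 then have "g = 0" using rep_zero by (intro l2_eqI) (auto elim: eventually_elim2)
 then show ?thesis using True by (simp add: cinner.zero_right)
next
 case False
 then have p: "n1 g > 0" using n1_nonneg[of g] by linarith
 define h where "h = cscale (of_real (1 / n1 g)) g"
 have "h \<in> B1" using n1_cscale[OF g, of "of_real (1 / n1 g)"] p by (simp add: B1_def h_def norm_divide)
 then have "ennreal (norm (cinner f h)) <= ennreal c" using cinner_le_linf c(1) order_trans by blast
 then have "norm (cinner f h) <= c" using c(2) by simp
 moreover have "norm (cinner f h) = norm (cinner f g) / n1 g" using p by (simp add: h_def norm_divide)
 ultimately show ?thesis using p by (simp add: divide_le_eq)
qed

text \<open>Duality with L1: on the part of [-n, n] where f exceeds c, the phase of f is an
  admissible test function up to normalisation, and pairing with it forces that part to be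
  null.\<close>

lemma AE_le_linf: "AE x in lborel. ennreal (norm (rep_l2 f x)) <= linf f"
proof (cases "linf f = \<infinity>")
 case False
 define c where "c = enn2real (linf f)"
 have c: "linf f = ennreal c" "0 <= c" using False by (auto simp: c_def top.not_eq_extremum)
 have "AE x in lborel. x \<in> {-real n..real n} \<longrightarrow> norm (rep_l2 f x) <= c" for n :: nat
 proof -
  define A where "A = {x. x \<in> {-real n..real n} \<and> c < norm (rep_l2 f x)}"
  have A[measurable]: "A \<in> sets borel" unfolding A_def by measurable
  have Ab: "bounded A" by (rule bounded_subset[OF bounded_closed_interval[of "-real n" "real n"]]) (auto simp: A_def)
  have Af: "emeasure lborel A < \<infinity>" by (rule emeasure_bounded_finite[OF Ab])
  define g where "g x = (if x \<in> A then rep_l2 f x / of_real (norm (rep_l2 f x)) else 0)" for x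
  have gm[measurable]: "g \<in> bmeas" unfolding g_def by measurable
  have ng: "norm (g x) <= indicat_real A x" for x
   by (auto simp: g_def norm_divide indicator_def)
  have ng': "norm (g x) = indicat_real A x" for x
  proof (cases "x \<in> A")
   case True
   then have "norm (rep_l2 f x) > 0" using c(2) by (auto simp: A_def)
   then show ?thesis using True by (simp add: g_def norm_divide)
  qed (simp add: g_def)
  have sg: "sqint g"
  proof (rule sqint_bound[OF gm])
   show "integrable lborel (indicat_real A)" using Af by (intro integrable_real_indicator) auto
   show "AE x in lborel. (norm (g x))\<^sup>2 <= indicat_real A x" by (simp add: ng')
  qed
  define h where "h = abs_l2 g"
  have hr: "AE x in lborel. rep_l2 h x = g x" unfolding h_def by (rule rep_abs[OF sg])
  have gi: "integrable lborel g"
   by (rule Bochner_Integration.integrable_bound[OF integrable_real_indicator[of A lborel]]) (use Af ng in auto)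
  have hi: "integrable lborel (rep_l2 h)"
   using gi integrable_cong_AE[of "rep_l2 h" lborel g] hr by simp
  have nh: "n1 h = measure lborel A"
  proof -
   have "n1 h = (LBINT x. norm (g x))"
    unfolding n1_def by (rule integral_cong_AE) (use hr in \<open>auto elim: eventually_mono\<close>)
   then show ?thesis by (simp add: ng')
  qed
  have fi: "integrable lborel (\<lambda>x. norm (rep_l2 f x) * indicat_real A x)"
  proof -
   have "integrable lborel (\<lambda>x. norm (rep_l2 f x * g x))"
    by (intro integrable_norm sqint_mult_integrable sg) simp
   then show ?thesis by (simp add: norm_mult ng')
  qed
  have eq: "cinner f h = of_real (LBINT x. norm (rep_l2 f x) * indicat_real A x)"
  proof -
   have "cinner f h = (LBINT x. of_real (norm (rep_l2 f x) * indicat_real A x))"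
    unfolding cinner_rep
   proof (rule integral_cong_AE)
    show "AE x in lborel. rep_l2 f x * cnj (rep_l2 h x) = of_real (norm (rep_l2 f x) * indicat_real A x)"
     using hr
    proof eventually_elim
     case (elim x)
     have "z * (cnj z / of_real (norm z)) = of_real (norm z)" for z :: complex
      using complex_norm_square[of z] by (cases "z = 0") (simp_all add: power2_eq_square field_simps)
     then show ?case using elim by (auto simp: g_def indicator_def)
    qed
   qed measurable
   then show ?thesis by (simp only: integral_complex_of_real)
  qed
  have "norm (cinner f h) <= c * n1 h" by (rule cinner_le_linf_n1[OF hi]) (use c in auto)
  then have "(LBINT x. norm (rep_l2 f x) * indicat_real A x) <= c * measure lborel A"
   unfolding eq nh by simp
  moreover have i2: "integrable lborel (\<lambda>x. (norm (rep_l2 f x) - c) * indicat_real A x)"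
  proof -
   have "integrable lborel (\<lambda>x. norm (rep_l2 f x) * indicat_real A x - c * indicat_real A x)"
    using fi Af by (intro Bochner_Integration.integrable_diff integrable_mult_right integrable_real_indicator) auto
   then show ?thesis by (simp add: left_diff_distrib)
  qed
  moreover have "(LBINT x. (norm (rep_l2 f x) - c) * indicat_real A x) =
    (LBINT x. norm (rep_l2 f x) * indicat_real A x) - c * measure lborel A"
  proof -
   have "integrable lborel (\<lambda>x. c * indicat_real A x)" using Af by (intro integrable_mult_right integrable_real_indicator) auto
   from Bochner_Integration.integral_diff[OF fi this] show ?thesis by (simp add: left_diff_distrib)
  qed
  moreover have nn: "0 <= (norm (rep_l2 f x) - c) * indicat_real A x" for x by (auto simp: A_def indicator_def)
  moreover have "0 <= (LBINT x. (norm (rep_l2 f x) - c) * indicat_real A x)"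
   by (intro Bochner_Integration.integral_nonneg nn)
  ultimately have "(LBINT x. (norm (rep_l2 f x) - c) * indicat_real A x) = 0" by simp
  then have "AE x in lborel. (norm (rep_l2 f x) - c) * indicat_real A x = 0"
   using i2 nn by (subst (asm) integral_nonneg_eq_0_iff_AE) auto
  then show ?thesis by eventually_elim (auto simp: A_def indicator_def not_le[symmetric])
 qed
 then have "AE x in lborel. \<forall>n::nat. x \<in> {-real n..real n} \<longrightarrow> norm (rep_l2 f x) <= c"
  by (simp only: AE_all_countable) blast
 then show ?thesis
 proof eventually_elim
  case (elim x)
  obtain n :: nat where "\<bar>x\<bar> <= real n" using real_arch_simple by blast
  then have "norm (rep_l2 f x) <= c" using elim by (auto simp: abs_le_iff)
  then show ?case by (simp add: c ennreal_leI)
 qed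
qed auto

lemma linf_le_AE:
 assumes "AE x in lborel. norm (rep_l2 f x) <= c" "0 <= c" shows "linf f <= ennreal c"
proof (rule linf_leI)
 fix g assume g: "g \<in> B1"
 then have gi: "integrable lborel (\<lambda>x. norm (rep_l2 g x))" by (auto simp: B1_def)
 have "norm (cinner f g) <= (LBINT x. norm (rep_l2 f x * cnj (rep_l2 g x)))"
  unfolding cinner_rep by (rule integral_norm_bound)
 also have "... <= (LBINT x. c * norm (rep_l2 g x))"
 proof (rule integral_mono_AE)
  show "integrable lborel (\<lambda>x. norm (rep_l2 f x * cnj (rep_l2 g x)))" by (intro integrable_norm cinner_integrable)
  show "AE x in lborel. norm (rep_l2 f x * cnj (rep_l2 g x)) <= c * norm (rep_l2 g x)"
   using assms(1) by eventually_elim (auto simp: norm_mult intro: mult_right_mono)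
 qed (use gi in simp)
 also have "... = c * n1 g" by (simp add: n1_def)
 also have "... <= c * 1" using g assms(2) by (intro mult_left_mono) (auto simp: B1_def)
 finally show "ennreal (norm (cinner f g)) <= ennreal c" by (simp add: ennreal_leI)
qed

lemma Linf_norm_of_fun:
 assumes f: "square_integrable f" shows "Linf_norm f = linf (of_fun f)"
proof -
 have fm: "f \<in> borel_measurable lebesgue" using f by (simp add: square_integrable_def)
 have nm: "(\<lambda>x. ennreal (norm (f x))) \<in> borel_measurable lebesgue" using fm by measurable
 show ?thesis
 proof (rule antisym)
  have "AE x in lborel. ennreal (norm (f x)) <= linf (of_fun f)"
   using AE_le_linf[of "of_fun f"] square_integrable_rep[OF f] by eventually_elim simp
  then show "Linf_norm f <= linf (of_fun f)"
   unfolding Linf_norm_def by (intro esssup_I nm) (simp add: AE_completion_iff)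
  show "linf (of_fun f) <= Linf_norm f"
  proof (cases "Linf_norm f = \<infinity>")
   case False
   define c where "c = enn2real (Linf_norm f)"
   have c: "Linf_norm f = ennreal c" "0 <= c" using False by (auto simp: c_def top.not_eq_extremum)
   have "AE x in lebesgue. ennreal (norm (f x)) <= Linf_norm f"
    unfolding Linf_norm_def by (rule esssup_AE)
   then have "AE x in lborel. ennreal (norm (f x)) <= ennreal c" by (simp add: AE_completion_iff c)
   then have "AE x in lborel. norm (rep_l2 (of_fun f) x) <= c"
    using square_integrable_rep[OF f] by eventually_elim (simp add: c(2))
   then show ?thesis unfolding c(1) using c(2) by (rule linf_le_AE)
  qed simp
 qed
qed

lemma linf_sg_dispersive:
 assumes f: "integrable lborel (rep_l2 f)" and t: "t \<noteq> 0"
 shows "linf (sg t f) <= ennreal (1 / sqrt \<bar>t\<bar> * n1 f)"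
proof (rule linf_leI)
 fix g assume g: "g \<in> B1"
 have "norm (cinner (sg t f) g) <= 1 / sqrt \<bar>t\<bar> * (n1 f * n1 g)"
  using g by (intro cinner_sg_dispersive f t) (auto simp: B1_def)
 also have "... <= 1 / sqrt \<bar>t\<bar> * (n1 f * 1)"
  using g n1_nonneg[of f] by (intro mult_left_mono) (auto simp: B1_def)
 finally show "ennreal (norm (cinner (sg t f) g)) <= ennreal (1 / sqrt \<bar>t\<bar> * n1 f)" by (simp add: ennreal_leI)
qed

section \<open>Hardy--Littlewood--Sobolev and Strichartz inequalities\<close>

lemma nn_integral_inv_sqrt:
 assumes R: "R > 0" shows "(NN s. ennreal (1 / sqrt \<bar>t - s\<bar>) * indicator {s. \<bar>t - s\<bar> < R} s) = ennreal (4 * sqrt R)"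
proof -
 have half: "(NN s. ennreal (1 / sqrt s) * indicator {0<..<R} s) = ennreal (2 * sqrt R)"
 proof -
  have d: "((\<lambda>x. 2 * sqrt x) has_real_derivative 1 / sqrt x) (at x)" if "x > 0" for x
   using that by (auto intro!: derivative_eq_intros simp: divide_simps)
  have lim: "((\<lambda>x. 2 * sqrt x) \<longlongrightarrow> 2 * sqrt y) (at y within S)" for y S by (intro tendsto_intros)
  have l0: "((\<lambda>x. 2 * sqrt x) \<longlongrightarrow> 0) (at_right 0)" using lim[of 0 "{0<..}"] by simp
  have lR: "(sqrt \<longlongrightarrow> sqrt R) (at_left R)" by (intro tendsto_real_sqrt tendsto_ident_at)
  have 1: "set_integrable lborel (einterval (ereal 0) (ereal R)) (\<lambda>x. 1 / sqrt x)"
   and 2: "(LBINT x=ereal 0..ereal R. 1 / sqrt x) = 2 * sqrt R - 0"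
   by (rule interval_integral_FTC_nonneg[where F="\<lambda>x. 2 * sqrt x" and A=0 and B="2 * sqrt R"];
     use R d in \<open>auto simp: ereal_tendsto_simps1 intro!: l0 lR isCont_divide continuous_intros AE_I2\<close>)+
  have "(LBINT x. 1 / sqrt x * indicat_real {0<..<R} x) = 2 * sqrt R"
   using 2 R by (simp add: interval_lebesgue_integral_def set_lebesgue_integral_def einterval_eq mult.commute)
  moreover have "integrable lborel (\<lambda>x. 1 / sqrt x * indicat_real {0<..<R} x)"
   using 1 R by (simp add: set_integrable_def einterval_eq mult.commute)
  moreover have "AE x in lborel. 0 <= 1 / sqrt x * indicat_real {0<..<R} x" by (auto simp: indicator_def)
  ultimately have "(NN x. ennreal (1 / sqrt x * indicat_real {0<..<R} x)) = ennreal (2 * sqrt R)"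
   by (subst nn_integral_eq_integral) auto
  also have "(NN x. ennreal (1 / sqrt x * indicat_real {0<..<R} x)) = (NN x. ennreal (1 / sqrt x) * indicator {0<..<R} x)"
   by (intro nn_integral_cong) (auto simp: indicator_def)
  finally show ?thesis .
 qed
 have "(NN s. ennreal (1 / sqrt \<bar>t - s\<bar>) * indicator {s. \<bar>t - s\<bar> < R} s) =
  (NN s. ennreal (1 / sqrt \<bar>s\<bar>) * indicator {s. \<bar>s\<bar> < R} s)"
  using nn_integral_real_affine[of "\<lambda>s. ennreal (1 / sqrt \<bar>t - s\<bar>) * indicator {s. \<bar>t - s\<bar> < R} s" "1" t]
  by (simp add: indicator_def)
 also have "... = (NN s. ennreal (1 / sqrt s) * indicator {0<..<R} s + ennreal (1 / sqrt (- s)) * indicator {0<..<R} (- s))"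
 proof (rule nn_integral_cong_AE)
  have "AE s in lborel. s \<noteq> (0::real)" by (rule AE_lborel_singleton)
  then show "AE s in lborel. ennreal (1 / sqrt \<bar>s\<bar>) * indicator {s. \<bar>s\<bar> < R} s =
   ennreal (1 / sqrt s) * indicator {0<..<R} s + ennreal (1 / sqrt (- s)) * indicator {0<..<R} (- s)"
   by eventually_elim (auto simp: indicator_def)
 qed
 also have "... = (NN s. ennreal (1 / sqrt s) * indicator {0<..<R} s) + (NN s. ennreal (1 / sqrt (- s)) * indicator {0<..<R} (- s))"
  by (rule nn_integral_add) measurable
 also have "(NN s. ennreal (1 / sqrt (- s)) * indicator {0<..<R} (- s)) = (NN s. ennreal (1 / sqrt s) * indicator {0<..<R} s)"
  using nn_integral_real_affine[of "\<lambda>s. ennreal (1 / sqrt s) * indicator {0<..<R} s" "-1" 0] by simp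
 finally show ?thesis using R by (simp add: half flip: ennreal_plus)
qed

lemma nn_integral_inv_sq:
 assumes R: "R > 0" shows "(NN s. ennreal (1 / (t - s)\<^sup>2) * indicator {s. R <= \<bar>t - s\<bar>} s) = ennreal (2 / R)"
proof -
 have half: "(NN s. ennreal (1 / s\<^sup>2) * indicator {R..} s) = ennreal (1 / R)"
 proof -
  have l: "((\<lambda>x::real. - (1 / x)) \<longlongrightarrow> - 0) at_top"
   by (intro tendsto_minus tendsto_divide_0[OF tendsto_const] filterlim_at_top_imp_at_infinity filterlim_ident)
  have "(NN s. ennreal (1 / s\<^sup>2) * indicator {R..} s) = ennreal (- 0 - - (1 / R))"
   by (rule nn_integral_FTC_atLeast[where F="\<lambda>x. - (1 / x)", OF _ _ _ l])
    (use R in \<open>auto intro!: derivative_eq_intros simp: power2_eq_square\<close>)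
  then show ?thesis by simp
 qed
 have "(NN s. ennreal (1 / (t - s)\<^sup>2) * indicator {s. R <= \<bar>t - s\<bar>} s) =
  (NN s. ennreal (1 / s\<^sup>2) * indicator {s. R <= \<bar>s\<bar>} s)"
  using nn_integral_real_affine[of "\<lambda>s. ennreal (1 / (t - s)\<^sup>2) * indicator {s. R <= \<bar>t - s\<bar>} s" "1" t]
  by (simp add: indicator_def)
 also have "... = (NN s. ennreal (1 / s\<^sup>2) * indicator {R..} s + ennreal (1 / (- s)\<^sup>2) * indicator {R..} (- s))"
  by (rule nn_integral_cong) (use R in \<open>auto simp: indicator_def\<close>)
 also have "... = (NN s. ennreal (1 / s\<^sup>2) * indicator {R..} s) + (NN s. ennreal (1 / (- s)\<^sup>2) * indicator {R..} (- s))"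
  by (rule nn_integral_add) measurable
 also have "(NN s. ennreal (1 / (- s)\<^sup>2) * indicator {R..} (- s)) = (NN s. ennreal (1 / s\<^sup>2) * indicator {R..} s)"
  using nn_integral_real_affine[of "\<lambda>s. ennreal (1 / s\<^sup>2) * indicator {R..} s" "-1" 0] by simp
 finally show ?thesis using R by (simp add: half flip: ennreal_plus)
qed

text \<open>The Hardy--Littlewood--Sobolev inequality is symmetric in \<open>s\<close> and \<open>t\<close>, so it suffices to integrate
 over \<open>g s <= g t\<close>.  There \<open>g s\<close> is replaced by \<open>g t\<close> for \<open>\<bar>t - s\<bar> < a / g(t)^4\<close>, and Young's inequality is
 used for the other \<open>s\<close>.\<close>

lemma hls_inner:
 fixes g :: "real => real"
 assumes g[measurable]: "g \<in> bmeas" and g0: "!!s. 0 <= g s"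
  and a: "(NN s. ennreal (g s ^ 4)) = ennreal a" "a > 0"
 shows "(NN s. ennreal (1 / sqrt \<bar>t - s\<bar> * g s ^ 3) * indicator {s. g s <= g t} s) <= ennreal (7 * sqrt a * g t)"
proof (cases "g t = 0")
 case True
 then have Z: "g s = 0" if "g s <= g t" for s using that g0[of s] by simp
 have "(NN s. ennreal (1 / sqrt \<bar>t - s\<bar> * g s ^ 3) * indicator {s. g s <= g t} s) = (NN (s::real). 0)"
 proof (rule nn_integral_cong)
  fix s
  show "ennreal (1 / sqrt \<bar>t - s\<bar> * g s ^ 3) * indicator {s. g s <= g t} s = 0"
  proof (cases "g s <= g t")
   case True
   from Z[OF True] show ?thesis by simp
  qed simp
 qed
 then show ?thesis by simp
next
 case False
 define G where "G = g t"
 have G: "G > 0" using False g0[of t] by (simp add: G_def)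
 \<comment> \<open>The radius and the Young parameter \<open>e\<close> are chosen so that the near
   part, the fourth power and the far part contribute 4, 1 and 2 times \<open>sqrt a * G\<close>,
   whence the constant 7.\<close>
 define R where "R = a / G ^ 4"
 define e where "e = G / sqrt a"
 have R: "R > 0" and e: "e > 0" using G a by (auto simp: R_def e_def)
 have sa: "sqrt a > 0" "sqrt a * sqrt a = a" using a(2) by auto
 have pt: "ennreal (1 / sqrt \<bar>t - s\<bar> * g s ^ 3) * indicator {s. g s <= g t} s <=
   ennreal (G ^ 3) * (ennreal (1 / sqrt \<bar>t - s\<bar>) * indicator {s. \<bar>t - s\<bar> < R} s) +
   (ennreal e * ennreal (g s ^ 4) + ennreal (1 / e ^ 3) * (ennreal (1 / (t - s)\<^sup>2) * indicator {s. R <= \<bar>t - s\<bar>} s))" for s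
 proof (cases "g s <= G")
  case gs: True
  show ?thesis
  proof (cases "\<bar>t - s\<bar> < R")
   case True
   have "1 / sqrt \<bar>t - s\<bar> * g s ^ 3 <= G ^ 3 * (1 / sqrt \<bar>t - s\<bar>)"
    using gs g0[of s] by (simp add: divide_right_mono power_mono)
   then have "ennreal (1 / sqrt \<bar>t - s\<bar> * g s ^ 3) <= ennreal (G ^ 3) * ennreal (1 / sqrt \<bar>t - s\<bar>)"
    using G by (subst ennreal_mult[symmetric]) (auto intro: ennreal_leI)
   then show ?thesis using True gs by (auto simp: G_def intro: order_trans[OF _ le_iff_add[THEN iffD2]] add_increasing2)
  next
   case False
   define Y where "Y = 1 / sqrt \<bar>t - s\<bar>"
   have Y: "Y \<ge> 0" by (simp add: Y_def)
   have Y4: "Y ^ 4 = 1 / (t - s)\<^sup>2"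
   proof -
    have "(sqrt \<bar>t - s\<bar>) ^ 4 = (sqrt \<bar>t - s\<bar>)\<^sup>2 * (sqrt \<bar>t - s\<bar>)\<^sup>2"
     by (simp only: power4_eq_xxxx power2_eq_square mult.assoc)
    also have "... = (t - s)\<^sup>2" by (simp add: power2_eq_square)
    finally show ?thesis by (simp add: Y_def power_divide)
   qed
   \<comment> \<open>Young's inequality with exponents 4 and 4/3, obtained by comparing Y with
     \<open>e * g s\<close>.\<close>
   have "Y * g s ^ 3 <= e * g s ^ 4 + 1 / e ^ 3 * Y ^ 4"
   proof (cases "Y <= e * g s")
    case True
    then have "Y * g s ^ 3 <= (e * g s) * g s ^ 3" using g0[of s] by (intro mult_right_mono) auto
    also have "... = e * g s ^ 4" by (simp add: power4_eq_xxxx power3_eq_cube mult.assoc)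
    also have "... <= e * g s ^ 4 + 1 / e ^ 3 * Y ^ 4" using e by simp
    finally show ?thesis .
   next
    case False
    then have "g s <= Y / e" using e by (simp add: field_simps)
    then have "Y * g s ^ 3 <= Y * (Y / e) ^ 3" using g0[of s] Y by (intro mult_left_mono power_mono) auto
    also have "... = 1 / e ^ 3 * Y ^ 4" by (simp add: power_divide power4_eq_xxxx power3_eq_cube)
    also have "... <= e * g s ^ 4 + 1 / e ^ 3 * Y ^ 4" using e g0[of s] by simp
    finally show ?thesis .
   qed
   then have "ennreal (Y * g s ^ 3) <= ennreal e * ennreal (g s ^ 4) + ennreal (1 / e ^ 3) * ennreal (1 / (t - s)\<^sup>2)"
    using e g0[of s] unfolding Y4 by (simp add: ennreal_mult[symmetric] ennreal_plus[symmetric] ennreal_leI del: ennreal_plus)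
   then show ?thesis using False gs by (simp add: Y_def G_def)
  qed
 qed (simp add: G_def)
 have "(NN s. ennreal (1 / sqrt \<bar>t - s\<bar> * g s ^ 3) * indicator {s. g s <= g t} s) <=
  (NN s. ennreal (G ^ 3) * (ennreal (1 / sqrt \<bar>t - s\<bar>) * indicator {s. \<bar>t - s\<bar> < R} s) +
   (ennreal e * ennreal (g s ^ 4) + ennreal (1 / e ^ 3) * (ennreal (1 / (t - s)\<^sup>2) * indicator {s. R <= \<bar>t - s\<bar>} s)))"
  by (intro nn_integral_mono pt)
 also have "... = ennreal (G ^ 3) * ennreal (4 * sqrt R) + (ennreal e * ennreal a + ennreal (1 / e ^ 3) * ennreal (2 / R))"
  by (simp add: nn_integral_add nn_integral_cmult nn_integral_inv_sqrt[OF R] nn_integral_inv_sq[OF R] a(1))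
 also have "... = ennreal (G ^ 3 * (4 * sqrt R) + (e * a + 1 / e ^ 3 * (2 / R)))"
  using G R e a by (simp add: ennreal_mult[symmetric] ennreal_plus[symmetric] del: ennreal_plus)
 also have "G ^ 3 * (4 * sqrt R) + (e * a + 1 / e ^ 3 * (2 / R)) = 7 * sqrt a * G"
 proof -
  define b where "b = sqrt a"
  have b: "b > 0" "a = b * b" using sa by (auto simp: b_def)
  have "G ^ 4 = (G\<^sup>2)\<^sup>2" by (simp only: power2_eq_square power4_eq_xxxx mult.assoc)
  then have "sqrt (G ^ 4) = G\<^sup>2" by (simp only: real_sqrt_abs) simp
  then have "sqrt R = b / G\<^sup>2" unfolding R_def by (simp add: real_sqrt_divide b_def)
  then have 1: "G ^ 3 * (4 * sqrt R) = 4 * (b * G)" using G by (simp add: power2_eq_square power3_eq_cube)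
  have 2: "e * a = b * G" using b by (simp add: e_def b_def[symmetric])
  have 3: "1 / e ^ 3 * (2 / R) = 2 * (b * G)"
   unfolding R_def e_def b_def[symmetric] using b(1) G
   by (simp add: b(2) power_divide power4_eq_xxxx power3_eq_cube)
  show ?thesis unfolding 1 2 3 by (simp add: b_def)
 qed
 finally show ?thesis by (simp add: G_def)
qed

lemma hls:
 fixes g :: "real => real"
 assumes g[measurable]: "g \<in> bmeas" and g0: "!!s. 0 <= g s"
  and a: "(NN s. ennreal (g s ^ 4)) = ennreal a" "a > 0"
 shows "(NN t. NN s. ennreal (1 / sqrt \<bar>t - s\<bar> * g t ^ 3 * g s ^ 3)) <= ennreal (14 * (a * sqrt a))"
proof -
 \<comment> \<open>K covers the half of the domain where \<open>g s <= g t\<close>; the other half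
   is K with its arguments exchanged, so the constant doubles to 14.\<close>
 define K where "K t s = ennreal (g t ^ 3) * (ennreal (1 / sqrt \<bar>t - s\<bar> * g s ^ 3) * indicator {s. g s <= g t} s)" for t s
 have Km: "(\<lambda>(t, s). K t s) \<in> borel_measurable (lborel \<Otimes>\<^sub>M lborel)" unfolding K_def by measurable
 have Km'[measurable]: "(\<lambda>s. K t s) \<in> bmeas" "(\<lambda>s. K s t) \<in> bmeas" for t
  unfolding K_def by measurable
 have pt: "ennreal (1 / sqrt \<bar>t - s\<bar> * g t ^ 3 * g s ^ 3) <= K t s + K s t" for t s
 proof -
  have e: "ennreal (1 / sqrt \<bar>t - s\<bar> * g t ^ 3 * g s ^ 3) = ennreal (g t ^ 3) * ennreal (1 / sqrt \<bar>t - s\<bar> * g s ^ 3)"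
   "ennreal (1 / sqrt \<bar>t - s\<bar> * g t ^ 3 * g s ^ 3) = ennreal (g s ^ 3) * ennreal (1 / sqrt \<bar>s - t\<bar> * g t ^ 3)"
   using g0 by (subst ennreal_mult[symmetric]; simp add: mult_ac abs_minus_commute)+
  show ?thesis
  proof (cases "g s <= g t")
   case True
   then have "ennreal (1 / sqrt \<bar>t - s\<bar> * g t ^ 3 * g s ^ 3) = K t s" unfolding e(1) K_def by simp
   then show ?thesis by simp
  next
   case False
   then have "ennreal (1 / sqrt \<bar>t - s\<bar> * g t ^ 3 * g s ^ 3) = K s t" unfolding e(2) K_def by simp
   then show ?thesis by simp
  qed
 qed
 have K1: "(NN t. NN s. K t s) <= ennreal (7 * (a * sqrt a))"
 proof -
  have "(NN t. NN s. K t s) =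
    (NN t. ennreal (g t ^ 3) * (NN s. ennreal (1 / sqrt \<bar>t - s\<bar> * g s ^ 3) * indicator {s. g s <= g t} s))"
   unfolding K_def by (intro nn_integral_cong nn_integral_cmult) measurable
  also have "... <= (NN t. ennreal (g t ^ 3) * ennreal (7 * sqrt a * g t))"
   by (intro nn_integral_mono mult_left_mono hls_inner[OF g g0 a]) auto
  also have "... = (NN t. ennreal (7 * sqrt a) * ennreal (g t ^ 4))"
   using g0 a(2) by (intro nn_integral_cong) (simp add: ennreal_mult[symmetric] power4_eq_xxxx power3_eq_cube mult_ac)
  also have "... = ennreal (7 * sqrt a) * ennreal a" by (simp add: nn_integral_cmult a(1))
  also have "... = ennreal (7 * (a * sqrt a))" using a(2) by (simp add: ennreal_mult[symmetric] mult_ac)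
  finally show ?thesis .
 qed
 have "(NN t. NN s. ennreal (1 / sqrt \<bar>t - s\<bar> * g t ^ 3 * g s ^ 3)) <=
  (NN t. NN s. K t s + K s t)"
  by (intro nn_integral_mono pt)
 also have "... = (NN t. (NN s. K t s) + (NN s. K s t))"
  by (intro nn_integral_cong nn_integral_add) measurable
 also have "... = (NN t. NN s. K t s) + (NN t. NN s. K s t)"
 proof (rule nn_integral_add)
  show "(\<lambda>t. NN s. K t s) \<in> borel_measurable lborel" unfolding K_def by measurable
  show "(\<lambda>t. NN s. K s t) \<in> borel_measurable lborel" unfolding K_def by measurable
 qed
 also have "(NN t. NN s. K s t) = (NN t. NN s. K t s)"
  using lborel_pair.Fubini'[of "\<lambda>s t. K s t"] Km by simp
 also have "(NN t. NN s. K t s) + (NN t. NN s. K t s) <= ennreal (7 * (a * sqrt a)) + ennreal (7 * (a * sqrt a))"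
  by (intro add_mono K1)
 also have "... = ennreal (14 * (a * sqrt a))" using a(2) by (simp flip: ennreal_plus)
 finally show ?thesis .
qed

text \<open>A countable subset of \<open>B1\<close> that is dense for the L2 norm computes the same
  supremum, since each pairing is continuous. Countability is what permits a measurable choice of a
  maximiser.\<close>

lemma norming_sequence:
 obtains q :: "nat => l2" where "!!n. q n \<in> B1" "!!f C. (!!n. norm (cinner f (q n)) <= C) ==> linf f <= ennreal C"
proof -
 obtain T :: "l2 set" where T: "countable T" "T \<subseteq> B1" "B1 \<subseteq> closure T" by (rule separable[of B1])
 have "T \<noteq> {}" using T(3) zero_B1 by auto
 define q where "q = from_nat_into T"
 have qT: "q n \<in> T" for n unfolding q_def by (rule from_nat_into[OF \<open>T \<noteq> {}\<close>])
 have "linf f <= ennreal C" if C: "!!n. norm (cinner f (q n)) <= C" for f C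
 proof (rule linf_leI)
  fix g assume "g \<in> B1"
  then have "g \<in> closure T" using T(3) by blast
  then obtain s where s: "!!n. s n \<in> T" "s \<longlonglongrightarrow> g" unfolding closure_sequential by blast
  have "norm (cinner f (s n)) <= C" for n
  proof -
   obtain m where "s n = q m" unfolding q_def using from_nat_into_surj[OF T(1) s(1)] by metis
   then show ?thesis using C by simp
  qed
  moreover have "(\<lambda>n. norm (cinner f (s n))) \<longlonglongrightarrow> norm (cinner f g)"
   by (intro tendsto_norm cinner.tendsto tendsto_const s)
  ultimately have "norm (cinner f g) <= C" by (intro LIMSEQ_le_const2) auto
  then show "ennreal (norm (cinner f g)) <= ennreal C" by (rule ennreal_leI)
 qed
 moreover have "q n \<in> B1" for n using qT T(2) by blast
 ultimately show thesis using that[of q] by blast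
qed

lemma nn_integral_ge_norm_integral:
 fixes f :: "'b => 'a::{banach, second_countable_topology}"
 shows "ennreal (norm (LINT x|M. f x)) <= (\<integral>\<^sup>+x. ennreal (norm (f x)) \<partial>M)"
proof (cases "integrable M f")
 case True
 then show ?thesis by (rule integral_norm_bound_ennreal)
qed (simp add: not_integrable_integral_eq)

lemma dispersive_pair:
 assumes "\<phi> \<in> B1" "\<psi> \<in> B1" "t \<noteq> s"
 shows "norm (cinner (sg (- t) (cscale a \<phi>)) (sg (- s) (cscale b \<psi>))) <= 1 / sqrt \<bar>t - s\<bar> * norm a * norm b"
proof -
 have "cinner (sg (- t) (cscale a \<phi>)) (sg (- s) (cscale b \<psi>)) = a * cnj b * cinner (sg (s - t) \<phi>) \<psi>"
  by (simp add: cinner_sg_sg sg_cscale)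
 then have n: "norm (cinner (sg (- t) (cscale a \<phi>)) (sg (- s) (cscale b \<psi>))) = norm a * norm b * norm (cinner (sg (s - t) \<phi>) \<psi>)"
  by (simp only: norm_mult complex_mod_cnj)
 have "norm (cinner (sg (s - t) \<phi>) \<psi>) <= 1 / sqrt \<bar>s - t\<bar> * (n1 \<phi> * n1 \<psi>)"
  using assms by (intro cinner_sg_dispersive) (auto simp: B1_def)
 also have "... <= 1 / sqrt \<bar>s - t\<bar> * (1 * 1)"
  using assms n1_nonneg by (intro mult_left_mono mult_mono) (auto simp: B1_def)
 finally have "norm (cinner (sg (- t) (cscale a \<phi>)) (sg (- s) (cscale b \<psi>))) <= norm a * norm b * (1 / sqrt \<bar>s - t\<bar>)"
  unfolding n by (intro mult_left_mono) auto
 then show ?thesis by (simp add: abs_minus_commute mult_ac)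
qed

text \<open>The \<open>T T\<^sup>*\<close> argument: a measurable choice of an almost extremal test function
 linearises the supremum, and the Hardy--Littlewood--Sobolev inequality bounds the dual operator.\<close>

lemma strichartz_finite:
 fixes q :: "nat => l2" and N :: nat and f :: l2
 assumes q: "!!n. q n \<in> B1"
 defines "m \<equiv> \<lambda>t. Max ((\<lambda>n. norm (cinner (sg t f) (q n))) ` {..N})"
 defines "g \<equiv> \<lambda>t. indicat_real {-real N..real N} t * m t"
 shows "(NN t. ennreal (g t ^ 4)) <= ennreal (196 * norm f ^ 4)"
proof -
 define c where "c n t = norm (cinner (sg t f) (q n))" for n t
 have cm[measurable]: "c n \<in> bmeas" for n unfolding c_def by measurable
 have m_eq: "m t = Max ((\<lambda>n. c n t) ` {..N})" for t by (simp add: m_def c_def)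
 have mm[measurable]: "m \<in> bmeas"
  unfolding m_def by (rule borel_measurable_Max) (auto simp: c_def[symmetric])
 have gm[measurable]: "g \<in> bmeas" unfolding g_def by measurable
 have cle: "c n t <= m t" if "n <= N" for n t unfolding m_eq using that by (intro Max_ge) auto
 have m0: "0 <= m t" for t using cle[of 0 t] by (auto simp: c_def intro: order_trans[rotated])
 have g0: "0 <= g t" for t using m0[of t] by (simp add: g_def)
 have ex: "\<exists>n. n <= N \<and> c n t = m t" for t
 proof -
  have "m t \<in> (\<lambda>n. c n t) ` {..N}" unfolding m_eq by (intro Max_in) auto
  then show ?thesis by force
 qed
 \<comment> \<open>Among the finitely many maximisers the least index is a measurable function of
   t.\<close>
 define idx where "idx t = (LEAST n. n <= N \<and> c n t = m t)" for t
 have idx: "idx t <= N" "c (idx t) t = m t" for t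
  using LeastI_ex[OF ex[of t]] unfolding idx_def by auto
 have idxm[measurable]: "idx \<in> measurable borel (count_space UNIV)" unfolding idx_def by measurable
 define \<phi> where "\<phi> t = q (idx t)" for t
 have \<phi>m[measurable]: "\<phi> \<in> bmeas"
  unfolding \<phi>_def by (rule measurable_compose[OF idxm]) simp
 have \<phi>B: "\<phi> t \<in> B1" for t by (simp add: \<phi>_def q)
 define z where "z t = cinner (sg t f) (\<phi> t)" for t
 have zm[measurable]: "z \<in> bmeas" unfolding z_def by measurable
 have nz: "norm (z t) = m t" for t using idx(2)[of t] by (simp add: z_def \<phi>_def c_def)
 \<comment> \<open>The power 3 is dual to 4: paired with the evolution of f, the curve
   \<open>G\<close> below gives exactly \<open>g t ^ 4\<close>, while the dispersive bound sees
   \<open>g t ^ 3\<close>.\<close>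
 define \<alpha> where "\<alpha> t = of_real (g t ^ 3) * (z t / of_real (norm (z t)))" for t
 have \<alpha>m[measurable]: "\<alpha> \<in> bmeas" unfolding \<alpha>_def by measurable
 have n\<alpha>: "norm (\<alpha> t) <= g t ^ 3" for t
  using g0[of t] by (auto simp: \<alpha>_def norm_mult norm_divide norm_power)
 define G where "G t = cscale (\<alpha> t) (\<phi> t)" for t
 have Gm[measurable]: "G \<in> bmeas" unfolding G_def by measurable
 have pair: "cinner (sg t f) (G t) = of_real (g t ^ 4)" for t
 proof -
  have "cnj (z t / of_real (norm (z t))) * z t = of_real (norm (z t))"
   using complex_norm_square[of "z t"] by (cases "z t = 0") (simp_all add: power2_eq_square field_simps)
  note key = this
  have "cinner (sg t f) (G t) = cnj (\<alpha> t) * z t" by (simp add: G_def z_def)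
  also have "... = of_real (g t ^ 3) * (cnj (z t / of_real (norm (z t))) * z t)"
   unfolding \<alpha>_def complex_cnj_mult complex_cnj_complex_of_real mult.assoc ..
  also have "... = of_real (g t ^ 3) * of_real (norm (z t))" unfolding key ..
  also have "... = of_real (g t ^ 4)"
   by (auto simp: nz g_def indicator_def power3_eq_cube power4_eq_xxxx)
  finally show ?thesis .
 qed
 \<comment> \<open>Finitely many test functions and a bounded time window give a crude bound that
   makes \<open>a\<close> finite; only then can a power of it be cancelled at the end.\<close>
 obtain K where K: "!!n. n <= N ==> norm (q n) <= K"
 proof -
  have "norm (q n) <= Max ((\<lambda>n. norm (q n)) ` {..N})" if "n <= N" for n using that by (intro Max_ge) auto
  then show thesis using that by blast
 qed
 have K0: "0 <= K" using K[of 0] norm_ge_zero order_trans by blast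
 have gK: "g t <= indicat_real {-real N..real N} t * (norm f * K)" for t
 proof -
  have "c (idx t) t <= norm (sg t f) * norm (q (idx t))" unfolding c_def by (rule norm_cinner_le)
  also have "... <= norm f * K" using K[OF idx(1)] by (auto intro: mult_left_mono)
  finally show ?thesis unfolding idx(2) g_def by (intro mult_left_mono) auto
 qed
 have ind_int: "integrable lborel (\<lambda>t. b * indicat_real {-real N..real N} t)" for b :: real
  by (intro integrable_mult_right integrable_real_indicator) (auto simp: emeasure_lborel_Icc_eq)
 have gpow: "g t ^ k <= (norm f * K) ^ k * indicat_real {-real N..real N} t" if "k > 0" for k t
  using gK[of t] g0[of t] power_mono[of "g t" "norm f * K" k] that
  by (auto simp: indicator_def g_def zero_power split: if_splits)
 have g4i: "integrable lborel (\<lambda>t. g t ^ 4)"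
  by (rule Bochner_Integration.integrable_bound[OF ind_int[of "(norm f * K) ^ 4"]])
   (use gpow[of 4] g0 in \<open>auto simp: abs_of_nonneg intro: order_trans[OF _ abs_ge_self]\<close>)
 have g3i: "integrable lborel (\<lambda>t. g t ^ 3)"
  by (rule Bochner_Integration.integrable_bound[OF ind_int[of "(norm f * K) ^ 3"]])
   (use gpow[of 3] g0 in \<open>auto simp: abs_of_nonneg intro: order_trans[OF _ abs_ge_self]\<close>)
 define a where "a = (LBINT t. g t ^ 4)"
 have a0: "0 <= a" unfolding a_def using g0 by (intro Bochner_Integration.integral_nonneg) auto
 have a_nn: "(NN t. ennreal (g t ^ 4)) = ennreal a"
  unfolding a_def using g4i g0 by (intro nn_integral_eq_integral) auto
 have "a <= 196 * norm f ^ 4"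
 proof (cases "a = 0")
  case False
  then have ap: "a > 0" using a0 by simp
  have Hi: "integrable lborel (\<lambda>t. sg (- t) (G t))"
  proof (rule Bochner_Integration.integrable_bound[OF integrable_mult_left[OF g3i, of K]])
   show "AE t in lborel. norm (sg (- t) (G t)) <= norm (g t ^ 3 * K)"
   proof (rule AE_I2)
    fix t
    have "norm (sg (- t) (G t)) = norm (\<alpha> t) * norm (\<phi> t)" by (simp add: G_def)
    also have "... <= g t ^ 3 * K"
     using n\<alpha>[of t] K[OF idx(1)[of t]] g0[of t] by (intro mult_mono) (auto simp: \<phi>_def)
    finally show "norm (sg (- t) (G t)) <= norm (g t ^ 3 * K)" by simp
   qed
  qed measurable
  define H where "H = (LBINT t. sg (- t) (G t))"
  have "cinner f H = (LBINT t. cinner f (sg (- t) (G t)))"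
   unfolding H_def by (rule cinner_integral_right[OF Hi])
  also have "... = (LBINT t. of_real (g t ^ 4))"
   by (rule Bochner_Integration.integral_cong[OF refl]) (simp only: cinner_sg_adj[symmetric] pair)
  also have "... = of_real a" unfolding a_def by (rule integral_complex_of_real)
  finally have "norm (cinner f H) = a" using a0 by simp
  then have aH: "a <= norm f * norm H" using norm_cinner_le[of f H] by simp
  have "ennreal ((norm H)\<^sup>2) = ennreal (norm (cinner H H))"
   by (simp add: cinner_self norm_power)
  also have "cinner H H = (LBINT t. cinner (sg (- t) (G t)) H)"
   using cinner_integral_left[OF Hi, of H] by (simp add: H_def)
  also have "ennreal (norm (LBINT t. cinner (sg (- t) (G t)) H)) <= (NN t. ennreal (norm (cinner (sg (- t) (G t)) H)))"
   by (rule nn_integral_ge_norm_integral)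
  also have "... <= (NN t. NN s. ennreal (1 / sqrt \<bar>t - s\<bar> * g t ^ 3 * g s ^ 3))"
  proof (rule nn_integral_mono)
   fix t
   have "cinner (sg (- t) (G t)) H = (LBINT s. cinner (sg (- t) (G t)) (sg (- s) (G s)))"
    unfolding H_def by (rule cinner_integral_right[OF Hi])
   then have "ennreal (norm (cinner (sg (- t) (G t)) H)) <= (NN s. ennreal (norm (cinner (sg (- t) (G t)) (sg (- s) (G s)))))"
    by (simp only: nn_integral_ge_norm_integral)
   also have "... <= (NN s. ennreal (1 / sqrt \<bar>t - s\<bar> * g t ^ 3 * g s ^ 3))"
   proof (rule nn_integral_mono_AE)
    have "AE s in lborel. s \<noteq> t" by (rule AE_lborel_singleton)
    then show "AE s in lborel. ennreal (norm (cinner (sg (- t) (G t)) (sg (- s) (G s)))) <= ennreal (1 / sqrt \<bar>t - s\<bar> * g t ^ 3 * g s ^ 3)"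
    proof eventually_elim
     case (elim s)
     have "norm (cinner (sg (- t) (G t)) (sg (- s) (G s))) <= 1 / sqrt \<bar>t - s\<bar> * norm (\<alpha> t) * norm (\<alpha> s)"
      unfolding G_def by (rule dispersive_pair) (use \<phi>B elim in auto)
     also have "... <= 1 / sqrt \<bar>t - s\<bar> * g t ^ 3 * g s ^ 3"
      using n\<alpha>[of t] n\<alpha>[of s] g0[of t] g0[of s] by (intro mult_mono mult_left_mono) auto
     finally show ?case by (rule ennreal_leI)
    qed
   qed
   finally show "ennreal (norm (cinner (sg (- t) (G t)) H)) <= (NN s. ennreal (1 / sqrt \<bar>t - s\<bar> * g t ^ 3 * g s ^ 3))" .
  qed
  also have "... <= ennreal (14 * (a * sqrt a))" by (rule hls[OF gm g0 a_nn ap])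
  finally have H2: "(norm H)\<^sup>2 <= 14 * (a * sqrt a)" using ap by (subst (asm) ennreal_le_iff) auto
  \<comment> \<open>From a <= |f| |H| and |H|^2 <= 14 a^(3/2) follows sqrt a <= 14 |f|^2, and 196 is
    the square of 14.\<close>
  define b where "b = sqrt a"
  have b: "b > 0" "a = b * b" using ap by (auto simp: b_def)
  have "a\<^sup>2 <= (norm f * norm H)\<^sup>2" using aH a0 by (intro power_mono) auto
  also have "... <= (norm f)\<^sup>2 * (14 * (a * sqrt a))"
   unfolding power_mult_distrib using H2 by (intro mult_left_mono) auto
  finally have "b * (b * b * b) <= (14 * (norm f)\<^sup>2) * (b * b * b)"
   unfolding b_def[symmetric] by (simp add: b(2) power2_eq_square mult_ac)
  then have b14: "b <= 14 * (norm f)\<^sup>2" using b(1) by (subst (asm) mult_le_cancel_right_pos) auto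
  have "b * b <= (14 * (norm f)\<^sup>2) * (14 * (norm f)\<^sup>2)" using b14 b(1) by (intro mult_mono) auto
  also have "... = 196 * norm f ^ 4" by (simp add: power4_eq_xxxx power2_eq_square)
  finally show ?thesis by (simp add: b(2)[symmetric])
 qed simp
 then show ?thesis unfolding a_nn by (rule ennreal_leI)
qed

text \<open>The finite maxima over growing windows increase, and any bound on their fourth powers
  bounds every pairing with the norming sequence; monotone convergence then gives the full
  norm.\<close>

lemma strichartz: "(NN t. linf (sg t f) ^ 4) <= ennreal (196 * norm f ^ 4)"
proof -
 obtain q :: "nat => l2" where q: "!!n. q n \<in> B1" and qn: "!!f C. (!!n. norm (cinner f (q n)) <= C) ==> linf f <= ennreal C"
  by (rule norming_sequence) blast
 define m where "m N t = Max ((\<lambda>n. norm (cinner (sg t f) (q n))) ` {..N})" for N t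
 define g where "g N t = indicat_real {-real N..real N} t * m N t" for N t
 have bd: "(NN t. ennreal (g N t ^ 4)) <= ennreal (196 * norm f ^ 4)" for N
  unfolding g_def m_def by (rule strichartz_finite[OF q])
 have m0: "0 <= m N t" for N t
 proof -
  have "norm (cinner (sg t f) (q 0)) <= m N t" unfolding m_def by (intro Max_ge) auto
  then show ?thesis using norm_ge_zero order_trans by blast
 qed
 have minc: "m N t <= m M t" if "N <= M" for N M t
  unfolding m_def using that by (intro Max_mono) auto
 have inc: "incseq (\<lambda>N t. ennreal (g N t ^ 4))"
 proof (rule incseq_SucI, rule le_funI)
  fix N t
  have "g N t <= g (Suc N) t"
   unfolding g_def using minc[of N "Suc N" t] m0 by (intro mult_mono) (auto simp: indicator_def)
  then show "ennreal (g N t ^ 4) <= ennreal (g (Suc N) t ^ 4)"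
   using m0[of N t] by (intro ennreal_leI power_mono) (auto simp: g_def)
 qed
 have mm: "(\<lambda>t. ennreal (g N t ^ 4)) \<in> borel_measurable lborel" for N
 proof -
  have "m N \<in> bmeas" unfolding m_def[abs_def] by (rule borel_measurable_Max) auto
  then show ?thesis unfolding g_def[abs_def] by measurable
 qed
 have "(NN t. linf (sg t f) ^ 4) <= (NN t. (SUP N. ennreal (g N t ^ 4)))"
 proof (rule nn_integral_mono)
  fix t
  define S where "S = (SUP N. ennreal (g N t ^ 4))"
  show "linf (sg t f) ^ 4 <= (SUP N. ennreal (g N t ^ 4))"
  proof (cases "S = \<infinity>")
   case False
   define s where "s = enn2real S"
   have s: "S = ennreal s" "0 <= s" using False by (auto simp: s_def top.not_eq_extremum)
   have "linf (sg t f) <= ennreal (root 4 s)"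
   proof (rule qn)
    fix n
    obtain N0 :: nat where "\<bar>t\<bar> <= real N0" using real_arch_simple by blast
    define N where "N = max n N0"
    have tN: "t \<in> {-real N..real N}" using \<open>\<bar>t\<bar> <= real N0\<close> unfolding N_def by auto
    have "norm (cinner (sg t f) (q n)) <= m N t" unfolding m_def N_def by (intro Max_ge) auto
    also have "... = g N t" using tN by (simp add: g_def)
    finally have "norm (cinner (sg t f) (q n)) ^ 4 <= g N t ^ 4" by (intro power_mono) auto
    moreover have "ennreal (g N t ^ 4) <= ennreal s" unfolding s(1)[symmetric] S_def by (rule SUP_upper) simp
    ultimately have "norm (cinner (sg t f) (q n)) ^ 4 <= s" using s(2) by simp
    then have "root 4 (norm (cinner (sg t f) (q n)) ^ 4) <= root 4 s" by simp
    then show "norm (cinner (sg t f) (q n)) <= root 4 s" by (simp add: real_root_power_cancel)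
   qed
   then have "linf (sg t f) ^ 4 <= ennreal (root 4 s) ^ 4" by (rule power_mono) simp
   also have "... = ennreal s" using s(2) by (simp add: ennreal_power)
   finally show ?thesis by (simp add: S_def[symmetric] s(1))
  next
   case True
   then have "(SUP N. ennreal (g N t ^ 4)) = \<infinity>" by (simp only: S_def)
   then show ?thesis by (simp only: infinity_ennreal_def top_greatest)
  qed
 qed
 also have "... = (SUP N. NN t. ennreal (g N t ^ 4))"
  by (rule nn_integral_monotone_convergence_SUP[OF inc mm])
 also have "... <= ennreal (196 * norm f ^ 4)" by (intro SUP_least bd)
 finally show ?thesis .
qed

text \<open>Minkowski's integral inequality in L4 when the slice at s has norm at most C^(1/4) times
  \<open>w s\<close>. Splitting off powers of w and applying Cauchy--Schwarz twice amounts to the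
  Hoelder inequality with exponents 4/3 and 4, in a form that tolerates infinite values.\<close>

lemma minkowski_L4:
 fixes h :: "real => real => ennreal" and w :: "real => real"
 assumes h: "(\<lambda>(t, s). h t s) \<in> borel_measurable (lborel \<Otimes>\<^sub>M lborel)"
  and w[measurable]: "w \<in> bmeas" and w0: "!!s. 0 <= w s"
  and z: "!!t s. w s = 0 ==> h t s = 0"
  and b: "!!s. (NN t. h t s ^ 4) <= C * ennreal (w s ^ 4)"
 shows "(NN t. (NN s. h t s) ^ 4) <= C * (NN s. ennreal (w s)) ^ 4"
proof -
 define W where "W = (NN s. ennreal (w s))"
 define Z where "Z t = (NN s. h t s ^ 4 * ennreal (1 / w s ^ 3))" for t
 have hm[measurable]: "h t \<in> bmeas" for t
 proof -
  have "(\<lambda>s. case (t, s) of (t, s) => h t s) \<in> borel_measurable lborel"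
   by (rule measurable_compose[OF _ h]) measurable
  then show ?thesis by simp
 qed
 have pt: "(NN s. h t s) ^ 4 <= W ^ 3 * Z t" for t
 proof -
  have e1: "h t s = ennreal (sqrt (w s)) * (h t s * ennreal (1 / sqrt (w s)))" for s
  proof (cases "w s = 0")
   case False
   then have "ennreal (sqrt (w s)) * ennreal (1 / sqrt (w s)) = 1"
    using w0[of s] by (subst ennreal_mult[symmetric]) auto
   then show ?thesis by (simp add: mult.left_commute)
  qed (use z in simp)
  have sq: "ennreal (sqrt (w s)) ^ 2 = ennreal (w s)" for s using w0[of s] by (simp add: ennreal_power)
  have e2: "(h t s * ennreal (1 / sqrt (w s)))\<^sup>2 = ennreal (sqrt (w s)) * (h t s ^ 2 * ennreal (1 / (w s * sqrt (w s))))" for s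
  proof -
   have "ennreal (1 / sqrt (w s)) ^ 2 = ennreal (sqrt (w s)) * ennreal (1 / (w s * sqrt (w s)))"
    using w0[of s] by (cases "w s = 0") (simp_all add: ennreal_power ennreal_mult[symmetric] power_divide)
   then show ?thesis by (simp add: power_mult_distrib mult.left_commute)
  qed
  have e3: "(h t s ^ 2 * ennreal (1 / (w s * sqrt (w s)))) ^ 2 = h t s ^ 4 * ennreal (1 / w s ^ 3)" for s
  proof -
   have "(w s * sqrt (w s))\<^sup>2 = w s ^ 3" using w0[of s] by (simp add: power_mult_distrib power3_eq_cube power2_eq_square)
   then have "ennreal (1 / (w s * sqrt (w s))) ^ 2 = ennreal (1 / w s ^ 3)"
    using w0[of s] by (simp add: ennreal_power power_divide)
   then show ?thesis by (simp add: power_mult_distrib flip: power_mult)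
  qed
  have c1: "(NN s. h t s)\<^sup>2 <= W * (NN s. (h t s * ennreal (1 / sqrt (w s)))\<^sup>2)"
   using Cauchy_Schwarz_nn_integral[of "\<lambda>s. ennreal (sqrt (w s))" lborel "\<lambda>s. h t s * ennreal (1 / sqrt (w s))"]
   by (simp only: e1[symmetric] sq W_def[symmetric]) measurable
  have c2: "(NN s. (h t s * ennreal (1 / sqrt (w s)))\<^sup>2)\<^sup>2 <= W * Z t"
   using Cauchy_Schwarz_nn_integral[of "\<lambda>s. ennreal (sqrt (w s))" lborel "\<lambda>s. h t s ^ 2 * ennreal (1 / (w s * sqrt (w s)))"]
   by (simp only: e2[symmetric] e3 sq W_def[symmetric] Z_def[symmetric]) measurable
  have "(NN s. h t s) ^ 4 = ((NN s. h t s)\<^sup>2)\<^sup>2" by (simp flip: power_mult)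
  also have "... <= (W * (NN s. (h t s * ennreal (1 / sqrt (w s)))\<^sup>2))\<^sup>2" by (intro power_mono c1) simp
  also have "... <= W\<^sup>2 * (W * Z t)" unfolding power_mult_distrib[of W] by (intro mult_left_mono c2) simp
  also have "... = W ^ 3 * Z t" by (simp add: power3_eq_cube power2_eq_square mult_ac)
  finally show ?thesis .
 qed
 have Zm: "(\<lambda>(t, s). h t s ^ 4 * ennreal (1 / w s ^ 3)) \<in> borel_measurable (lborel \<Otimes>\<^sub>M lborel)"
 proof -
  have "(\<lambda>p. (case p of (t, s) => h t s) ^ 4 * ennreal (1 / w (snd p) ^ 3)) \<in> borel_measurable (lborel \<Otimes>\<^sub>M lborel)"
   using h by measurable
  then show ?thesis by (simp add: case_prod_unfold)
 qed
 have "(NN t. Z t) = (NN s. NN t. h t s ^ 4 * ennreal (1 / w s ^ 3))"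
  unfolding Z_def using lborel_pair.Fubini'[of "\<lambda>t s. h t s ^ 4 * ennreal (1 / w s ^ 3)"] Zm by simp
 also have "... <= (NN s. C * ennreal (w s))"
 proof (rule nn_integral_mono)
  fix s
  have hm2[measurable]: "(\<lambda>t. h t s) \<in> bmeas"
  proof -
   have "(\<lambda>t. case (t, s) of (t, s) => h t s) \<in> borel_measurable lborel"
    by (rule measurable_compose[OF _ h]) measurable
   then show ?thesis by simp
  qed
  have "(NN t. h t s ^ 4 * ennreal (1 / w s ^ 3)) = (NN t. h t s ^ 4) * ennreal (1 / w s ^ 3)"
   by (intro nn_integral_multc) measurable
  also have "... <= (C * ennreal (w s ^ 4)) * ennreal (1 / w s ^ 3)" by (intro mult_right_mono b) simp
  also have "... = C * ennreal (w s)"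
   using w0[of s] by (cases "w s = 0")
    (simp_all add: mult.assoc ennreal_mult[symmetric] power4_eq_xxxx power3_eq_cube)
  finally show "(NN t. h t s ^ 4 * ennreal (1 / w s ^ 3)) <= C * ennreal (w s)" .
 qed
 also have "... = C * W" unfolding W_def by (intro nn_integral_cmult) measurable
 finally have ZW: "(NN t. Z t) <= C * W" .
 have Zm': "Z \<in> borel_measurable lborel"
  unfolding Z_def[abs_def] using lborel.borel_measurable_nn_integral[of "\<lambda>t s. h t s ^ 4 * ennreal (1 / w s ^ 3)" lborel] Zm by simp
 have "(NN t. (NN s. h t s) ^ 4) <= (NN t. W ^ 3 * Z t)" by (intro nn_integral_mono pt)
 also have "... = W ^ 3 * (NN t. Z t)" by (rule nn_integral_cmult[OF Zm'])
 also have "... <= W ^ 3 * (C * W)" by (intro mult_left_mono ZW) simp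
 also have "... = C * W ^ 4" by (simp add: power4_eq_xxxx power3_eq_cube mult_ac)
 finally show ?thesis by (simp add: W_def)
qed

text \<open>The integrand is in L1 of time with values in L2, so the time ordering is harmless:
  positivity removes the cut-off before Minkowski's inequality, and each slice is a free solution
  covered by \<open>strichartz\<close>.\<close>

lemma strichartz_retarded:
 fixes F :: "real => l2"
 assumes F: "integrable lborel F"
 shows "(NN t. linf (LBINT s. indicat_real {t..} s *\<^sub>R sg (t - s) (F s)) ^ 4)
  <= ennreal (196 * (LBINT s. norm (F s)) ^ 4)"
proof -
 have Fm[measurable]: "F \<in> bmeas" using borel_measurable_integrable[OF F] by simp
 have Fi: "integrable lborel (\<lambda>s. indicat_real {t..} s *\<^sub>R sg (t - s) (F s))" for t
  by (rule Bochner_Integration.integrable_bound[OF F]) (auto simp: indicator_def)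
 have "(NN t. linf (LBINT s. indicat_real {t..} s *\<^sub>R sg (t - s) (F s)) ^ 4)
  <= (NN t. (NN s. linf (sg (t - s) (F s))) ^ 4)"
 proof (intro nn_integral_mono power_mono)
  fix t
  have "linf (LBINT s. indicat_real {t..} s *\<^sub>R sg (t - s) (F s)) <= (NN s. linf (indicat_real {t..} s *\<^sub>R sg (t - s) (F s)))"
   by (rule linf_integral[OF Fi])
  also have "... <= (NN s. linf (sg (t - s) (F s)))"
   by (intro nn_integral_mono) (auto simp: indicator_def)
  finally show "linf (LBINT s. indicat_real {t..} s *\<^sub>R sg (t - s) (F s)) <= (NN s. linf (sg (t - s) (F s)))" .
 qed simp
 also have "... <= ennreal 196 * (NN s. ennreal (norm (F s))) ^ 4"
 proof (rule minkowski_L4)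
  show "(\<lambda>(t, s). linf (sg (t - s) (F s))) \<in> borel_measurable (lborel \<Otimes>\<^sub>M lborel)" by measurable
  show "linf (sg (t - s) (F s)) = 0" if "norm (F s) = 0" for t s using that by simp
  fix s
  have "(NN t. linf (sg (t - s) (F s)) ^ 4) = (NN t. linf (sg t (sg (- s) (F s))) ^ 4)"
   by (simp add: sg_sg)
  also have "... <= ennreal (196 * norm (sg (- s) (F s)) ^ 4)" by (rule strichartz)
  also have "... = ennreal 196 * ennreal (norm (F s) ^ 4)" by (simp add: ennreal_mult)
  finally show "(NN t. linf (sg (t - s) (F s)) ^ 4) <= ennreal 196 * ennreal (norm (F s) ^ 4)" .
 qed auto
 also have "(NN s. ennreal (norm (F s))) = ennreal (LBINT s. norm (F s))"
  using F by (intro nn_integral_eq_integral) auto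
 also have "ennreal 196 * ennreal (LBINT s. norm (F s)) ^ 4 = ennreal (196 * (LBINT s. norm (F s)) ^ 4)"
  by (simp add: ennreal_mult ennreal_power)
 finally show ?thesis .
qed

section \<open>The nonlinearity\<close>

text \<open>The nonlinearity for v = a + z, without its factor 1/t. Its real linear part at z = 0 is
  \<open>a\<^sup>2 * (z + cnj z)\<close>.\<close>

definition NL :: "real => complex => complex" where
 "NL a z = of_real ((norm (of_real a + z))\<^sup>2 - a\<^sup>2) * (of_real a + z)"

lemma NL_0[simp]: "0 <= a ==> NL a 0 = 0" by (simp add: NL_def)

text \<open>Twice the difference of the two sides is the sum of squares in the proof. Removing the
  mixed terms leaves a only in 5 a^2, the part that is not integrable in time.\<close>

lemma cubic_weight:
 fixes x y a :: real
 shows "2 * a * x + x\<^sup>2 + (2 * a + x + y) * (a + y) <= 5 * a\<^sup>2 + 3 * x\<^sup>2 + 3 * y\<^sup>2"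
proof -
 have "0 <= 3 * (a - x)\<^sup>2 + 3 * (a - y)\<^sup>2 + (x - y)\<^sup>2" by simp
 then show ?thesis by (simp add: power2_eq_square algebra_simps)
qed

lemma NL_lipschitz:
 assumes a: "0 <= a"
 shows "norm (NL a z - NL a z') <= (5 * a\<^sup>2 + 3 * (norm z)\<^sup>2 + 3 * (norm z')\<^sup>2) * norm (z - z')"
proof -
 define A where "A = (norm (of_real a + z))\<^sup>2 - a\<^sup>2"
 define B where "B = (norm (of_real a + z'))\<^sup>2 - a\<^sup>2"
 define x y where "x = norm z" and "y = norm z'"
 have na: "norm (of_real a :: complex) = a" using a by simp
 have az: "norm (of_real a + z) <= a + x" "norm (of_real a + z') <= a + y"
  using norm_triangle_ineq[of "of_real a" z] norm_triangle_ineq[of "of_real a" z'] a by (simp_all add: x_def y_def)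
 have A: "\<bar>A\<bar> <= 2 * a * x + x\<^sup>2"
 proof -
  have Aeq: "A = (norm (of_real a + z) - a) * (norm (of_real a + z) + a)"
   by (simp add: A_def power2_eq_square algebra_simps)
  have "\<bar>norm (of_real a + z) - a\<bar> <= x"
   using norm_triangle_ineq3[of "of_real a + z" "of_real a"] a by (simp add: x_def)
  then have "\<bar>A\<bar> <= x * ((a + x) + a)"
   unfolding Aeq abs_mult using az(1) a by (intro mult_mono) auto
  then show ?thesis by (simp add: power2_eq_square algebra_simps)
 qed
 have AB: "\<bar>A - B\<bar> <= norm (z - z') * (2 * a + x + y)"
 proof -
  have ABeq: "A - B = (norm (of_real a + z) - norm (of_real a + z')) * (norm (of_real a + z) + norm (of_real a + z'))"
   by (simp add: A_def B_def power2_eq_square algebra_simps)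
  have "\<bar>norm (of_real a + z) - norm (of_real a + z')\<bar> <= norm (z - z')"
   using norm_triangle_ineq3[of "of_real a + z" "of_real a + z'"] by simp
  then have "\<bar>A - B\<bar> <= norm (z - z') * ((a + x) + (a + y))"
   unfolding ABeq abs_mult using az a by (intro mult_mono) auto
  then show ?thesis by (simp add: algebra_simps)
 qed
 have "NL a z - NL a z' = of_real A * (z - z') + of_real (A - B) * (of_real a + z')"
  by (simp add: NL_def A_def[symmetric] B_def[symmetric]) (simp add: algebra_simps)
 then have "norm (NL a z - NL a z') <= norm (of_real A * (z - z')) + norm (of_real (A - B) * (of_real a + z'))"
  by (simp only: norm_triangle_ineq)
 also have "... = \<bar>A\<bar> * norm (z - z') + \<bar>A - B\<bar> * norm (of_real a + z')"
  by (simp only: norm_mult norm_of_real)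
 also have "... <= (2 * a * x + x\<^sup>2) * norm (z - z') + (norm (z - z') * (2 * a + x + y)) * (a + y)"
 proof (intro add_mono mult_mono)
  show "0 <= norm (z - z') * (2 * a + x + y)" using a by (auto simp: x_def y_def)
 qed (use A AB az in auto)
 also have "... = (2 * a * x + x\<^sup>2 + (2 * a + x + y) * (a + y)) * norm (z - z')"
  by (simp add: algebra_simps)
 also have "... <= (5 * a\<^sup>2 + 3 * x\<^sup>2 + 3 * y\<^sup>2) * norm (z - z')"
  by (intro mult_right_mono cubic_weight) simp
 finally show ?thesis by (simp add: x_def y_def)
qed

text \<open>Beyond the linear part there are quadratic terms with a factor a and one cubic term; the
  coefficient 3 collects \<open>z * z\<close> and twice \<open>z * cnj z\<close>.\<close>

lemma NL_remainder:
 assumes a: "0 <= a"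
 shows "norm (NL a z - of_real (a\<^sup>2) * z - of_real (a\<^sup>2) * cnj z) <= (3 * a * norm z + (norm z)\<^sup>2) * norm z"
proof -
 have n: "of_real ((norm (of_real a + z))\<^sup>2) = (of_real a + z) * (of_real a + cnj z)"
  by (simp only: complex_norm_square complex_cnj_add complex_cnj_complex_of_real)
 have "NL a z - of_real (a\<^sup>2) * z - of_real (a\<^sup>2) * cnj z = of_real a * (z * z) + of_real (2 * a) * (z * cnj z) + (z * cnj z) * z"
  unfolding NL_def of_real_diff n by (simp add: power2_eq_square algebra_simps)
 then have "norm (NL a z - of_real (a\<^sup>2) * z - of_real (a\<^sup>2) * cnj z) <=
   norm (of_real a * (z * z)) + norm (of_real (2 * a) * (z * cnj z)) + norm ((z * cnj z) * z)"
  using norm_triangle_ineq[of "of_real a * (z * z) + of_real (2 * a) * (z * cnj z)" "(z * cnj z) * z"]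
   norm_triangle_ineq[of "of_real a * (z * z)" "of_real (2 * a) * (z * cnj z)"] by simp
 also have "... = (3 * a * norm z + (norm z)\<^sup>2) * norm z"
  using a by (simp add: norm_mult power2_eq_square algebra_simps)
 finally show ?thesis .
qed

lemma NL_continuous: "continuous_on UNIV (NL a)"
 unfolding NL_def by (intro continuous_intros)

lemma NL_measurable[measurable]: "NL a \<in> bmeas"
 by (intro borel_measurable_continuous_onI NL_continuous)

section \<open>The nonlinearity on classes\<close>

lemma l2_norm_mono:
 assumes "AE x in lborel. norm (rep_l2 f x) <= C * norm (rep_l2 g x)" "0 <= C"
 shows "norm f <= C * norm g"
proof -
 have "(norm f)\<^sup>2 <= (C * norm g)\<^sup>2"
  unfolding power_mult_distrib norm_sq integral_mult_right_zero[symmetric]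
 proof (rule integral_mono_AE)
  show "integrable lborel (\<lambda>x. C\<^sup>2 * (norm (rep_l2 g x))\<^sup>2)"
   by (intro integrable_mult_right sqint_integrable sqint_rep)
  show "AE x in lborel. (norm (rep_l2 f x))\<^sup>2 <= C\<^sup>2 * (norm (rep_l2 g x))\<^sup>2"
   using assms(1) by eventually_elim (metis norm_ge_zero power_mono power_mult_distrib)
 qed (intro sqint_integrable sqint_rep)
 then show ?thesis by (rule power2_le_imp_le) (use assms(2) in simp)
qed

text \<open>The cubic nonlinearity need not map \<open>L\<^sup>2\<close> into \<open>L\<^sup>2\<close>; 0 is a junk value.\<close>

definition Nem :: "real => l2 => l2" where
 "Nem a q = (if linf q = \<infinity> then 0 else abs_l2 (\<lambda>x. NL a (rep_l2 q x)))"

text \<open>Truncation makes the map globally Lipschitz on L2, and it agrees with \<open>Nem\<close>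
  wherever the sup norm is at most M; square integrability and measurability of \<open>Nem\<close>
  are drawn from it.\<close>

definition NemT :: "real => real => l2 => l2" where
 "NemT a M q = abs_l2 (\<lambda>x. NL a (trunc M (rep_l2 q x)))"

lemma NL_trunc_lipschitz:
 assumes a: "0 <= a" and M: "0 <= M"
 shows "norm (NL a (trunc M z) - NL a (trunc M z')) <= (5 * a\<^sup>2 + 6 * M\<^sup>2) * norm (z - z')"
proof -
 have "norm (NL a (trunc M z) - NL a (trunc M z')) <=
   (5 * a\<^sup>2 + 3 * (norm (trunc M z))\<^sup>2 + 3 * (norm (trunc M z'))\<^sup>2) * norm (trunc M z - trunc M z')"
  by (rule NL_lipschitz[OF a])
 also have "... <= (5 * a\<^sup>2 + 3 * M\<^sup>2 + 3 * M\<^sup>2) * norm (z - z')"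
  using M a by (intro mult_mono add_mono mult_left_mono power_mono trunc_le trunc_lipschitz) auto
 finally show ?thesis by (simp add: algebra_simps)
qed

lemma NemT_sqint:
 assumes a: "0 <= a" and M: "0 <= M" shows "sqint (\<lambda>x. NL a (trunc M (rep_l2 q x)))"
proof (rule sqint_bound)
 have [measurable]: "trunc M \<in> bmeas" by (rule trunc_measurable[OF M])
 show "(\<lambda>x. NL a (trunc M (rep_l2 q x))) \<in> bmeas" by measurable
 show "integrable lborel (\<lambda>x. (5 * a\<^sup>2 + 6 * M\<^sup>2)\<^sup>2 * (norm (rep_l2 q x))\<^sup>2)"
  by (intro integrable_mult_right sqint_integrable sqint_rep)
 show "AE x in lborel. (norm (NL a (trunc M (rep_l2 q x))))\<^sup>2 <= (5 * a\<^sup>2 + 6 * M\<^sup>2)\<^sup>2 * (norm (rep_l2 q x))\<^sup>2"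
 proof (rule AE_I2)
  fix x
  have "norm (NL a (trunc M (rep_l2 q x))) <= (5 * a\<^sup>2 + 6 * M\<^sup>2) * norm (rep_l2 q x)"
   using NL_trunc_lipschitz[OF a M, of "rep_l2 q x" 0] a M by simp
  then have "(norm (NL a (trunc M (rep_l2 q x))))\<^sup>2 <= ((5 * a\<^sup>2 + 6 * M\<^sup>2) * norm (rep_l2 q x))\<^sup>2"
   by (intro power_mono) auto
  then show "(norm (NL a (trunc M (rep_l2 q x))))\<^sup>2 <= (5 * a\<^sup>2 + 6 * M\<^sup>2)\<^sup>2 * (norm (rep_l2 q x))\<^sup>2"
   by (simp only: power_mult_distrib)
 qed
qed

lemma NemT_lipschitz:
 assumes a: "0 <= a" and M: "0 <= M"
 shows "norm (NemT a M q - NemT a M q') <= (5 * a\<^sup>2 + 6 * M\<^sup>2) * norm (q - q')"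
proof (rule l2_norm_mono)
 have "AE x in lborel. rep_l2 (NemT a M q) x = NL a (trunc M (rep_l2 q x))"
  "AE x in lborel. rep_l2 (NemT a M q') x = NL a (trunc M (rep_l2 q' x))"
  unfolding NemT_def by (intro rep_abs NemT_sqint a M)+
 then show "AE x in lborel. norm (rep_l2 (NemT a M q - NemT a M q') x) <= (5 * a\<^sup>2 + 6 * M\<^sup>2) * norm (rep_l2 (q - q') x)"
  using rep_diff[of "NemT a M q" "NemT a M q'"] rep_diff[of q q']
  by eventually_elim (simp add: NL_trunc_lipschitz[OF a M])
qed simp

lemma NemT_measurable:
 assumes a: "0 <= a" and M: "0 <= M" shows "NemT a M \<in> bmeas"
proof (rule borel_measurable_continuous_onI)
 have "(5 * a\<^sup>2 + 6 * M\<^sup>2)-lipschitz_on UNIV (NemT a M)"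
  by (rule lipschitz_onI) (use NemT_lipschitz[OF a M] in \<open>auto simp: dist_norm\<close>)
 then show "continuous_on UNIV (NemT a M)" by (rule lipschitz_on_continuous_on)
qed

lemma linf_bound_AE: "linf q <= ennreal m ==> 0 <= m ==> AE x in lborel. norm (rep_l2 q x) <= m"
 using AE_le_linf[of q]
proof eventually_elim
 case (elim x)
 then have "ennreal (norm (rep_l2 q x)) <= ennreal m" by (meson order_trans)
 then show ?case using elim by simp
qed

lemma Nem_eq_NemT:
 assumes a: "0 <= a" and q: "linf q <= ennreal m" "0 <= m"
 shows "sqint (\<lambda>x. NL a (rep_l2 q x))" "Nem a q = NemT a m q"
proof -
 have e: "AE x in lborel. NL a (rep_l2 q x) = NL a (trunc m (rep_l2 q x))"
  using linf_bound_AE[OF q] by eventually_elim (simp add: trunc_self)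
 show s: "sqint (\<lambda>x. NL a (rep_l2 q x))"
  by (rule sqint_cong_AE[OF NemT_sqint[OF a q(2), of q] _ e]) measurable
 have "linf q \<noteq> \<infinity>" using q(1) by (auto simp: top_unique)
 then show "Nem a q = NemT a m q" unfolding Nem_def NemT_def
  using abs_eqI[OF s NemT_sqint[OF a q(2), of q] e] by simp
qed

lemma rep_Nem:
 assumes a: "0 <= a" and q: "linf q \<noteq> \<infinity>"
 shows "AE x in lborel. rep_l2 (Nem a q) x = NL a (rep_l2 q x)"
proof -
 have "linf q <= ennreal (enn2real (linf q))" using q by (simp add: top.not_eq_extremum)
 from Nem_eq_NemT(1)[OF a this] have "sqint (\<lambda>x. NL a (rep_l2 q x))" by simp
 then show ?thesis unfolding Nem_def using q by (simp add: rep_abs)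
qed

lemma Nem_lipschitz:
 assumes a: "0 <= a" and q: "linf q <= ennreal m" "0 <= m" and q': "linf q' <= ennreal m'" "0 <= m'"
 shows "norm (Nem a q - Nem a q') <= (5 * a\<^sup>2 + 3 * m\<^sup>2 + 3 * m'\<^sup>2) * norm (q - q')"
proof (rule l2_norm_mono)
 have "linf q \<noteq> \<infinity>" "linf q' \<noteq> \<infinity>" using q(1) q'(1) by (auto simp: top_unique)
 note r = rep_Nem[OF a this(1)] rep_Nem[OF a this(2)]
 show "AE x in lborel. norm (rep_l2 (Nem a q - Nem a q') x) <= (5 * a\<^sup>2 + 3 * m\<^sup>2 + 3 * m'\<^sup>2) * norm (rep_l2 (q - q') x)"
  using r rep_diff[of "Nem a q" "Nem a q'"] rep_diff[of q q'] linf_bound_AE[OF q] linf_bound_AE[OF q']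
 proof eventually_elim
  case (elim x)
  have "norm (NL a (rep_l2 q x) - NL a (rep_l2 q' x)) <=
    (5 * a\<^sup>2 + 3 * (norm (rep_l2 q x))\<^sup>2 + 3 * (norm (rep_l2 q' x))\<^sup>2) * norm (rep_l2 q x - rep_l2 q' x)"
   by (rule NL_lipschitz[OF a])
  also have "... <= (5 * a\<^sup>2 + 3 * m\<^sup>2 + 3 * m'\<^sup>2) * norm (rep_l2 q x - rep_l2 q' x)"
   using elim by (intro mult_right_mono add_mono mult_left_mono power_mono) auto
  finally show ?case using elim by simp
 qed
qed simp

lemma Nem_remainder:
 assumes a: "0 <= a" and q: "linf q <= ennreal m" "0 <= m"
 shows "norm (Nem a q - cscale (of_real (a\<^sup>2)) q - cscale (of_real (a\<^sup>2)) (cnj_l2 q)) <= (3 * a * m + m\<^sup>2) * norm q"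
proof (rule l2_norm_mono)
 have "linf q \<noteq> \<infinity>" using q(1) by (auto simp: top_unique)
 note r = rep_Nem[OF a this]
 show "AE x in lborel. norm (rep_l2 (Nem a q - cscale (of_real (a\<^sup>2)) q - cscale (of_real (a\<^sup>2)) (cnj_l2 q)) x)
   <= (3 * a * m + m\<^sup>2) * norm (rep_l2 q x)"
  using r rep_diff[of "Nem a q - cscale (of_real (a\<^sup>2)) q" "cscale (of_real (a\<^sup>2)) (cnj_l2 q)"]
   rep_diff[of "Nem a q" "cscale (of_real (a\<^sup>2)) q"] rep_cscale[of "of_real (a\<^sup>2)" q]
   rep_cscale[of "of_real (a\<^sup>2)" "cnj_l2 q"] rep_cnj[of q] linf_bound_AE[OF q]
 proof eventually_elim
  case (elim x)
  have "norm (NL a (rep_l2 q x) - of_real (a\<^sup>2) * rep_l2 q x - of_real (a\<^sup>2) * cnj (rep_l2 q x)) <=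
    (3 * a * norm (rep_l2 q x) + (norm (rep_l2 q x))\<^sup>2) * norm (rep_l2 q x)"
   by (rule NL_remainder[OF a])
  also have "... <= (3 * a * m + m\<^sup>2) * norm (rep_l2 q x)"
   using elim a by (intro mult_right_mono add_mono mult_left_mono power_mono) auto
  finally show ?case using elim by simp
 qed
qed (use a q in simp)

text \<open>Where the sup norm is finite, \<open>NemT a (real n)\<close> is eventually constant in
  n, so \<open>Nem\<close> is there a pointwise limit of continuous maps, and the remaining set is
  Borel.\<close>

lemma Nem_measurable[measurable]:
 assumes a: "0 <= a" shows "Nem a \<in> bmeas"
proof -
 have [measurable]: "NemT a (real n) \<in> bmeas" for n by (rule NemT_measurable[OF a]) simp
 have "Nem a = (\<lambda>q. if linf q = \<infinity> then 0 else lim (\<lambda>n. NemT a (real n) q))"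
 proof
  fix q
  show "Nem a q = (if linf q = \<infinity> then 0 else lim (\<lambda>n. NemT a (real n) q))"
  proof (cases "linf q = \<infinity>")
   case False
   obtain N :: nat where N: "enn2real (linf q) <= real N" using real_arch_simple by blast
   have "Nem a q = NemT a (real n) q" if "n \<ge> N" for n
   proof (rule Nem_eq_NemT(2)[OF a])
    have "linf q = ennreal (enn2real (linf q))" using False by (simp add: top.not_eq_extremum)
    also have "... <= ennreal (real n)" using N that by (intro ennreal_leI) linarith
    finally show "linf q <= ennreal (real n)" .
   qed simp
   then have "(\<lambda>n. NemT a (real n) q) \<longlonglongrightarrow> Nem a q"
    by (intro tendsto_eventually eventually_sequentiallyI[of N]) simp
   then show ?thesis using False by (simp add: limI)
  qed (simp add: Nem_def)
 qed
 moreover have "(\<lambda>q. if linf q = \<infinity> then 0 else lim (\<lambda>n. NemT a (real n) q)) \<in> bmeas"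
  by measurable
 ultimately show ?thesis by simp
qed

section \<open>Uniqueness\<close>

lemma nn_integral_powr_tail:
 assumes t: "t > 0" and p: "p > 1"
 shows "(NN s. ennreal (s powr (- p)) * indicator {t..} s) = ennreal (t powr (1 - p) / (p - 1))"
proof -
 have l: "((\<lambda>x::real. - (x powr (1 - p) / (p - 1))) \<longlongrightarrow> - (0 / (p - 1))) at_top"
  using p by (intro tendsto_intros tendsto_neg_powr filterlim_ident) auto
 have "(NN s. ennreal (s powr (- p)) * indicator {t..} s) = ennreal (- (0 / (p - 1)) - - (t powr (1 - p) / (p - 1)))"
 proof (rule nn_integral_FTC_atLeast[where F="\<lambda>x. - (x powr (1 - p) / (p - 1))", OF _ _ _ l])
  fix x assume x: "t <= x"
  have "((\<lambda>x. - (x powr (1 - p) / (p - 1))) has_real_derivative - ((1 - p) * x powr (1 - p - 1) / (p - 1))) (at x)"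
   using x t p by (auto intro!: derivative_eq_intros)
  moreover have "- ((1 - p) * x powr (1 - p - 1) / (p - 1)) = x powr (- p)"
   using p by (simp add: field_simps)
  ultimately show "((\<lambda>x. - (x powr (1 - p) / (p - 1))) has_real_derivative x powr (- p)) (at x)" by simp
 qed auto
 then show ?thesis by simp
qed

lemma powr_divide_self: "s > 0 ==> s powr b / s = s powr (b - 1)" for s b :: real
 by (simp add: powr_diff)

lemma ennreal_enn2real_le: "ennreal (enn2real x) <= x"
 by (cases x) auto

text \<open>The fourth power of the norm is kept in \<open>ennreal\<close>, free of roots and of
  finiteness conditions.\<close>

definition tail4 :: "real => (real => l2) => ennreal" where
 "tail4 t r = (NN s. linf (r s) ^ 4 * indicator {t..} s)"

lemma tail4_AE_finite:
 assumes [measurable]: "r \<in> bmeas" and "tail4 t r < \<infinity>"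
 shows "AE s in lborel. t <= s \<longrightarrow> linf (r s) \<noteq> \<infinity>"
proof -
 have "AE s in lborel. linf (r s) ^ 4 * indicator {t..} s \<noteq> \<infinity>"
  using assms(2) unfolding tail4_def by (intro nn_integral_PInf_AE) auto
 then show ?thesis
  by eventually_elim (auto simp: indicator_def power_eq_top_ennreal split: if_splits)
qed

lemma sq_sum_le: "(x + y)\<^sup>2 <= 2 * x\<^sup>2 + 2 * y\<^sup>2" for x y :: real
 using zero_le_power2[of "x - y"] by (simp add: power2_eq_square algebra_simps)

lemma ennreal_sum_mult:
 "0 <= b ==> 0 <= x ==> 0 <= c ==> 0 <= y ==> ennreal (b * x + c * y) = ennreal b * ennreal x + ennreal c * ennreal y"
 by (simp add: ennreal_mult)

text \<open>Here u is the class of the asymptotic datum. Its square integrability is part of the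
  type, so L1 is the condition to be added.\<close>

locale nls =
 fixes \<sigma> a t0 :: real and u :: l2
 assumes \<sigma>: "\<sigma> = 1 \<or> \<sigma> = - 1" and t0: "t0 > 0" and a: "0 < a" and u: "integrable lborel (rep_l2 u)"
begin

definition phase :: "real => complex" where "phase s = exp (\<i> * of_real (\<sigma> * a\<^sup>2 * ln s))"

definition w :: "real => l2" where "w s = cscale (phase s) (sg s u)"

lemma norm_phase[simp]: "norm (phase s) = 1"
 by (simp add: phase_def)

lemma norm_w[simp]: "norm (w s) = norm u" by (simp add: w_def)

lemma w_measurable[measurable]: "w \<in> bmeas"
 unfolding w_def[abs_def] phase_def[abs_def] by measurable

lemma linf_w:
 assumes s: "s > 0" shows "linf (w s) <= ennreal (n1 u / sqrt s)"
proof -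
 have "linf (w s) <= ennreal 1 * linf (sg s u)" unfolding w_def using linf_cscale[of "phase s" "sg s u"] by simp
 also have "... <= ennreal (1 / sqrt \<bar>s\<bar> * n1 u)" using linf_sg_dispersive[OF u, of s] s by simp
 finally show ?thesis using s by simp
qed

text \<open>The part of the Lipschitz constant of the nonlinearity that is integrable in time; the rest is
 \<open>5 a\<^sup>2 / s\<close>.\<close>

definition \<kappa> :: "(real => l2) => (real => l2) => real => real" where
 "\<kappa> r r' s = 12 * (n1 u)\<^sup>2 / s\<^sup>2 + 6 * (enn2real (linf (r s)))\<^sup>2 / s + 6 * (enn2real (linf (r' s)))\<^sup>2 / s"

lemma \<kappa>_nonneg: "s > 0 ==> 0 <= \<kappa> r r' s"
 unfolding \<kappa>_def by (intro add_nonneg_nonneg divide_nonneg_nonneg) auto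

lemma \<kappa>_measurable[measurable]:
 assumes [measurable]: "r \<in> bmeas" "r' \<in> bmeas"
 shows "\<kappa> r r' \<in> bmeas"
 unfolding \<kappa>_def[abs_def] by measurable

text \<open>The sup norms of w + r and w + r' are split and squared by \<open>sq_sum_le\<close>: two
  terms with coefficient 3, each doubled, give 12 for w and 6 for each remainder.\<close>

lemma Nem_difference:
 assumes s: "s > 0" and r: "linf (r s) \<noteq> \<infinity>" "linf (r' s) \<noteq> \<infinity>"
 shows "norm ((1 / s) *\<^sub>R (Nem a (w s + r s) - Nem a (w s + r' s))) <= (5 * a\<^sup>2 / s + \<kappa> r r' s) * norm (r s - r' s)"
proof -
 define l l' where "l = enn2real (linf (r s))" and "l' = enn2real (linf (r' s))"
 define m where "m = n1 u / sqrt s"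
 have l: "linf (r s) = ennreal l" "linf (r' s) = ennreal l'" "0 <= l" "0 <= l'"
  using r by (auto simp: l_def l'_def top.not_eq_extremum)
 have m: "0 <= m" "m\<^sup>2 = (n1 u)\<^sup>2 / s" using s n1_nonneg[of u] by (auto simp: m_def power_divide)
 have b: "linf (w s + r s) <= ennreal (m + l)" "linf (w s + r' s) <= ennreal (m + l')"
 proof -
  have "linf (w s + f) <= ennreal m + linf f" for f
   using linf_add[of "w s" f] linf_w[OF s] unfolding m_def by (meson add_right_mono order_trans)
  then show "linf (w s + r s) <= ennreal (m + l)" "linf (w s + r' s) <= ennreal (m + l')"
   using l m by (metis ennreal_plus)+
 qed
 have "norm (Nem a (w s + r s) - Nem a (w s + r' s)) <=
   (5 * a\<^sup>2 + 3 * (m + l)\<^sup>2 + 3 * (m + l')\<^sup>2) * norm ((w s + r s) - (w s + r' s))"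
  by (rule Nem_lipschitz) (use a b m l in auto)
 also have "... <= (5 * a\<^sup>2 + (12 * m\<^sup>2 + 6 * l\<^sup>2 + 6 * l'\<^sup>2)) * norm (r s - r' s)"
  using sq_sum_le[of m l] sq_sum_le[of m l'] by (intro mult_mono) auto
 finally have "norm (Nem a (w s + r s) - Nem a (w s + r' s)) / s <= (5 * a\<^sup>2 + (12 * m\<^sup>2 + 6 * l\<^sup>2 + 6 * l'\<^sup>2)) * norm (r s - r' s) / s"
  using s by (intro divide_right_mono) auto
 also have "... = (5 * a\<^sup>2 / s + \<kappa> r r' s) * norm (r s - r' s)"
  unfolding \<kappa>_def l_def[symmetric] l'_def[symmetric] m(2)
  by (simp add: add_divide_distrib distrib_right power2_eq_square)
 finally show ?thesis using s by simp
qed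

text \<open>Integration against 1/s reproduces the weight s^(-1/4) with a factor 4. The bound does
  not improve as t grows, so only a small a makes it small.\<close>

lemma nn_integral_main_weight:
 assumes t: "t > 0"
 shows "(NN s. ennreal (5 * a\<^sup>2 / s * s powr (- 1/4)) * indicator {t..} s) = ennreal (20 * a\<^sup>2 * t powr (- 1/4))"
proof -
 have "(NN s. ennreal (5 * a\<^sup>2 / s * s powr (- 1/4)) * indicator {t..} s) =
  (NN s. ennreal (5 * a\<^sup>2) * (ennreal (s powr (- (5/4))) * indicator {t..} s))"
 proof (rule nn_integral_cong)
  fix s
  show "ennreal (5 * a\<^sup>2 / s * s powr (- 1/4)) * indicator {t..} s = ennreal (5 * a\<^sup>2) * (ennreal (s powr (- (5/4))) * indicator {t..} s)"
  proof (cases "t <= s")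
   case True
   then have "s powr (- 1/4) / s = s powr (- (5/4))" using t powr_divide_self[of s "-1/4"] by simp
   then have "5 * a\<^sup>2 / s * s powr (- 1/4) = 5 * a\<^sup>2 * s powr (- (5/4))" by (metis mult.assoc times_divide_eq_left times_divide_eq_right)
   then show ?thesis using True by (simp add: ennreal_mult)
  qed simp
 qed
 also have "... = ennreal (5 * a\<^sup>2) * ennreal (t powr (1 - 5/4) / (5/4 - 1))"
  using nn_integral_powr_tail[OF t, of "5/4"] by (subst nn_integral_cmult) auto
 also have "... = ennreal (20 * a\<^sup>2 * t powr (- 1/4))"
  by (subst ennreal_mult[symmetric]) auto
 finally show ?thesis .
qed

text \<open>The arithmetic--geometric mean inequality after scaling l by R; with this scaling both
  terms integrate to R^2/t once the tail of the fourth power is at most R^4/t.\<close>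

lemma ell_sq_weight:
 fixes l s R :: real assumes "R > 0" shows "l\<^sup>2 / s <= R\<^sup>2 * ((l / R) ^ 4 + 1 / s\<^sup>2)"
proof -
 have "2 * ((l / R)\<^sup>2 * (1 / s)) <= ((l / R)\<^sup>2)\<^sup>2 + (1 / s)\<^sup>2"
  using sum_squares_bound[of "(l / R)\<^sup>2" "1 / s"] by simp
 moreover have "0 <= ((l / R)\<^sup>2)\<^sup>2 + (1 / s)\<^sup>2" by simp
 ultimately have "(l / R)\<^sup>2 * (1 / s) <= ((l / R)\<^sup>2)\<^sup>2 + (1 / s)\<^sup>2" by linarith
 then have "(l / R)\<^sup>2 * (1 / s) <= (l / R) ^ 4 + 1 / s\<^sup>2"
  by (simp add: power_divide flip: power_mult)
 then have "R\<^sup>2 * ((l / R)\<^sup>2 * (1 / s)) <= R\<^sup>2 * ((l / R) ^ 4 + 1 / s\<^sup>2)" by (intro mult_left_mono) auto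
 then show ?thesis using assms by (simp add: power_divide)
qed

lemma nn_integral_inv_sq_tail:
 assumes t: "t > 0" shows "(NN s. ennreal (1 / s\<^sup>2) * indicator {t..} s) = ennreal (1 / t)"
proof -
 have "(NN s. ennreal (1 / s\<^sup>2) * indicator {t..} s) = (NN s. ennreal (s powr (- 2)) * indicator {t..} s)"
  by (intro nn_integral_cong) (use t in \<open>auto simp: indicator_def powr_minus powr_numeral divide_inverse\<close>)
 then show ?thesis using nn_integral_powr_tail[OF t, of 2] t by (simp add: powr_minus divide_inverse)
qed

lemma nn_integral_ell_sq:
 assumes t: "t > 0" and R: "R > 0" and r[measurable]: "r \<in> bmeas"
  and b: "tail4 t r <= ennreal (R ^ 4 / t)"
 shows "(NN s. ennreal ((enn2real (linf (r s)))\<^sup>2 / s) * indicator {t..} s) <= ennreal (2 * R\<^sup>2 / t)"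
proof -
 have "(NN s. ennreal ((enn2real (linf (r s)))\<^sup>2 / s) * indicator {t..} s) <=
  (NN s. ennreal (R\<^sup>2 / R ^ 4) * (linf (r s) ^ 4 * indicator {t..} s) + ennreal (R\<^sup>2) * (ennreal (1 / s\<^sup>2) * indicator {t..} s))"
 proof (rule nn_integral_mono)
  fix s
  define l where "l = enn2real (linf (r s))"
  have l: "ennreal (l ^ 4) <= linf (r s) ^ 4" "0 <= l"
   unfolding l_def using power_mono[OF ennreal_enn2real_le, of "linf (r s)" 4] by (auto simp: ennreal_power)
  have "ennreal (l\<^sup>2 / s) <= ennreal (R\<^sup>2 / R ^ 4 * l ^ 4 + R\<^sup>2 * (1 / s\<^sup>2))"
   using ell_sq_weight[OF R, of l s] by (intro ennreal_leI) (simp add: power_divide distrib_left)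
  also have "... = ennreal (R\<^sup>2 / R ^ 4) * ennreal (l ^ 4) + ennreal (R\<^sup>2) * ennreal (1 / s\<^sup>2)"
   using R l by (simp add: ennreal_mult[symmetric] del: ennreal_plus flip: ennreal_plus)
  also have "... <= ennreal (R\<^sup>2 / R ^ 4) * linf (r s) ^ 4 + ennreal (R\<^sup>2) * ennreal (1 / s\<^sup>2)"
   by (intro add_right_mono mult_left_mono l) auto
  finally show "ennreal ((enn2real (linf (r s)))\<^sup>2 / s) * indicator {t..} s <=
   ennreal (R\<^sup>2 / R ^ 4) * (linf (r s) ^ 4 * indicator {t..} s) + ennreal (R\<^sup>2) * (ennreal (1 / s\<^sup>2) * indicator {t..} s)"
   by (auto simp: indicator_def l_def)
 qed
 also have "... = ennreal (R\<^sup>2 / R ^ 4) * tail4 t r + ennreal (R\<^sup>2) * ennreal (1 / t)"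
  by (simp add: nn_integral_add nn_integral_cmult tail4_def nn_integral_inv_sq_tail[OF t])
 also have "... <= ennreal (R\<^sup>2 / R ^ 4) * ennreal (R ^ 4 / t) + ennreal (R\<^sup>2) * ennreal (1 / t)"
  by (intro add_right_mono mult_left_mono b) simp
 also have "... = ennreal (R\<^sup>2 / R ^ 4 * (R ^ 4 / t) + R\<^sup>2 * (1 / t))"
  using R t by (subst (1 2) ennreal_mult[symmetric]) (auto simp flip: ennreal_plus)
 also have "R\<^sup>2 / R ^ 4 * (R ^ 4 / t) + R\<^sup>2 * (1 / t) = 2 * R\<^sup>2 / t"
 proof -
  have "c / X * (X / t) = c / t" if "X \<noteq> 0" for c X using that by simp
  from this[of "R ^ 4" "R\<^sup>2"] R show ?thesis by (simp only: power_not_zero) (simp add: power_not_zero)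
 qed
 finally show ?thesis .
qed

lemma nn_integral_\<kappa>:
 assumes t: "t > 0" and R: "R > 0" and [measurable]: "r \<in> bmeas" "r' \<in> bmeas"
  and b: "tail4 t r <= ennreal (R ^ 4 / t)" "tail4 t r' <= ennreal (R ^ 4 / t)"
 shows "(NN s. ennreal (\<kappa> r r' s) * indicator {t..} s) <= ennreal ((12 * (n1 u)\<^sup>2 + 24 * R\<^sup>2) / t)"
proof -
 have "(NN s. ennreal (\<kappa> r r' s) * indicator {t..} s) =
  (NN s. ennreal (12 * (n1 u)\<^sup>2) * (ennreal (1 / s\<^sup>2) * indicator {t..} s) +
   (ennreal 6 * (ennreal ((enn2real (linf (r s)))\<^sup>2 / s) * indicator {t..} s) +
    ennreal 6 * (ennreal ((enn2real (linf (r' s)))\<^sup>2 / s) * indicator {t..} s)))"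
 proof (rule nn_integral_cong)
  fix s
  define l l' where "l = enn2real (linf (r s))" and "l' = enn2real (linf (r' s))"
  have "ennreal (\<kappa> r r' s) = ennreal (12 * (n1 u)\<^sup>2) * ennreal (1 / s\<^sup>2) + (ennreal 6 * ennreal (l\<^sup>2 / s) + ennreal 6 * ennreal (l'\<^sup>2 / s))"
   if "t <= s"
  proof -
   have s: "s > 0" using that t by simp
   have "\<kappa> r r' s = 12 * (n1 u)\<^sup>2 * (1 / s\<^sup>2) + (6 * (l\<^sup>2 / s) + 6 * (l'\<^sup>2 / s))"
    by (simp add: \<kappa>_def l_def l'_def)
   then show ?thesis using s
    by (simp only: ennreal_plus ennreal_mult mult_nonneg_nonneg add_nonneg_nonneg zero_le_power2 divide_nonneg_nonneg zero_le_numeral zero_le_one less_imp_le)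
  qed
  then show "ennreal (\<kappa> r r' s) * indicator {t..} s = ennreal (12 * (n1 u)\<^sup>2) * (ennreal (1 / s\<^sup>2) * indicator {t..} s) +
   (ennreal 6 * (ennreal ((enn2real (linf (r s)))\<^sup>2 / s) * indicator {t..} s) +
    ennreal 6 * (ennreal ((enn2real (linf (r' s)))\<^sup>2 / s) * indicator {t..} s))"
   by (cases "t <= s") (simp_all add: l_def l'_def)
 qed
 also have "... = ennreal (12 * (n1 u)\<^sup>2) * ennreal (1 / t) +
   (ennreal 6 * (NN s. ennreal ((enn2real (linf (r s)))\<^sup>2 / s) * indicator {t..} s) +
   ennreal 6 * (NN s. ennreal ((enn2real (linf (r' s)))\<^sup>2 / s) * indicator {t..} s))"
  by (simp add: nn_integral_add nn_integral_cmult nn_integral_inv_sq_tail[OF t])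
 also have "... <= ennreal (12 * (n1 u)\<^sup>2) * ennreal (1 / t) + (ennreal 6 * ennreal (2 * R\<^sup>2 / t) + ennreal 6 * ennreal (2 * R\<^sup>2 / t))"
  by (intro add_mono mult_left_mono nn_integral_ell_sq t R b order_refl) auto
 also have "... = ennreal (12 * (n1 u)\<^sup>2 * (1 / t) + (6 * (2 * R\<^sup>2 / t) + 6 * (2 * R\<^sup>2 / t)))"
  using t R by (simp only: ennreal_plus ennreal_mult mult_nonneg_nonneg add_nonneg_nonneg zero_le_power2 divide_nonneg_nonneg zero_le_numeral zero_le_one less_imp_le)
 also have "12 * (n1 u)\<^sup>2 * (1 / t) + (6 * (2 * R\<^sup>2 / t) + 6 * (2 * R\<^sup>2 / t)) = (12 * (n1 u)\<^sup>2 + 24 * R\<^sup>2) / t"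
  by (simp add: add_divide_distrib)
 finally show ?thesis .
qed

text \<open>Duhamel's formula pulled back by the group: the integrand no longer depends on the final
  time, so increments in time are integrals over intervals.\<close>

definition duh :: "(real => l2) => bool" where
 "duh q \<longleftrightarrow> (\<forall>t\<ge>t0. integrable lborel (\<lambda>s. indicat_real {t0..t} s *\<^sub>R ((1 / s) *\<^sub>R Nem a (q s))) \<and>
   sg (- t) (q t) = sg (- t0) (q t0) + cscale (\<i> * of_real \<sigma>) (LBINT s. indicat_real {t0..t} s *\<^sub>R sg (- s) ((1 / s) *\<^sub>R Nem a (q s))))"

text \<open>Comparing with a later time T instead of with t0 leaves an integral over times after t,
  the form in which decay at infinity can be used.\<close>

lemma duh_difference:
 assumes q: "duh q" and q': "duh q'" and m[measurable]: "q \<in> bmeas" "q' \<in> bmeas"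
  and t: "t0 <= t" "t <= T"
 shows "ennreal (norm (q t - q' t)) <= ennreal (norm (q T - q' T)) +
  (NN s. ennreal (norm ((1 / s) *\<^sub>R (Nem a (q s) - Nem a (q' s)))) * indicator {t..} s)"
proof -
 have a0: "0 <= a" using a by simp
 note [measurable] = Nem_measurable[OF a0]
 let ?N = "\<lambda>s. (1 / s) *\<^sub>R (Nem a (q s) - Nem a (q' s))"
 define P where "P q s = sg (- s) ((1 / s) *\<^sub>R Nem a (q s))" for q and s :: real
 have Pm[measurable]: "P p \<in> bmeas" if "p \<in> bmeas" for p
  using that unfolding P_def by measurable
 have Pi: "integrable lborel (\<lambda>s. indicat_real {t0..\<tau>} s *\<^sub>R P p s)" if "duh p" "t0 <= \<tau>" "p \<in> bmeas" for p \<tau>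
 proof (rule Bochner_Integration.integrable_bound)
  show "integrable lborel (\<lambda>s. indicat_real {t0..\<tau>} s *\<^sub>R ((1 / s) *\<^sub>R Nem a (p s)))" using that by (simp add: duh_def)
 qed (use that in \<open>auto simp: P_def\<close>)
 define D where "D \<tau> = (LBINT s. indicat_real {t0..\<tau>} s *\<^sub>R (P q s - P q' s))" for \<tau>
 have Di: "integrable lborel (\<lambda>s. indicat_real {t0..\<tau>} s *\<^sub>R (P q s - P q' s))" if "t0 <= \<tau>" for \<tau>
  using Bochner_Integration.integrable_diff[OF Pi[OF q that m(1)] Pi[OF q' that m(2)]] by (simp add: scaleR_diff_right)
 have eq: "sg (- \<tau>) (q \<tau> - q' \<tau>) = sg (- t0) (q t0 - q' t0) + cscale (\<i> * of_real \<sigma>) (D \<tau>)" if \<tau>: "t0 <= \<tau>" for \<tau>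
 proof -
  have Deq: "D \<tau> = (LBINT s. indicat_real {t0..\<tau>} s *\<^sub>R P q s) - (LBINT s. indicat_real {t0..\<tau>} s *\<^sub>R P q' s)"
   unfolding D_def scaleR_diff_right
   by (rule Bochner_Integration.integral_diff[OF Pi[OF q \<tau> m(1)] Pi[OF q' \<tau> m(2)]])
  have E: "sg (- \<tau>) (p \<tau>) = sg (- t0) (p t0) + cscale (\<i> * of_real \<sigma>) (LBINT s. indicat_real {t0..\<tau>} s *\<^sub>R P p s)" if "duh p" for p
   using that[unfolded duh_def, rule_format, OF \<tau>] unfolding P_def by (rule conjunct2)
  show ?thesis unfolding sg_diff E[OF q] E[OF q'] Deq cscale.diff_right by (simp only: algebra_simps)
 qed
 have tT: "t0 <= T" using t by simp
 have "sg (- t) (q t - q' t) = sg (- T) (q T - q' T) - cscale (\<i> * of_real \<sigma>) (D T - D t)"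
  unfolding eq[OF t(1)] eq[OF tT] by (simp add: cscale.diff_right)
 then have "norm (sg (- t) (q t - q' t)) <= norm (sg (- T) (q T - q' T)) + norm (cscale (\<i> * of_real \<sigma>) (D T - D t))"
  by (simp only: norm_triangle_ineq4)
 then have n: "norm (q t - q' t) <= norm (q T - q' T) + norm (D T - D t)"
  using \<sigma> by (auto simp: norm_mult)
 have DD: "D T - D t = (LBINT s. (indicat_real {t0..T} s - indicat_real {t0..t} s) *\<^sub>R (P q s - P q' s))"
  unfolding D_def scaleR_diff_left by (rule Bochner_Integration.integral_diff[OF Di[OF tT] Di[OF t(1)], symmetric])
 have "ennreal (norm (D T - D t)) <= (NN s. ennreal (norm ((indicat_real {t0..T} s - indicat_real {t0..t} s) *\<^sub>R (P q s - P q' s))))"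
  unfolding DD by (rule nn_integral_ge_norm_integral)
 also have "... <= (NN s. ennreal (norm (?N s)) * indicator {t..} s)"
 proof (rule nn_integral_mono)
  fix s
  have "norm (P q s - P q' s) = norm (?N s)"
   unfolding P_def sg_diff[symmetric] by (simp add: scaleR_diff_right)
  moreover have "\<bar>indicat_real {t0..T} s - indicat_real {t0..t} s\<bar> <= indicat_real {t..} s"
   using t by (auto simp: indicator_def)
  ultimately have "norm ((indicat_real {t0..T} s - indicat_real {t0..t} s) *\<^sub>R (P q s - P q' s)) <= indicat_real {t..} s * norm (?N s)"
   unfolding norm_scaleR by (intro mult_mono) auto
  then have "ennreal (norm ((indicat_real {t0..T} s - indicat_real {t0..t} s) *\<^sub>R (P q s - P q' s))) <= ennreal (indicat_real {t..} s * norm (?N s))"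
   by (rule ennreal_leI)
  also have "... = ennreal (norm (?N s)) * indicator {t..} s"
   by (auto simp: indicator_def)
  finally show "ennreal (norm ((indicat_real {t0..T} s - indicat_real {t0..t} s) *\<^sub>R (P q s - P q' s))) <= ennreal (norm (?N s)) * indicator {t..} s" .
 qed
 finally have D: "ennreal (norm (D T - D t)) <= (NN s. ennreal (norm (?N s)) * indicator {t..} s)" .
 have "ennreal (norm (q t - q' t)) <= ennreal (norm (q T - q' T) + norm (D T - D t))" by (rule ennreal_leI[OF n])
 also have "... = ennreal (norm (q T - q' T)) + ennreal (norm (D T - D t))" by simp
 finally show ?thesis using D by (meson add_left_mono order_trans)
qed

text \<open>Letting T tend to infinity bounds the difference d by an integral of d itself over later
  times. In the weight s^(-1/4) the part 5 a^2 / s costs a factor of at most 1/2; where the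
  remaining kernel has mass at most 1/4, iterating the resulting factor 3/4 gives d = 0.\<close>

lemma duh_unique:
 assumes a_small: "40 * a\<^sup>2 <= 1"
  and rc: "continuous_on UNIV r" "continuous_on UNIV r'"
  and r4: "tail4 t0 r < \<infinity>" "tail4 t0 r' < \<infinity>"
  and decay: "!!t. T0 <= t ==> norm (r t) <= C * t powr (- 1/4)" "!!t. T0 <= t ==> norm (r' t) <= C * t powr (- 1/4)"
  and duh: "duh (\<lambda>t. w t + r t)" "duh (\<lambda>t. w t + r' t)"
  and t: "t0 <= t"
 shows "r t = r' t"
proof -
 define d where "d s = norm (r s - r' s)" for s
 have dc: "continuous_on UNIV d" unfolding d_def using rc by (intro continuous_intros)
 have [measurable]: "r \<in> bmeas" "r' \<in> bmeas" "d \<in> bmeas"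
  using rc dc by (auto intro: borel_measurable_continuous_onI)
 have d0: "0 <= d s" for s by (simp add: d_def)
 have "AE s in lborel. t0 <= s \<longrightarrow> linf (r s) \<noteq> \<infinity>" "AE s in lborel. t0 <= s \<longrightarrow> linf (r' s) \<noteq> \<infinity>"
  by (rule tail4_AE_finite[OF _ r4(1)], measurable) (rule tail4_AE_finite[OF _ r4(2)], measurable)
 then have AEf: "AE s in lborel. t0 <= s \<longrightarrow> linf (r s) \<noteq> \<infinity> \<and> linf (r' s) \<noteq> \<infinity>"
  by eventually_elim auto
 have C0: "0 <= C"
 proof -
  define s where "s = max T0 1"
  have "T0 <= s" by (simp add: s_def)
  then have "0 <= C * s powr (- 1/4)" by (rule order_trans[OF norm_ge_zero decay(1)])
  moreover have "s powr (- 1/4) > 0" by (simp add: s_def)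
  ultimately show ?thesis by (simp add: zero_le_mult_iff)
 qed
 have dd: "d s <= 2 * C * s powr (- 1/4)" if "T0 <= s" for s
  using decay[OF that] norm_triangle_ineq4[of "r s" "r' s"] unfolding d_def by linarith
 have lim0: "(\<lambda>n. ennreal (d (t + real n))) \<longlonglongrightarrow> 0" for t
 proof -
  have "filterlim (\<lambda>n. t + real n) at_top sequentially"
   by (rule filterlim_tendsto_add_at_top[OF tendsto_const filterlim_real_sequentially])
  then have "(\<lambda>n. 2 * C * (t + real n) powr (- 1/4)) \<longlonglongrightarrow> 2 * C * 0"
   by (intro tendsto_mult tendsto_const tendsto_neg_powr) auto
  then have lim: "(\<lambda>n. 2 * C * (t + real n) powr (- 1/4)) \<longlonglongrightarrow> 0" by (simp only: mult_zero_right)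
  have "\<forall>\<^sub>F n in sequentially. T0 <= t + real n"
  proof -
   obtain N :: nat where "T0 - t <= real N" using real_arch_simple by blast
   then have "T0 <= t + real n" if "N <= n" for n using that of_nat_mono[OF that, where 'a=real] by linarith
   then show ?thesis by (rule eventually_sequentiallyI)
  qed
  then have ub: "\<forall>\<^sub>F n in sequentially. d (t + real n) <= 2 * C * (t + real n) powr (- 1/4)"
   by eventually_elim (rule dd)
  have "(\<lambda>n. d (t + real n)) \<longlonglongrightarrow> 0"
   by (rule tendsto_sandwich[OF always_eventually ub tendsto_const lim]) (simp add: d0)
  from tendsto_ennrealI[OF this] show ?thesis by (simp only: ennreal_0)
 qed
 \<comment> \<open>The kernel is cut off where d already vanishes. Its mass after t then counts only
   the region not yet settled, and the smallness criterion can be met again further back in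
   time.\<close>
 define k0 where "k0 s = indicat_real {t0..} s * (if d s = 0 then 0 else \<kappa> r r' s)" for s
 have k0m[measurable]: "k0 \<in> bmeas" unfolding k0_def by measurable
 have k00: "0 <= k0 s" for s using \<kappa>_nonneg[of s r r'] t0 by (auto simp: k0_def indicator_def)
 let ?I = "\<lambda>t. NN s. ennreal ((5 * a\<^sup>2 / s + k0 s) * d s) * indicator {t..} s"
 let ?k = "\<lambda>t. NN s. ennreal (k0 s) * indicator {t..} s"
 have ineq: "ennreal (d t) <= (?I t)" if t: "t0 <= t" for t
 proof -
  have "(NN s. ennreal (norm ((1 / s) *\<^sub>R (Nem a (w s + r s) - Nem a (w s + r' s)))) * indicator {t..} s) <=
    (?I t)"
  proof (rule nn_integral_mono_AE)
   show "AE s in lborel. ennreal (norm ((1 / s) *\<^sub>R (Nem a (w s + r s) - Nem a (w s + r' s)))) * indicator {t..} s <=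
     ennreal ((5 * a\<^sup>2 / s + k0 s) * d s) * indicator {t..} s"
    using AEf
   proof eventually_elim
    case (elim s)
    show ?case
    proof (cases "t <= s")
     case True
     then have s: "t0 <= s" "s > 0" using t t0 by auto
     have "norm ((1 / s) *\<^sub>R (Nem a (w s + r s) - Nem a (w s + r' s))) <= (5 * a\<^sup>2 / s + \<kappa> r r' s) * d s"
      unfolding d_def by (rule Nem_difference) (use s elim in auto)
     also have "... = (5 * a\<^sup>2 / s + k0 s) * d s" using s by (simp add: k0_def)
     finally show ?thesis using True by (simp add: ennreal_leI)
    qed simp
   qed
  qed
  note B = this
  have "ennreal (d t) <= ennreal (d (t + real n)) + (?I t)" for n
  proof -
   have "ennreal (d t) <= ennreal (d (t + real n)) +
    (NN s. ennreal (norm ((1 / s) *\<^sub>R (Nem a (w s + r s) - Nem a (w s + r' s)))) * indicator {t..} s)"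
    using duh_difference[OF duh, of t "t + real n"] t unfolding d_def by simp
   then show ?thesis using B by (meson add_left_mono order_trans)
  qed
  moreover have "(\<lambda>n. ennreal (d (t + real n)) + (?I t))
   \<longlonglongrightarrow> 0 + (?I t)"
   by (intro tendsto_add lim0 tendsto_const)
  ultimately show ?thesis by (intro LIMSEQ_le_const[where X="\<lambda>n. ennreal (d (t + real n)) + (?I t)"]) auto
 qed
 have improve: "\<forall>s\<ge>t. d s <= 3/4 * M * s powr (- 1/4)"
  if t: "t0 <= t" and M: "0 <= M" "\<forall>s\<ge>t. d s <= M * s powr (- 1/4)"
   and small: "(?k t) <= ennreal (1/4)" for t M
 proof (intro allI impI)
  fix \<tau> assume \<tau>: "t <= \<tau>"
  have \<tau>0: "\<tau> > 0" using t \<tau> t0 by linarith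
  have "ennreal (d \<tau>) <= (?I \<tau>)"
   using t \<tau> by (intro ineq) auto
  also have "... <= (NN s. ennreal M * (ennreal (5 * a\<^sup>2 / s * s powr (- 1/4)) * indicator {\<tau>..} s) +
    ennreal (M * \<tau> powr (- 1/4)) * (ennreal (k0 s) * indicator {t..} s))"
  proof (rule nn_integral_mono)
   fix s
   show "ennreal ((5 * a\<^sup>2 / s + k0 s) * d s) * indicator {\<tau>..} s <= ennreal M * (ennreal (5 * a\<^sup>2 / s * s powr (- 1/4)) * indicator {\<tau>..} s) +
    ennreal (M * \<tau> powr (- 1/4)) * (ennreal (k0 s) * indicator {t..} s)"
   proof (cases "\<tau> <= s")
    case True
    then have s: "s > 0" "t <= s" using \<tau>0 \<tau> by auto
    have p: "s powr (- 1/4) <= \<tau> powr (- 1/4)" using True \<tau>0 by (intro powr_mono2') auto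
    have "(5 * a\<^sup>2 / s + k0 s) * d s <= (5 * a\<^sup>2 / s + k0 s) * (M * s powr (- 1/4))"
     using M(2) s k00[of s] by (intro mult_left_mono add_nonneg_nonneg) auto
    also have "... = M * (5 * a\<^sup>2 / s * s powr (- 1/4)) + (M * s powr (- 1/4)) * k0 s" by (simp add: algebra_simps)
    also have "... <= M * (5 * a\<^sup>2 / s * s powr (- 1/4)) + (M * \<tau> powr (- 1/4)) * k0 s"
     using p M(1) k00[of s] by (intro add_left_mono mult_right_mono mult_left_mono) auto
    finally have "ennreal ((5 * a\<^sup>2 / s + k0 s) * d s) <= ennreal (M * (5 * a\<^sup>2 / s * s powr (- 1/4)) + (M * \<tau> powr (- 1/4)) * k0 s)"
     by (rule ennreal_leI)
    also have "... = ennreal M * ennreal (5 * a\<^sup>2 / s * s powr (- 1/4)) + ennreal (M * \<tau> powr (- 1/4)) * ennreal (k0 s)"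
     by (rule ennreal_sum_mult) (use M(1) s k00[of s] in auto)
    finally show ?thesis using True s by simp
   qed simp
  qed
  also have "... = ennreal M * ennreal (20 * a\<^sup>2 * \<tau> powr (- 1/4)) + ennreal (M * \<tau> powr (- 1/4)) * (?k t)"
   by (simp add: nn_integral_add nn_integral_cmult nn_integral_main_weight[OF \<tau>0, simplified])
  also have "... <= ennreal M * ennreal (20 * a\<^sup>2 * \<tau> powr (- 1/4)) + ennreal (M * \<tau> powr (- 1/4)) * ennreal (1/4)"
   by (intro add_left_mono mult_left_mono small) simp
  also have "... = ennreal (M * (20 * a\<^sup>2 * \<tau> powr (- 1/4)) + (M * \<tau> powr (- 1/4)) * (1/4))"
   by (rule ennreal_sum_mult[symmetric]) (use M(1) in auto)
  also have "... <= ennreal (3/4 * M * \<tau> powr (- 1/4))"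
  proof (rule ennreal_leI)
   have "(20 * a\<^sup>2) * (M * \<tau> powr (- 1/4)) <= 1/2 * (M * \<tau> powr (- 1/4))"
    using a_small M(1) by (intro mult_right_mono) auto
   then show "M * (20 * a\<^sup>2 * \<tau> powr (- 1/4)) + M * \<tau> powr (- 1/4) * (1/4) <= 3/4 * M * \<tau> powr (- 1/4)"
    by (simp add: algebra_simps)
  qed
  finally show "d \<tau> <= 3/4 * M * \<tau> powr (- 1/4)" using M(1) by (subst (asm) ennreal_le_iff) auto
 qed
 \<comment> \<open>Decay gives the weighted bound at late times and compactness gives it before; any
   finite M starts the iteration.\<close>
 obtain M where M: "0 <= M" "\<forall>s\<ge>t0. d s <= M * s powr (- 1/4)"
 proof -
  define T1 where "T1 = max T0 t0"
  have cc: "continuous_on {t0..T1} (\<lambda>s. d s * s powr (1/4))"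
   using t0 by (intro continuous_intros continuous_on_subset[OF dc]) auto
  have "bounded ((\<lambda>s. d s * s powr (1/4)) ` {t0..T1})"
   by (rule compact_imp_bounded[OF compact_continuous_image[OF cc]]) simp
  then obtain B where B: "\<forall>y\<in>(\<lambda>s. d s * s powr (1/4)) ` {t0..T1}. norm y <= B"
   unfolding bounded_iff by (elim exE)
  have "d s <= (max B (2 * C)) * s powr (- 1/4)" if s: "t0 <= s" for s
  proof (cases "s <= T1")
   case True
   then have "s \<in> {t0..T1}" using s by simp
   then have "norm (d s * s powr (1/4)) <= B" using B by (metis imageI)
   then have "d s * s powr (1/4) <= max B (2 * C)" by simp
   then have "d s * s powr (1/4) * s powr (- 1/4) <= max B (2 * C) * s powr (- 1/4)" by (intro mult_right_mono) auto
   then show ?thesis using s t0 by (simp add: mult.assoc flip: powr_add)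
  next
   case False
   then have "d s <= 2 * C * s powr (- 1/4)" by (intro dd) (simp add: T1_def)
   also have "... <= max B (2 * C) * s powr (- 1/4)" by (intro mult_right_mono) auto
   finally show ?thesis .
  qed
  then show thesis using that[of "max B (2 * C)"] C0 by auto
 qed
 have vanish: "\<forall>s\<ge>t. d s = 0" if t: "t0 <= t" and small: "(?k t) <= ennreal (1/4)" for t
 proof (intro allI impI)
  fix s assume s: "t <= s"
  have all: "\<forall>s\<ge>t. d s <= ((3/4) ^ n * M) * s powr (- 1/4)" for n
  proof (induction n)
   case 0
   then show ?case using M t by auto
  next
   case (Suc n)
   have "0 <= (3/4) ^ n * M" using M(1) by simp
   from improve[OF t this Suc small] show ?case by (simp add: mult.assoc)
  qed
  have "(\<lambda>n. ((3/4) ^ n * M) * s powr (- 1/4)) \<longlonglongrightarrow> (0 * M) * s powr (- 1/4)"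
   by (intro tendsto_intros LIMSEQ_power_zero) auto
  then have "d s <= (0 * M) * s powr (- 1/4)"
   by (rule LIMSEQ_le_const) (use all s in blast)
  then show "d s = 0" using d0[of s] by simp
 qed
 have k0i: "integrable lborel k0"
 proof -
  \<comment> \<open>Chosen so that R^4 / t0 exceeds both tails; R may be large, as only the
    finiteness of the resulting kernel bound is used.\<close>
  define R where "R = root 4 ((enn2real (tail4 t0 r) + enn2real (tail4 t0 r') + 1) * t0)"
  have pos: "(enn2real (tail4 t0 r) + enn2real (tail4 t0 r') + 1) * t0 > 0"
   using t0 by (intro mult_pos_pos) (auto simp: add_nonneg_pos)
  have R: "R > 0" "R ^ 4 = (enn2real (tail4 t0 r) + enn2real (tail4 t0 r') + 1) * t0"
   using pos by (auto simp: R_def real_root_pow_pos)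
  have "tail4 t0 f <= ennreal (R ^ 4 / t0)" if "tail4 t0 f < \<infinity>" "enn2real (tail4 t0 f) <= R ^ 4 / t0" for f
   using that ennreal_leI[OF that(2)] by simp
  from this[OF r4(1)] this[OF r4(2)] have "tail4 t0 r <= ennreal (R ^ 4 / t0)" "tail4 t0 r' <= ennreal (R ^ 4 / t0)"
   unfolding R(2) using t0 by simp_all
  from nn_integral_\<kappa>[OF t0 R(1) _ _ this] have "(NN s. ennreal (\<kappa> r r' s) * indicator {t0..} s) < \<infinity>"
   by (auto intro: le_less_trans)
  moreover have "(NN s. ennreal (norm (k0 s))) <= (NN s. ennreal (\<kappa> r r' s) * indicator {t0..} s)"
   using k00 by (intro nn_integral_mono) (auto simp: k0_def indicator_def)
  ultimately show ?thesis by (auto simp: integrable_iff_bounded intro: le_less_trans)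
 qed
 \<comment> \<open>By dominated convergence the mass of \<open>k0\<close> on half lines becomes
   small along starting points that eventually leave out each point where \<open>k0\<close> is
   nonzero.\<close>
 have smalltail: "\<exists>n. (?k (ts n)) <= ennreal (1/4)"
  if p: "!!s. k0 s \<noteq> 0 ==> (\<lambda>n. indicat_real {ts n..} s) \<longlonglongrightarrow> 0" for ts :: "nat => real"
 proof -
  have "(\<lambda>n. LBINT s. k0 s * indicat_real {ts n..} s) \<longlonglongrightarrow> (LINT s::real|lborel. 0)"
  proof (rule integral_dominated_convergence[where w=k0])
   show "AE s in lborel. (\<lambda>n. k0 s * indicat_real {ts n..} s) \<longlonglongrightarrow> 0"
   proof (rule AE_I2)
    fix s
    show "(\<lambda>n. k0 s * indicat_real {ts n..} s) \<longlonglongrightarrow> 0"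
    proof (cases "k0 s = 0")
     case False
     from tendsto_mult[OF tendsto_const p[OF this], of "k0 s"] show ?thesis by simp
    qed simp
   qed
  qed (use k0i k00 in \<open>auto simp: indicator_def\<close>)
  then have "\<forall>\<^sub>F n in sequentially. (LBINT s. k0 s * indicat_real {ts n..} s) < 1/4"
   by (intro order_tendstoD(2)) auto
  then obtain n where n: "(LBINT s. k0 s * indicat_real {ts n..} s) < 1/4" by (auto simp: eventually_sequentially)
  have i: "integrable lborel (\<lambda>s. k0 s * indicat_real {ts n..} s)"
   by (rule Bochner_Integration.integrable_bound[OF k0i]) (auto simp: indicator_def)
  have "(?k (ts n)) = (NN s. ennreal (k0 s * indicat_real {ts n..} s))"
   by (intro nn_integral_cong) (auto simp: indicator_def)
  also have "... = ennreal (LBINT s. k0 s * indicat_real {ts n..} s)"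
   by (rule nn_integral_eq_integral[OF i]) (use k00 in auto)
  finally show ?thesis using n by (intro exI[of _ n]) (simp add: ennreal_leI)
 qed
 \<comment> \<open>At the infimum of the settled times d vanishes too, because the inequality there
   integrates zero. If the infimum exceeded t0, \<open>smalltail\<close> would settle a slightly
   earlier time.\<close>
 define Z where "Z = {\<tau>. t0 <= \<tau> \<and> (\<forall>s\<ge>\<tau>. d s = 0)}"
 have Zne: "Z \<noteq> {}"
 proof -
  have "\<exists>n. (?k (t0 + real n)) <= ennreal (1/4)"
  proof (rule smalltail)
   fix s
   obtain N :: nat where "s - t0 < real N" using reals_Archimedean2 by blast
   then have "indicat_real {t0 + real n..} s = 0" if "n \<ge> N" for n using that by (auto simp: indicator_def)
   then show "(\<lambda>n. indicat_real {t0 + real n..} s) \<longlonglongrightarrow> 0"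
    by (intro tendsto_eventually eventually_sequentiallyI[of N])
  qed
  then obtain n where "(?k (t0 + real n)) <= ennreal (1/4)" ..
  from vanish[OF _ this] show ?thesis unfolding Z_def by (auto intro!: exI[of _ "t0 + real n"])
 qed
 have Zbd: "bdd_below Z" unfolding Z_def by (auto intro!: bdd_belowI[of _ t0])
 define \<tau> where "\<tau> = Inf Z"
 have \<tau>t0: "t0 <= \<tau>" unfolding \<tau>_def by (rule cInf_greatest[OF Zne]) (simp add: Z_def)
 have above: "d s = 0" if "\<tau> < s" for s
 proof -
  have "\<exists>z\<in>Z. z < s" using that unfolding \<tau>_def cInf_less_iff[OF Zne Zbd] .
  then show ?thesis by (auto simp: Z_def)
 qed
 have at: "d \<tau> = 0"
 proof -
  have "ennreal (d \<tau>) <= (?I \<tau>)" by (rule ineq[OF \<tau>t0])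
  also have "... = (NN (s::real). 0)"
  proof (rule nn_integral_cong_AE)
   have "AE s in lborel. s \<noteq> \<tau>" by (rule AE_lborel_singleton)
   then show "AE s in lborel. ennreal ((5 * a\<^sup>2 / s + k0 s) * d s) * indicator {\<tau>..} s = 0"
    by eventually_elim (auto simp: indicator_def above)
  qed
  finally show ?thesis using d0[of \<tau>] by (simp add: ennreal_eq_0_iff)
 qed
 have ge: "d s = 0" if "\<tau> <= s" for s using above[of s] at that by (cases "s = \<tau>") auto
 have "\<tau> = t0"
 proof (rule ccontr)
  assume "\<tau> \<noteq> t0"
  then have lt: "t0 < \<tau>" using \<tau>t0 by simp
  define ts where "ts n = max t0 (\<tau> - 1 / real (Suc n))" for n
  have "\<exists>n. (?k (ts n)) <= ennreal (1/4)"
  proof (rule smalltail)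
   fix s assume "k0 s \<noteq> 0"
   then have "s < \<tau>" using ge[of s] by (auto simp: k0_def split: if_splits intro: leI)
   then obtain N where N: "1 / real (Suc N) < \<tau> - s" using nat_approx_posE[of "\<tau> - s"] by auto
   have "indicat_real {ts n..} s = 0" if "n \<ge> N" for n
   proof -
    have "1 / real (Suc n) <= 1 / real (Suc N)" using that by (intro divide_left_mono) auto
    then show ?thesis using N by (auto simp: ts_def indicator_def)
   qed
   then show "(\<lambda>n. indicat_real {ts n..} s) \<longlonglongrightarrow> 0"
    by (intro tendsto_eventually eventually_sequentiallyI[of N])
  qed
  then obtain n where n: "(?k (ts n)) <= ennreal (1/4)" ..
  have "ts n \<in> Z" using vanish[OF _ n] by (auto simp: Z_def ts_def)
  then have "\<tau> <= ts n" unfolding \<tau>_def by (rule cInf_lower[OF _ Zbd])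
  moreover have "ts n < \<tau>" using lt by (auto simp: ts_def)
  ultimately show False by simp
 qed
 then have "d t = 0" using ge[of t] t by simp
 then show ?thesis by (simp add: d_def)
qed

end

section \<open>The source term\<close>

lemma continuous_indefinite_integral:
 fixes f :: "real => 'a::{banach, second_countable_topology}"
 assumes f: "integrable lborel f"
 shows "continuous_on UNIV (\<lambda>t. LBINT s. indicat_real {b..t} s *\<^sub>R f s)"
proof (rule continuous_at_imp_continuous_on, rule ballI)
 fix t :: real
 have fm[measurable]: "f \<in> bmeas" using borel_measurable_integrable[OF f] by simp
 show "isCont (\<lambda>t. LBINT s. indicat_real {b..t} s *\<^sub>R f s) t"
  unfolding continuous_at_sequentially o_def
 proof (intro allI impI)
  fix X :: "nat => real" assume X: "X \<longlonglongrightarrow> t"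
  show "(\<lambda>n. LBINT s. indicat_real {b..X n} s *\<^sub>R f s) \<longlonglongrightarrow> (LBINT s. indicat_real {b..t} s *\<^sub>R f s)"
  proof (rule integral_dominated_convergence[where w="\<lambda>s. norm (f s)"])
   have "AE s in lborel. s \<noteq> t" by (rule AE_lborel_singleton)
   then show "AE s in lborel. (\<lambda>n. indicat_real {b..X n} s *\<^sub>R f s) \<longlonglongrightarrow> indicat_real {b..t} s *\<^sub>R f s"
   proof eventually_elim
    case (elim s)
    have "\<forall>\<^sub>F n in sequentially. indicat_real {b..X n} s = indicat_real {b..t} s"
    proof (cases "s < t")
     case True
     from order_tendstoD(1)[OF X this] show ?thesis by eventually_elim (use True in \<open>auto simp: indicator_def\<close>)
    next
     case False
     then have "t < s" using elim by simp
     from order_tendstoD(2)[OF X this] show ?thesis by eventually_elim (use \<open>t < s\<close> in \<open>auto simp: indicator_def\<close>)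
    qed
    then have "\<forall>\<^sub>F n in sequentially. indicat_real {b..X n} s *\<^sub>R f s = indicat_real {b..t} s *\<^sub>R f s"
     by eventually_elim simp
    then show ?case by (rule tendsto_eventually)
   qed
  qed (use f in \<open>auto simp: indicator_def\<close>)
 qed
qed

lemma n1_cnj:
 assumes "integrable lborel (rep_l2 f)"
 shows "integrable lborel (rep_l2 (cnj_l2 f))" "n1 (cnj_l2 f) = n1 f"
proof -
 have "integrable lborel (rep_l2 (cnj_l2 f)) \<longleftrightarrow> integrable lborel (\<lambda>x. cnj (rep_l2 f x))"
  by (rule integrable_cong_AE[OF _ _ rep_cnj]) measurable
 moreover have "integrable lborel (\<lambda>x. cnj (rep_l2 f x))" using assms by simp
 ultimately show "integrable lborel (rep_l2 (cnj_l2 f))" by simp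
 have "AE x in lborel. norm (rep_l2 (cnj_l2 f) x) = norm (rep_l2 f x)"
  using rep_cnj[of f] by eventually_elim simp
 then show "n1 (cnj_l2 f) = n1 f"
  unfolding n1_def by (intro integral_cong_AE) measurable
qed

text \<open>Young's inequality with exponents 4/3 and 4 and a free parameter A; the power s^(-4/3)
  dual to the fourth power of l is integrable at infinity.\<close>

lemma young_weight:
 fixes s A l :: real
 assumes s: "s > 0" and A: "A > 0" and l: "l \<ge> 0"
 shows "1 / s * l <= A * s powr (- 4/3) + 1 / A ^ 3 * l ^ 4"
proof (cases "l <= A * s powr (- 1/3)")
 case True
 have "1 / s * l <= 1 / s * (A * s powr (- 1/3))" using True s by (intro mult_left_mono) auto
 also have "... = A * s powr (- 4/3)" using powr_divide_self[OF s, of "- 1/3"] by (simp add: field_simps)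
 finally show ?thesis using A l by (simp add: add_increasing2)
next
 case False
 then have "(A * s powr (- 1/3)) ^ 3 <= l ^ 3" using A by (intro power_mono) auto
 moreover have "(A * s powr (- 1/3)) ^ 3 = A ^ 3 * (1 / s)"
 proof -
  have "(s powr (- 1/3)) ^ 3 = s powr (- 1)" using s by (simp add: powr_power)
  also have "... = 1 / s" using s by (simp add: powr_minus_divide)
  finally show ?thesis by (simp only: power_mult_distrib)
 qed
 ultimately have "A ^ 3 * (1 / s) <= l ^ 3" by simp
 then have "1 / s <= l ^ 3 / A ^ 3" using A by (simp add: pos_le_divide_eq mult.commute)
 then have "1 / s * l <= l ^ 3 / A ^ 3 * l" using l by (rule mult_right_mono)
 also have "... = 1 / A ^ 3 * l ^ 4" by (simp add: power_eq_if)
 finally show ?thesis using A by (simp add: add_increasing)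
qed

text \<open>Rescaling time even gains a factor 1/2, which is given away.\<close>

lemma strichartz_double: "(NN t. linf (sg (2 * t) f) ^ 4) <= ennreal (196 * norm f ^ 4)"
proof -
 have "1 * X <= ennreal \<bar>2\<bar> * X" for X by (intro mult_right_mono) simp_all
 then have "(NN t. linf (sg (2 * t) f) ^ 4) <= ennreal \<bar>2\<bar> * (NN t. linf (sg (0 + 2 * t) f) ^ 4)"
  by (simp only: mult_1 add_0)
 also have "... = (NN t. linf (sg t f) ^ 4)"
  by (rule nn_integral_real_affine[symmetric]) simp_all
 also have "... <= ennreal (196 * norm f ^ 4)" by (rule strichartz)
 finally show ?thesis .
qed

lemma nn_integral_source_weight:
 assumes t: "t > 0" and \<phi>: "norm \<phi> <= 1"
 shows "(NN s. ennreal (1 / s) * linf (sg (2 * s) \<phi>) * indicator {t..} s) <= ennreal (16 * t powr (- 1/4))"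
proof -
 \<comment> \<open>The exponent 1/12 gives both Young terms the order t^(-1/4): the coefficients are
   12 and 196/64, together at most 16.\<close>
 define A where "A = 4 * t powr (1/12)"
 have A: "A > 0" using t by (simp add: A_def)
 have Am: "1 / A ^ 3 = 1 / 64 * t powr (- 1/4)"
 proof -
  have "(t powr (1/12)) ^ 3 = t powr (1/4)" using t by (simp add: powr_power)
  then have "A ^ 3 = 64 * t powr (1/4)" unfolding A_def power_mult_distrib by simp
  moreover have "t powr (- 1/4) = 1 / t powr (1/4)" using powr_minus_divide[of t "1/4"] by simp
  ultimately show ?thesis by simp
 qed
 have "(NN s. ennreal (1 / s) * linf (sg (2 * s) \<phi>) * indicator {t..} s) <=
  (NN s. ennreal A * (ennreal (s powr (- (4/3))) * indicator {t..} s) + ennreal (1 / A ^ 3) * linf (sg (2 * s) \<phi>) ^ 4)"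
 proof (rule nn_integral_mono)
  fix s
  show "ennreal (1 / s) * linf (sg (2 * s) \<phi>) * indicator {t..} s <= ennreal A * (ennreal (s powr (- (4/3))) * indicator {t..} s) + ennreal (1 / A ^ 3) * linf (sg (2 * s) \<phi>) ^ 4"
  proof (cases "t <= s")
   case True
   then have s: "s > 0" using t by simp
   show ?thesis
   proof (cases "linf (sg (2 * s) \<phi>)")
    case (real l)
    have "ennreal (1 / s * l) <= ennreal (A * s powr (- (4/3)) + 1 / A ^ 3 * l ^ 4)"
     using young_weight[OF s A real(1)] by (intro ennreal_leI) simp
    also have "... = ennreal A * ennreal (s powr (- (4/3))) + ennreal (1 / A ^ 3) * ennreal (l ^ 4)"
     by (rule ennreal_sum_mult) (use A real(1) in auto)
    finally have "ennreal (1 / s) * ennreal l <= ennreal A * ennreal (s powr (- (4/3))) + ennreal (1 / A ^ 3) * ennreal (l ^ 4)"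
     using s real(1) by (subst ennreal_mult[symmetric]) auto
    then show ?thesis using True real by (simp add: ennreal_power)
   next
    case top
    then show ?thesis using A by (simp add: ennreal_mult_top ennreal_top_mult power_eq_top_ennreal)
   qed
  qed simp
 qed
 also have "... = ennreal A * ennreal (t powr (1 - 4/3) / (4/3 - 1)) + ennreal (1 / A ^ 3) * (NN s. linf (sg (2 * s) \<phi>) ^ 4)"
  using nn_integral_powr_tail[OF t, of "4/3"] by (subst nn_integral_add) (auto simp: nn_integral_cmult)
 also have "... <= ennreal A * ennreal (t powr (1 - 4/3) / (4/3 - 1)) + ennreal (1 / A ^ 3) * ennreal 196"
 proof (intro add_left_mono mult_left_mono)
  have "196 * norm \<phi> ^ 4 <= 196" using power_le_one[of "norm \<phi>" 4] \<phi> by simp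
  then show "(NN s. linf (sg (2 * s) \<phi>) ^ 4) <= ennreal 196"
   by (rule order_trans[OF strichartz_double ennreal_leI])
 qed simp
 also have "... = ennreal (A * (t powr (1 - 4/3) / (4/3 - 1)) + 1 / A ^ 3 * 196)"
  by (rule ennreal_sum_mult[symmetric]) (use A in auto)
 also have "... <= ennreal (16 * t powr (- 1/4))"
 proof (rule ennreal_leI)
  have "t powr (1/12) * t powr (- 1/3) = t powr (- 1/4)" by (simp flip: powr_add)
  then have e: "A * (t powr (1 - 4/3) / (4/3 - 1)) = 12 * t powr (- 1/4)" unfolding A_def by (simp add: mult.assoc)
  then show "A * (t powr (1 - 4/3) / (4/3 - 1)) + 1 / A ^ 3 * 196 <= 16 * t powr (- 1/4)"
   unfolding Am e using powr_ge_zero[of t "- 1/4"] by linarith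
 qed
 finally show ?thesis .
qed

context nls
begin

section \<open>The oscillating linear source and the correction it generates\<close>

definition k :: "real => l2" where "k s = (1 / s) *\<^sub>R sg (- s) (cnj_l2 (w s))"

lemma cnj_measurable_l2[measurable]: "cnj_l2 \<in> bmeas"
 by (intro borel_measurable_continuous_onI linear_continuous_on bounded_linear_cnj_l2)

lemma k_measurable[measurable]: "k \<in> bmeas"
 unfolding k_def[abs_def] by measurable

lemma k_eq: "k s = cscale (of_real (1 / s) * cnj (phase s)) (sg (- (2 * s)) (cnj_l2 u))"
proof -
 have "- s + - s = - (2 * s)" by simp
 then show ?thesis unfolding k_def w_def cnj_l2_cscale cnj_sg sg_cscale sg_sg scaleR_cscale cscale_assoc by (simp only:)
qed

lemma norm_k: "s > 0 ==> norm (k s) = norm u / s"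
 by (simp add: k_def)

lemma k_integrable:
 assumes A[measurable]: "A \<in> sets borel" and s: "A \<subseteq> {t..T}" and t: "t > 0"
 shows "integrable lborel (\<lambda>s. indicat_real A s *\<^sub>R k s)"
proof (rule Bochner_Integration.integrable_bound[where f="\<lambda>s. indicat_real {t..T} s * (norm u / t)"])
 show "AE s in lborel. norm (indicat_real A s *\<^sub>R k s) <= norm (indicat_real {t..T} s * (norm u / t))"
 proof (rule AE_I2)
  fix s
  show "norm (indicat_real A s *\<^sub>R k s) <= norm (indicat_real {t..T} s * (norm u / t))"
  proof (cases "s \<in> A")
   case True
   then have "t <= s" "s <= T" using s by auto
   then have "norm u / s <= norm u / t" using t by (intro divide_left_mono) auto
   then show ?thesis using True \<open>t <= s\<close> \<open>s <= T\<close> t by (simp add: norm_k)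
  qed simp
 qed
 show "integrable lborel (\<lambda>s. indicat_real {t..T} s * (norm u / t))"
   by (intro integrable_mult_left integrable_real_indicator emeasure_bounded_finite) auto
qed simp

text \<open>The function \<open>k\<close> is not integrable at infinity, its norm being \<open>norm u / s\<close>.  The bound, uniform
 in \<open>A\<close>, comes from pairing with \<open>sg (2 s) \<phi>\<close> and the Strichartz estimate for the latter.\<close>

lemma k_integral_bound:
 assumes A[measurable]: "A \<in> sets borel" and s: "A \<subseteq> {t..T}" and t: "t > 0"
 shows "norm (LBINT s. indicat_real A s *\<^sub>R k s) <= 16 * n1 u * t powr (- 1/4)"
proof -
 define J where "J = (LBINT s. indicat_real A s *\<^sub>R k s)"
 note i = k_integrable[OF A s t]
 note nc = n1_cnj[OF u]
 \<comment> \<open>Pairing J with its normalisation recovers the norm; for J = 0 the quotient is 0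
   and both sides vanish.\<close>
 define \<phi> where "\<phi> = (1 / norm J) *\<^sub>R J"
 have \<phi>: "norm \<phi> <= 1" by (simp add: \<phi>_def)
 have "ennreal (norm J) = ennreal (norm (cinner J \<phi>))"
  by (cases "J = 0") (auto simp: \<phi>_def cinner_self norm_divide norm_mult power2_eq_square simp flip: of_real_mult)
 also have "cinner J \<phi> = (LBINT s. cinner (indicat_real A s *\<^sub>R k s) \<phi>)"
  unfolding J_def by (rule cinner_integral_left[OF i])
 also have "ennreal (norm \<dots>) <= (NN s. ennreal (norm (cinner (indicat_real A s *\<^sub>R k s) \<phi>)))"
  by (rule nn_integral_ge_norm_integral)
 also have "... <= (NN s. ennreal (n1 u) * (ennreal (1 / s) * linf (sg (2 * s) \<phi>) * indicator {t..} s))"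
 proof (rule nn_integral_mono)
  fix s
  show "ennreal (norm (cinner (indicat_real A s *\<^sub>R k s) \<phi>)) <= ennreal (n1 u) * (ennreal (1 / s) * linf (sg (2 * s) \<phi>) * indicator {t..} s)"
  proof (cases "s \<in> A")
   case True
   then have st: "t <= s" using s by auto
   then have s0: "s > 0" using t by simp
   have e: "norm (cinner (k s) \<phi>) = 1 / s * norm (cinner (sg (2 * s) \<phi>) (cnj_l2 u))"
   proof -
    have "cinner (k s) \<phi> = (of_real (1 / s) * cnj (phase s)) * cinner (cnj_l2 u) (sg (2 * s) \<phi>)"
     unfolding k_eq cinner_cscale_left cinner_sg_adj by simp
    then show ?thesis using s0 cinner_commute[of "cnj_l2 u" "sg (2 * s) \<phi>"] by (simp add: norm_mult norm_divide)
   qed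
   show ?thesis
   proof (cases "linf (sg (2 * s) \<phi>)")
    case (real l)
    have "norm (cinner (sg (2 * s) \<phi>) (cnj_l2 u)) <= l * n1 (cnj_l2 u)"
     by (rule cinner_le_linf_n1[OF nc(1)]) (use real in auto)
    then have "norm (cinner (k s) \<phi>) <= 1 / s * (l * n1 u)"
     unfolding e nc(2) using s0 by (intro mult_left_mono) auto
    then have "ennreal (norm (cinner (k s) \<phi>)) <= ennreal (1 / s * (l * n1 u))" by (rule ennreal_leI)
    also have "... = ennreal (n1 u) * (ennreal (1 / s) * ennreal l)"
     using s0 real(1) n1_nonneg[of u] by (simp add: ennreal_mult[symmetric] mult_ac)
    finally show ?thesis using True st real by simp
   next
    \<comment> \<open>An infinite sup norm makes the right-hand side infinite unless
      \<open>n1 u = 0\<close>, where 0 times infinity is 0. In that case u vanishes, and the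
      left-hand side with it.\<close>
    case top
    show ?thesis
    proof (cases "n1 u = 0")
     case True
     have "sg (2 * s) \<phi> = sg (2 * s) \<phi>" ..
     have "norm (cinner (cnj_l2 u) (sg (2 * s) \<phi>)) = 0"
     proof -
      have "AE x in lborel. norm (rep_l2 u x) = 0"
       using True u integral_nonneg_eq_0_iff_AE[of lborel "\<lambda>x. norm (rep_l2 u x)"] unfolding n1_def by simp
      then have "AE x in lborel. rep_l2 u x = rep_l2 0 x" using rep_zero by eventually_elim simp
      then have "u = 0" by (rule l2_eqI)
      then show ?thesis using linear_0[OF bounded_linear.linear[OF bounded_linear_cnj_l2]] by (simp add: cinner.zero_left)
     qed
     then have "norm (cinner (k s) \<phi>) = 0" unfolding e using cinner_commute[of "cnj_l2 u" "sg (2 * s) \<phi>"] by simp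
     then show ?thesis using \<open>s \<in> A\<close> by simp
    next
     case False
     then have "n1 u > 0" using n1_nonneg[of u] by simp
     then show ?thesis using top st s0 by (simp add: ennreal_mult_top)
    qed
   qed
  qed (simp add: cinner.zero_left)
 qed
 also have "... = ennreal (n1 u) * (NN s. ennreal (1 / s) * linf (sg (2 * s) \<phi>) * indicator {t..} s)"
  by (rule nn_integral_cmult) measurable
 also have "... <= ennreal (n1 u) * ennreal (16 * t powr (- 1/4))"
  by (intro mult_left_mono nn_integral_source_weight t \<phi>) simp
 also have "... = ennreal (16 * n1 u * t powr (- 1/4))"
  using n1_nonneg[of u] by (subst ennreal_mult[symmetric]) (auto simp: mult_ac)
 finally show ?thesis using n1_nonneg[of u] unfolding J_def by (subst (asm) ennreal_le_iff) auto
qed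

definition K :: "real => l2" where "K t = (LBINT s. indicat_real {t0..t} s *\<^sub>R k s)"

lemma K_diff:
 assumes "t0 <= t" "t <= T"
 shows "K T - K t = (LBINT s. indicat_real {t<..T} s *\<^sub>R k s)"
proof -
 have i: "integrable lborel (\<lambda>s. indicat_real {t0..T} s *\<^sub>R k s)" for T
  by (rule k_integrable[OF _ order_refl t0]) simp
 have "K T - K t = (LBINT s. indicat_real {t0..T} s *\<^sub>R k s - indicat_real {t0..t} s *\<^sub>R k s)"
  unfolding K_def by (rule Bochner_Integration.integral_diff[OF i i, symmetric])
 also have "... = (LBINT s. indicat_real {t<..T} s *\<^sub>R k s)"
  by (rule Bochner_Integration.integral_cong) (use assms in \<open>auto simp: indicator_def\<close>)
 finally show ?thesis .
qed

lemma K_diff_bound: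
 assumes "t0 <= t" "t <= T"
 shows "norm (K T - K t) <= 16 * n1 u * t powr (- 1/4)"
 unfolding K_diff[OF assms] by (rule k_integral_bound[where T=T]) (use assms t0 in auto)

lemma K_t0: "K t0 = 0"
proof -
 have "K t0 = (LINT s::real|lborel. (0::l2))"
  unfolding K_def
 proof (rule integral_cong_AE)
  have "AE s in lborel. s \<noteq> t0" by (rule AE_lborel_singleton)
  then show "AE s in lborel. indicat_real {t0..t0} s *\<^sub>R k s = 0" by eventually_elim simp
 qed measurable
 then show ?thesis by simp
qed

text \<open>The integral of k over all times after t0, which exists conditionally; by
  \<open>K_diff_bound\<close> the curve is Cauchy at infinity, so the limit along integer steps
  determines it.\<close>

definition Kinf :: l2 where "Kinf = lim (\<lambda>n. K (t0 + real n))"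

lemma K_tendsto: "(\<lambda>n. K (t0 + real n)) \<longlonglongrightarrow> Kinf"
 unfolding Kinf_def convergent_LIMSEQ_iff[symmetric]
proof (rule Cauchy_convergent, rule metric_CauchyI)
 fix e :: real assume e: "e > 0"
 have "filterlim (\<lambda>n. t0 + real n) at_top sequentially"
  by (rule filterlim_tendsto_add_at_top[OF tendsto_const filterlim_real_sequentially])
 then have "(\<lambda>n. 16 * n1 u * (t0 + real n) powr (- 1/4)) \<longlonglongrightarrow> 16 * n1 u * 0"
  by (intro tendsto_mult tendsto_const tendsto_neg_powr) auto
 then have "\<forall>\<^sub>F n in sequentially. 16 * n1 u * (t0 + real n) powr (- 1/4) < e"
  using e by (intro order_tendstoD(2)) auto
 then obtain N where N: "16 * n1 u * (t0 + real N) powr (- 1/4) < e" by (auto simp: eventually_sequentially)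
 have a: "dist (K (t0 + real m)) (K (t0 + real n)) < e" if "N <= n" "n <= m" for m n
 proof -
  have "dist (K (t0 + real m)) (K (t0 + real n)) <= 16 * n1 u * (t0 + real n) powr (- 1/4)"
   unfolding dist_norm using that by (intro K_diff_bound) auto
  also have "... <= 16 * n1 u * (t0 + real N) powr (- 1/4)"
   using that t0 n1_nonneg[of u] by (intro mult_left_mono powr_mono2') auto
  finally show ?thesis using N by simp
 qed
 have "dist (K (t0 + real m)) (K (t0 + real n)) < e" if "N <= m" "N <= n" for m n
  using a[of n m] a[of m n] that by (cases "n <= m") (auto simp: dist_commute)
 then show "\<exists>M. \<forall>m\<ge>M. \<forall>n\<ge>M. dist (K (t0 + real m)) (K (t0 + real n)) < e" by auto
qed

lemma K_continuous: "continuous_on {t0..} K"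
proof -
 have "(norm u / t0)-lipschitz_on {t0..} K"
 proof (rule lipschitz_onI)
  have a: "dist (K T) (K t) <= norm u / t0 * dist T t" if "t0 <= t" "t <= T" for t T
  proof -
   have "norm (K T - K t) <= (LBINT s. indicat_real {t<..T} s * (norm u / t0))"
    unfolding K_diff[OF that]
   proof (rule Bochner_Integration.integral_norm_bound_integral)
    show "integrable lborel (\<lambda>s. indicat_real {t<..T} s *\<^sub>R k s)"
     by (rule k_integrable[where t=t0 and T=T]) (use that t0 in auto)
    fix s
    show "norm (indicat_real {t<..T} s *\<^sub>R k s) <= indicat_real {t<..T} s * (norm u / t0)"
    proof (cases "s \<in> {t<..T}")
     case True
     then have "norm u / s <= norm u / t0" using that t0 by (intro divide_left_mono) auto
     then show ?thesis using True that t0 by (simp add: norm_k)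
    qed simp
   next
    show "integrable lborel (\<lambda>s. indicat_real {t<..T} s * (norm u / t0))"
   by (intro integrable_mult_left integrable_real_indicator emeasure_bounded_finite) auto
   qed
   also have "... = norm u / t0 * (T - t)" using that by simp
   finally show ?thesis using that by (simp add: dist_norm)
  qed
  fix x y assume "x \<in> {t0..}" "y \<in> {t0..}"
  then show "dist (K x) (K y) <= norm u / t0 * dist x y"
   using a[of x y] a[of y x] by (cases "x <= y") (auto simp: dist_commute)
 qed (use t0 in simp)
 then show ?thesis by (rule lipschitz_on_continuous_on)
qed

text \<open>The solution of the linear equation with source \<open>a\<^sup>2\<close> times cnj w / t
  that vanishes at infinity; the minus sign comes from integrating from infinity down to t.\<close>

definition S :: "real => l2" where "S t = cscale (- (\<i> * of_real (\<sigma> * a\<^sup>2))) (sg t (Kinf - K t))"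

lemma norm_Kinf_diff: "t0 <= t ==> norm (Kinf - K t) <= 16 * n1 u * t powr (- 1/4)"
proof -
 assume t: "t0 <= t"
 have "(\<lambda>n. norm (K (t0 + real n) - K t)) \<longlonglongrightarrow> norm (Kinf - K t)"
  by (intro tendsto_norm tendsto_diff K_tendsto tendsto_const)
 then show ?thesis
 proof (rule LIMSEQ_le_const2)
  obtain N :: nat where N: "t - t0 <= real N" using real_arch_simple by blast
  have "norm (K (t0 + real n) - K t) <= 16 * n1 u * t powr (- 1/4)" if "N <= n" for n
   using N that t by (intro K_diff_bound) auto
  then show "\<exists>N. \<forall>n\<ge>N. norm (K (t0 + real n) - K t) <= 16 * n1 u * t powr (- 1/4)" by blast
 qed
qed

lemma norm_coefficient: "norm (- (\<i> * of_real (\<sigma> * a\<^sup>2) :: complex)) = a\<^sup>2"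
proof -
 have "\<bar>\<sigma>\<bar> = 1" using \<sigma> by auto
 then show ?thesis by (simp only: norm_minus_cancel norm_mult norm_ii norm_of_real abs_mult abs_power2 mult_1)
qed

lemma norm_S: "t0 <= t ==> norm (S t) <= 16 * a\<^sup>2 * n1 u * t powr (- 1/4)"
proof -
 assume "t0 <= t"
 have "norm (S t) = a\<^sup>2 * norm (Kinf - K t)"
  unfolding S_def norm_cscale norm_coefficient norm_sg ..
 also have "... <= a\<^sup>2 * (16 * n1 u * t powr (- 1/4))"
  by (intro mult_left_mono norm_Kinf_diff \<open>t0 <= t\<close>) simp
 finally show ?thesis by (simp add: mult_ac)
qed

lemma S_continuous: "continuous_on {t0..} S"
proof -
 have "continuous_on {t0..} (\<lambda>t. (\<lambda>(s, f). sg s f) (t, Kinf - K t))"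
  by (rule continuous_on_compose2[OF sg_continuous_pair]) (auto intro!: continuous_intros K_continuous)
 then show ?thesis unfolding S_def by (intro cscale.continuous_on continuous_on_const) simp
qed

text \<open>After time t the pulled back source meets U(t) as U(t - 2 s), and the modulus of t - 2 s
  is at least s, so dispersion gives the integrable decay s^(-3/2). In contrast to the L2 bound no
  cancellation is involved; lower semicontinuity reaches the limit \<open>Kinf\<close>.\<close>

lemma linf_S:
 assumes t: "t0 <= t" shows "linf (S t) <= ennreal (2 * a\<^sup>2 * n1 u * t powr (- 1/2))"
proof -
 have tp: "t > 0" using t t0 by simp
 note nc = n1_cnj[OF u]
 have b: "linf (sg t (K T - K t)) <= ennreal (2 * n1 u * t powr (- 1/2))" if T: "t <= T" for T
 proof -
  have i: "integrable lborel (\<lambda>s. indicat_real {t<..T} s *\<^sub>R k s)"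
   by (rule k_integrable[where t=t0 and T=T]) (use t t0 in auto)
  have "sg t (K T - K t) = (LBINT s. sg t (indicat_real {t<..T} s *\<^sub>R k s))"
   unfolding K_diff[OF t T] by (rule integral_bounded_linear[OF bounded_linear_sg i, symmetric])
  also have "linf \<dots> <= (NN s. linf (sg t (indicat_real {t<..T} s *\<^sub>R k s)))"
   by (rule linf_integral[OF integrable_bounded_linear[OF bounded_linear_sg i]])
  also have "... <= (NN s. ennreal (n1 u) * (ennreal (s powr (- (3/2))) * indicator {t..} s))"
  proof (rule nn_integral_mono)
   fix s
   show "linf (sg t (indicat_real {t<..T} s *\<^sub>R k s)) <= ennreal (n1 u) * (ennreal (s powr (- (3/2))) * indicator {t..} s)"
   proof (cases "s \<in> {t<..T}")
    case True
    then have s: "s > 0" "t < s" using tp by auto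
    have "linf (sg t (k s)) <= ennreal (norm (of_real (1 / s) * cnj (phase s))) * linf (sg (t + - (2 * s)) (cnj_l2 u))"
     unfolding k_eq sg_cscale sg_sg by (rule linf_cscale)
    also have "... <= ennreal (1 / s) * ennreal (1 / sqrt \<bar>t + - (2 * s)\<bar> * n1 (cnj_l2 u))"
    proof (rule mult_mono)
     show "ennreal (norm (of_real (1 / s) * cnj (phase s))) <= ennreal (1 / s)"
      using s by (simp add: norm_mult norm_divide)
     show "linf (sg (t + - (2 * s)) (cnj_l2 u)) <= ennreal (1 / sqrt \<bar>t + - (2 * s)\<bar> * n1 (cnj_l2 u))"
      by (rule linf_sg_dispersive[OF nc(1)]) (use s tp in simp)
    qed auto
    also have "... = ennreal (1 / s * (1 / sqrt \<bar>t + - (2 * s)\<bar> * n1 (cnj_l2 u)))"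
     using s n1_nonneg by (subst ennreal_mult) auto
    also have "... <= ennreal (n1 u * s powr (- (3/2)))"
    proof (rule ennreal_leI)
     have "sqrt s <= sqrt \<bar>t + - (2 * s)\<bar>" using s by simp
     then have "1 / sqrt \<bar>t + - (2 * s)\<bar> <= 1 / sqrt s" using s by (intro divide_left_mono mult_pos_pos) auto
     then have "1 / s * (1 / sqrt \<bar>t + - (2 * s)\<bar> * n1 u) <= 1 / s * (1 / sqrt s * n1 u)"
      using s n1_nonneg[of u] by (intro mult_left_mono mult_right_mono) auto
     also have "1 / s * (1 / sqrt s * n1 u) = n1 u * s powr (- (3/2))"
     proof -
      have "s powr (- (1/2)) / s = s powr (- (3/2))" using powr_divide_self[OF s(1), of "- (1/2)"] by simp
      moreover have "1 / sqrt s = s powr (- (1/2))" using s by (simp only: powr_minus_divide powr_half_sqrt less_imp_le)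
      moreover have "1 / s * (1 / sqrt s * n1 u) = n1 u * (1 / sqrt s / s)" by simp
      ultimately show ?thesis by (simp only:)
     qed
     finally show "1 / s * (1 / sqrt \<bar>t + - (2 * s)\<bar> * n1 (cnj_l2 u)) <= n1 u * s powr (- (3/2))" unfolding nc(2) .
    qed
    also have "... = ennreal (n1 u) * ennreal (s powr (- (3/2)))" using n1_nonneg by (intro ennreal_mult) auto
    finally show ?thesis using True by simp
   qed simp
  qed
  also have "... = ennreal (n1 u) * ennreal (t powr (1 - 3/2) / (3/2 - 1))"
   using nn_integral_powr_tail[OF tp, of "3/2"] by (subst nn_integral_cmult) auto
  also have "... = ennreal (n1 u * (t powr (1 - 3/2) / (3/2 - 1)))"
   using n1_nonneg by (intro ennreal_mult[symmetric]) auto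
  also have "n1 u * (t powr (1 - 3/2) / (3/2 - 1)) = 2 * n1 u * t powr (- 1/2)" by simp
  finally show ?thesis .
 qed
 have "(\<lambda>n. sg t (K (t0 + real n) - K t)) \<longlonglongrightarrow> sg t (Kinf - K t)"
  by (intro sg_tendsto tendsto_const tendsto_diff K_tendsto)
 then have "linf (sg t (Kinf - K t)) <= liminf (\<lambda>n. linf (sg t (K (t0 + real n) - K t)))" by (rule linf_lsc)
 also have "... <= liminf (\<lambda>n::nat. ennreal (2 * n1 u * t powr (- 1/2)))"
 proof (rule Liminf_mono)
  obtain N :: nat where N: "t - t0 <= real N" using real_arch_simple by blast
  have "linf (sg t (K (t0 + real n) - K t)) <= ennreal (2 * n1 u * t powr (- 1/2))" if "N <= n" for n
   using N that by (intro b) auto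
  then show "\<forall>\<^sub>F n in sequentially. linf (sg t (K (t0 + real n) - K t)) <= ennreal (2 * n1 u * t powr (- 1/2))"
   by (rule eventually_sequentiallyI)
 qed
 also have "... = ennreal (2 * n1 u * t powr (- 1/2))" by (simp add: Liminf_const)
 finally have l: "linf (sg t (Kinf - K t)) <= ennreal (2 * n1 u * t powr (- 1/2))" .
 have "linf (S t) <= ennreal (a\<^sup>2) * linf (sg t (Kinf - K t))"
  using linf_cscale[of "- (\<i> * of_real (\<sigma> * a\<^sup>2))" "sg t (Kinf - K t)"] unfolding S_def norm_coefficient .
 also have "... <= ennreal (a\<^sup>2) * ennreal (2 * n1 u * t powr (- 1/2))" by (intro mult_left_mono l) simp
 also have "... = ennreal (2 * a\<^sup>2 * n1 u * t powr (- 1/2))"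
  using n1_nonneg[of u] by (subst ennreal_mult[symmetric]) (auto simp: mult_ac)
 finally show ?thesis .
qed

lemma S_equation: "sg (- t) (S t) = sg (- t0) (S t0) + cscale (\<i> * of_real (\<sigma> * a\<^sup>2)) (K t)"
 unfolding S_def sg_cscale sg_sg K_t0 by (simp add: cscale.diff_right cscale_uminus)

text \<open>The derivative of the phase is i \<sigma> a^2 times the phase over s, and the pulled
  back w is the phase times the fixed u; the fundamental theorem of calculus does the rest.\<close>

lemma w_equation:
 assumes t: "t0 <= t"
 shows "integrable lborel (\<lambda>s. indicat_real {t0..t} s *\<^sub>R ((1 / s) *\<^sub>R sg (- s) (w s)))"
  and "sg (- t) (w t) = sg (- t0) (w t0) + cscale (\<i> * of_real (\<sigma> * a\<^sup>2)) (LBINT s. indicat_real {t0..t} s *\<^sub>R ((1 / s) *\<^sub>R sg (- s) (w s)))"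
proof -
 let ?f = "\<lambda>s. \<sigma> * a\<^sup>2 * ln s"
 define c where "c = \<i> * complex_of_real (\<sigma> * a\<^sup>2)"
 define g where "g s = of_real (1 / s) * phase s" for s
 have gc: "continuous_on {t0..t} g"
  unfolding g_def phase_def using t0 by (intro continuous_intros) auto
 have gm: "set_integrable lborel {t0..t} g" by (rule borel_integrable_atLeastAtMost'[OF gc])
 have d: "(phase has_vector_derivative (c * g s)) (at s within {t0..t})" if "t0 <= s" "s <= t" for s
 proof -
  have s: "s > 0" using that t0 by simp
  have L: "((\<lambda>s. of_real (?f s)) has_vector_derivative complex_of_real (\<sigma> * a\<^sup>2 * (1 / s))) (at s within {t0..t})"
  proof (rule has_vector_derivative_of_real)
   have "(ln has_field_derivative 1 / s) (at s within {t0..t})"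
    using DERIV_ln_divide[OF s] by (rule DERIV_subset) simp
   then show "((\<lambda>s. ?f s) has_field_derivative (\<sigma> * a\<^sup>2 * (1 / s))) (at s within {t0..t})"
    by (rule DERIV_cmult)
  qed
  have o: "(\<lambda>z. exp (\<i> * z)) \<circ> (\<lambda>s. of_real (?f s)) = phase" by (auto simp: phase_def)
  have "((\<lambda>z. exp (\<i> * z)) has_field_derivative (\<i> * exp (\<i> * of_real (?f s)))) (at (of_real (?f s)))"
   by (auto intro!: derivative_eq_intros)
  from field_vector_diff_chain_within[OF L has_field_derivative_at_within[OF this]]
  have "((\<lambda>z. exp (\<i> * z)) \<circ> (\<lambda>s. of_real (?f s)) has_vector_derivative
    of_real (\<sigma> * a\<^sup>2 * (1 / s)) * (\<i> * exp (\<i> * of_real (?f s)))) (at s within {t0..t})" .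
  then have "(phase has_vector_derivative of_real (\<sigma> * a\<^sup>2 * (1 / s)) * (\<i> * exp (\<i> * of_real (?f s)))) (at s within {t0..t})" unfolding o .
  moreover have "of_real (\<sigma> * a\<^sup>2 * (1 / s)) * (\<i> * exp (\<i> * of_real (?f s))) = c * g s"
   by (simp add: c_def g_def phase_def)
  ultimately show ?thesis by (simp only:)
 qed
 have ft: "(LBINT s. indicat_real {t0..t} s *\<^sub>R (c * g s)) = phase t - phase t0"
  by (rule integral_FTC_atLeastAtMost[OF t d]) (auto intro!: continuous_intros gc)
 have e: "indicat_real {t0..t} s *\<^sub>R ((1 / s) *\<^sub>R sg (- s) (w s)) = cscale (indicat_real {t0..t} s *\<^sub>R g s) u" for s
  by (simp add: w_def g_def sg_cscale sg_sg scaleR_cscale scaleR_conv_of_real)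
 have gi: "integrable lborel (\<lambda>s. indicat_real {t0..t} s *\<^sub>R g s)" using gm unfolding set_integrable_def .
 show "integrable lborel (\<lambda>s. indicat_real {t0..t} s *\<^sub>R ((1 / s) *\<^sub>R sg (- s) (w s)))"
  unfolding e by (rule integrable_bounded_linear[OF cscale.bounded_linear_left gi])
 have "cscale c (LBINT s. indicat_real {t0..t} s *\<^sub>R ((1 / s) *\<^sub>R sg (- s) (w s))) = cscale (c * (LBINT s. indicat_real {t0..t} s *\<^sub>R g s)) u"
  unfolding e integral_bounded_linear[OF cscale.bounded_linear_left gi] cscale_assoc ..
 also have "c * (LBINT s. indicat_real {t0..t} s *\<^sub>R g s) = phase t - phase t0"
  unfolding ft[symmetric] integral_mult_right_zero[symmetric] by (simp add: mult_ac)
 finally show "sg (- t) (w t) = sg (- t0) (w t0) + cscale (\<i> * of_real (\<sigma> * a\<^sup>2)) (LBINT s. indicat_real {t0..t} s *\<^sub>R ((1 / s) *\<^sub>R sg (- s) (w s)))"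
  unfolding c_def[symmetric] by (simp add: w_def sg_cscale sg_sg cscale.diff_left)
qed

end

section \<open>The fixed point\<close>

lemma power4_sum_le: "(x + y) ^ 4 <= 8 * x ^ 4 + 8 * y ^ 4" for x y :: ennreal
proof (cases "x = \<infinity> \<or> y = \<infinity>")
 case True
 then show ?thesis by (auto simp: power_eq_top_ennreal ennreal_mult_top)
next
 case False
 then have "\<exists>p q. x = ennreal p \<and> y = ennreal q \<and> 0 <= p \<and> 0 <= q"
  by (intro exI[of _ "enn2real x"] exI[of _ "enn2real y"]) (auto simp: top.not_eq_extremum)
 then obtain p q where pq: "x = ennreal p" "y = ennreal q" "0 <= p" "0 <= q" by auto
 have "((p + q)\<^sup>2)\<^sup>2 <= (2 * p\<^sup>2 + 2 * q\<^sup>2)\<^sup>2" using sq_sum_le[of p q] by (intro power_mono) auto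
 also have "... <= 2 * (2 * p\<^sup>2)\<^sup>2 + 2 * (2 * q\<^sup>2)\<^sup>2" by (rule sq_sum_le)
 finally have le: "(p + q) ^ 4 <= 8 * p ^ 4 + 8 * q ^ 4"
  by (simp only: power2_sum power_mult_distrib power4_eq_xxxx power2_eq_square)
 have "(x + y) ^ 4 = ennreal ((p + q) ^ 4)" using pq by (simp add: ennreal_power flip: ennreal_plus)
 also have "... <= ennreal (8 * p ^ 4 + 8 * q ^ 4)" by (rule ennreal_leI[OF le])
 also have "... = ennreal 8 * ennreal (p ^ 4) + ennreal 8 * ennreal (q ^ 4)" by (rule ennreal_sum_mult) (use pq in auto)
 also have "... = 8 * x ^ 4 + 8 * y ^ 4" using pq by (simp add: ennreal_power)
 finally show ?thesis .
qed

text \<open>\<open>c1\<close> makes the map a contraction with factor 1/16 and ties R to the square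
  root of t0, \<open>c2\<close> bounds the terms that are at least quadratic in w by R/16, and
  \<open>c3\<close> keeps the correction S in a small part of the ball.\<close>

locale nls_small = nls +
 fixes R :: real
 assumes R: "R > 0" and a1: "a <= 1"
  and c1: "20 * a\<^sup>2 + (12 * (n1 u)\<^sup>2 + 24 * R\<^sup>2) / t0 <= 1/16"
  and c2: "norm u * (6 * a * n1 u * t0 powr (- 1/4) + (n1 u)\<^sup>2 * t0 powr (- 3/4)) <= R / 16"
  and c3: "256 * n1 u <= R"
begin

text \<open>The tail bound R^4/t is the fourth power of R t^(-1/4), the rate claimed for the L4
  norm, and is therefore imposed at every t.\<close>

definition ok :: "(real => l2) => bool" where
 "ok r \<longleftrightarrow> continuous_on UNIV r \<and> (\<forall>t\<ge>t0. norm (r t) <= R * t powr (- 1/4)) \<and> (\<forall>t\<ge>t0. tail4 t r <= ennreal (R ^ 4 / t))"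

lemma ok_zero: "ok (\<lambda>s. 0)"
 unfolding ok_def tail4_def using R by auto

lemma ok_measurable: "ok r ==> r \<in> bmeas"
 unfolding ok_def by (intro borel_measurable_continuous_onI) auto

lemma ok_AE_finite: "ok r ==> AE s in lborel. t0 <= s \<longrightarrow> linf (r s) \<noteq> \<infinity>"
proof -
 assume r: "ok r"
 then have "tail4 t0 r <= ennreal (R ^ 4 / t0)" by (simp add: ok_def)
 then have "tail4 t0 r < \<infinity>" by (rule le_less_trans) simp
 then show ?thesis by (rule tail4_AE_finite[OF ok_measurable[OF r]])
qed

text \<open>What is left of the integrand once the two terms linear in w are removed; those are
  carried by \<open>w_equation\<close> and by S. The rest has an integrable L2 norm in time.\<close>

definition G :: "(real => l2) => real => l2" where
 "G r s = indicat_real {t0..} s *\<^sub>R ((1 / s) *\<^sub>R (Nem a (w s + r s) - cscale (of_real (a\<^sup>2)) (w s) - cscale (of_real (a\<^sup>2)) (cnj_l2 (w s))))"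

lemma G_measurable:
 assumes r: "ok r" shows "G r \<in> bmeas"
proof -
 have [measurable]: "r \<in> bmeas" by (rule ok_measurable[OF r])
 have "0 <= a" using a by simp
 note [measurable] = Nem_measurable[OF this]
 show ?thesis unfolding G_def by measurable
qed

text \<open>The share 20 a^2 of the linear term and the kernel mass from
  \<open>nn_integral_\<kappa>\<close> add up to at most 1/16 by \<open>c1\<close>. Differences enter
  in L2 only; the sup norms of r and r' enter through their tails.\<close>

lemma G_difference:
 assumes r: "ok r" "ok r'" and D: "!!s. t0 <= s ==> norm (r s - r' s) <= D * s powr (- 1/4)" "0 <= D" and t: "t0 <= t"
 shows "(NN s. ennreal (norm (G r s - G r' s)) * indicator {t..} s) <= ennreal (D / 16 * t powr (- 1/4))"
proof -
 let ?C = "12 * (n1 u)\<^sup>2 + 24 * R\<^sup>2"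
 let ?m = "\<lambda>s. 5 * a\<^sup>2 / s * s powr (- 1/4)"
 have tp: "t > 0" using t t0 by simp
 have rm[measurable]: "r \<in> bmeas" "r' \<in> bmeas" using r by (auto intro: ok_measurable)
 have "(NN s. ennreal (norm (G r s - G r' s)) * indicator {t..} s) <=
  (NN s. ennreal D * (ennreal (?m s) * indicator {t..} s) +
    ennreal (D * t powr (- 1/4)) * (ennreal (\<kappa> r r' s) * indicator {t..} s))"
 proof (rule nn_integral_mono_AE)
  show "AE s in lborel. ennreal (norm (G r s - G r' s)) * indicator {t..} s <=
    ennreal D * (ennreal (?m s) * indicator {t..} s) +
    ennreal (D * t powr (- 1/4)) * (ennreal (\<kappa> r r' s) * indicator {t..} s)"
   using ok_AE_finite[OF r(1)] ok_AE_finite[OF r(2)]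
  proof eventually_elim
   case (elim s)
   show ?case
   proof (cases "t <= s")
    case True
    then have s: "s > 0" "t0 <= s" using tp t by auto
    have k0: "0 <= \<kappa> r r' s" by (rule \<kappa>_nonneg[OF s(1)])
    have p: "s powr (- 1/4) <= t powr (- 1/4)" using True tp by (intro powr_mono2') auto
    have "G r s - G r' s = (1 / s) *\<^sub>R (Nem a (w s + r s) - Nem a (w s + r' s))"
     using s by (simp add: G_def flip: scaleR_diff_right)
    then have "norm (G r s - G r' s) <= (5 * a\<^sup>2 / s + \<kappa> r r' s) * norm (r s - r' s)"
     using Nem_difference[of s r r'] elim s by (simp only: simp_thms)
    also have "... <= (5 * a\<^sup>2 / s + \<kappa> r r' s) * (D * s powr (- 1/4))"
     using D(1)[OF s(2)] s k0 by (intro mult_left_mono add_nonneg_nonneg) auto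
    also have "... = D * (?m s) + (D * s powr (- 1/4)) * \<kappa> r r' s" by (simp add: algebra_simps)
    also have "... <= D * (?m s) + (D * t powr (- 1/4)) * \<kappa> r r' s"
     using p D(2) k0 by (intro add_left_mono mult_right_mono mult_left_mono) auto
    finally have "ennreal (norm (G r s - G r' s)) <= ennreal (D * (?m s) + (D * t powr (- 1/4)) * \<kappa> r r' s)"
     by (rule ennreal_leI)
    also have "... = ennreal D * ennreal (?m s) + ennreal (D * t powr (- 1/4)) * ennreal (\<kappa> r r' s)"
     by (rule ennreal_sum_mult) (use D(2) s k0 in auto)
    finally show ?thesis using True by simp
   qed simp
  qed
 qed
 also have "... = ennreal D * ennreal (20 * a\<^sup>2 * t powr (- 1/4)) + ennreal (D * t powr (- 1/4)) * (NN s. ennreal (\<kappa> r r' s) * indicator {t..} s)"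
  by (simp add: nn_integral_add nn_integral_cmult nn_integral_main_weight[OF tp, simplified])
 also have "... <= ennreal D * ennreal (20 * a\<^sup>2 * t powr (- 1/4)) + ennreal (D * t powr (- 1/4)) * ennreal ((?C) / t)"
  by (intro add_left_mono mult_left_mono nn_integral_\<kappa> tp R rm) (use r t in \<open>auto simp: ok_def\<close>)
 also have "... = ennreal (D * (20 * a\<^sup>2 * t powr (- 1/4)) + (D * t powr (- 1/4)) * ((?C) / t))"
  by (rule ennreal_sum_mult[symmetric]) (use D(2) tp in auto)
 also have "... <= ennreal (D / 16 * t powr (- 1/4))"
 proof (rule ennreal_leI)
  have "(?C) / t <= (?C) / t0"
   using t t0 by (intro divide_left_mono) auto
  then have "20 * a\<^sup>2 + (?C) / t <= 1 / 16" using c1 by linarith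
  then have "(D * t powr (- 1/4)) * (20 * a\<^sup>2 + (?C) / t) <= (D * t powr (- 1/4)) * (1 / 16)"
   using D(2) by (intro mult_left_mono) auto
  then show "D * (20 * a\<^sup>2 * t powr (- 1/4)) + (D * t powr (- 1/4)) * ((?C) / t) <= D / 16 * t powr (- 1/4)"
   by (simp only: distrib_left) (simp add: mult_ac)
 qed
 finally show ?thesis .
qed

text \<open>For r = 0 only terms at least quadratic in w remain. Dispersion gives them s^(-3/2) and
  s^(-2), and \<open>c2\<close> turns the surplus decay, evaluated at t0, into the factor
  R/16.\<close>

lemma G_zero_bound:
 assumes t: "t0 <= t"
 shows "(NN s. ennreal (norm (G (\<lambda>s. 0) s)) * indicator {t..} s) <= ennreal (R / 16 * t powr (- 1/4))"
proof -
 have tp: "t > 0" using t t0 by simp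
 define b c where "b = 3 * a * n1 u * norm u" and "c = (n1 u)\<^sup>2 * norm u"
 have bc: "0 <= b" "0 <= c" using a n1_nonneg[of u] by (auto simp: b_def c_def)
 have "(NN s. ennreal (norm (G (\<lambda>s. 0) s)) * indicator {t..} s) <=
  (NN s. ennreal b * (ennreal (s powr (- (3/2))) * indicator {t..} s) + ennreal c * (ennreal (1 / s\<^sup>2) * indicator {t..} s))"
 proof (rule nn_integral_mono)
  fix s
  show "ennreal (norm (G (\<lambda>s. 0) s)) * indicator {t..} s <= ennreal b * (ennreal (s powr (- (3/2))) * indicator {t..} s) + ennreal c * (ennreal (1 / s\<^sup>2) * indicator {t..} s)"
  proof (cases "t <= s")
   case True
   then have s: "s > 0" "t0 <= s" using tp t by auto
   define m where "m = n1 u / sqrt s"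
   have m: "0 <= m" "m\<^sup>2 = (n1 u)\<^sup>2 / s" using s n1_nonneg[of u] by (auto simp: m_def power_divide)
   have "norm (Nem a (w s) - cscale (of_real (a\<^sup>2)) (w s) - cscale (of_real (a\<^sup>2)) (cnj_l2 (w s))) <= (3 * a * m + m\<^sup>2) * norm (w s)"
    by (rule Nem_remainder) (use a linf_w[OF s(1)] m in \<open>auto simp: m_def\<close>)
   then have "norm (G (\<lambda>s. 0) s) <= 1 / s * ((3 * a * m + m\<^sup>2) * norm u)"
    using s by (simp add: G_def divide_right_mono)
   also have "... = b * s powr (- (3/2)) + c * (1 / s\<^sup>2)"
   proof -
    have "s powr (- (1/2)) / s = s powr (- (3/2))" using powr_divide_self[OF s(1), of "- (1/2)"] by simp
    moreover have "1 / sqrt s = s powr (- (1/2))" using s by (simp only: powr_minus_divide powr_half_sqrt less_imp_le)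
    ultimately have e: "s powr (- (3/2)) = 1 / sqrt s / s" by (simp only:)
    show ?thesis unfolding e m(2) unfolding m_def b_def c_def by (simp add: algebra_simps add_divide_distrib power2_eq_square)
   qed
   finally have "ennreal (norm (G (\<lambda>s. 0) s)) <= ennreal (b * s powr (- (3/2)) + c * (1 / s\<^sup>2))" by (rule ennreal_leI)
   also have "... = ennreal b * ennreal (s powr (- (3/2))) + ennreal c * ennreal (1 / s\<^sup>2)"
    by (rule ennreal_sum_mult) (use bc in auto)
   finally show ?thesis using True by simp
  qed simp
 qed
 also have "... = ennreal b * ennreal (t powr (1 - 3/2) / (3/2 - 1)) + ennreal c * ennreal (1 / t)"
  using nn_integral_powr_tail[OF tp, of "3/2"] nn_integral_inv_sq_tail[OF tp]
  by (subst nn_integral_add) (auto simp: nn_integral_cmult)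
 also have "... = ennreal (b * (t powr (1 - 3/2) / (3/2 - 1)) + c * (1 / t))"
  by (rule ennreal_sum_mult[symmetric]) (use bc tp in auto)
 also have "... <= ennreal (R / 16 * t powr (- 1/4))"
 proof (rule ennreal_leI)
  define p where "p = t powr (- 1/4)"
  have p0: "0 <= p" by (simp add: p_def)
  have h: "t powr (1 - 3/2) / (3/2 - 1) = 2 * (p * t powr (- 1/4))" by (simp add: p_def flip: powr_add)
  have o: "1 / t = p * t powr (- 3/4)"
  proof -
   have "p * t powr (- 3/4) = t powr (- 1)" by (simp add: p_def flip: powr_add)
   also have "... = 1 / t" using tp by (simp add: powr_minus_divide)
   finally show ?thesis ..
  qed
  have "b * (2 * (p * t powr (- 1/4))) + c * (p * t powr (- 3/4)) <= b * (2 * (p * t0 powr (- 1/4))) + c * (p * t0 powr (- 3/4))"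
   using bc p0 t t0 by (intro add_mono mult_left_mono powr_mono2') auto
  also have "... = p * (norm u * (6 * a * n1 u * t0 powr (- 1/4) + (n1 u)\<^sup>2 * t0 powr (- 3/4)))"
   by (simp add: b_def c_def algebra_simps)
  also have "... <= p * (R / 16)" using c2 p0 by (rule mult_left_mono)
  finally show "b * (t powr (1 - 3/2) / (3/2 - 1)) + c * (1 / t) <= R / 16 * t powr (- 1/4)"
   unfolding h o p_def[symmetric] by (simp only: mult.commute)
 qed
 finally show ?thesis .
qed

lemma G_bound:
 assumes r: "ok r" and t: "t0 <= t"
 shows "(NN s. ennreal (norm (G r s)) * indicator {t..} s) <= ennreal (R / 8 * t powr (- 1/4))"
proof -
 note [measurable] = G_measurable[OF r] G_measurable[OF ok_zero]
 have "(NN s. ennreal (norm (G r s)) * indicator {t..} s) <=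
   (NN s. ennreal (norm (G r s - G (\<lambda>s. 0) s)) * indicator {t..} s + ennreal (norm (G (\<lambda>s. 0) s)) * indicator {t..} s)"
 proof (rule nn_integral_mono)
  fix s
  have "norm (G r s) <= norm (G r s - G (\<lambda>s. 0) s) + norm (G (\<lambda>s. 0) s)"
   using norm_triangle_ineq[of "G r s - G (\<lambda>s. 0) s" "G (\<lambda>s. 0) s"] by simp
  then have "ennreal (norm (G r s)) <= ennreal (norm (G r s - G (\<lambda>s. 0) s)) + ennreal (norm (G (\<lambda>s. 0) s))"
   by (simp add: ennreal_leI flip: ennreal_plus)
  then show "ennreal (norm (G r s)) * indicator {t..} s <= ennreal (norm (G r s - G (\<lambda>s. 0) s)) * indicator {t..} s + ennreal (norm (G (\<lambda>s. 0) s)) * indicator {t..} s"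
   by (cases "t <= s") auto
 qed
 also have "... = (NN s. ennreal (norm (G r s - G (\<lambda>s. 0) s)) * indicator {t..} s) + (NN s. ennreal (norm (G (\<lambda>s. 0) s)) * indicator {t..} s)"
  by (rule nn_integral_add) measurable
 also have "... <= ennreal (R / 16 * t powr (- 1/4)) + ennreal (R / 16 * t powr (- 1/4))"
 proof (rule add_mono[OF G_difference[OF r ok_zero _ _ t] G_zero_bound[OF t]])
  show "norm (r s - 0) <= R * s powr (- 1/4)" if "t0 <= s" for s using r that by (simp add: ok_def)
 qed (use R in simp)
 also have "... = ennreal (R / 16 * t powr (- 1/4) + R / 16 * t powr (- 1/4))"
  using R by (intro ennreal_plus[symmetric]) auto
 also have "R / 16 * t powr (- 1/4) + R / 16 * t powr (- 1/4) = R / 8 * t powr (- 1/4)" by simp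
 finally show ?thesis .
qed

lemma G_integrable:
 assumes r: "ok r" shows "integrable lborel (G r)"
proof -
 have "(NN s. ennreal (norm (G r s))) = (NN s. ennreal (norm (G r s)) * indicator {t0..} s)"
  by (intro nn_integral_cong) (auto simp: G_def indicator_def)
 also have "... <= ennreal (R / 8 * t0 powr (- 1/4))" by (rule G_bound[OF r order_refl])
 also have "... < \<infinity>" by simp
 finally show ?thesis using G_measurable[OF r] by (simp add: integrable_iff_bounded)
qed

definition P :: "(real => l2) => real => l2" where "P r s = sg (- s) (G r s)"

lemma P_measurable: "ok r ==> P r \<in> bmeas"
 using G_measurable[of r] unfolding P_def[abs_def] by measurable

lemma P_integrable: "ok r ==> integrable lborel (P r)"
 by (rule Bochner_Integration.integrable_bound[OF G_integrable]) (auto simp: P_measurable, simp add: P_def)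

definition Q :: "(real => l2) => real => l2" where "Q r t = (LBINT s. indicat_real {t0..t} s *\<^sub>R P r s)"

text \<open>The integral from t to infinity, written as a difference so that continuity in t reduces
  to that of an indefinite integral.\<close>

definition T :: "(real => l2) => real => l2" where "T r t = sg t ((LBINT s. P r s) - Q r t)"

lemma indicat_P_integrable: "ok r ==> A \<in> sets borel ==> integrable lborel (\<lambda>s. indicat_real A s *\<^sub>R P r s)"
 by (rule integrable_mult_indicator[OF _ P_integrable]) auto

lemma P_tail:
 assumes r: "ok r" and t: "t0 <= t"
 shows "(LBINT s. P r s) - Q r t = (LBINT s. indicat_real {t..} s *\<^sub>R P r s)"
proof -
 have [measurable]: "P r \<in> bmeas" by (rule P_measurable[OF r])
 have "(LBINT s. P r s) - Q r t = (LBINT s. P r s - indicat_real {t0..t} s *\<^sub>R P r s)"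
  unfolding Q_def by (rule Bochner_Integration.integral_diff[symmetric]) (auto intro: P_integrable[OF r] indicat_P_integrable[OF r])
 also have "... = (LBINT s. indicat_real {t..} s *\<^sub>R P r s)"
 proof (rule integral_cong_AE)
  have "AE s in lborel. s \<noteq> t" by (rule AE_lborel_singleton)
  then show "AE s in lborel. P r s - indicat_real {t0..t} s *\<^sub>R P r s = indicat_real {t..} s *\<^sub>R P r s"
   by eventually_elim (use t in \<open>auto simp: indicator_def P_def G_def\<close>)
 qed measurable
 finally show ?thesis .
qed

lemma T_difference:
 assumes r: "ok r" "ok r'" and D: "!!s. t0 <= s ==> norm (r s - r' s) <= D * s powr (- 1/4)" "0 <= D" and t: "t0 <= t"
 shows "norm (T r t - T r' t) <= D / 16 * t powr (- 1/4)"
proof -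
 have "T r t - T r' t = sg t (LBINT s. indicat_real {t..} s *\<^sub>R P r s - indicat_real {t..} s *\<^sub>R P r' s)"
  unfolding T_def sg_diff[symmetric] P_tail[OF r(1) t] P_tail[OF r(2) t]
  by (subst Bochner_Integration.integral_diff) (auto intro: indicat_P_integrable r)
 then have "ennreal (norm (T r t - T r' t)) = ennreal (norm (LBINT s. indicat_real {t..} s *\<^sub>R P r s - indicat_real {t..} s *\<^sub>R P r' s))"
  by (simp only: norm_sg)
 also have "... <= (NN s. ennreal (norm (indicat_real {t..} s *\<^sub>R P r s - indicat_real {t..} s *\<^sub>R P r' s)))"
  by (rule nn_integral_ge_norm_integral)
 also have "... = (NN s. ennreal (norm (G r s - G r' s)) * indicator {t..} s)"
  by (intro nn_integral_cong) (auto simp: indicator_def P_def simp flip: sg_diff)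
 also have "... <= ennreal (D / 16 * t powr (- 1/4))" by (rule G_difference[OF r D t])
 finally show ?thesis using D(2) by (subst (asm) ennreal_le_iff) auto
qed

lemma norm_T:
 assumes r: "ok r" and t: "t0 <= t"
 shows "norm (T r t) <= R / 8 * t powr (- 1/4)"
proof -
 have "ennreal (norm (T r t)) = ennreal (norm (LBINT s. indicat_real {t..} s *\<^sub>R P r s))"
  unfolding T_def P_tail[OF r t] norm_sg ..
 also have "... <= (NN s. ennreal (norm (indicat_real {t..} s *\<^sub>R P r s)))"
  by (rule nn_integral_ge_norm_integral)
 also have "... = (NN s. ennreal (norm (G r s)) * indicator {t..} s)"
  by (intro nn_integral_cong) (auto simp: indicator_def P_def)
 also have "... <= ennreal (R / 8 * t powr (- 1/4))" by (rule G_bound[OF r t])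
 finally show ?thesis using R by (subst (asm) ennreal_le_iff) auto
qed

text \<open>From t1 on, T is a time ordered integral of the cut-off integrand, so
  \<open>strichartz_retarded\<close> converts the L1 bound of \<open>G_bound\<close> into a tail
  bound; the fourth power of t1^(-1/4) is 1/t1.\<close>

lemma tail4_T:
 assumes r: "ok r" and t: "t0 <= t1"
 shows "tail4 t1 (T r) <= ennreal (196 * (R / 8) ^ 4 / t1)"
proof -
 have tp: "t1 > 0" using t t0 by simp
 define F where "F s = indicat_real {t1..} s *\<^sub>R G r s" for s
 have F: "integrable lborel F" unfolding F_def by (rule integrable_mult_indicator[OF _ G_integrable[OF r]]) simp
 have e: "T r t = (LBINT s. indicat_real {t..} s *\<^sub>R sg (t - s) (F s))" if "t1 <= t" for t
 proof -
  have "t0 <= t" using that \<open>t0 <= t1\<close> by simp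
  then have "T r t = (LBINT s. sg t (indicat_real {t..} s *\<^sub>R P r s))"
   unfolding T_def P_tail[OF r \<open>t0 <= t\<close>]
   by (intro integral_bounded_linear[symmetric] bounded_linear_sg indicat_P_integrable[OF r]) simp
  also have "... = (LBINT s. indicat_real {t..} s *\<^sub>R sg (t - s) (F s))"
   by (rule Bochner_Integration.integral_cong) (use that in \<open>auto simp: indicator_def P_def F_def sg_sg\<close>)
  finally show ?thesis .
 qed
 have "tail4 t1 (T r) <= (NN t. linf (LBINT s. indicat_real {t..} s *\<^sub>R sg (t - s) (F s)) ^ 4)"
  unfolding tail4_def by (intro nn_integral_mono) (auto simp: indicator_def e)
 also have "... <= ennreal (196 * (LBINT s. norm (F s)) ^ 4)" by (rule strichartz_retarded[OF F])
 also have "... <= ennreal (196 * (R / 8 * t1 powr (- 1/4)) ^ 4)"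
 proof (intro ennreal_leI mult_left_mono power_mono)
  have "ennreal (LBINT s. norm (F s)) = (NN s. ennreal (norm (F s)))"
   by (rule nn_integral_eq_integral[symmetric]) (use F in auto)
  also have "... = (NN s. ennreal (norm (G r s)) * indicator {t1..} s)"
   by (intro nn_integral_cong) (auto simp: indicator_def F_def)
  also have "... <= ennreal (R / 8 * t1 powr (- 1/4))" by (rule G_bound[OF r t])
  finally show "(LBINT s. norm (F s)) <= R / 8 * t1 powr (- 1/4)" using R by (subst (asm) ennreal_le_iff) auto
 qed auto
 also have "196 * (R / 8 * t1 powr (- 1/4)) ^ 4 = 196 * (R / 8) ^ 4 / t1"
 proof -
  have "(t1 powr (- 1/4)) ^ 4 = t1 powr (- 1)" using tp by (simp add: powr_power)
  also have "... = 1 / t1" using tp by (simp add: powr_minus_divide)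
  finally show ?thesis unfolding power_mult_distrib by (simp only: times_divide_eq_right mult_1_right mult.assoc)
 qed
 finally show ?thesis .
qed

text \<open>By \<open>linf_S\<close> the fourth power is of order 1/s^2, which integrates to the
  order 1/t that the ball demands.\<close>

lemma tail4_S:
 assumes t: "t0 <= t" shows "tail4 t S <= ennreal (16 * n1 u ^ 4 / t)"
proof -
 have tp: "t > 0" using t t0 by simp
 have "tail4 t S <= (NN s. ennreal (16 * n1 u ^ 4) * (ennreal (1 / s\<^sup>2) * indicator {t..} s))"
  unfolding tail4_def
 proof (rule nn_integral_mono)
  fix s
  show "linf (S s) ^ 4 * indicator {t..} s <= ennreal (16 * n1 u ^ 4) * (ennreal (1 / s\<^sup>2) * indicator {t..} s)"
  proof (cases "t <= s")
   case True
   then have s: "s > 0" "t0 <= s" using tp t by auto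
   have "linf (S s) <= ennreal (2 * a\<^sup>2 * n1 u * s powr (- 1/2))" by (rule linf_S[OF s(2)])
   also have "... <= ennreal (2 * 1 * n1 u * s powr (- 1/2))"
    using a a1 n1_nonneg[of u] by (intro ennreal_leI mult_right_mono mult_left_mono) (auto simp: power_le_one)
   finally have "linf (S s) ^ 4 <= ennreal (2 * 1 * n1 u * s powr (- 1/2)) ^ 4" by (rule power_mono) simp
   also have "... = ennreal ((2 * 1 * n1 u * s powr (- 1/2)) ^ 4)" using n1_nonneg[of u] by (simp add: ennreal_power)
   also have "(2 * 1 * n1 u * s powr (- 1/2)) ^ 4 = 16 * n1 u ^ 4 * (1 / s\<^sup>2)"
   proof -
    have "(s powr (- 1/2)) ^ 4 = s powr (- 2)" using s by (simp add: powr_power)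
    also have "... = 1 / s\<^sup>2" using s by (simp add: powr_minus_divide powr_numeral)
    finally show ?thesis unfolding power_mult_distrib by simp
   qed
   also have "ennreal \<dots> = ennreal (16 * n1 u ^ 4) * ennreal (1 / s\<^sup>2)" using n1_nonneg[of u] by (intro ennreal_mult) auto
   finally show ?thesis using True by simp
  qed simp
 qed
 also have "... = ennreal (16 * n1 u ^ 4) * ennreal (1 / t)"
  using nn_integral_inv_sq_tail[OF tp] by (subst nn_integral_cmult) auto
 also have "... = ennreal (16 * n1 u ^ 4 / t)" using n1_nonneg[of u] tp by (subst ennreal_mult[symmetric]) auto
 finally show ?thesis .
qed

text \<open>The nonlinear integral runs from infinity, hence the minus sign; a fixed point has the
  prescribed asymptotics built in.\<close>

definition \<Theta> :: "(real => l2) => real => l2" where "\<Theta> r t = S t - cscale (\<i> * of_real \<sigma>) (T r t)"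

lemma norm_\<sigma>: "norm (\<i> * of_real \<sigma> :: complex) = 1"
 using \<sigma> by (auto simp: norm_mult)

lemma T_continuous:
 assumes r: "ok r" shows "continuous_on UNIV (T r)"
proof -
 have "continuous_on UNIV (\<lambda>t. (\<lambda>(s, f). sg s f) (t, (LBINT s. P r s) - Q r t))"
  by (rule continuous_on_compose2[OF sg_continuous_pair])
   (auto intro!: continuous_intros simp: Q_def continuous_indefinite_integral[OF P_integrable[OF r]])
 then show ?thesis unfolding T_def[abs_def] by simp
qed

lemma \<Theta>_continuous:
 assumes r: "ok r" shows "continuous_on {t0..} (\<Theta> r)"
 unfolding \<Theta>_def
 by (intro continuous_on_diff S_continuous cscale.continuous_on continuous_on_const continuous_on_subset[OF T_continuous[OF r]]) simp

lemma norm_\<Theta>: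
 assumes r: "ok r" and t: "t0 <= t" shows "norm (\<Theta> r t) <= R * t powr (- 1/4)"
proof -
 have "norm (\<Theta> r t) <= norm (S t) + norm (T r t)"
  unfolding \<Theta>_def using norm_triangle_ineq4[of "S t" "cscale (\<i> * of_real \<sigma>) (T r t)"] by (simp only: norm_cscale norm_\<sigma> mult_1)
 also have "... <= 16 * a\<^sup>2 * n1 u * t powr (- 1/4) + R / 8 * t powr (- 1/4)"
  by (intro add_mono norm_S norm_T r t)
 also have "... = (16 * a\<^sup>2 * n1 u + R / 8) * t powr (- 1/4)" by (simp only: distrib_right)
 also have "... <= R * t powr (- 1/4)"
 proof (rule mult_right_mono)
  have "a\<^sup>2 * n1 u <= 1 * n1 u" using a a1 n1_nonneg[of u] by (intro mult_right_mono) (auto simp: power_le_one)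
  then show "16 * a\<^sup>2 * n1 u + R / 8 <= R" using c3 R by linarith
 qed simp
 finally show ?thesis .
qed

text \<open>The bound (x + y)^4 <= 8 x^4 + 8 y^4 replaces the triangle inequality. The share of T is
  8 times 196 over 8^4, about 0.38, so the factor R/8 in \<open>G_bound\<close> leaves ample room
  for S.\<close>

lemma tail4_\<Theta>:
 assumes r: "ok r" and t: "t0 <= t" shows "tail4 t (\<Theta> r) <= ennreal (R ^ 4 / t)"
proof -
 have tp: "t > 0" using t t0 by simp
 have "T r \<in> bmeas" by (rule borel_measurable_continuous_onI[OF T_continuous[OF r]])
 note [measurable] = this
 have Sm: "(\<lambda>s. indicat_real {t0..} s *\<^sub>R S s) \<in> bmeas"
  by (rule borel_measurable_continuous_on_indicator[OF _ S_continuous]) simp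
 have Se: "linf (S s) ^ 4 * indicator {t..} s = linf (indicat_real {t0..} s *\<^sub>R S s) ^ 4 * indicator {t..} s" for s
  using t by (auto simp: indicator_def)
 have [measurable]: "(\<lambda>s. linf (S s) ^ 4 * indicator {t..} s) \<in> bmeas"
  unfolding Se using Sm by measurable
 have "tail4 t (\<Theta> r) <= (NN s. 8 * (linf (S s) ^ 4 * indicator {t..} s) + 8 * (linf (T r s) ^ 4 * indicator {t..} s))"
  unfolding tail4_def
 proof (rule nn_integral_mono)
  fix s
  have "linf (\<Theta> r s) <= linf (S s) + linf (cscale (- (\<i> * of_real \<sigma>)) (T r s))"
   unfolding \<Theta>_def using linf_add[of "S s" "cscale (- (\<i> * of_real \<sigma>)) (T r s)"] by (simp only: cscale_uminus diff_conv_add_uminus)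
  also have "... <= linf (S s) + ennreal 1 * linf (T r s)"
   using linf_cscale[of "- (\<i> * of_real \<sigma>)" "T r s"] by (intro add_left_mono) (simp only: norm_minus_cancel norm_\<sigma>)
  finally have "linf (\<Theta> r s) ^ 4 <= (linf (S s) + linf (T r s)) ^ 4" by (intro power_mono) simp_all
  also have "... <= 8 * linf (S s) ^ 4 + 8 * linf (T r s) ^ 4" by (rule power4_sum_le)
  finally show "linf (\<Theta> r s) ^ 4 * indicator {t..} s <= 8 * (linf (S s) ^ 4 * indicator {t..} s) + 8 * (linf (T r s) ^ 4 * indicator {t..} s)"
   by (simp add: indicator_def)
 qed
 also have "... = 8 * tail4 t S + 8 * tail4 t (T r)"
  unfolding tail4_def by (subst nn_integral_add) (auto simp: nn_integral_cmult)
 also have "... <= ennreal 8 * ennreal (16 * n1 u ^ 4 / t) + ennreal 8 * ennreal (196 * (R / 8) ^ 4 / t)"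
  using tail4_S[OF t] tail4_T[OF r t] by (intro add_mono mult_mono) auto
 also have "... = ennreal (8 * (16 * n1 u ^ 4 / t) + 8 * (196 * (R / 8) ^ 4 / t))"
  by (rule ennreal_sum_mult[symmetric]) (use tp n1_nonneg[of u] R in auto)
 also have "... <= ennreal (R ^ 4 / t)"
 proof (rule ennreal_leI)
  have "n1 u ^ 4 <= (R / 256) ^ 4" using c3 n1_nonneg[of u] by (intro power_mono) auto
  then have "8 * (16 * n1 u ^ 4) + 8 * (196 * (R / 8) ^ 4) <= 8 * (16 * (R / 256) ^ 4) + 8 * (196 * (R / 8) ^ 4)" by simp
  also have "... <= R ^ 4" by (simp add: power_divide)
  finally have "(8 * (16 * n1 u ^ 4) + 8 * (196 * (R / 8) ^ 4)) / t <= R ^ 4 / t" using tp by (intro divide_right_mono) auto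
  then show "8 * (16 * n1 u ^ 4 / t) + 8 * (196 * (R / 8) ^ 4 / t) <= R ^ 4 / t" by (simp add: add_divide_distrib)
 qed
 finally show ?thesis .
qed

text \<open>A bounded continuous \<rho> stands for t^(1/4) r(t), so the sup metric is the weighted
  L2 metric; \<open>max t t0\<close> extends curves from [t0, infinity) to the whole line.\<close>

definition ext :: "(real \<Rightarrow>\<^sub>C l2) => real => l2" where
 "ext \<rho> t = (max t t0) powr (- 1/4) *\<^sub>R apply_bcontfun \<rho> (max t t0)"

definition B :: "(real \<Rightarrow>\<^sub>C l2) set" where
 "B = {\<rho>. (\<forall>t. norm (apply_bcontfun \<rho> t) <= R) \<and> (\<forall>t\<ge>t0. tail4 t (ext \<rho>) <= ennreal (R ^ 4 / t))}"

lemma max_pos: "0 < max t t0" using t0 by (simp add: less_max_iff_disj)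

lemma ext_continuous: "continuous_on UNIV (ext \<rho>)"
proof -
 have c: "continuous_on UNIV (\<lambda>t. apply_bcontfun \<rho> (max t t0))"
  by (rule continuous_on_compose2[OF continuous_on_apply_bcontfun[of UNIV]]) (auto intro!: continuous_intros)
 show ?thesis unfolding ext_def
  by (intro continuous_on_scaleR c continuous_on_powr continuous_intros) (use max_pos in \<open>auto simp: less_le\<close>)
qed

lemma ext_ok: "\<rho> \<in> B ==> ok (ext \<rho>)"
proof -
 assume r: "\<rho> \<in> B"
 have "norm (ext \<rho> t) <= R * t powr (- 1/4)" if "t0 <= t" for t
 proof -
  have "norm (apply_bcontfun \<rho> t) <= R" using r by (simp add: B_def)
  then have "norm (apply_bcontfun \<rho> t) * t powr (- 1/4) <= R * t powr (- 1/4)" by (rule mult_right_mono) simp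
  then show ?thesis using that by (simp add: ext_def max_def mult.commute)
 qed
 then show ?thesis unfolding ok_def using r ext_continuous by (auto simp: B_def)
qed

definition \<Phi> :: "(real \<Rightarrow>\<^sub>C l2) => real \<Rightarrow>\<^sub>C l2" where
 "\<Phi> \<rho> = Bcontfun (\<lambda>t. (max t t0) powr (1/4) *\<^sub>R \<Theta> (ext \<rho>) (max t t0))"

lemma apply_\<Phi>:
 assumes r: "\<rho> \<in> B"
 shows "apply_bcontfun (\<Phi> \<rho>) = (\<lambda>t. (max t t0) powr (1/4) *\<^sub>R \<Theta> (ext \<rho>) (max t t0))"
  and "norm (apply_bcontfun (\<Phi> \<rho>) t) <= R"
proof -
 have c: "continuous_on UNIV (\<lambda>t. \<Theta> (ext \<rho>) (max t t0))"
  by (rule continuous_on_compose2[OF \<Theta>_continuous[OF ext_ok[OF r]]]) (auto intro!: continuous_intros)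
 have cc: "continuous_on UNIV (\<lambda>t. (max t t0) powr (1/4) *\<^sub>R \<Theta> (ext \<rho>) (max t t0))"
  by (intro continuous_on_scaleR c continuous_on_powr continuous_intros) (use max_pos in \<open>auto simp: less_le\<close>)
 have b: "norm ((max t t0) powr (1/4) *\<^sub>R \<Theta> (ext \<rho>) (max t t0)) <= R" for t
 proof -
  have "norm ((max t t0) powr (1/4) *\<^sub>R \<Theta> (ext \<rho>) (max t t0)) <= (max t t0) powr (1/4) * (R * (max t t0) powr (- 1/4))"
   unfolding norm_scaleR using norm_\<Theta>[OF ext_ok[OF r], of "max t t0"] by (intro mult_mono) auto
  also have "... = R * ((max t t0) powr (1/4) * (max t t0) powr (- 1/4))" by (simp only: mult_ac)
  also have "... = R" using max_pos[of t] by (simp flip: powr_add)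
  finally show ?thesis .
 qed
 show e: "apply_bcontfun (\<Phi> \<rho>) = (\<lambda>t. (max t t0) powr (1/4) *\<^sub>R \<Theta> (ext \<rho>) (max t t0))"
  unfolding \<Phi>_def by (rule Bcontfun_inverse[OF bcontfun_normI[OF cc b]])
 show "norm (apply_bcontfun (\<Phi> \<rho>) t) <= R" unfolding e by (rule b)
qed

lemma ext_\<Phi>:
 assumes "\<rho> \<in> B" "t0 <= t" shows "ext (\<Phi> \<rho>) t = \<Theta> (ext \<rho>) t"
 using assms t0 unfolding ext_def apply_\<Phi>(1)[OF assms(1)] by (simp add: max_def flip: powr_add)

lemma tail4_cong: "(!!s. t <= s ==> r s = r' s) ==> tail4 t r = tail4 t r'"
 unfolding tail4_def by (intro nn_integral_cong) (auto simp: indicator_def)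

lemma \<Phi>_B: "\<Phi> ` B \<subseteq> B"
proof
 fix x assume "x \<in> \<Phi> ` B"
 then obtain \<rho> where r: "\<rho> \<in> B" "x = \<Phi> \<rho>" by auto
 have "tail4 t (ext (\<Phi> \<rho>)) <= ennreal (R ^ 4 / t)" if t: "t0 <= t" for t
 proof -
  have "tail4 t (ext (\<Phi> \<rho>)) = tail4 t (\<Theta> (ext \<rho>))" by (rule tail4_cong, rule ext_\<Phi>[OF r(1)]) (use t in simp)
  then show ?thesis using tail4_\<Theta>[OF ext_ok[OF r(1)] t] by simp
 qed
 then show "x \<in> B" using apply_\<Phi>(2)[OF r(1)] r(2) by (simp add: B_def)
qed

lemma ext_dist: "t0 <= s ==> norm (ext \<rho> s - ext \<rho>' s) <= dist \<rho> \<rho>' * s powr (- 1/4)"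
proof -
 assume "t0 <= s"
 then have "norm (ext \<rho> s - ext \<rho>' s) = s powr (- 1/4) * dist (apply_bcontfun \<rho> s) (apply_bcontfun \<rho>' s)"
  by (simp add: ext_def max_def dist_norm flip: scaleR_diff_right)
 also have "... <= s powr (- 1/4) * dist \<rho> \<rho>'" by (intro mult_left_mono dist_bounded) simp
 finally show ?thesis by (simp only: mult.commute)
qed

lemma \<Phi>_contraction:
 assumes r: "\<rho> \<in> B" "\<rho>' \<in> B" shows "dist (\<Phi> \<rho>) (\<Phi> \<rho>') <= 1/16 * dist \<rho> \<rho>'"
proof (rule dist_bound)
 fix t
 define \<tau> where "\<tau> = max t t0"
 have \<tau>: "t0 <= \<tau>" "0 < \<tau>" using max_pos[of t] by (auto simp: \<tau>_def)
 have "\<Theta> (ext \<rho>) \<tau> - \<Theta> (ext \<rho>') \<tau> = - cscale (\<i> * of_real \<sigma>) (T (ext \<rho>) \<tau> - T (ext \<rho>') \<tau>)"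
  by (simp add: \<Theta>_def cscale.diff_right)
 then have n: "norm (\<Theta> (ext \<rho>) \<tau> - \<Theta> (ext \<rho>') \<tau>) = norm (T (ext \<rho>) \<tau> - T (ext \<rho>') \<tau>)"
  by (simp only: norm_minus_cancel norm_cscale norm_\<sigma> mult_1)
 have "dist (apply_bcontfun (\<Phi> \<rho>) t) (apply_bcontfun (\<Phi> \<rho>') t) = \<tau> powr (1/4) * norm (T (ext \<rho>) \<tau> - T (ext \<rho>') \<tau>)"
  unfolding apply_\<Phi>(1)[OF r(1)] apply_\<Phi>(1)[OF r(2)] \<tau>_def[symmetric] dist_norm scaleR_diff_right[symmetric] norm_scaleR n by simp
 also have "... <= \<tau> powr (1/4) * (dist \<rho> \<rho>' / 16 * \<tau> powr (- 1/4))"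
  by (intro mult_left_mono T_difference ext_ok r ext_dist \<tau>) auto
 also have "... = 1/16 * dist \<rho> \<rho>' * (\<tau> powr (1/4) * \<tau> powr (- 1/4))" by (simp add: mult_ac)
 also have "\<tau> powr (1/4) * \<tau> powr (- 1/4) = 1" using \<tau>(2) by (simp flip: powr_add)
 finally show "dist (apply_bcontfun (\<Phi> \<rho>) t) (apply_bcontfun (\<Phi> \<rho>') t) <= 1/16 * dist \<rho> \<rho>'" by simp
qed

lemma power4_liminf:
 fixes f :: "nat => ennreal" shows "liminf f ^ 4 = liminf (\<lambda>n. f n ^ 4)"
proof (rule Liminf_compose_continuous_mono[where f="\<lambda>x. x ^ 4", symmetric])
 show "continuous_on UNIV (\<lambda>x::ennreal. x ^ 4)"
  unfolding continuous_on_def power4_eq_xxxx by (intro ballI tendsto_mult_ennreal tendsto_ident_at) auto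
qed (auto intro!: monoI power_mono)

text \<open>Convergence in the weighted L2 metric is pointwise in time; lower semicontinuity of
  \<open>linf\<close> at each time and Fatou's lemma in time then preserve the tail bounds.\<close>

lemma closed_B: "closed B"
 unfolding closed_sequential_limits
proof (intro allI impI, elim conjE)
 fix \<rho>s \<rho> assume B: "\<forall>n. \<rho>s n \<in> B" and lim: "\<rho>s \<longlonglongrightarrow> \<rho>"
 have pl: "(\<lambda>n. apply_bcontfun (\<rho>s n) t) \<longlonglongrightarrow> apply_bcontfun \<rho> t" for t
  by (rule tendsto_uniform_limitI[OF tendsto_bcontfun_uniform_limit[OF lim]]) simp
 have "norm (apply_bcontfun \<rho> t) <= R" for t
  by (rule LIMSEQ_le_const2[OF tendsto_norm[OF pl]]) (use B in \<open>auto simp: B_def\<close>)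
 moreover have "tail4 t (ext \<rho>) <= ennreal (R ^ 4 / t)" if t: "t0 <= t" for t
 proof -
  have em[measurable]: "ext \<rho> \<in> bmeas" for \<rho> by (rule borel_measurable_continuous_onI[OF ext_continuous])
  have "tail4 t (ext \<rho>) <= (NN s. liminf (\<lambda>n. linf (ext (\<rho>s n) s) ^ 4 * indicator {t..} s))"
   unfolding tail4_def
  proof (rule nn_integral_mono)
   fix s
   have "(\<lambda>n. ext (\<rho>s n) s) \<longlonglongrightarrow> ext \<rho> s" unfolding ext_def by (intro tendsto_intros pl)
   then have "linf (ext \<rho> s) <= liminf (\<lambda>n. linf (ext (\<rho>s n) s))" by (rule linf_lsc)
   then have "linf (ext \<rho> s) ^ 4 <= liminf (\<lambda>n. linf (ext (\<rho>s n) s)) ^ 4" by (rule power_mono) simp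
   then have "linf (ext \<rho> s) ^ 4 <= liminf (\<lambda>n. linf (ext (\<rho>s n) s) ^ 4)" unfolding power4_liminf .
   then show "linf (ext \<rho> s) ^ 4 * indicator {t..} s <= liminf (\<lambda>n. linf (ext (\<rho>s n) s) ^ 4 * indicator {t..} s)"
    by (cases "t <= s") auto
  qed
  also have "... <= liminf (\<lambda>n. tail4 t (ext (\<rho>s n)))"
   unfolding tail4_def by (rule nn_integral_liminf) measurable
  also have "... <= liminf (\<lambda>n::nat. ennreal (R ^ 4 / t))"
   by (intro Liminf_mono always_eventually allI) (use B t in \<open>auto simp: B_def\<close>)
  also have "... = ennreal (R ^ 4 / t)" by (simp add: Liminf_const)
  finally show ?thesis .
 qed
 ultimately show "\<rho> \<in> B" by (simp add: B_def)
qed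

lemma fixed_point: "\<exists>r. ok r \<and> (\<forall>t\<ge>t0. r t = \<Theta> r t)"
proof -
 have "\<exists>!\<rho>. \<rho> \<in> B \<and> \<Phi> \<rho> = \<rho>"
 proof (rule Banach_fix[where c="1/16"])
  show "complete B" using closed_B by (simp add: complete_eq_closed)
  have "0 \<in> B"
  proof -
   have "tail4 t (ext 0) = tail4 t (\<lambda>s. 0)" for t by (rule tail4_cong) (simp add: ext_def)
   then show ?thesis using ok_zero R unfolding ok_def B_def by simp
  qed
  then show "B \<noteq> {}" by auto
 qed (use \<Phi>_B \<Phi>_contraction in auto)
 then obtain \<rho> where \<rho>: "\<rho> \<in> B" "\<Phi> \<rho> = \<rho>" by auto
 have "ext \<rho> t = \<Theta> (ext \<rho>) t" if "t0 <= t" for t using ext_\<Phi>[OF \<rho>(1) that] unfolding \<rho>(2) .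
 then show ?thesis using ext_ok[OF \<rho>(1)] by auto
qed

text \<open>The integrand splits into G and the two terms linear in w, and the increments of the
  integrals of these pieces are those recorded by Q, \<open>w_equation\<close> and
  \<open>S_equation\<close>.\<close>

lemma duh_fixed_point:
 assumes r: "ok r" and fp: "!!t. t0 <= t ==> r t = \<Theta> r t"
 shows "duh (\<lambda>t. w t + r t)"
 unfolding duh_def
proof (intro allI impI conjI)
 let ?N = "\<lambda>s. (1 / s) *\<^sub>R Nem a (w s + r s)"
 fix t assume t: "t0 <= t"
 define W where "W s = (1 / s) *\<^sub>R sg (- s) (w s)" for s
 define b where "b = complex_of_real (a\<^sup>2)"
 note wi = w_equation[OF t, folded W_def]
 have ki: "integrable lborel (\<lambda>s. indicat_real {t0..t} s *\<^sub>R k s)" by (rule k_integrable[OF _ order_refl t0]) simp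
 have Pi: "integrable lborel (\<lambda>s. indicat_real {t0..t} s *\<^sub>R P r s)" by (rule indicat_P_integrable[OF r]) simp
 have e: "indicat_real {t0..t} s *\<^sub>R sg (- s) (?N s) =
   indicat_real {t0..t} s *\<^sub>R P r s + (cscale b (indicat_real {t0..t} s *\<^sub>R W s) + cscale b (indicat_real {t0..t} s *\<^sub>R k s))" for s
 proof (cases "s \<in> {t0..t}")
  case True
  then have "Nem a (w s + r s) = s *\<^sub>R G r s + cscale b (w s) + cscale b (cnj_l2 (w s))"
   using t0 by (simp add: G_def b_def)
  then have "?N s = G r s + cscale b ((1 / s) *\<^sub>R w s) + cscale b ((1 / s) *\<^sub>R cnj_l2 (w s))"
   using True t0 by (simp add: cscale_add_right scaleR_cscale mult.commute)
  then have "sg (- s) (?N s) = P r s + cscale b (W s) + cscale b (k s)"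
   by (simp only: P_def W_def k_def sg_add sg_cscale scaleR_cscale)
  then show ?thesis using True by simp
 qed (simp add: cscale.zero_right)
 have i: "integrable lborel (\<lambda>s. indicat_real {t0..t} s *\<^sub>R sg (- s) (?N s))"
  unfolding e by (intro Bochner_Integration.integrable_add Pi integrable_bounded_linear[OF cscale.bounded_linear_right] wi(1) ki)
 have rm[measurable]: "r \<in> bmeas" by (rule ok_measurable[OF r])
 have "0 <= a" using a by simp
 note [measurable] = Nem_measurable[OF this]
 have m: "(\<lambda>s. indicat_real {t0..t} s *\<^sub>R (?N s)) \<in> bmeas" by measurable
 show "integrable lborel (\<lambda>s. indicat_real {t0..t} s *\<^sub>R (?N s))"
 proof (rule Bochner_Integration.integrable_bound[OF i])
  show "(\<lambda>s. indicat_real {t0..t} s *\<^sub>R (?N s)) \<in> borel_measurable lborel" using m by simp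
 qed simp
 have I: "(LBINT s. indicat_real {t0..t} s *\<^sub>R sg (- s) (?N s)) =
  Q r t + (cscale b (LBINT s. indicat_real {t0..t} s *\<^sub>R W s) + cscale b (K t))"
  unfolding e Q_def K_def
  by (simp only: Bochner_Integration.integral_add Pi wi(1) ki Bochner_Integration.integrable_add
    integrable_bounded_linear[OF cscale.bounded_linear_right] integral_bounded_linear[OF cscale.bounded_linear_right])
 have Q0: "Q r t0 = 0"
 proof -
  have "Q r t0 = (LINT s::real|lborel. (0::l2))"
   unfolding Q_def
  proof (rule integral_cong_AE)
   have "AE s in lborel. s \<noteq> t0" by (rule AE_lborel_singleton)
   then show "AE s in lborel. indicat_real {t0..t0} s *\<^sub>R P r s = 0" by eventually_elim simp
  qed (use P_measurable[OF r] in measurable)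
  then show ?thesis by simp
 qed
 define c where "c = \<i> * complex_of_real \<sigma>"
 have th: "sg (- \<tau>) (\<Theta> r \<tau>) = sg (- \<tau>) (S \<tau>) - cscale c ((LBINT s. P r s) - Q r \<tau>)" for \<tau>
  unfolding \<Theta>_def T_def sg_diff sg_cscale sg_sg c_def by simp
 have cb: "\<i> * complex_of_real (\<sigma> * a\<^sup>2) = c * b" by (simp add: c_def b_def)
 show "sg (- t) (w t + r t) = sg (- t0) (w t0 + r t0) + cscale (\<i> * of_real \<sigma>)
   (LBINT s. indicat_real {t0..t} s *\<^sub>R sg (- s) (?N s))"
  unfolding I fp[OF t] fp[OF order_refl] sg_add th wi(2) S_equation[of t] cb c_def[symmetric] Q0
  by (simp add: cscale_add_right cscale.diff_right)
qed

end

section \<open>From equivalence classes back to functions\<close>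

lemma integrable_lebesgue_AE:
 fixes f g :: "real => 'b::euclidean_space"
 assumes g: "integrable lborel g" and e: "AE x in lborel. f x = g x"
 shows "integrable lebesgue f" "(LINT x|lebesgue. f x) = (LBINT x. g x)"
proof -
 have gm: "g \<in> bmeas" using borel_measurable_integrable[OF g] by simp
 have e': "AE x in lebesgue. g x = f x" using e by (simp add: AE_completion_iff eq_commute)
 have "g \<in> borel_measurable lebesgue" using gm by (intro measurable_completion) simp
 then have f: "f \<in> borel_measurable lebesgue" by (rule borel_measurable_AE[OF _ e'])
 show "integrable lebesgue f" "(LINT x|lebesgue. f x) = (LBINT x. g x)"
  using integrable_lebesgue_iff[OF f gm e] g by auto
qed

lemma square_integrable_rep_l2: "square_integrable (rep_l2 h)" "of_fun (rep_l2 h) = h"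
 using square_integrable_AE[of "rep_l2 h" h] by auto

lemma L1_norm_of_fun:
 assumes u: "square_integrable u" "integrable lebesgue u"
 shows "integrable lborel (rep_l2 (of_fun u))" "n1 (of_fun u) = L1_norm u"
proof -
 have e: "AE x in lborel. u x = rep_l2 (of_fun u) x" using square_integrable_rep[OF u(1)] by eventually_elim simp
 have um: "u \<in> borel_measurable lebesgue" using u by auto
 show "integrable lborel (rep_l2 (of_fun u))"
  using integrable_lebesgue_iff(1)[OF um _ e] u(2) by simp
 have "(LINT x|lebesgue. norm (u x)) = (LBINT x. norm (rep_l2 (of_fun u) x))"
  by (rule integrable_lebesgue_iff(2)) (use e um in \<open>auto elim: eventually_mono\<close>)
 then show "n1 (of_fun u) = L1_norm u" by (simp add: n1_def L1_norm_def)
qed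

lemma nn_integral_Linf_norm:
 assumes rf: "!!t. t0 <= t ==> square_integrable (rf t)" "!!t. t0 <= t ==> of_fun (rf t) = r t"
  and r[measurable]: "r \<in> bmeas" and I[measurable]: "I \<in> sets borel" and It: "I \<subseteq> {t0..}"
 shows "(\<integral>\<^sup>+t\<in>I. (Linf_norm (rf t)) ^ 4 \<partial>lebesgue) = (NN t. linf (r t) ^ 4 * indicator I t)"
proof -
 have "(\<integral>\<^sup>+t\<in>I. (Linf_norm (rf t)) ^ 4 \<partial>lebesgue) = (\<integral>\<^sup>+t. linf (r t) ^ 4 * indicator I t \<partial>lebesgue)"
 proof (rule nn_integral_cong)
  fix t
  show "(Linf_norm (rf t)) ^ 4 * indicator I t = linf (r t) ^ 4 * indicator I t"
  proof (cases "t \<in> I")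
   case True
   then have "t0 <= t" using It by auto
   then show ?thesis by (simp add: Linf_norm_of_fun rf)
  qed simp
 qed
 also have "... = (NN t. linf (r t) ^ 4 * indicator I t)" by (rule nn_integral_completion)
 finally show ?thesis .
qed

context nls
begin

lemma asymptotic_profile_rep:
 assumes uf: "square_integrable uf" "of_fun uf = u"
 shows "AE x in lborel. asymptotic_profile \<sigma> a uf t x = of_real a + rep_l2 (w t) x"
proof -
 note s = schroedinger_group_sg[OF uf(1), of t]
 show ?thesis using square_integrable_rep[OF s(1)] rep_cscale[of "phase t" "sg t u"]
  unfolding s(2) uf(2) by eventually_elim (simp add: asymptotic_profile_def w_def phase_def)
qed

lemma linf_add_finite: "linf f \<noteq> \<infinity> ==> linf g \<noteq> \<infinity> ==> linf (f + g) \<noteq> \<infinity>"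
 using linf_add[of f g] by (metis ennreal_add_eq_top infinity_ennreal_def top.extremum_uniqueI)

lemma linf_w_finite: "s > 0 ==> linf (w s) \<noteq> \<infinity>"
 using linf_w[of s] by (metis ennreal_neq_top infinity_ennreal_def top.extremum_uniqueI)

lemma nonlinearity_of_fun:
 assumes s: "s > 0" and v: "AE x in lborel. v s x = of_real a + rep_l2 (q s) x" and q: "linf (q s) \<noteq> \<infinity>"
 shows "square_integrable (nonlinearity a v s)" "of_fun (nonlinearity a v s) = (1 / s) *\<^sub>R Nem a (q s)"
proof -
 have "0 <= a" using a by simp
 from rep_Nem[OF this q] have "AE x in lborel. nonlinearity a v s x = rep_l2 ((1 / s) *\<^sub>R Nem a (q s)) x"
  using v rep_cscale[of "of_real (1 / s)" "Nem a (q s)"] unfolding scaleR_cscale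
  by eventually_elim (simp add: nonlinearity_def NL_def)
 from square_integrable_AE[OF this]
 show "square_integrable (nonlinearity a v s)" "of_fun (nonlinearity a v s) = (1 / s) *\<^sub>R Nem a (q s)" .
qed

text \<open>Applying the isometry \<open>sg t\<close>, which commutes with the integral, passes
  between the pulled back form and the form used in \<open>duhamel_solution\<close>.\<close>

lemma duh_iff:
 assumes q[measurable]: "q \<in> bmeas"
 shows "duh q \<longleftrightarrow> (\<forall>t\<ge>t0. integrable lborel (\<lambda>s. indicat_real {t0..t} s *\<^sub>R sg (t - s) ((1 / s) *\<^sub>R Nem a (q s))) \<and>
   q t = sg (t - t0) (q t0) + cscale (\<i> * of_real \<sigma>) (LBINT s. indicat_real {t0..t} s *\<^sub>R sg (t - s) ((1 / s) *\<^sub>R Nem a (q s))))"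
proof -
 have "0 <= a" using a by simp
 note [measurable] = Nem_measurable[OF this]
 have "(integrable lborel (\<lambda>s. indicat_real {t0..t} s *\<^sub>R ((1 / s) *\<^sub>R Nem a (q s))) \<and>
   sg (- t) (q t) = sg (- t0) (q t0) + cscale (\<i> * of_real \<sigma>) (LBINT s. indicat_real {t0..t} s *\<^sub>R sg (- s) ((1 / s) *\<^sub>R Nem a (q s)))) \<longleftrightarrow>
   (integrable lborel (\<lambda>s. indicat_real {t0..t} s *\<^sub>R sg (t - s) ((1 / s) *\<^sub>R Nem a (q s))) \<and>
   q t = sg (t - t0) (q t0) + cscale (\<i> * of_real \<sigma>) (LBINT s. indicat_real {t0..t} s *\<^sub>R sg (t - s) ((1 / s) *\<^sub>R Nem a (q s))))" for t
 proof -
  define N where "N s = (1 / s) *\<^sub>R Nem a (q s)" for s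
  have Nm[measurable]: "N \<in> bmeas" unfolding N_def[abs_def] by measurable
  have m: "(\<lambda>s. indicat_real {t0..t} s *\<^sub>R N s) \<in> borel_measurable lborel"
   "(\<lambda>s. indicat_real {t0..t} s *\<^sub>R sg (c - s) (N s)) \<in> borel_measurable lborel" for c
   by measurable
  have ii: "integrable lborel (\<lambda>s. indicat_real {t0..t} s *\<^sub>R N s) \<longleftrightarrow> integrable lborel (\<lambda>s. indicat_real {t0..t} s *\<^sub>R sg (c - s) (N s))" for c
  proof
   assume "integrable lborel (\<lambda>s. indicat_real {t0..t} s *\<^sub>R N s)"
   then show "integrable lborel (\<lambda>s. indicat_real {t0..t} s *\<^sub>R sg (c - s) (N s))"
    by (rule Bochner_Integration.integrable_bound[OF _ m(2)]) simp
  next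
   assume "integrable lborel (\<lambda>s. indicat_real {t0..t} s *\<^sub>R sg (c - s) (N s))"
   then show "integrable lborel (\<lambda>s. indicat_real {t0..t} s *\<^sub>R N s)"
    by (rule Bochner_Integration.integrable_bound[OF _ m(1)]) simp
  qed
  have "sg (- t) (q t) = sg (- t0) (q t0) + cscale (\<i> * of_real \<sigma>) (LBINT s. indicat_real {t0..t} s *\<^sub>R sg (- s) (N s)) \<longleftrightarrow>
   q t = sg (t - t0) (q t0) + cscale (\<i> * of_real \<sigma>) (LBINT s. indicat_real {t0..t} s *\<^sub>R sg (t - s) (N s))"
   if i: "integrable lborel (\<lambda>s. indicat_real {t0..t} s *\<^sub>R N s)"
  proof -
   define X where "X = (LBINT s. indicat_real {t0..t} s *\<^sub>R sg (- s) (N s))"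
   define b where "b = \<i> * complex_of_real \<sigma>"
   have "integrable lborel (\<lambda>s. indicat_real {t0..t} s *\<^sub>R sg (- s) (N s))" using i ii[of 0] by simp
   from integral_bounded_linear[OF bounded_linear_sg this, of t]
   have X: "sg t X = (LBINT s. indicat_real {t0..t} s *\<^sub>R sg (t - s) (N s))"
    unfolding X_def linear_scale[OF bounded_linear.linear[OF bounded_linear_sg]] sg_sg by simp
   have inj: "sg (- t) f = g \<longleftrightarrow> f = sg t g" for f g by (auto simp: sg_sg)
   show ?thesis unfolding X[symmetric] X_def[symmetric] b_def[symmetric] inj sg_add sg_cscale sg_sg by simp
  qed
  then show ?thesis unfolding N_def[symmetric] using ii[of t] by auto
 qed
 then show ?thesis unfolding duh_def by blast
qed

text \<open>Pairings with all L2 functions determine an element of \<open>l2\<close>, so the weak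
  notion of the statement coincides with the Bochner integral. Measurability of the integrand comes
  from q, hence integrability of its norm is enough.\<close>

lemma has_L2_integral_iff:
 assumes q[measurable]: "q \<in> bmeas" and qf: "AE s in lborel. t0 <= s \<longrightarrow> linf (q s) \<noteq> \<infinity>"
  and v: "!!s. t0 <= s ==> AE x in lborel. v s x = of_real a + rep_l2 (q s) x"
 defines "H \<equiv> \<lambda>t s. indicat_real {t0..t} s *\<^sub>R sg (t - s) ((1 / s) *\<^sub>R Nem a (q s))"
 shows "has_L2_integral (\<lambda>s. schroedinger_group (t - s) (nonlinearity a v s)) J {t0..t} \<longleftrightarrow>
  square_integrable J \<and> integrable lborel (H t) \<and> of_fun J = (LBINT s. H t s)"
proof -
 define E where "E s = schroedinger_group (t - s) (nonlinearity a v s)" for s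
 have "0 <= a" using a by simp
 note [measurable] = Nem_measurable[OF this]
 have Hm: "H t \<in> bmeas" unfolding H_def by measurable
 have AEE: "AE s in lborel. s \<in> {t0..t} \<longrightarrow> square_integrable (E s) \<and> of_fun (E s) = H t s"
  using qf
 proof eventually_elim
  case (elim s)
  show ?case
  proof
   assume s: "s \<in> {t0..t}"
   then have "s > 0" using t0 by simp
   have "linf (q s) \<noteq> \<infinity>" "t0 <= s" using elim s by auto
   note n = nonlinearity_of_fun[of s v q, OF \<open>s > 0\<close> v[OF this(2)] this(1)]
   show "square_integrable (E s) \<and> of_fun (E s) = H t s"
    using schroedinger_group_sg[OF n(1), of "t - s"] s unfolding E_def n(2) H_def by simp
  qed
 qed
 have AEn: "AE s in lborel. indicat_real {t0..t} s *\<^sub>R L2_norm (E s) = norm (H t s)"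
  using AEE by eventually_elim (auto simp: L2_norm_of_fun indicator_def, auto simp: H_def)
 have AEi: "AE s in lborel. indicat_real {t0..t} s *\<^sub>R L2_inner (E s) \<phi> = cinner (H t s) (of_fun \<phi>)" if "square_integrable \<phi>" for \<phi>
  using AEE by eventually_elim (auto simp: L2_inner_of_fun that indicator_def, auto simp: H_def cinner.zero_left)
 have *: "set_integrable lebesgue {t0..t} (\<lambda>s. L2_inner (E s) \<phi>)"
  "(LINT s:{t0..t}|lebesgue. L2_inner (E s) \<phi>) = cinner (LBINT s. H t s) (of_fun \<phi>)"
  if i: "integrable lborel (H t)" and \<phi>: "square_integrable \<phi>" for \<phi>
  unfolding set_integrable_def set_lebesgue_integral_def cinner_integral_left[OF i]
  by (rule integrable_lebesgue_AE[OF integrable_bounded_linear[OF cinner.bounded_linear_left i] AEi[OF \<phi>]])+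
 show ?thesis unfolding E_def[symmetric]
 proof
  assume L: "has_L2_integral E J {t0..t}"
  then have n: "integrable lebesgue (\<lambda>s. indicat_real {t0..t} s *\<^sub>R L2_norm (E s))" and J: "square_integrable J"
   by (auto simp: has_L2_integral_def set_integrable_def)
  have "integrable lborel (\<lambda>s. norm (H t s))"
   using integrable_lebesgue_iff(1)[OF borel_measurable_integrable[OF n] _ AEn] n Hm by simp
  then have i: "integrable lborel (H t)" using Hm by (simp add: integrable_norm_iff)
  have "of_fun J = (LBINT s. H t s)"
  proof (rule l2_eq_cinnerI)
   fix g
   have "L2_inner J (rep_l2 g) = (LINT s:{t0..t}|lebesgue. L2_inner (E s) (rep_l2 g))"
    using L square_integrable_rep_l2[of g] by (simp add: has_L2_integral_def)
   also have "... = cinner (LBINT s. H t s) g"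
    using *(2)[OF i square_integrable_rep_l2(1)[of g]] by (simp add: square_integrable_rep_l2)
   finally show "cinner (of_fun J) g = cinner (LBINT s. H t s) g"
    by (simp add: L2_inner_of_fun J square_integrable_rep_l2)
  qed
  then show "square_integrable J \<and> integrable lborel (H t) \<and> of_fun J = (LBINT s. H t s)"
   using i J by simp
 next
  assume R: "square_integrable J \<and> integrable lborel (H t) \<and> of_fun J = (LBINT s. H t s)"
  then have i: "integrable lborel (H t)" by simp
  have "AE s in lborel. s \<in> {t0..t} \<longrightarrow> square_integrable (E s)" using AEE by eventually_elim auto
  then have "AE s in lebesgue. s \<in> {t0..t} \<longrightarrow> square_integrable (E s)" by (simp add: AE_completion_iff)
  moreover have "set_integrable lebesgue {t0..t} (\<lambda>s. L2_norm (E s))"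
   unfolding set_integrable_def by (rule integrable_lebesgue_AE(1)[OF integrable_norm[OF i] AEn])
  moreover have "set_integrable lebesgue {t0..t} (\<lambda>s. L2_inner (E s) \<phi>) \<and> L2_inner J \<phi> = (LINT s:{t0..t}|lebesgue. L2_inner (E s) \<phi>)"
   if "square_integrable \<phi>" for \<phi>
   using *[OF i that] R that by (simp add: L2_inner_of_fun)
  ultimately show "has_L2_integral E J {t0..t}" using R unfolding has_L2_integral_def by blast
 qed
qed

lemma duhamel_solution_iff:
 assumes q[measurable]: "q \<in> bmeas" and qf: "AE s in lborel. t0 <= s \<longrightarrow> linf (q s) \<noteq> \<infinity>"
  and v: "!!s. t0 <= s ==> AE x in lborel. v s x = of_real a + rep_l2 (q s) x"
 shows "duhamel_solution \<sigma> a t0 v \<longleftrightarrow> duh q"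
proof -
 let ?v = "\<lambda>y. v t0 y - of_real a"
 let ?c = "\<i> * of_real \<sigma>"
 define H where "H t s = indicat_real {t0..t} s *\<^sub>R sg (t - s) ((1 / s) *\<^sub>R Nem a (q s))" for t s
 have "AE x in lborel. v t0 x - of_real a = rep_l2 (q t0) x"
  using v[OF order_refl] by eventually_elim simp
 note v0 = square_integrable_AE[OF this]
 note s0 = schroedinger_group_sg[OF v0(1), unfolded v0(2)]
 have eq: "(AE x in lebesgue. v t x = of_real a + schroedinger_group (t - t0) (?v) x + ?c * J x) \<longleftrightarrow>
   q t = sg (t - t0) (q t0) + cscale (?c) (of_fun J)" if t: "t0 <= t" and J: "square_integrable J" for t J
 proof -
  have r: "AE x in lborel. rep_l2 (sg (t - t0) (q t0) + cscale (?c) (of_fun J)) x =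
    schroedinger_group (t - t0) (?v) x + ?c * J x"
   using square_integrable_rep[OF s0(1)[of "t - t0"]] square_integrable_rep[OF J] rep_cscale[of "?c" "of_fun J"]
    rep_add[of "sg (t - t0) (q t0)" "cscale (?c) (of_fun J)"]
   unfolding s0(2) by eventually_elim simp
  show ?thesis
  proof
   assume "AE x in lebesgue. v t x = of_real a + schroedinger_group (t - t0) (?v) x + ?c * J x"
   then have "AE x in lborel. v t x = of_real a + schroedinger_group (t - t0) (?v) x + ?c * J x"
    by (simp add: AE_completion_iff)
   then have "AE x in lborel. rep_l2 (q t) x = rep_l2 (sg (t - t0) (q t0) + cscale (?c) (of_fun J)) x"
    using r v[OF t] by eventually_elim simp
   then show "q t = sg (t - t0) (q t0) + cscale (?c) (of_fun J)" by (rule l2_eqI)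
  next
   assume e: "q t = sg (t - t0) (q t0) + cscale (?c) (of_fun J)"
   have "AE x in lborel. v t x = of_real a + schroedinger_group (t - t0) (?v) x + ?c * J x"
    using r v[OF t] unfolding e[symmetric] by eventually_elim simp
   then show "AE x in lebesgue. v t x = of_real a + schroedinger_group (t - t0) (?v) x + ?c * J x"
    by (simp add: AE_completion_iff)
  qed
 qed
 have L: "has_L2_integral (\<lambda>s. schroedinger_group (t - s) (nonlinearity a v s)) J {t0..t} \<longleftrightarrow>
  square_integrable J \<and> integrable lborel (H t) \<and> of_fun J = (LBINT s. H t s)" for t J
  unfolding H_def[abs_def] by (rule has_L2_integral_iff[OF q qf v])
 have "(\<exists>J. has_L2_integral (\<lambda>s. schroedinger_group (t - s) (nonlinearity a v s)) J {t0..t} \<and>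
    (AE x in lebesgue. v t x = of_real a + schroedinger_group (t - t0) (?v) x + ?c * J x)) \<longleftrightarrow>
   integrable lborel (H t) \<and> q t = sg (t - t0) (q t0) + cscale (?c) (LBINT s. H t s)" (is "?l \<longleftrightarrow> ?r") if t: "t0 <= t" for t
 proof
  assume ?l
  then obtain J where J: "square_integrable J" "integrable lborel (H t)" "of_fun J = (LBINT s. H t s)"
   and e: "AE x in lebesgue. v t x = of_real a + schroedinger_group (t - t0) (?v) x + ?c * J x"
   unfolding L by (elim exE conjE)
  show ?r using e[unfolded eq[OF t J(1)]] J by simp
 next
  assume r: ?r
  define J where "J = rep_l2 (LBINT s. H t s)"
  have J: "square_integrable J" "of_fun J = (LBINT s. H t s)" by (simp_all add: J_def square_integrable_rep_l2)
  show ?l unfolding L by (rule exI[of _ J]) (use r J eq[OF t J(1)] in simp)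
 qed
 then show ?thesis unfolding duhamel_solution_def duh_iff[OF q] H_def using v0(1) by simp
qed

end

context nls_small
begin

lemma scattering_solution_exists:
 assumes uf: "square_integrable uf" "of_fun uf = u" and r: "ok r" and d: "duh (\<lambda>t. w t + r t)"
 shows "scattering_solution \<sigma> a t0 uf (\<lambda>t x. of_real a + rep_l2 (w t + r t) x)" (is "scattering_solution _ _ _ _ ?v")
proof -
 have rm[measurable]: "r \<in> bmeas" by (rule ok_measurable[OF r])
 have qf: "AE s in lborel. t0 <= s \<longrightarrow> linf (w s + r s) \<noteq> \<infinity>"
  using ok_AE_finite[OF r]
 proof eventually_elim
  case (elim s)
  then show ?case using linf_add_finite[of "w s" "r s"] linf_w_finite[of s] t0 by auto
 qed
 have D: "duhamel_solution \<sigma> a t0 ?v"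
  by (subst duhamel_solution_iff[of "\<lambda>t. w t + r t"]) (use qf d in auto)
 define rf where "rf t x = ?v t x - asymptotic_profile \<sigma> a uf t x" for t x
 have e: "AE x in lborel. rf t x = rep_l2 (r t) x" for t
  using asymptotic_profile_rep[OF uf, of t] rep_add[of "w t" "r t"] by eventually_elim (simp add: rf_def)
 note rfs = square_integrable_AE[OF e]
 have C: "L2_continuous_on {t0..} rf"
  by (subst L2_continuous_on_iff) (use r rfs in \<open>auto simp: ok_def intro: continuous_on_subset\<close>)
 have nn: "(\<integral>\<^sup>+t\<in>I. (Linf_norm (rf t)) ^ 4 \<partial>lebesgue) = (NN t. linf (r t) ^ 4 * indicator I t)"
  if "I \<in> sets borel" "I \<subseteq> {t0..}" for I
  by (rule nn_integral_Linf_norm[OF rfs rm that])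
 have L: "in_L4_Linf {t0..} rf"
  unfolding in_L4_Linf_def
 proof
  have "(\<lambda>t. linf (r t)) \<in> borel_measurable lebesgue" by (intro measurable_completion) simp
  then show "(\<lambda>t. Linf_norm (rf t)) \<in> borel_measurable (restrict_space lebesgue {t0..})"
   by (intro measurable_restrict_space1) (simp add: Linf_norm_of_fun rfs)
  have "tail4 t0 r <= ennreal (R ^ 4 / t0)" using r by (simp add: ok_def)
  also have "... < \<infinity>" by simp
  finally show "(\<integral>\<^sup>+t\<in>{t0..}. (Linf_norm (rf t)) ^ 4 \<partial>lebesgue) < \<infinity>" by (simp add: nn tail4_def)
 qed
 have "(\<lambda>t. L2_norm (rf t) + L4_Linf_norm {t<..} rf) \<in> O[at_top](\<lambda>t. t powr (- 1 / 4))"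
 \<comment> \<open>One R for each of the two norms.\<close>
 proof (rule bigoI[where c="2 * R"])
  show "\<forall>\<^sub>F t in at_top. norm (L2_norm (rf t) + L4_Linf_norm {t<..} rf) <= 2 * R * norm (t powr (- 1 / 4))"
  proof (rule eventually_at_top_linorderI[of t0])
   fix t assume t: "t0 <= t"
   then have tp: "t > 0" using t0 by simp
   have 1: "L2_norm (rf t) <= R * t powr (- 1/4)" "0 <= L2_norm (rf t)"
    using r t by (auto simp: L2_norm_of_fun rfs ok_def)
   have "(\<integral>\<^sup>+s\<in>{t<..}. (Linf_norm (rf s)) ^ 4 \<partial>lebesgue) = (NN s. linf (r s) ^ 4 * indicator {t<..} s)"
    using t by (intro nn) auto
   also have "... <= tail4 t r" unfolding tail4_def by (intro nn_integral_mono) (auto simp: indicator_def)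
   also have "... <= ennreal (R ^ 4 / t)" using r t by (simp add: ok_def)
   finally have "enn2real (\<integral>\<^sup>+s\<in>{t<..}. (Linf_norm (rf s)) ^ 4 \<partial>lebesgue) <= R ^ 4 / t"
    using tp R by (intro enn2real_leI) auto
   then have "L4_Linf_norm {t<..} rf <= root 4 (R ^ 4 / t)" by (simp add: L4_Linf_norm_def)
   also have "R ^ 4 / t = (R * t powr (- 1/4)) ^ 4"
   proof -
    have "(t powr (- 1/4)) ^ 4 = t powr (- 1)" using tp by (simp add: powr_power)
    also have "... = 1 / t" using tp by (simp add: powr_minus_divide)
    finally show ?thesis by (simp add: power_mult_distrib)
   qed
   also have "root 4 \<dots> = R * t powr (- 1/4)" using R by (intro real_root_power_cancel) auto
   finally have 2: "L4_Linf_norm {t<..} rf <= R * t powr (- 1/4)" .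
   have 3: "0 <= L4_Linf_norm {t<..} rf" by (simp add: L4_Linf_norm_def)
   show "norm (L2_norm (rf t) + L4_Linf_norm {t<..} rf) <= 2 * R * norm (t powr (- 1 / 4))"
    using 1 2 3 by simp
  qed
 qed
 then show ?thesis unfolding scattering_solution_def Let_def using D C L unfolding rf_def[abs_def] by blast
qed

lemma scattering_solution_unique:
 assumes uf: "square_integrable uf" "of_fun uf = u" and r: "ok r" and d: "duh (\<lambda>t. w t + r t)"
  and v: "scattering_solution \<sigma> a t0 uf v" and t: "t0 <= t" and a_small: "40 * a\<^sup>2 <= 1"
 shows "AE x in lebesgue. v t x = of_real a + rep_l2 (w t + r t) x"
proof -
 define rf where "rf t x = v t x - asymptotic_profile \<sigma> a uf t x" for t x
 have S: "duhamel_solution \<sigma> a t0 v" "L2_continuous_on {t0..} rf" "in_L4_Linf {t0..} rf"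
  "(\<lambda>t. L2_norm (rf t) + L4_Linf_norm {t<..} rf) \<in> O[at_top](\<lambda>t. t powr (- 1 / 4))"
  using v unfolding scattering_solution_def Let_def rf_def[abs_def] by auto
 have sq: "square_integrable (rf t)" if "t0 <= t" for t using S(2) that by (auto simp: L2_continuous_on_def)
 \<comment> \<open>Constant before t0, which makes the curve continuous on the whole line as
   \<open>duh_unique\<close> asks.\<close>
 define r' where "r' t = of_fun (rf (max t t0))" for t
 have r'e: "of_fun (rf t) = r' t" if "t0 <= t" for t using that by (simp add: r'_def max_def)
 have "continuous_on {t0..} (\<lambda>t. of_fun (rf t))" using S(2) by (subst (asm) L2_continuous_on_iff) (auto intro: sq)
 then have rc: "continuous_on UNIV r'" unfolding r'_def
  by (rule continuous_on_compose2) (auto intro!: continuous_intros)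
 have rm[measurable]: "r' \<in> bmeas" by (rule borel_measurable_continuous_onI[OF rc])
 have r4: "tail4 t0 r' < \<infinity>"
  using S(3) nn_integral_Linf_norm[OF sq r'e rm, where I="{t0..}"] by (simp add: in_L4_Linf_def tail4_def)
 have ve: "AE x in lborel. v s x = of_real a + rep_l2 (w s + r' s) x" if s: "t0 <= s" for s
  using square_integrable_rep[OF sq[OF s]] asymptotic_profile_rep[OF uf, of s] rep_add[of "w s" "r' s"]
  unfolding r'e[OF s] by eventually_elim (simp add: rf_def)
 have qf: "AE s in lborel. t0 <= s \<longrightarrow> linf (w s + r' s) \<noteq> \<infinity>"
  using tail4_AE_finite[OF rm r4]
 proof eventually_elim
  case (elim s)
  then show ?case using linf_add_finite[of "w s" "r' s"] linf_w_finite[of s] t0 by auto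
 qed
 have d': "duh (\<lambda>t. w t + r' t)"
  using S(1) by (subst (asm) duhamel_solution_iff[of "\<lambda>t. w t + r' t"]) (use qf ve in auto)
 obtain C where C: "C > 0" "\<forall>\<^sub>F t in at_top. norm (L2_norm (rf t) + L4_Linf_norm {t<..} rf) <= C * norm (t powr (- 1 / 4))"
  using S(4) by (rule landau_o.bigE)
 then have "\<exists>T. \<forall>t\<ge>T. norm (L2_norm (rf t) + L4_Linf_norm {t<..} rf) <= C * norm (t powr (- 1 / 4))"
  by (simp add: eventually_at_top_linorder)
 then obtain T where T: "!!t. T <= t ==> norm (L2_norm (rf t) + L4_Linf_norm {t<..} rf) <= C * norm (t powr (- 1 / 4))" by auto
 \<comment> \<open>A common constant for both curves: R belongs to the fixed point, C comes from the
   asymptotic condition on the competitor and may be large.\<close>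
 have dec': "norm (r' s) <= max C R * s powr (- 1/4)" if "max T t0 <= s" for s
 proof -
  have s: "T <= s" "t0 <= s" using that by auto
  have "0 <= L4_Linf_norm {s<..} rf" by (simp add: L4_Linf_norm_def)
  then have "norm (r' s) <= C * s powr (- 1/4)"
   using T[OF s(1)] L2_norm_of_fun[OF sq[OF s(2)]] r'e[OF s(2)] by simp
  also have "... <= max C R * s powr (- 1/4)" by (intro mult_right_mono) auto
  finally show ?thesis .
 qed
 have dec: "norm (r s) <= max C R * s powr (- 1/4)" if "max T t0 <= s" for s
 proof -
  have "norm (r s) <= R * s powr (- 1/4)" using r that by (simp add: ok_def)
  also have "... <= max C R * s powr (- 1/4)" by (intro mult_right_mono) auto
  finally show ?thesis .
 qed
 have rfin: "tail4 t0 r < \<infinity>"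
 proof -
  have "tail4 t0 r <= ennreal (R ^ 4 / t0)" using r by (simp add: ok_def)
  also have "... < \<infinity>" by simp
  finally show ?thesis .
 qed
 have rcont: "continuous_on UNIV r" using r by (simp add: ok_def)
 have "r' t = r t"
  by (rule duh_unique[OF a_small rc rcont r4 rfin dec' dec d' d t])
 then have "AE x in lborel. v t x = of_real a + rep_l2 (w t + r t) x" using ve[OF t] by simp
 then show ?thesis by (simp add: AE_completion_iff)
qed

lemma scattering_solution_ex1:
 assumes uf: "square_integrable uf" "of_fun uf = u" and a_small: "40 * a\<^sup>2 <= 1"
 shows "\<exists>v. scattering_solution \<sigma> a t0 uf v \<and>
  (\<forall>v'. scattering_solution \<sigma> a t0 uf v' \<longrightarrow> (\<forall>t\<ge>t0. AE x in lebesgue. v' t x = v t x))"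
proof -
 obtain r where r: "ok r" "\<forall>t\<ge>t0. r t = \<Theta> r t" using fixed_point by auto
 have d: "duh (\<lambda>t. w t + r t)" by (rule duh_fixed_point[OF r(1)]) (use r(2) in auto)
 show ?thesis
  using scattering_solution_exists[OF uf r(1) d] scattering_solution_unique[OF uf r(1) d _ _ a_small] by blast
qed

end

lemma nls_small_constants:
 assumes t0: "t0 > 0"
 shows "\<exists>R>0. \<exists>\<delta>>0. \<forall>a n m::real. 0 < a \<and> a < 1/48 \<and> 0 <= n \<and> 0 <= m \<and> n + m <= \<delta> \<longrightarrow>
  20 * a\<^sup>2 + (12 * n\<^sup>2 + 24 * R\<^sup>2) / t0 <= 1/16 \<and>
  m * (6 * a * n * t0 powr (- 1/4) + n\<^sup>2 * t0 powr (- 3/4)) <= R / 16 \<and> 256 * n <= R"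
proof -
 \<comment> \<open>Then 24 R^2/t0 is 24/2304, the bound n <= R adds at most 12/2304, and 20 a^2 at
   most 20/2304: in all 56/2304, below 1/16.\<close>
 define R where "R = sqrt t0 / 48"
 define c where "c = 6 * t0 powr (- 1/4) + t0 powr (- 3/4)"
 \<comment> \<open>The three bounds give n <= 1, the condition \<open>256 * n <= R\<close>, and m (c
   + 1) <= R/16, where c dominates the bracket in the second condition as a and n are at most
   1.\<close>
 define \<delta> where "\<delta> = min 1 (min (R / 256) (R / (16 * (c + 1))))"
 have R: "R > 0" "R\<^sup>2 = t0 / 2304" using t0 by (auto simp: R_def power_divide)
 have c: "c \<ge> 0" by (simp add: c_def)
 have \<delta>: "\<delta> > 0" using R c by (auto simp: \<delta>_def)
 have "20 * a\<^sup>2 + (12 * n\<^sup>2 + 24 * R\<^sup>2) / t0 <= 1/16 \<and>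
  m * (6 * a * n * t0 powr (- 1/4) + n\<^sup>2 * t0 powr (- 3/4)) <= R / 16 \<and> 256 * n <= R"
  if h: "0 < a" "a < 1/48" "0 <= n" "0 <= m" "n + m <= \<delta>" for a n m
 proof (intro conjI)
  have n: "n <= R / 256" "n <= 1" "m <= R / (16 * (c + 1))" using h by (auto simp: \<delta>_def)
  then show "256 * n <= R" by simp
  have "n\<^sup>2 <= R\<^sup>2" using n h R by (intro power_mono) auto
  then have "(12 * n\<^sup>2 + 24 * R\<^sup>2) / t0 <= (36 * R\<^sup>2) / t0" using t0 by (intro divide_right_mono) auto
  also have "... = 36 / 2304" unfolding R(2) using t0 by simp
  finally have 1: "(12 * n\<^sup>2 + 24 * R\<^sup>2) / t0 <= 36 / 2304" .
  have "a\<^sup>2 <= (1/48)\<^sup>2" using h by (intro power_mono) auto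
  then have "20 * a\<^sup>2 <= 20 / 2304" by (simp add: power2_eq_square)
  with 1 show "20 * a\<^sup>2 + (12 * n\<^sup>2 + 24 * R\<^sup>2) / t0 <= 1/16" by linarith
  have "a * n <= 1 * 1" using h n by (intro mult_mono) auto
  moreover have "n\<^sup>2 <= 1" using h n by (simp add: power_le_one)
  ultimately have "6 * (a * n) * t0 powr (- 1/4) + n\<^sup>2 * t0 powr (- 3/4) <= 6 * t0 powr (- 1/4) + 1 * t0 powr (- 3/4)"
   by (intro add_mono mult_right_mono) auto
  then have "m * (6 * a * n * t0 powr (- 1/4) + n\<^sup>2 * t0 powr (- 3/4)) <= R / (16 * (c + 1)) * (c + 1)"
   using n(3) h c R by (intro mult_mono) (auto simp: c_def mult.assoc)
  also have "... = R / 16" using c by (simp add: field_simps)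
  finally show "m * (6 * a * n * t0 powr (- 1/4) + n\<^sup>2 * t0 powr (- 3/4)) <= R / 16" .
 qed
 then show ?thesis using R(1) \<delta> by blast
qed

theorem theorem1p2:
  fixes \<sigma> t\<^sub>0 :: real
  assumes "\<sigma> = 1 \<or> \<sigma> = - 1" and "t\<^sub>0 > 0"
  shows "\<exists>a\<^sub>0>0. \<exists>\<delta>>0. \<forall>a. 0 < a \<and> a < a\<^sub>0 \<longrightarrow>
    (\<forall>u :: real \<Rightarrow> complex.
       integrable lebesgue u \<and> square_integrable u \<and> L1_norm u + L2_norm u \<le> \<delta> \<longrightarrow>
       (\<exists>v. scattering_solution \<sigma> a t\<^sub>0 u v \<and>
          (\<forall>v'. scattering_solution \<sigma> a t\<^sub>0 u v' \<longrightarrow>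
             (\<forall>t\<ge>t\<^sub>0. AE x in lebesgue. v' t x = v t x))))"
proof -
  obtain R \<delta> where R: "R > 0" and \<delta>: "\<delta> > 0"
    and small: "\<forall>a n m::real. 0 < a \<and> a < 1/48 \<and> 0 \<le> n \<and> 0 \<le> m \<and> n + m \<le> \<delta> \<longrightarrow>
      20 * a\<^sup>2 + (12 * n\<^sup>2 + 24 * R\<^sup>2) / t\<^sub>0 \<le> 1/16 \<and>
      m * (6 * a * n * t\<^sub>0 powr (- 1/4) + n\<^sup>2 * t\<^sub>0 powr (- 3/4)) \<le> R / 16 \<and> 256 * n \<le> R"
    using nls_small_constants[OF assms(2)] by (elim exE conjE)
  show ?thesis
  \<comment> \<open>The threshold for a is an absolute constant; the dependence on the initial time
    lies in R and \<delta>.\<close>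
  proof (rule exI[of _ "1/48"], rule conjI[OF _ exI[of _ \<delta>]], simp, rule conjI[OF \<delta>], intro allI impI)
    fix a :: real and u :: "real \<Rightarrow> complex"
    assume ha: "0 < a \<and> a < 1/48"
      and hu: "integrable lebesgue u \<and> square_integrable u \<and> L1_norm u + L2_norm u \<le> \<delta>"
    define U where "U = of_fun u"
    have n: "integrable lborel (rep_l2 U)" "n1 U + norm U \<le> \<delta>"
      using L1_norm_of_fun[of u] L2_norm_of_fun[of u] hu unfolding U_def by auto
    note c = small[rule_format, of a "n1 U" "norm U"]
    have "nls_small \<sigma> a t\<^sub>0 U R"
      by unfold_locales (use assms ha n c R n1_nonneg[of U] in auto)
    moreover have "40 * a\<^sup>2 \<le> 1"
    proof -
      have "a\<^sup>2 \<le> (1/48)\<^sup>2" using ha by (intro power_mono) auto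
      then show ?thesis by (simp add: power2_eq_square)
    qed
    ultimately show "\<exists>v. scattering_solution \<sigma> a t\<^sub>0 u v \<and>
          (\<forall>v'. scattering_solution \<sigma> a t\<^sub>0 u v' \<longrightarrow> (\<forall>t\<ge>t\<^sub>0. AE x in lebesgue. v' t x = v t x))"
      using hu by (intro nls_small.scattering_solution_ex1[where u=U]) (auto simp: U_def)
  qed
qed

end
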